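(* Let $\mathcal{O}$ be a discrete valuation ring and let $A$, with surjection $\lambda_A\colon A\to\mathcal{O}$, be an object of $\mathsf{C}_{\mathcal{O}}$ such that the ring $A$ is Gorenstein. Let $M$ be a finitely generated $A$-module with $\operatorname{depth}_AM\ge 1$, and set $d=\operatorname{rank}_{\mathcal{O}}M[\mathfrak{p}_A]$. The $A$-module $M$ is free if and only if both inequalities \[ \delta_A(M)\le d\cdot\delta_A(A)\qquad\text{and}\qquad e_A(M)\le d\cdot e(A) \] hold.
   Context: $\mathsf{C}_{\mathcal{O}}$ is the category of pairs $(A,\lambda_A)$ with $A$ a commutative noetherian local ring and $\lambda_A\colon A\to\mathcal{O}$ a surjective ring map with kernel $\mathfrak{p}_A$ such that $\Phi_A=\mathfrak{p}_A/\mathfrak{p}_A^2$ has finite length over $\mathcal{O}$. For an ideal $\mathfrak{a}\subseteq A$ and an $A$-module $M$, $M[\mathfrak{a}]=\{m\in M\mid \mathfrak{a}\cdot m=0\}$, and $I_A=A[\mathfrak{p}_A]$. For a finitely generated $A$-module $M$, the congruence module is $\Psi_A(M)=M/(M[\mathfrak{p}_A]+M[I_A])$; it is an $\mathcal{O}=A/\mathfrak{p}_A$-module of finite length. Likewise $M[\mathfrak{p}_A]$ is an $\mathcal{O}$-module. The Wiles defect of $M$ is \[ \delta_A(M)=(\operatorname{rank}_{\mathcal{O}}M[\mathfrak{p}_A])\cdot\operatorname{length}_{\mathcal{O}}\Phi_A-\operatorname{length}_{\mathcal{O}}\Psi_A(M). \] The zero module has depth $\infty$. $e_A(M)$ is the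 Hilbert–Samuel multiplicity of $M$ with respect to the maximal ideal $\mathfrak{m}_A$, normalized by $D=\dim A$: $e_A(M)=\lim_{n\to\infty}\frac{D!}{n^{D}}\operatorname{length}_A(M/\mathfrak{m}_A^nM)$ (so $e_A(M)=0$ when $\dim M<\dim A$); $e(A)=e_A(A)$. *)

theory Defs
  imports Complex_Main "HOL-Library.Extended_Nat" "HOL-Algebra.Algebra"
begin

section \<open>Modules\<close>

definition regular_module :: "('a, 'm) ring_scheme \<Rightarrow> ('a, 'a) module" where
  "regular_module R =
    \<lparr>carrier = carrier R, monoid.mult = monoid.mult R, monoid.one = monoid.one R,
     ring.zero = ring.zero R, ring.add = ring.add R, smult = monoid.mult R\<rparr>"

text \<open>The record fields \<open>mult\<close> and \<open>one\<close> play no role in a module and are filled arbitrarily here.\<close>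

definition quot_module :: "('a, 'b, 'n) module_scheme \<Rightarrow> 'b set \<Rightarrow> ('a, 'b set) module" where
  "quot_module M N =
    \<lparr>carrier = a_rcosets\<^bsub>M\<^esub> N, monoid.mult = (\<lambda>_ _. N), monoid.one = N,
     ring.zero = N, ring.add = set_add M,
     smult = (\<lambda>a C. \<Union>x\<in>C. N +>\<^bsub>M\<^esub> (a \<odot>\<^bsub>M\<^esub> x))\<rparr>"

definition module_span ::
  "('a, 'm) ring_scheme \<Rightarrow> ('a, 'b, 'n) module_scheme \<Rightarrow> 'b set \<Rightarrow> 'b set" where
  "module_span R M S = \<Inter> {N. submodule N R M \<and> S \<subseteq> N}"

definition fin_gen_module ::
  "('a, 'm) ring_scheme \<Rightarrow> ('a, 'b, 'n) module_scheme \<Rightarrow> bool" where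
  "fin_gen_module R M \<longleftrightarrow>
    module R M \<and> (\<exists>S. finite S \<and> S \<subseteq> carrier M \<and> module_span R M S = carrier M)"

definition lin_independent ::
  "('a, 'm) ring_scheme \<Rightarrow> ('a, 'b, 'n) module_scheme \<Rightarrow> 'b set \<Rightarrow> bool" where
  "lin_independent R M B \<longleftrightarrow> B \<subseteq> carrier M \<and>
    (\<forall>F c. finite F \<and> F \<subseteq> B \<and> c \<in> F \<rightarrow> carrier R \<and> (\<Oplus>\<^bsub>M\<^esub>b\<in>F. c b \<odot>\<^bsub>M\<^esub> b) = \<zero>\<^bsub>M\<^esub>
       \<longrightarrow> (\<forall>b\<in>F. c b = \<zero>\<^bsub>R\<^esub>))"

definition free_module ::
  "('a, 'm) ring_scheme \<Rightarrow> ('a, 'b, 'n) module_scheme \<Rightarrow> bool" where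
  "free_module R M \<longleftrightarrow>
    module R M \<and> (\<exists>B. lin_independent R M B \<and> module_span R M B = carrier M)"

text \<open>Over a domain, the dimension of \<open>N\<close> tensored with the field of fractions, i.e. the maximal
  number of linearly independent elements of \<open>N\<close>.\<close>

definition module_rank ::
  "('a, 'm) ring_scheme \<Rightarrow> ('a, 'b, 'n) module_scheme \<Rightarrow> enat" where
  "module_rank R N = (SUP B \<in> {B. finite B \<and> lin_independent R N B}. enat (card B))"

definition module_length ::
  "('a, 'm) ring_scheme \<Rightarrow> ('a, 'b, 'n) module_scheme \<Rightarrow> enat" where
  "module_length R M = Sup {enat n |n. \<exists>N :: nat \<Rightarrow> 'b set.
     (\<forall>i\<le>n. submodule (N i) R M) \<and> (\<forall>i<n. N i \<subset> N (Suc i))}"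

text \<open>\<open>M[J]\<close>, the elements of \<open>M\<close> annihilated by \<open>J\<close>.\<close>

definition ann_in :: "('a, 'b, 'n) module_scheme \<Rightarrow> 'a set \<Rightarrow> 'b set" where
  "ann_in M J = {x \<in> carrier M. \<forall>a\<in>J. a \<odot>\<^bsub>M\<^esub> x = \<zero>\<^bsub>M\<^esub>}"

definition ideal_smult ::
  "('a, 'm) ring_scheme \<Rightarrow> ('a, 'b, 'n) module_scheme \<Rightarrow> 'a set \<Rightarrow> 'b set" where
  "ideal_smult R M J = module_span R M {a \<odot>\<^bsub>M\<^esub> x |a x. a \<in> J \<and> x \<in> carrier M}"

definition lin_maps ::
  "('a, 'm) ring_scheme \<Rightarrow> ('a, 'b, 'n) module_scheme \<Rightarrow> ('a, 'c, 'k) module_scheme \<Rightarrow> ('b \<Rightarrow> 'c) set"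
  where "lin_maps R M N = {f \<in> carrier M \<rightarrow> carrier N.
    (\<forall>x\<in>carrier M. \<forall>y\<in>carrier M. f (x \<oplus>\<^bsub>M\<^esub> y) = f x \<oplus>\<^bsub>N\<^esub> f y) \<and>
    (\<forall>a\<in>carrier R. \<forall>x\<in>carrier M. f (a \<odot>\<^bsub>M\<^esub> x) = a \<odot>\<^bsub>N\<^esub> f x)}"


section \<open>Local rings, dimension, depth, multiplicity\<close>

definition local_ring :: "('a, 'm) ring_scheme \<Rightarrow> bool" where
  "local_ring R \<longleftrightarrow> cring R \<and> (\<exists>!I. maximalideal I R)"

definition max_ideal :: "('a, 'm) ring_scheme \<Rightarrow> 'a set" where
  "max_ideal R = (THE I. maximalideal I R)"

definition discrete_valuation_ring :: "('a, 'm) ring_scheme \<Rightarrow> bool" where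
  "discrete_valuation_ring R \<longleftrightarrow> principal_domain R \<and> local_ring R \<and> \<not> field R"

definition krull_dim :: "('a, 'm) ring_scheme \<Rightarrow> enat" where
  "krull_dim R = Sup {enat n |n. \<exists>P :: nat \<Rightarrow> 'a set.
     (\<forall>i\<le>n. primeideal (P i) R) \<and> (\<forall>i<n. P i \<subset> P (Suc i))}"

definition regular_sequence ::
  "('a, 'm) ring_scheme \<Rightarrow> ('a, 'b, 'n) module_scheme \<Rightarrow> 'a list \<Rightarrow> bool" where
  "regular_sequence R M xs \<longleftrightarrow> set xs \<subseteq> carrier R \<and>
    (\<forall>i<length xs. let Q = quot_module M (ideal_smult R M (genideal R (set (take i xs)))) in
       \<forall>y\<in>carrier Q. (xs ! i) \<odot>\<^bsub>Q\<^esub> y = \<zero>\<^bsub>Q\<^esub> \<longrightarrow> y = \<zero>\<^bsub>Q\<^esub>) \<and>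
    ideal_smult R M (genideal R (set xs)) \<noteq> carrier M"

definition module_depth ::
  "('a, 'm) ring_scheme \<Rightarrow> ('a, 'b, 'n) module_scheme \<Rightarrow> enat" where
  "module_depth R M = (if carrier M = {\<zero>\<^bsub>M\<^esub>} then \<infinity> else
     Sup {enat (length xs) |xs. set xs \<subseteq> max_ideal R \<and> regular_sequence R M xs})"

definition hs_multiplicity ::
  "('a, 'm) ring_scheme \<Rightarrow> ('a, 'b, 'n) module_scheme \<Rightarrow> real" where
  "hs_multiplicity R M = (let D = the_enat (krull_dim R) in
     lim (\<lambda>n. fact D / real n ^ D *
       real (the_enat (module_length R
         (quot_module M (ideal_smult R M (max_ideal R [^]\<^bsub>ideals_set R\<^esub> n)))))))"


section \<open>Gorenstein local rings\<close>

text \<open>The lifting property is required against all modules carried by the type of the ring. This is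
  no restriction: by Baer's criterion the inclusions of ideals into the ring are enough.\<close>

definition injective_module ::
  "('a, 'm) ring_scheme \<Rightarrow> ('a, 'e, 'n) module_scheme \<Rightarrow> bool" where
  "injective_module R E \<longleftrightarrow> module R E \<and>
    (\<forall>(N :: ('a, 'a) module) (P :: ('a, 'a) module) j f.
       module R N \<and> module R P \<and> j \<in> lin_maps R N P \<and> inj_on j (carrier N) \<and> f \<in> lin_maps R N E
       \<longrightarrow> (\<exists>g\<in>lin_maps R P E. \<forall>x\<in>carrier N. g (j x) = f x))"

text \<open>An exact complex \<open>0 \<rightarrow> N \<rightarrow> E 0 \<rightarrow> E 1 \<rightarrow> \<dots>\<close> with injective \<open>E i\<close>.\<close>

definition injective_resolution ::
  "('a, 'm) ring_scheme \<Rightarrow> ('a, 'b, 'n) module_scheme \<Rightarrow>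
   (nat \<Rightarrow> ('a, 'e) module) \<Rightarrow> ('b \<Rightarrow> 'e) \<Rightarrow> (nat \<Rightarrow> 'e \<Rightarrow> 'e) \<Rightarrow> bool" where
  "injective_resolution R N E \<eta> \<delta> \<longleftrightarrow>
    (\<forall>i. injective_module R (E i)) \<and>
    \<eta> \<in> lin_maps R N (E 0) \<and> inj_on \<eta> (carrier N) \<and>
    (\<forall>i. \<delta> i \<in> lin_maps R (E i) (E (Suc i))) \<and>
    \<eta> ` carrier N = {x \<in> carrier (E 0). \<delta> 0 x = \<zero>\<^bsub>E 1\<^esub>} \<and>
    (\<forall>i. \<delta> i ` carrier (E i) = {x \<in> carrier (E (Suc i)). \<delta> (Suc i) x = \<zero>\<^bsub>E (Suc (Suc i))\<^esub>})"

text \<open>The terms of the resolution of the \<open>R\<close>-module \<open>R\<close> live on the type \<open>(nat \<times> 'a) set\<close>. Its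
  cardinality has the form \<open>2\<^sup>\<kappa>\<close> with \<open>\<kappa>\<close> infinite and at least the cardinality of \<open>R\<close>, so the usual
  embedding of a module into an injective one does not lead out of this type, and over a
  noetherian \<open>R\<close> every minimal injective resolution of \<open>R\<close> fits into it.\<close>

definition self_injective_dim :: "('a, 'm) ring_scheme \<Rightarrow> enat" where
  "self_injective_dim R = Inf {enat n |n.
     \<exists>(E :: nat \<Rightarrow> ('a, (nat \<times> 'a) set) module) \<eta> \<delta>.
       injective_resolution R (regular_module R) E \<eta> \<delta> \<and> (\<forall>i>n. carrier (E i) = {\<zero>\<^bsub>E i\<^esub>})}"

definition gorenstein_local_ring :: "('a, 'm) ring_scheme \<Rightarrow> bool" where
  "gorenstein_local_ring R \<longleftrightarrow>
    noetherian_ring R \<and> local_ring R \<and> self_injective_dim R < \<infinity>"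


section \<open>Congruence modules and the Wiles defect\<close>

text \<open>For a surjection \<open>l : A \<rightarrow> Q\<close> and an \<open>A\<close>-module \<open>N\<close> annihilated by the kernel of \<open>l\<close>, the
  \<open>Q\<close>-module structure on \<open>N\<close>; the chosen preimage of a scalar is then immaterial.\<close>

definition descend_module ::
  "('a, 'm) ring_scheme \<Rightarrow> ('a \<Rightarrow> 'o) \<Rightarrow> ('a, 'b, 'n) module_scheme \<Rightarrow> ('o, 'b) module" where
  "descend_module A l N =
    \<lparr>carrier = carrier N, monoid.mult = monoid.mult N, monoid.one = monoid.one N,
     ring.zero = ring.zero N, ring.add = ring.add N,
     smult = (\<lambda>c x. inv_into (carrier A) l c \<odot>\<^bsub>N\<^esub> x)\<rparr>"

abbreviation aug_ideal ::
  "('o, 'k) ring_scheme \<Rightarrow> ('a, 'm) ring_scheme \<Rightarrow> ('a \<Rightarrow> 'o) \<Rightarrow> 'a set" where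
  "aug_ideal Q A l \<equiv> a_kernel A Q l"

definition cotangent_module ::
  "('o, 'k) ring_scheme \<Rightarrow> ('a, 'm) ring_scheme \<Rightarrow> ('a \<Rightarrow> 'o) \<Rightarrow> ('o, 'a set) module" where
  "cotangent_module Q A l = (let p = aug_ideal Q A l in
     descend_module A l (quot_module ((regular_module A)\<lparr>carrier := p\<rparr>) (p \<cdot>\<^bsub>A\<^esub> p)))"

definition in_category_C ::
  "('o, 'k) ring_scheme \<Rightarrow> ('a, 'm) ring_scheme \<Rightarrow> ('a \<Rightarrow> 'o) \<Rightarrow> bool" where
  "in_category_C Q A l \<longleftrightarrow>
    noetherian_ring A \<and> local_ring A \<and>
    l \<in> ring_hom A Q \<and> l ` carrier A = carrier Q \<and>
    module_length Q (cotangent_module Q A l) < \<infinity>"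

definition congruence_module ::
  "('o, 'k) ring_scheme \<Rightarrow> ('a, 'm) ring_scheme \<Rightarrow> ('a \<Rightarrow> 'o) \<Rightarrow>
   ('a, 'b, 'n) module_scheme \<Rightarrow> ('o, 'b set) module" where
  "congruence_module Q A l M =
    (let p = aug_ideal Q A l; I = ann_in (regular_module A) p in
     descend_module A l (quot_module M (ann_in M p <+>\<^bsub>M\<^esub> ann_in M I)))"

text \<open>The rank over \<open>Q\<close> of \<open>M[p]\<close>, \<open>p\<close> the kernel of \<open>l\<close>. It is finite for finitely generated \<open>M\<close>,
  and so are the lengths below for \<open>(A, l)\<close> in the category; only then is \<^const>\<open>the_enat\<close> meaningful.\<close>

definition aug_rank ::
  "('o, 'k) ring_scheme \<Rightarrow> ('a, 'm) ring_scheme \<Rightarrow> ('a \<Rightarrow> 'o) \<Rightarrow> ('a, 'b, 'n) module_scheme \<Rightarrow> nat"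
  where
  "aug_rank Q A l M =
    the_enat (module_rank Q (descend_module A l (M\<lparr>carrier := ann_in M (aug_ideal Q A l)\<rparr>)))"

definition wiles_defect ::
  "('o, 'k) ring_scheme \<Rightarrow> ('a, 'm) ring_scheme \<Rightarrow> ('a \<Rightarrow> 'o) \<Rightarrow> ('a, 'b, 'n) module_scheme \<Rightarrow> int"
  where
  "wiles_defect Q A l M =
    int (aug_rank Q A l M) * int (the_enat (module_length Q (cotangent_module Q A l)))
    - int (the_enat (module_length Q (congruence_module Q A l M)))"

end

theory Submission
  imports Defs
begin

text \<open>Write \<open>p\<close> for the kernel of \<open>\<lambda>\<close>, \<open>I = A[p]\<close> and \<open>N = M[p]\<close>. As \<open>p/p\<^sup>2\<close> has finite length, the
  localization of \<open>A\<close> at \<open>p\<close> is a field, and the finite injective resolution of \<open>A\<close> then forces \<open>A\<close> to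
  have dimension one, with every ideal of \<open>A/t\<close> a double annihilator when \<open>t\<close> is regular. Hence
  \<open>I = x0 A\<close> is principal, and \<open>x0\<close> acts on \<open>N\<close> as \<open>\<pi>\<^sup>c\<close> up to a unit, where \<open>c\<close> is the length of the
  congruence module of \<open>A\<close>. Multiplication by \<open>x0\<close> identifies the congruence module of \<open>M\<close> with
  \<open>x0 M / x0 N\<close>, a submodule of \<open>N / x0 N\<close>, which has length \<open>c d\<close>; so the inequality of the Wiles defects
  says precisely that \<open>x0 M = N\<close>.

  If this holds, lift a basis of \<open>N\<close> along \<open>x0\<close> to elements of \<open>M\<close>. A relation between the lifts modulo
  \<open>t\<close> could be multiplied into the socle of \<open>A/t\<close> and would yield a relation in \<open>N\<close>. So the lifts span a free
  module \<open>F\<close>, and \<open>F\<close> meets \<open>\<mm>\<^sup>k M\<close> in \<open>\<mm>\<^sup>k F\<close>. If \<open>F\<close> were not \<open>M\<close>, the length of \<open>M/\<mm>\<^sup>k M\<close> would exceed \<open>d\<close> times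
  that of \<open>A/\<mm>\<^sup>k\<close> by at least \<open>k\<close>, contradicting the inequality of the multiplicities.\<close>

section \<open>Submodules and spans\<close>

text \<open>The terms with the cotangent module cancel in the inequality of the Wiles defects,
  because \<open>A[p]\<close> has rank one; what remains compares the lengths of the two congruence
  modules. The finiteness of the injective resolution is used only to start a descending induction
  on the vanishing of Ext^i(R/\<mm>, R), computed by cocycles of the given resolution that are
  killed by an ideal. If \<mm> killed a nonzero element, the descent would reach i = 1; an explicit
  homomorphism from \<mm> to \<open>R\<close> excludes this, and so a regular \<open>t\<close>
  exists. With a regular \<open>t\<close> and a nonzero socle modulo \<open>t\<close> it reaches i =
  2, and that is the duality behind double annihilators. The socle element is
  \<open>\<pi>^k x0\<close>, where \<open>k + 1\<close> is the valuation of \<open>t\<close> in the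
  quotient by \<open>p\<close>: this links duality modulo \<open>t\<close> with the structure of
  \<open>M[p]\<close>. Lengths are measured between two submodules of one module, so that no
  iterated quotients arise. The multiplicity is a value of \<open>lim\<close> and says something
  only after convergence is known; hence the Hilbert function is shown to be eventually constant,
  the bound coming from the length of \<open>M/tM\<close>.\<close>

context module
begin

lemma submodule_subset: "submodule H R M \<Longrightarrow> H \<subseteq> carrier M"
  and submodule_zero_mem: "submodule H R M \<Longrightarrow> \<zero>\<^bsub>M\<^esub> \<in> H"
  and submodule_add_mem: "submodule H R M \<Longrightarrow> x \<in> H \<Longrightarrow> y \<in> H \<Longrightarrow> x \<oplus>\<^bsub>M\<^esub> y \<in> H"
  and submodule_neg_mem: "submodule H R M \<Longrightarrow> x \<in> H \<Longrightarrow> \<ominus>\<^bsub>M\<^esub> x \<in> H"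
  and submodule_smult_mem: "submodule H R M \<Longrightarrow> a \<in> carrier R \<Longrightarrow> x \<in> H \<Longrightarrow> a \<odot>\<^bsub>M\<^esub> x \<in> H"
  using submoduleE[of H] submodule.axioms(1)[of H R M] subgroup.one_closed[of H "add_monoid M"] by auto

lemma submodule_diff_mem: "submodule H R M \<Longrightarrow> x \<in> H \<Longrightarrow> y \<in> H \<Longrightarrow> x \<ominus>\<^bsub>M\<^esub> y \<in> H"
  by (simp add: M.minus_eq submodule_add_mem submodule_neg_mem)

lemma submodule_mem_carrier: "submodule H R M \<Longrightarrow> x \<in> H \<Longrightarrow> x \<in> carrier M"
  using submodule_subset by blast

lemma submodule_add_cancel:
  assumes "submodule H R M" "x \<in> H" "y \<in> carrier M" "x \<oplus>\<^bsub>M\<^esub> y \<in> H"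
  shows "y \<in> H"
proof -
  have "x \<in> carrier M" using assms submodule_subset by blast
  hence "y = \<ominus>\<^bsub>M\<^esub> x \<oplus>\<^bsub>M\<^esub> (x \<oplus>\<^bsub>M\<^esub> y)" using assms(3) by (simp add: M.r_neg1)
  also have "\<dots> \<in> H" using assms submodule_add_mem submodule_neg_mem by blast
  finally show ?thesis .
qed

lemma submoduleI2:
  assumes "H \<subseteq> carrier M" "\<zero>\<^bsub>M\<^esub> \<in> H"
    and "\<And>a b. \<lbrakk>a \<in> H; b \<in> H\<rbrakk> \<Longrightarrow> a \<oplus>\<^bsub>M\<^esub> b \<in> H"
    and "\<And>a x. \<lbrakk>a \<in> carrier R; x \<in> H\<rbrakk> \<Longrightarrow> a \<odot>\<^bsub>M\<^esub> x \<in> H"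
  shows "submodule H R M"
proof (rule submoduleI)
  fix a assume a: "a \<in> H"
  have "\<ominus>\<^bsub>M\<^esub> a = (\<ominus>\<^bsub>R\<^esub> \<one>\<^bsub>R\<^esub>) \<odot>\<^bsub>M\<^esub> a" using a assms(1) by (simp add: smult_l_minus subset_iff)
  thus "\<ominus>\<^bsub>M\<^esub> a \<in> H" using assms(4)[OF _ a] by simp
qed (use assms in auto)

lemma zero_submodule: "submodule {\<zero>\<^bsub>M\<^esub>} R M"
  by (rule submoduleI2) auto

lemma submodule_Inter: "\<C> \<noteq> {} \<Longrightarrow> (\<And>H. H \<in> \<C> \<Longrightarrow> submodule H R M) \<Longrightarrow> submodule (\<Inter>\<C>) R M"
  by (rule submoduleI2)
    (auto simp: submodule_zero_mem submodule_add_mem submodule_smult_mem dest: submodule_mem_carrier)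

lemma submodule_Int: "submodule H R M \<Longrightarrow> submodule K R M \<Longrightarrow> submodule (H \<inter> K) R M"
  using submodule_Inter[of "{H, K}"] by auto

lemma mem_set_add: "x \<in> H <+>\<^bsub>M\<^esub> K \<longleftrightarrow> (\<exists>h\<in>H. \<exists>k\<in>K. x = h \<oplus>\<^bsub>M\<^esub> k)"
  by (auto simp: set_add_def')

lemma submodule_set_add:
  assumes H: "submodule H R M" and K: "submodule K R M"
  shows "submodule (H <+>\<^bsub>M\<^esub> K) R M"
proof (rule submoduleI2)
  note c = submodule_mem_carrier[OF H] submodule_mem_carrier[OF K]
  show "H <+>\<^bsub>M\<^esub> K \<subseteq> carrier M" using c by (auto simp: mem_set_add)
  show "\<zero>\<^bsub>M\<^esub> \<in> H <+>\<^bsub>M\<^esub> K" using submodule_zero_mem[OF H] submodule_zero_mem[OF K]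
    by (auto simp: mem_set_add intro!: bexI)
  fix x y assume "x \<in> H <+>\<^bsub>M\<^esub> K" "y \<in> H <+>\<^bsub>M\<^esub> K"
  then obtain h k h' k' where *: "h \<in> H" "k \<in> K" "h' \<in> H" "k' \<in> K" "x = h \<oplus>\<^bsub>M\<^esub> k" "y = h' \<oplus>\<^bsub>M\<^esub> k'"
    by (auto simp: mem_set_add)
  hence "x \<oplus>\<^bsub>M\<^esub> y = (h \<oplus>\<^bsub>M\<^esub> h') \<oplus>\<^bsub>M\<^esub> (k \<oplus>\<^bsub>M\<^esub> k')" using c by (simp add: M.a_ac)
  thus "x \<oplus>\<^bsub>M\<^esub> y \<in> H <+>\<^bsub>M\<^esub> K" unfolding mem_set_add using * H K submodule_add_mem by blast
next
  note c = submodule_mem_carrier[OF H] submodule_mem_carrier[OF K]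
  fix a x assume a: "a \<in> carrier R" "x \<in> H <+>\<^bsub>M\<^esub> K"
  then obtain h k where *: "h \<in> H" "k \<in> K" "x = h \<oplus>\<^bsub>M\<^esub> k"
    by (auto simp: mem_set_add)
  hence "a \<odot>\<^bsub>M\<^esub> x = a \<odot>\<^bsub>M\<^esub> h \<oplus>\<^bsub>M\<^esub> a \<odot>\<^bsub>M\<^esub> k" using a c by (simp add: smult_r_distr)
  thus "a \<odot>\<^bsub>M\<^esub> x \<in> H <+>\<^bsub>M\<^esub> K" unfolding mem_set_add using * a H K submodule_smult_mem by blast
qed

lemma set_add_upper1: "submodule H R M \<Longrightarrow> submodule K R M \<Longrightarrow> H \<subseteq> H <+>\<^bsub>M\<^esub> K"
proof
  fix x assume *: "submodule H R M" "submodule K R M" "x \<in> H"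
  hence "x = x \<oplus>\<^bsub>M\<^esub> \<zero>\<^bsub>M\<^esub>" using submodule_mem_carrier by simp
  thus "x \<in> H <+>\<^bsub>M\<^esub> K" using * submodule_zero_mem unfolding mem_set_add by blast
qed

lemma set_add_upper2: "submodule H R M \<Longrightarrow> submodule K R M \<Longrightarrow> K \<subseteq> H <+>\<^bsub>M\<^esub> K"
proof
  fix x assume *: "submodule H R M" "submodule K R M" "x \<in> K"
  hence "x = \<zero>\<^bsub>M\<^esub> \<oplus>\<^bsub>M\<^esub> x" using submodule_mem_carrier by simp
  thus "x \<in> H <+>\<^bsub>M\<^esub> K" using * submodule_zero_mem unfolding mem_set_add by blast
qed

lemma set_add_least: "submodule L R M \<Longrightarrow> H \<subseteq> L \<Longrightarrow> K \<subseteq> L \<Longrightarrow> H <+>\<^bsub>M\<^esub> K \<subseteq> L"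
  using submodule_add_mem by (fastforce simp: mem_set_add)

lemma set_add_mono: "H \<subseteq> H' \<Longrightarrow> K \<subseteq> K' \<Longrightarrow> H <+>\<^bsub>M\<^esub> K \<subseteq> H' <+>\<^bsub>M\<^esub> K'"
  by (fastforce simp: mem_set_add)

lemma set_add_absorb: "submodule H R M \<Longrightarrow> submodule K R M \<Longrightarrow> K \<subseteq> H \<Longrightarrow> H <+>\<^bsub>M\<^esub> K = H"
  using set_add_upper1 set_add_least by blast

lemma set_add_zero: "submodule H R M \<Longrightarrow> H <+>\<^bsub>M\<^esub> {\<zero>\<^bsub>M\<^esub>} = H"
  using set_add_absorb zero_submodule submodule_zero_mem by simp

lemma submodule_set_add_assoc:
  "submodule H R M \<Longrightarrow> submodule K R M \<Longrightarrow> submodule L R M \<Longrightarrow>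
   (H <+>\<^bsub>M\<^esub> K) <+>\<^bsub>M\<^esub> L = H <+>\<^bsub>M\<^esub> (K <+>\<^bsub>M\<^esub> L)"
  by (intro equalityI set_add_least submodule_set_add)
    (meson set_add_upper1 set_add_upper2 submodule_set_add order_trans order_refl)+

section \<open>Spans, linear combinations and products with ideals\<close>

lemma span_submodule: "S \<subseteq> carrier M \<Longrightarrow> submodule (module_span R M S) R M"
  unfolding module_span_def by (rule submodule_Inter) (use carrier_is_submodule in auto)

lemma span_superset: "S \<subseteq> module_span R M S"
  unfolding module_span_def by auto

lemma span_least: "submodule H R M \<Longrightarrow> S \<subseteq> H \<Longrightarrow> module_span R M S \<subseteq> H"
  unfolding module_span_def by auto

lemma span_mono: "S \<subseteq> T \<Longrightarrow> module_span R M S \<subseteq> module_span R M T"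
  unfolding module_span_def by auto

lemma span_empty: "module_span R M {} = {\<zero>\<^bsub>M\<^esub>}"
  using span_least[OF zero_submodule, of "{}"] submodule_zero_mem[OF span_submodule, of "{}"] by auto

definition cyc :: "'c \<Rightarrow> 'c set" where "cyc g = (\<lambda>a. a \<odot>\<^bsub>M\<^esub> g) ` carrier R"

lemma submodule_cyc: "g \<in> carrier M \<Longrightarrow> submodule (cyc g) R M"
proof (rule submoduleI2)
  assume g: "g \<in> carrier M"
  show "cyc g \<subseteq> carrier M" using g by (auto simp: cyc_def)
  have "\<zero>\<^bsub>M\<^esub> = \<zero>\<^bsub>R\<^esub> \<odot>\<^bsub>M\<^esub> g" using g by simp
  thus "\<zero>\<^bsub>M\<^esub> \<in> cyc g" unfolding cyc_def by blast
  { fix x y assume "x \<in> cyc g" "y \<in> cyc g"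
    then obtain a b where "a \<in> carrier R" "b \<in> carrier R" "x = a \<odot>\<^bsub>M\<^esub> g" "y = b \<odot>\<^bsub>M\<^esub> g"
      by (auto simp: cyc_def)
    thus "x \<oplus>\<^bsub>M\<^esub> y \<in> cyc g" using g unfolding cyc_def
      by (intro image_eqI[where x="a \<oplus>\<^bsub>R\<^esub> b"]) (auto simp: smult_l_distr) }
  { fix a x assume a: "a \<in> carrier R" and "x \<in> cyc g"
    then obtain b where "b \<in> carrier R" "x = b \<odot>\<^bsub>M\<^esub> g" by (auto simp: cyc_def)
    thus "a \<odot>\<^bsub>M\<^esub> x \<in> cyc g" using g a unfolding cyc_def
      by (intro image_eqI[where x="a \<otimes>\<^bsub>R\<^esub> b"]) (auto simp: smult_assoc1) }
qed

lemma cyc_self: "g \<in> carrier M \<Longrightarrow> g \<in> cyc g"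
  unfolding cyc_def by (rule image_eqI[where x="\<one>\<^bsub>R\<^esub>"]) auto

lemma cyc_least: "submodule H R M \<Longrightarrow> g \<in> H \<Longrightarrow> cyc g \<subseteq> H"
  by (auto simp: cyc_def submodule_smult_mem)

lemma span_insert:
  assumes "g \<in> carrier M" "S \<subseteq> carrier M"
  shows "module_span R M (insert g S) = cyc g <+>\<^bsub>M\<^esub> module_span R M S"
proof
  note sm = submodule_cyc[OF assms(1)] span_submodule[OF assms(2)]
  show "module_span R M (insert g S) \<subseteq> cyc g <+>\<^bsub>M\<^esub> module_span R M S"
    using set_add_upper1[OF sm] set_add_upper2[OF sm] cyc_self[OF assms(1)] span_superset[of S]
    by (intro span_least submodule_set_add sm) auto
  have "insert g S \<subseteq> carrier M" using assms by auto
  thus "cyc g <+>\<^bsub>M\<^esub> module_span R M S \<subseteq> module_span R M (insert g S)"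
    using span_superset[of "insert g S"] span_mono[of S "insert g S"]
    by (intro set_add_least cyc_least span_submodule) auto
qed

lemma finsum_mem_submodule:
  assumes "submodule H R M" "finite I" "\<And>i. i \<in> I \<Longrightarrow> f i \<in> H"
  shows "finsum M f I \<in> H"
  using assms(2,3)
proof (induction I rule: finite_induct)
  case empty thus ?case using submodule_zero_mem[OF assms(1)] by simp
next
  case (insert i I)
  hence "finsum M f (insert i I) = f i \<oplus>\<^bsub>M\<^esub> finsum M f I"
    using submodule_mem_carrier[OF assms(1)] by (intro M.finsum_insert) auto
  thus ?case using insert submodule_add_mem[OF assms(1)] by simp
qed

text \<open>Indexing by a family permits repeated vectors, so the lifts of a basis can later be
  indexed by the basis itself without first proving them distinct.\<close>

lemma span_image_finsum:
  assumes "finite I" "f \<in> I \<rightarrow> carrier M"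
  shows "x \<in> module_span R M (f ` I) \<longleftrightarrow> (\<exists>c. c \<in> I \<rightarrow> carrier R \<and> x = (\<Oplus>\<^bsub>M\<^esub>i\<in>I. c i \<odot>\<^bsub>M\<^esub> f i))"
  using assms
proof (induction I arbitrary: x rule: finite_induct)
  case empty thus ?case by (simp add: span_empty)
next
  case (insert i I)
  hence f: "f i \<in> carrier M" "f \<in> I \<rightarrow> carrier M" "f ` I \<subseteq> carrier M" by auto
  have "x \<in> module_span R M (f ` insert i I) \<longleftrightarrow>
    (\<exists>a\<in>carrier R. \<exists>y\<in>module_span R M (f ` I). x = a \<odot>\<^bsub>M\<^esub> f i \<oplus>\<^bsub>M\<^esub> y)"
    using span_insert[OF f(1,3)] by (auto simp: mem_set_add cyc_def)
  also have "\<dots> \<longleftrightarrow> (\<exists>a\<in>carrier R. \<exists>c. c \<in> I \<rightarrow> carrier R \<and> x = a \<odot>\<^bsub>M\<^esub> f i \<oplus>\<^bsub>M\<^esub> (\<Oplus>\<^bsub>M\<^esub>i\<in>I. c i \<odot>\<^bsub>M\<^esub> f i))"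
    unfolding Bex_def insert.IH[OF f(2)] by blast
  also have "\<dots> \<longleftrightarrow> (\<exists>c. c \<in> insert i I \<rightarrow> carrier R \<and> x = (\<Oplus>\<^bsub>M\<^esub>i\<in>insert i I. c i \<odot>\<^bsub>M\<^esub> f i))" (is "?L = ?R")
  proof
    assume ?L
    then obtain a c where ac: "a \<in> carrier R" "c \<in> I \<rightarrow> carrier R" "x = a \<odot>\<^bsub>M\<^esub> f i \<oplus>\<^bsub>M\<^esub> (\<Oplus>\<^bsub>M\<^esub>i\<in>I. c i \<odot>\<^bsub>M\<^esub> f i)" by blast
    let ?c = "c(i := a)"
    have "(\<Oplus>\<^bsub>M\<^esub>j\<in>insert i I. ?c j \<odot>\<^bsub>M\<^esub> f j) = ?c i \<odot>\<^bsub>M\<^esub> f i \<oplus>\<^bsub>M\<^esub> (\<Oplus>\<^bsub>M\<^esub>j\<in>I. ?c j \<odot>\<^bsub>M\<^esub> f j)"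
      using insert.hyps ac f by (intro M.finsum_insert) (auto simp: Pi_iff)
    also have "(\<Oplus>\<^bsub>M\<^esub>j\<in>I. ?c j \<odot>\<^bsub>M\<^esub> f j) = (\<Oplus>\<^bsub>M\<^esub>j\<in>I. c j \<odot>\<^bsub>M\<^esub> f j)"
      using insert.hyps ac f by (intro M.finsum_cong') (auto simp: Pi_iff)
    finally have "x = (\<Oplus>\<^bsub>M\<^esub>j\<in>insert i I. ?c j \<odot>\<^bsub>M\<^esub> f j)" using ac by simp
    moreover have "?c \<in> insert i I \<rightarrow> carrier R" using ac by auto
    ultimately show ?R by blast
  next
    assume ?R
    then obtain c where c: "c \<in> insert i I \<rightarrow> carrier R" "x = (\<Oplus>\<^bsub>M\<^esub>i\<in>insert i I. c i \<odot>\<^bsub>M\<^esub> f i)" by blast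
    have "(\<Oplus>\<^bsub>M\<^esub>j\<in>insert i I. c j \<odot>\<^bsub>M\<^esub> f j) = c i \<odot>\<^bsub>M\<^esub> f i \<oplus>\<^bsub>M\<^esub> (\<Oplus>\<^bsub>M\<^esub>j\<in>I. c j \<odot>\<^bsub>M\<^esub> f j)"
      using insert.hyps c f by (intro M.finsum_insert) (auto simp: Pi_iff)
    thus ?L using c by auto
  qed
  finally show ?case .
qed

text \<open>\<open>ideal_smult\<close> multiplies only the whole module, while Nakayama's lemma
  needs the product of an ideal with a submodule.\<close>

definition idmul :: "'a set \<Rightarrow> 'c set \<Rightarrow> 'c set" where
  "idmul J U = module_span R M {a \<odot>\<^bsub>M\<^esub> x |a x. a \<in> J \<and> x \<in> U}"

lemma submodule_idmul: "J \<subseteq> carrier R \<Longrightarrow> U \<subseteq> carrier M \<Longrightarrow> submodule (idmul J U) R M"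
  unfolding idmul_def by (rule span_submodule) auto

lemma idmul_mem: "a \<in> J \<Longrightarrow> x \<in> U \<Longrightarrow> a \<odot>\<^bsub>M\<^esub> x \<in> idmul J U"
  unfolding idmul_def by (rule set_mp[OF span_superset]) auto

lemma idmul_least: "submodule H R M \<Longrightarrow> (\<And>a x. a \<in> J \<Longrightarrow> x \<in> U \<Longrightarrow> a \<odot>\<^bsub>M\<^esub> x \<in> H) \<Longrightarrow> idmul J U \<subseteq> H"
  unfolding idmul_def by (rule span_least) auto

lemma idmul_subset: "J \<subseteq> carrier R \<Longrightarrow> submodule U R M \<Longrightarrow> idmul J U \<subseteq> U"
  by (rule idmul_least) (auto intro: submodule_smult_mem)

lemma ideal_smult_eq_idmul: "ideal_smult R M J = idmul J (carrier M)"
  by (simp add: ideal_smult_def idmul_def)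

lemma submodule_smult_image:
  assumes "a \<in> carrier R" "submodule U R M" shows "submodule ((\<lambda>x. a \<odot>\<^bsub>M\<^esub> x) ` U) R M"
proof (rule submoduleI2)
  note c = submodule_mem_carrier[OF assms(2)]
  show "(\<lambda>x. a \<odot>\<^bsub>M\<^esub> x) ` U \<subseteq> carrier M" using assms c by auto
  show "\<zero>\<^bsub>M\<^esub> \<in> (\<lambda>x. a \<odot>\<^bsub>M\<^esub> x) ` U"
    using assms submodule_zero_mem[OF assms(2)] by (intro image_eqI[where x="\<zero>\<^bsub>M\<^esub>"]) auto
  { fix x y assume "x \<in> (\<lambda>x. a \<odot>\<^bsub>M\<^esub> x) ` U" "y \<in> (\<lambda>x. a \<odot>\<^bsub>M\<^esub> x) ` U"
    then obtain u v where "u \<in> U" "v \<in> U" "x = a \<odot>\<^bsub>M\<^esub> u" "y = a \<odot>\<^bsub>M\<^esub> v" by auto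
    thus "x \<oplus>\<^bsub>M\<^esub> y \<in> (\<lambda>x. a \<odot>\<^bsub>M\<^esub> x) ` U" using assms c
      by (intro image_eqI[where x="u \<oplus>\<^bsub>M\<^esub> v"]) (auto simp: smult_r_distr submodule_add_mem) }
  { fix b x assume b: "b \<in> carrier R" and "x \<in> (\<lambda>x. a \<odot>\<^bsub>M\<^esub> x) ` U"
    then obtain u where u: "u \<in> U" "x = a \<odot>\<^bsub>M\<^esub> u" by auto
    have "b \<odot>\<^bsub>M\<^esub> (a \<odot>\<^bsub>M\<^esub> u) = a \<odot>\<^bsub>M\<^esub> (b \<odot>\<^bsub>M\<^esub> u)"
      using b u c assms by (metis R.m_comm smult_assoc1)
    thus "b \<odot>\<^bsub>M\<^esub> x \<in> (\<lambda>x. a \<odot>\<^bsub>M\<^esub> x) ` U" using u b assms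
      by (intro image_eqI[where x="b \<odot>\<^bsub>M\<^esub> u"]) (auto simp: submodule_smult_mem) }
qed

end

lemma lin_mapsD:
  assumes "f \<in> lin_maps R M N"
  shows "x \<in> carrier M \<Longrightarrow> f x \<in> carrier N"
    and "x \<in> carrier M \<Longrightarrow> y \<in> carrier M \<Longrightarrow> f (x \<oplus>\<^bsub>M\<^esub> y) = f x \<oplus>\<^bsub>N\<^esub> f y"
    and "a \<in> carrier R \<Longrightarrow> x \<in> carrier M \<Longrightarrow> f (a \<odot>\<^bsub>M\<^esub> x) = a \<odot>\<^bsub>N\<^esub> f x"
  using assms by (auto simp: lin_maps_def)

lemma lin_maps_zero:
  assumes "module R M" "module R N" "f \<in> lin_maps R M N"
  shows "f \<zero>\<^bsub>M\<^esub> = \<zero>\<^bsub>N\<^esub>"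
proof -
  interpret M: module R M by fact
  interpret N: module R N by fact
  have "f (\<zero>\<^bsub>R\<^esub> \<odot>\<^bsub>M\<^esub> \<zero>\<^bsub>M\<^esub>) = \<zero>\<^bsub>R\<^esub> \<odot>\<^bsub>N\<^esub> f \<zero>\<^bsub>M\<^esub>"
    by (rule lin_mapsD(3)[OF assms(3)]) auto
  thus ?thesis using lin_mapsD(1)[OF assms(3)] by simp
qed

lemma lin_maps_diff:
  assumes "module R M" "module R N" "f \<in> lin_maps R M N" "x \<in> carrier M" "y \<in> carrier M"
  shows "f (x \<ominus>\<^bsub>M\<^esub> y) = f x \<ominus>\<^bsub>N\<^esub> f y"
proof -
  interpret M: module R M by fact
  interpret N: module R N by fact
  note f = lin_mapsD[OF assms(3)]
  have "f x = f ((x \<ominus>\<^bsub>M\<^esub> y) \<oplus>\<^bsub>M\<^esub> y)"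
    using assms(4,5) by (simp add: M.minus_eq M.a_assoc M.l_neg)
  also have "\<dots> = f (x \<ominus>\<^bsub>M\<^esub> y) \<oplus>\<^bsub>N\<^esub> f y" using assms(4,5) by (simp add: f)
  finally show ?thesis using assms(4,5) f(1) by (simp add: N.minus_eq N.a_assoc N.r_neg)
qed

lemma submodule_lin_image:
  assumes "module R M" "module R N" "f \<in> lin_maps R M N" "submodule U R M"
  shows "submodule (f ` U) R N"
proof -
  interpret M: module R M by fact
  interpret N: module R N by fact
  note f = lin_mapsD[OF assms(3)] and c = M.submodule_mem_carrier[OF assms(4)]
  show ?thesis
  proof (rule N.submoduleI2)
    show "f ` U \<subseteq> carrier N" using f c by auto
    show "\<zero>\<^bsub>N\<^esub> \<in> f ` U" using lin_maps_zero[OF assms(1-3)] M.submodule_zero_mem[OF assms(4)] by (metis imageI)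
  next
    fix x y assume "x \<in> f ` U" "y \<in> f ` U"
    then obtain u v where "u \<in> U" "v \<in> U" "x = f u" "y = f v" by auto
    thus "x \<oplus>\<^bsub>N\<^esub> y \<in> f ` U" using c f M.submodule_add_mem[OF assms(4)] by (metis imageI)
  next
    fix b x assume b: "b \<in> carrier R" and "x \<in> f ` U"
    then obtain u where u: "u \<in> U" "x = f u" by auto
    hence "b \<odot>\<^bsub>N\<^esub> x = f (b \<odot>\<^bsub>M\<^esub> u)" using b c f(3) by simp
    thus "b \<odot>\<^bsub>N\<^esub> x \<in> f ` U" using M.submodule_smult_mem[OF assms(4) b u(1)] by simp
  qed
qed

lemma submodule_lin_vimage:
  assumes "module R M" "module R N" "f \<in> lin_maps R M N" "submodule U R M" "submodule W R N"
  shows "submodule {u \<in> U. f u \<in> W} R M"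
proof -
  interpret M: module R M by fact
  interpret N: module R N by fact
  note f = lin_mapsD[OF assms(3)] and c = M.submodule_mem_carrier[OF assms(4)]
  show ?thesis
  proof (rule M.submoduleI2)
    show "{u \<in> U. f u \<in> W} \<subseteq> carrier M" using c by auto
    show "\<zero>\<^bsub>M\<^esub> \<in> {u \<in> U. f u \<in> W}"
      using lin_maps_zero[OF assms(1-3)] M.submodule_zero_mem[OF assms(4)] N.submodule_zero_mem[OF assms(5)] by simp
  next
    fix x y assume "x \<in> {u \<in> U. f u \<in> W}" "y \<in> {u \<in> U. f u \<in> W}"
    thus "x \<oplus>\<^bsub>M\<^esub> y \<in> {u \<in> U. f u \<in> W}"
      using c by (simp add: f M.submodule_add_mem[OF assms(4)] N.submodule_add_mem[OF assms(5)])
  next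
    fix b x assume "b \<in> carrier R" "x \<in> {u \<in> U. f u \<in> W}"
    thus "b \<odot>\<^bsub>M\<^esub> x \<in> {u \<in> U. f u \<in> W}"
      using c by (simp add: f M.submodule_smult_mem[OF assms(4)] N.submodule_smult_mem[OF assms(5)])
  qed
qed

lemma (in module) smult_lin_map: "a \<in> carrier R \<Longrightarrow> (\<lambda>x. a \<odot>\<^bsub>M\<^esub> x) \<in> lin_maps R M M"
  unfolding lin_maps_def by (auto simp: smult_r_distr) (metis R.m_comm smult_assoc1)

section \<open>The ring as a module over itself\<close>

lemma regular_module_simps [simp]:
  "carrier (regular_module R) = carrier R" "smult (regular_module R) = monoid.mult R"
  "add (regular_module R) = add R" "\<zero>\<^bsub>regular_module R\<^esub> = \<zero>\<^bsub>R\<^esub>"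
  by (simp_all add: regular_module_def)

lemma regular_module_set_add [simp]: "set_add (regular_module R) = set_add R"
  by (simp add: set_add_defs fun_eq_iff)

lemma regular_module_a_inv [simp]: "a_inv (regular_module R) = a_inv R"
  by (simp add: a_inv_def m_inv_def fun_eq_iff)

lemma regular_module_minus [simp]: "a_minus (regular_module R) = a_minus R"
  by (simp add: a_minus_def fun_eq_iff)

lemma regular_module_finsum [simp]: "finsum (regular_module R) = finsum R"
  by (simp add: finsum_def finprod_def fun_eq_iff)

context cring
begin

lemma module_regular: "module R (regular_module R)"
proof (rule moduleI)
  show "cring R" by (rule is_cring)
  show "abelian_group (regular_module R)"
    by (rule abelian_groupI) (auto simp: a_ac intro: l_neg bexI[where x="\<ominus> _"])
qed (auto simp: l_distr r_distr m_assoc)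

text \<open>Through this equivalence ideals inherit what is proved for submodules, in particular
  additivity of length and Nakayama's lemma.\<close>

lemma submodule_regular_iff: "submodule J R (regular_module R) \<longleftrightarrow> ideal J R"
proof
  assume J: "submodule J R (regular_module R)"
  note c = module.submodule_mem_carrier[OF module_regular J]
  show "ideal J R"
  proof (rule idealI)
    show "ring R" by (rule ring_axioms)
    show "subgroup J (add_monoid R)"
      using c module.submodule_zero_mem[OF module_regular J] module.submodule_neg_mem[OF module_regular J]
        module.submodule_add_mem[OF module_regular J]
      by (intro add.subgroupI) (auto simp: a_inv_def[symmetric])
    fix a x assume ax: "a \<in> J" "x \<in> carrier R"
    show "x \<otimes> a \<in> J" using module.submodule_smult_mem[OF module_regular J, of x a] ax by simp
    thus "a \<otimes> x \<in> J" using ax c m_comm by (metis regular_module_simps(1))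
  qed
next
  assume "ideal J R"
  then interpret ideal J R .
  show "submodule J R (regular_module R)"
    by (rule module.submoduleI2[OF module_regular]) (auto simp: I_l_closed Icarr)
qed

end

section \<open>Lengths of chains of submodules\<close>

text \<open>Chains run between two fixed submodules of one ambient module. Their supremum
  \<open>sublen R M U V\<close> is thus the length of V/U, obtained without forming a quotient
  module.\<close>

definition subchain ::
  "('a, 'm) ring_scheme \<Rightarrow> ('a, 'b, 'n) module_scheme \<Rightarrow> 'b set \<Rightarrow> 'b set \<Rightarrow> nat \<Rightarrow> bool" where
  "subchain R M U V n \<longleftrightarrow> (\<exists>N :: nat \<Rightarrow> 'b set.
     (\<forall>i\<le>n. submodule (N i) R M \<and> U \<subseteq> N i \<and> N i \<subseteq> V) \<and> (\<forall>i<n. N i \<subset> N (Suc i)))"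

definition sublen ::
  "('a, 'm) ring_scheme \<Rightarrow> ('a, 'b, 'n) module_scheme \<Rightarrow> 'b set \<Rightarrow> 'b set \<Rightarrow> enat" where
  "sublen R M U V = Sup {enat n |n. subchain R M U V n}"

lemma subchainI:
  assumes "\<And>i. i \<le> n \<Longrightarrow> submodule (N i) R M \<and> U \<subseteq> N i \<and> N i \<subseteq> V"
    and "\<And>i. i < n \<Longrightarrow> N i \<subset> N (Suc i)"
  shows "subchain R M U V n"
  unfolding subchain_def using assms by (intro exI[of _ N]) simp

lemma subchain_le: "subchain R M U V n \<Longrightarrow> k \<le> n \<Longrightarrow> subchain R M U V k"
  unfolding subchain_def by (elim exE, rule_tac x=N in exI) simp

lemma subchain_mono: "subchain R M U V n \<Longrightarrow> U' \<subseteq> U \<Longrightarrow> V \<subseteq> V' \<Longrightarrow> subchain R M U' V' n"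
  unfolding subchain_def by (elim exE, rule_tac x=N in exI) blast

lemma subchain_snoc:
  assumes "subchain R M U V n" "V \<subset> V'" "submodule V' R M"
  shows "subchain R M U V' (Suc n)"
proof -
  obtain N where N: "\<And>i. i \<le> n \<Longrightarrow> submodule (N i) R M \<and> U \<subseteq> N i \<and> N i \<subseteq> V" "\<And>i. i < n \<Longrightarrow> N i \<subset> N (Suc i)"
    using assms(1) unfolding subchain_def by auto
  have "U \<subseteq> V'" using N(1)[of 0] assms(2) by auto
  let ?N = "\<lambda>i. if i \<le> n then N i else V'"
  have "submodule (?N i) R M \<and> U \<subseteq> ?N i \<and> ?N i \<subseteq> V'" if "i \<le> Suc n" for i
    using N(1)[of i] assms \<open>U \<subseteq> V'\<close> by auto
  moreover have "?N i \<subset> ?N (Suc i)" if "i < Suc n" for i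
    using N(1)[of i] N(2)[of i] assms that by (cases "i = n") auto
  ultimately show ?thesis by (rule subchainI)
qed

lemma subchain_append:
  assumes "subchain R M U V m" "subchain R M V W n" "U \<subseteq> V" "V \<subseteq> W"
  shows "subchain R M U W (m + n)"
proof -
  obtain N where N: "\<And>i. i \<le> m \<Longrightarrow> submodule (N i) R M \<and> U \<subseteq> N i \<and> N i \<subseteq> V" "\<And>i. i < m \<Longrightarrow> N i \<subset> N (Suc i)"
    using assms(1) unfolding subchain_def by auto
  obtain P where P: "\<And>i. i \<le> n \<Longrightarrow> submodule (P i) R M \<and> V \<subseteq> P i \<and> P i \<subseteq> W" "\<And>i. i < n \<Longrightarrow> P i \<subset> P (Suc i)"
    using assms(2) unfolding subchain_def by auto
  let ?N = "\<lambda>i. if i \<le> m then N i else P (i - m)"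
  have 1: "submodule (?N i) R M \<and> U \<subseteq> ?N i \<and> ?N i \<subseteq> W" if "i \<le> m + n" for i
  proof (cases "i \<le> m")
    case True thus ?thesis using N(1)[of i] assms(4) by auto
  next
    case False thus ?thesis using P(1)[of "i - m"] that subset_trans[OF assms(3)] by simp
  qed
  have 2: "?N i \<subset> ?N (Suc i)" if "i < m + n" for i
  proof -
    consider "i < m" | "i = m" | "i > m" by linarith
    thus ?thesis
    proof cases
      case 1 thus ?thesis using N(2)[of i] by simp
    next
      case 2
      hence "N m \<subseteq> P 0" "P 0 \<subset> P 1" using N(1)[of m] P(1)[of 0] P(2)[of 0] that by auto
      thus ?thesis using 2 by auto
    next
      case 3
      hence "P (i - m) \<subset> P (Suc (i - m))" using P(2)[of "i - m"] that by simp
      thus ?thesis using 3 by (simp add: Suc_diff_le)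
    qed
  qed
  show ?thesis using 1 2 by (rule subchainI)
qed

text \<open>Chains can be truncated, so the set of their lengths is closed downwards and every
  finite bound below the supremum is attained, even if the supremum is infinite.\<close>

lemma enat_le_sublen_iff:
  assumes "submodule U R M" "U \<subseteq> V"
  shows "enat k \<le> sublen R M U V \<longleftrightarrow> subchain R M U V k"
proof
  assume "subchain R M U V k"
  thus "enat k \<le> sublen R M U V" unfolding sublen_def by (intro Sup_upper) auto
next
  assume k: "enat k \<le> sublen R M U V"
  show "subchain R M U V k"
  proof (rule ccontr)
    assume n: "\<not> subchain R M U V k"
    have "subchain R M U V 0" unfolding subchain_def by (rule exI[of _ "\<lambda>_. U"]) (use assms in auto)
    hence "k \<noteq> 0" using n by metis
    have "n \<le> k - 1" if "subchain R M U V n" for n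
      using subchain_le[OF that] n by (metis Suc_pred' \<open>k \<noteq> 0\<close> not_less_eq_eq bot_nat_0.not_eq_extremum)
    hence "sublen R M U V \<le> enat (k - 1)" unfolding sublen_def by (intro Sup_least) auto
    hence "enat k \<le> enat (k - 1)" using k order_trans by blast
    thus False using \<open>k \<noteq> 0\<close> by simp
  qed
qed

lemma enat_leI: "(\<And>k. enat k \<le> a \<Longrightarrow> enat k \<le> b) \<Longrightarrow> a \<le> (b::enat)"
proof (cases a)
  case infinity
  assume *: "\<And>k. enat k \<le> a \<Longrightarrow> enat k \<le> b"
  hence "enat k \<le> b" for k using infinity by simp
  hence "b = \<infinity>" by (metis Suc_n_not_le_n enat_ord_simps(1) not_infinity_eq)
  thus ?thesis by simp
qed auto

lemma sublen_leI:
  assumes "submodule U R M" "U \<subseteq> V" "submodule U' R' M'" "U' \<subseteq> V'"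
    and "\<And>k. subchain R M U V k \<Longrightarrow> subchain R' M' U' V' k"
  shows "sublen R M U V \<le> sublen R' M' U' V'"
  using assms enat_le_sublen_iff by (metis enat_leI)

context module
begin

text \<open>Serves for the intersections and the sums of a strict chain with a fixed submodule,
  where some steps collapse and only the surviving ones count.\<close>

lemma subchain_card:
  assumes "\<And>i. i \<le> n \<Longrightarrow> submodule (N i) R M \<and> U \<subseteq> N i" "\<And>i. i < n \<Longrightarrow> N i \<subseteq> N (Suc i)"
  shows "subchain R M U (N n) (card {i. i < n \<and> N i \<noteq> N (Suc i)})"
  using assms
proof (induction n)
  case 0 thus ?case unfolding subchain_def by (auto intro!: exI[of _ "\<lambda>_. N 0"])
next
  case (Suc n)
  hence IH: "subchain R M U (N n) (card {i. i < n \<and> N i \<noteq> N (Suc i)})" by auto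
  show ?case
  proof (cases "N n = N (Suc n)")
    case True
    hence "{i. i < Suc n \<and> N i \<noteq> N (Suc i)} = {i. i < n \<and> N i \<noteq> N (Suc i)}"
      using less_Suc_eq by auto
    thus ?thesis using IH True by simp
  next
    case False
    have "N n \<subset> N (Suc n)" "submodule (N (Suc n)) R M" using False Suc.prems by auto
    from subchain_snoc[OF IH this]
    have "subchain R M U (N (Suc n)) (Suc (card {i. i < n \<and> N i \<noteq> N (Suc i)}))" .
    moreover have "{i. i < Suc n \<and> N i \<noteq> N (Suc i)} = insert n {i. i < n \<and> N i \<noteq> N (Suc i)}"
      using False less_Suc_eq by auto
    ultimately show ?thesis by simp
  qed
qed

text \<open>The modular law. It shows that a strict step of a chain stays strict after intersecting
  with \<open>L\<close> or after adding \<open>L\<close>.\<close>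

lemma submodule_modular:
  assumes "submodule H R M" "submodule K R M" "submodule L R M" "H \<subseteq> K"
    "H \<inter> L = K \<inter> L" "H <+>\<^bsub>M\<^esub> L = K <+>\<^bsub>M\<^esub> L"
  shows "H = K"
proof (intro equalityI assms subsetI)
  fix x assume x: "x \<in> K"
  hence "x \<in> H <+>\<^bsub>M\<^esub> L" using assms(6) set_add_upper1[OF assms(2,3)] by auto
  then obtain h l where hl: "h \<in> H" "l \<in> L" "x = h \<oplus>\<^bsub>M\<^esub> l" by (auto simp: mem_set_add)
  have "l \<in> K" using submodule_add_cancel[OF assms(2), of h l] hl x assms(3,4) submodule_mem_carrier by auto
  hence "l \<in> H" using hl assms(5) by auto
  thus "x \<in> H" using hl submodule_add_mem[OF assms(1)] by simp
qed

text \<open>Intersections with \<open>V\<close> and sums with \<open>V\<close> turn a chain from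
  \<open>U\<close> to \<open>W\<close> into two chains, and by the modular law no strict step is
  lost in both. Conversely, chains are concatenated.\<close>

lemma sublen_additive:
  assumes U: "submodule U R M" and V: "submodule V R M" and W: "submodule W R M"
    and UV: "U \<subseteq> V" and VW: "V \<subseteq> W"
  shows "sublen R M U W = sublen R M U V + sublen R M V W"
proof (rule antisym)
  have UW: "U \<subseteq> W" using UV VW by simp
  show "sublen R M U W \<le> sublen R M U V + sublen R M V W"
  proof (rule enat_leI)
    fix k assume "enat k \<le> sublen R M U W"
    then obtain N where N: "\<And>i. i \<le> k \<Longrightarrow> submodule (N i) R M \<and> U \<subseteq> N i \<and> N i \<subseteq> W" "\<And>i. i < k \<Longrightarrow> N i \<subset> N (Suc i)"
      using enat_le_sublen_iff[OF U UW] unfolding subchain_def by auto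
    let ?P = "\<lambda>i. N i \<inter> V" let ?Q = "\<lambda>i. N i <+>\<^bsub>M\<^esub> V"
    let ?A = "{i. i < k \<and> ?P i \<noteq> ?P (Suc i)}" let ?B = "{i. i < k \<and> ?Q i \<noteq> ?Q (Suc i)}"
    have N2: "N i \<subseteq> N (Suc i)" if "i < k" for i using N(2)[OF that] by auto
    have "subchain R M U (?P k) (card ?A)"
    proof (rule subchain_card)
      show "submodule (?P i) R M \<and> U \<subseteq> ?P i" if "i \<le> k" for i
        using N(1)[OF that] submodule_Int V UV by auto
      show "?P i \<subseteq> ?P (Suc i)" if "i < k" for i using N2[OF that] by auto
    qed
    hence A: "subchain R M U V (card ?A)" by (rule subchain_mono) auto
    have "subchain R M V (?Q k) (card ?B)"
    proof (rule subchain_card)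
      show "submodule (?Q i) R M \<and> V \<subseteq> ?Q i" if "i \<le> k" for i
        using N(1)[OF that] V submodule_set_add set_add_upper2 by auto
      show "?Q i \<subseteq> ?Q (Suc i)" if "i < k" for i using N2[OF that] by (intro set_add_mono) auto
    qed
    hence B: "subchain R M V W (card ?B)"
      by (rule subchain_mono) (use N(1)[of k] set_add_least[OF W] VW in auto)
    have "i \<in> ?A \<union> ?B" if "i < k" for i
      using submodule_modular[of "N i" "N (Suc i)" V] N(1)[of i] N(1)[of "Suc i"] N(2)[OF that] that V by auto
    hence "{..<k} \<subseteq> ?A \<union> ?B" by auto
    hence "k \<le> card (?A \<union> ?B)" using card_mono[of "?A \<union> ?B" "{..<k}"] by simp
    also have "\<dots> \<le> card ?A + card ?B" by (rule card_Un_le)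
    finally have "enat k \<le> enat (card ?A) + enat (card ?B)" by simp
    also have "\<dots> \<le> sublen R M U V + sublen R M V W"
      using A B enat_le_sublen_iff[OF U UV] enat_le_sublen_iff[OF V VW] by (intro add_mono) auto
    finally show "enat k \<le> sublen R M U V + sublen R M V W" .
  qed
  have app: "enat (i + j) \<le> sublen R M U W" if "enat i \<le> sublen R M U V" "enat j \<le> sublen R M V W" for i j
    using subchain_append[OF _ _ UV VW] that enat_le_sublen_iff[OF U UV] enat_le_sublen_iff[OF V VW]
      enat_le_sublen_iff[OF U UW] by auto
  show "sublen R M U V + sublen R M V W \<le> sublen R M U W"
  proof (cases "sublen R M U V = \<infinity> \<or> sublen R M V W = \<infinity>")
    case True
    have "enat k \<le> sublen R M U W" for k
      using True app[of k 0] app[of 0 k] by (auto simp: zero_enat_def[symmetric])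
    thus ?thesis using enat_leI by blast
  next
    case False
    then obtain i j where "sublen R M U V = enat i" "sublen R M V W = enat j" by auto
    thus ?thesis using app[of i j] by simp
  qed
qed

lemma sublen_refl: "submodule U R M \<Longrightarrow> sublen R M U U = 0"
proof -
  assume U: "submodule U R M"
  have "\<not> enat 1 \<le> sublen R M U U"
    unfolding enat_le_sublen_iff[OF U order_refl] subchain_def by (auto dest!: spec[of _ 0])
  thus ?thesis by (metis enat_0_iff(1) enat_ord_simps(1) ileI1 iless_eSuc0 not_le_imp_less one_eSuc one_enat_def)
qed

lemma sublen_pos: "submodule U R M \<Longrightarrow> submodule V R M \<Longrightarrow> U \<subset> V \<Longrightarrow> 1 \<le> sublen R M U V"
proof -
  assume U: "submodule U R M" "submodule V R M" "U \<subset> V"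
  hence "subchain R M U U 0" unfolding subchain_def by (intro exI[of _ "\<lambda>_. U"]) auto
  from subchain_snoc[OF this U(3,2)] have "enat 1 \<le> sublen R M U V"
    using enat_le_sublen_iff[OF U(1)] U(3) by auto
  thus ?thesis by (simp add: one_enat_def)
qed

lemma sublen_eq_0: "submodule U R M \<Longrightarrow> submodule V R M \<Longrightarrow> U \<subseteq> V \<Longrightarrow> sublen R M U V = 0 \<Longrightarrow> U = V"
  using sublen_pos by fastforce

lemma sublen_mono:
  assumes "submodule U R M" "submodule V R M" "submodule U' R M" "submodule V' R M"
    "U' \<subseteq> U" "U \<subseteq> V" "V \<subseteq> V'"
  shows "sublen R M U V \<le> sublen R M U' V'"
proof -
  have "U' \<subseteq> V'" using assms by auto
  show ?thesis by (rule sublen_leI) (use assms subchain_mono in \<open>auto\<close>)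
qed

end

section \<open>Lengths of images under linear maps\<close>

context
  fixes R :: "('a, 'm) ring_scheme" and N :: "('a, 'b, 'n) module_scheme" and M :: "('a, 'c, 'k) module_scheme"
    and f :: "'b \<Rightarrow> 'c" and U U' V
  assumes N: "module R N" and M: "module R M" and f: "f \<in> lin_maps R N M"
    and U: "submodule U R N" and U': "submodule U' R N" and sub: "U' \<subseteq> U" and V: "submodule V R M"
begin

interpretation N: module R N by (fact N)
interpretation M: module R M by (fact M)

text \<open>Adding \<open>V\<close> replaces the passage to M/V: \<open>f\<close> induces a
  surjection from U/U' onto the quotient of \<open>V + f U\<close> by \<open>V + f U'\<close>, and a
  chain in the target is pulled back along it.\<close>

lemma sublen_lin_image_le:
  "sublen R M (V <+>\<^bsub>M\<^esub> f ` U') (V <+>\<^bsub>M\<^esub> f ` U) \<le> sublen R N U' U"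
proof (rule sublen_leI)
  show "submodule (V <+>\<^bsub>M\<^esub> f ` U') R M" using M.submodule_set_add submodule_lin_image[OF N M f] V U' by blast
  show "V <+>\<^bsub>M\<^esub> f ` U' \<subseteq> V <+>\<^bsub>M\<^esub> f ` U" using sub by (intro M.set_add_mono) auto
  show "submodule U' R N" "U' \<subseteq> U" by fact+
  fix k assume "subchain R M (V <+>\<^bsub>M\<^esub> f ` U') (V <+>\<^bsub>M\<^esub> f ` U) k"
  then obtain Y where Y: "\<And>i. i \<le> k \<Longrightarrow> submodule (Y i) R M \<and> V <+>\<^bsub>M\<^esub> f ` U' \<subseteq> Y i \<and> Y i \<subseteq> V <+>\<^bsub>M\<^esub> f ` U"
    "\<And>i. i < k \<Longrightarrow> Y i \<subset> Y (Suc i)" unfolding subchain_def by auto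
  have Vsub: "V \<subseteq> Y i" "f ` U' \<subseteq> Y i" if "i \<le> k" for i
    using Y(1)[OF that] M.set_add_upper1[OF V submodule_lin_image[OF N M f U']]
      M.set_add_upper2[OF V submodule_lin_image[OF N M f U']] by auto
  let ?Z = "\<lambda>i. {u \<in> U. f u \<in> Y i}"
  have "submodule (?Z i) R N \<and> U' \<subseteq> ?Z i \<and> ?Z i \<subseteq> U" if "i \<le> k" for i
    using submodule_lin_vimage[OF N M f U, of "Y i"] Y(1)[OF that] Vsub[OF that] sub by auto
  moreover have "?Z i \<subset> ?Z (Suc i)" if i: "i < k" for i
  proof -
    obtain x where x: "x \<in> Y (Suc i)" "x \<notin> Y i" using Y(2)[OF i] by auto
    have S: "submodule (Y i) R M" "submodule (Y (Suc i)) R M" using Y(1) i by auto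
    have "x \<in> V <+>\<^bsub>M\<^esub> f ` U" using x Y(1)[of "Suc i"] i by auto
    then obtain v u where vu: "v \<in> V" "u \<in> U" "x = v \<oplus>\<^bsub>M\<^esub> f u" by (auto simp: M.mem_set_add)
    have "f u \<in> Y (Suc i)"
      using M.submodule_add_cancel[OF S(2), of v "f u"] vu x Vsub[of "Suc i"] i
        lin_mapsD(1)[OF f, of u] N.submodule_mem_carrier[OF U] by auto
    moreover have "f u \<notin> Y i" using M.submodule_add_mem[OF S(1), of v "f u"] vu x Vsub[of i] i by auto
    ultimately have "u \<in> ?Z (Suc i)" "u \<notin> ?Z i" using vu by auto
    moreover have "?Z i \<subseteq> ?Z (Suc i)" using Y(2)[OF i] by auto
    ultimately show ?thesis by blast
  qed
  ultimately show "subchain R N U' U k" by (rule subchainI)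
qed

text \<open>The assumption \<open>inj\<close> makes the surjection of the preceding lemma injective,
  so that chains can also be pushed forward.\<close>

lemma sublen_lin_image_eq:
  assumes inj: "\<And>u. u \<in> U \<Longrightarrow> f u \<in> V <+>\<^bsub>M\<^esub> f ` U' \<Longrightarrow> u \<in> U'"
  shows "sublen R M (V <+>\<^bsub>M\<^esub> f ` U') (V <+>\<^bsub>M\<^esub> f ` U) = sublen R N U' U"
proof (rule antisym[OF sublen_lin_image_le sublen_leI])
  show S: "submodule (V <+>\<^bsub>M\<^esub> f ` U') R M" using M.submodule_set_add submodule_lin_image[OF N M f] V U' by blast
  show "V <+>\<^bsub>M\<^esub> f ` U' \<subseteq> V <+>\<^bsub>M\<^esub> f ` U" using sub by (intro M.set_add_mono) auto
  show "submodule U' R N" "U' \<subseteq> U" by fact+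
  fix k assume "subchain R N U' U k"
  then obtain Y where Y: "\<And>i. i \<le> k \<Longrightarrow> submodule (Y i) R N \<and> U' \<subseteq> Y i \<and> Y i \<subseteq> U"
    "\<And>i. i < k \<Longrightarrow> Y i \<subset> Y (Suc i)" unfolding subchain_def by auto
  let ?Z = "\<lambda>i. V <+>\<^bsub>M\<^esub> f ` (Y i)"
  have "submodule (?Z i) R M \<and> V <+>\<^bsub>M\<^esub> f ` U' \<subseteq> ?Z i \<and> ?Z i \<subseteq> V <+>\<^bsub>M\<^esub> f ` U" if "i \<le> k" for i
    using Y(1)[OF that] M.submodule_set_add[OF V submodule_lin_image[OF N M f]]
    by (intro conjI M.set_add_mono image_mono) auto
  moreover have "?Z i \<subset> ?Z (Suc i)" if i: "i < k" for i
  proof -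
    obtain u where u: "u \<in> Y (Suc i)" "u \<notin> Y i" using Y(2)[OF i] by auto
    have SY: "submodule (Y i) R N" "submodule (Y (Suc i)) R N" using Y(1) i by auto
    have uc: "u \<in> U" "u \<in> carrier N" using u Y(1)[of "Suc i"] i N.submodule_mem_carrier[OF SY(2)] by auto
    have "f u \<in> ?Z (Suc i)"
      using M.set_add_upper2[OF V submodule_lin_image[OF N M f SY(2)]] u by auto
    moreover have "f u \<notin> ?Z i"
    proof
      assume "f u \<in> ?Z i"
      then obtain v y where vy: "v \<in> V" "y \<in> Y i" "f u = v \<oplus>\<^bsub>M\<^esub> f y" by (auto simp: M.mem_set_add)
      have yc: "y \<in> carrier N" "y \<in> U" using vy N.submodule_mem_carrier[OF SY(1)] Y(1)[of i] i by auto
      have "f (u \<ominus>\<^bsub>N\<^esub> y) = f u \<ominus>\<^bsub>M\<^esub> f y" using lin_maps_diff[OF N M f] uc yc by auto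
      also have "\<dots> = v" using vy lin_mapsD(1)[OF f yc(1)] M.submodule_mem_carrier[OF V]
        by (simp add: M.minus_eq M.a_assoc M.r_neg)
      finally have "f (u \<ominus>\<^bsub>N\<^esub> y) \<in> V <+>\<^bsub>M\<^esub> f ` U'"
        using vy M.set_add_upper1[OF V submodule_lin_image[OF N M f U']] by auto
      hence "u \<ominus>\<^bsub>N\<^esub> y \<in> U'" using inj N.submodule_diff_mem[OF U] uc yc by auto
      hence "u \<ominus>\<^bsub>N\<^esub> y \<in> Y i" using Y(1)[of i] i by auto
      hence "(u \<ominus>\<^bsub>N\<^esub> y) \<oplus>\<^bsub>N\<^esub> y \<in> Y i" using vy N.submodule_add_mem[OF SY(1)] by auto
      moreover have "(u \<ominus>\<^bsub>N\<^esub> y) \<oplus>\<^bsub>N\<^esub> y = u" using uc yc by (simp add: N.minus_eq N.a_assoc N.l_neg)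
      ultimately show False using u by simp
    qed
    moreover have "?Z i \<subseteq> ?Z (Suc i)" using Y(2)[OF i] by (intro M.set_add_mono) auto
    ultimately show ?thesis by blast
  qed
  ultimately show "subchain R M (V <+>\<^bsub>M\<^esub> f ` U') (V <+>\<^bsub>M\<^esub> f ` U) k" by (rule subchainI)
qed

end

section \<open>Quotient modules and change of rings\<close>

context module
begin

lemma submodule_abelian_subgroup: "submodule N R M \<Longrightarrow> abelian_subgroup N M"
  by (intro abelian_subgroupI3 additive_subgroup.intro M.abelian_group_axioms submodule.axioms(1))

lemma a_rcos_eq_iff:
  assumes N: "submodule N R M" and "x \<in> carrier M" "y \<in> carrier M"
  shows "N +>\<^bsub>M\<^esub> x = N +>\<^bsub>M\<^esub> y \<longleftrightarrow> x \<ominus>\<^bsub>M\<^esub> y \<in> N"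
proof -
  interpret abelian_subgroup N M by (rule submodule_abelian_subgroup[OF N])
  show ?thesis
  proof
    assume "N +>\<^bsub>M\<^esub> x = N +>\<^bsub>M\<^esub> y"
    hence "x \<in> N +>\<^bsub>M\<^esub> y" using a_rcos_self[OF assms(2)] by simp
    thus "x \<ominus>\<^bsub>M\<^esub> y \<in> N" using a_rcos_module_imp[OF assms(3)] assms by (simp add: M.minus_eq)
  next
    assume "x \<ominus>\<^bsub>M\<^esub> y \<in> N"
    hence "x \<in> N +>\<^bsub>M\<^esub> y" using a_rcos_module_rev[OF assms(3,2)] by (simp add: M.minus_eq)
    thus "N +>\<^bsub>M\<^esub> x = N +>\<^bsub>M\<^esub> y" using a_repr_independence'[of x y] assms by simp
  qed
qed

lemma quot_module_simps [simp]:
  "carrier (quot_module M N) = a_rcosets\<^bsub>M\<^esub> N" "\<zero>\<^bsub>quot_module M N\<^esub> = N"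
  "add (quot_module M N) = set_add M"
  by (simp_all add: quot_module_def)

lemma quot_carrier: "a_rcosets\<^bsub>M\<^esub> N = (\<lambda>x. N +>\<^bsub>M\<^esub> x) ` carrier M"
  by (auto simp: A_RCOSETS_def')

lemma quot_add:
  assumes N: "submodule N R M" and "x \<in> carrier M" "y \<in> carrier M"
  shows "(N +>\<^bsub>M\<^esub> x) <+>\<^bsub>M\<^esub> (N +>\<^bsub>M\<^esub> y) = N +>\<^bsub>M\<^esub> (x \<oplus>\<^bsub>M\<^esub> y)"
  using abelian_subgroup.a_rcos_sum[OF submodule_abelian_subgroup[OF N]] assms by simp

text \<open>\<open>quot_module\<close> defines the scalar multiple as a union over all
  representatives of the coset; the union collapses because each of them yields the same
  coset.\<close>

lemma quot_smult:
  assumes N: "submodule N R M" and a: "a \<in> carrier R" and x: "x \<in> carrier M"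
  shows "a \<odot>\<^bsub>quot_module M N\<^esub> (N +>\<^bsub>M\<^esub> x) = N +>\<^bsub>M\<^esub> (a \<odot>\<^bsub>M\<^esub> x)"
proof -
  interpret S: abelian_subgroup N M by (rule submodule_abelian_subgroup[OF N])
  have *: "N +>\<^bsub>M\<^esub> (a \<odot>\<^bsub>M\<^esub> y) = N +>\<^bsub>M\<^esub> (a \<odot>\<^bsub>M\<^esub> x)" if y: "y \<in> N +>\<^bsub>M\<^esub> x" for y
  proof -
    obtain n where n: "n \<in> N" "y = n \<oplus>\<^bsub>M\<^esub> x" using y by (auto simp: a_r_coset_def')
    have nc: "n \<in> carrier M" using n submodule_mem_carrier[OF N] by simp
    have "a \<odot>\<^bsub>M\<^esub> y \<ominus>\<^bsub>M\<^esub> a \<odot>\<^bsub>M\<^esub> x = a \<odot>\<^bsub>M\<^esub> n"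
      using n nc x a by (simp add: smult_r_distr M.minus_eq M.a_assoc M.r_neg)
    also have "\<dots> \<in> N" using submodule_smult_mem[OF N a n(1)] .
    finally show ?thesis using a_rcos_eq_iff[OF N] n nc x a by simp
  qed
  have "a \<odot>\<^bsub>quot_module M N\<^esub> (N +>\<^bsub>M\<^esub> x) = (\<Union>y\<in>N +>\<^bsub>M\<^esub> x. N +>\<^bsub>M\<^esub> (a \<odot>\<^bsub>M\<^esub> y))"
    by (simp add: quot_module_def)
  also have "\<dots> = (\<Union>y\<in>N +>\<^bsub>M\<^esub> x. N +>\<^bsub>M\<^esub> (a \<odot>\<^bsub>M\<^esub> x))" by (rule SUP_cong[OF refl *])
  also have "\<dots> = N +>\<^bsub>M\<^esub> (a \<odot>\<^bsub>M\<^esub> x)" using S.a_rcos_self[OF x] by (simp only: UN_constant) auto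
  finally show ?thesis .
qed

lemma zero_set_add: "submodule H R M \<Longrightarrow> {\<zero>\<^bsub>M\<^esub>} <+>\<^bsub>M\<^esub> H = H"
  using set_add_upper2[OF zero_submodule] set_add_least[of H "{\<zero>\<^bsub>M\<^esub>}" H] submodule_zero_mem by blast

lemma quot_zero: "submodule N R M \<Longrightarrow> N +>\<^bsub>M\<^esub> \<zero>\<^bsub>M\<^esub> = N"
  using submodule_subset by simp

lemma module_quot:
  assumes N: "submodule N R M" shows "module R (quot_module M N)"
proof -
  note S = quot_smult[OF N] and A = quot_add[OF N] and Z = quot_zero[OF N]
  show ?thesis
  proof (rule moduleI)
    show "cring R" by (rule R.is_cring)
    show "abelian_group (quot_module M N)"
    proof (rule abelian_groupI)
      fix x assume "x \<in> carrier (quot_module M N)"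
      then obtain u where u: "u \<in> carrier M" "x = N +>\<^bsub>M\<^esub> u" by (auto simp: quot_carrier)
      have "(N +>\<^bsub>M\<^esub> (\<ominus>\<^bsub>M\<^esub> u)) <+>\<^bsub>M\<^esub> x = N" using u A Z by (simp add: M.l_neg)
      thus "\<exists>y\<in>carrier (quot_module M N). y \<oplus>\<^bsub>quot_module M N\<^esub> x = \<zero>\<^bsub>quot_module M N\<^esub>"
        using u by (auto simp: quot_carrier)
      show "\<zero>\<^bsub>quot_module M N\<^esub> \<oplus>\<^bsub>quot_module M N\<^esub> x = x" using A[of "\<zero>\<^bsub>M\<^esub>" u] u Z by simp
    next
      show "\<zero>\<^bsub>quot_module M N\<^esub> \<in> carrier (quot_module M N)"
        using Z by (auto simp: quot_carrier intro!: image_eqI[where x="\<zero>\<^bsub>M\<^esub>"])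
    qed (auto simp: quot_carrier A M.a_ac)
  qed (auto simp: quot_carrier A S smult_l_distr smult_r_distr smult_assoc1)
qed

lemma quot_lin_map:
  "submodule N R M \<Longrightarrow> (\<lambda>x. N +>\<^bsub>M\<^esub> x) \<in> lin_maps R M (quot_module M N)"
  unfolding lin_maps_def by (auto simp: quot_carrier quot_add quot_smult)

lemma module_length_eq_sublen: "module_length R M = sublen R M {\<zero>\<^bsub>M\<^esub>} (carrier M)"
proof -
  have "subchain R M {\<zero>\<^bsub>M\<^esub>} (carrier M) n \<longleftrightarrow> (\<exists>N :: nat \<Rightarrow> 'c set.
     (\<forall>i\<le>n. submodule (N i) R M) \<and> (\<forall>i<n. N i \<subset> N (Suc i)))" for n
  proof
    assume "subchain R M {\<zero>\<^bsub>M\<^esub>} (carrier M) n"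
    thus "\<exists>N :: nat \<Rightarrow> 'c set. (\<forall>i\<le>n. submodule (N i) R M) \<and> (\<forall>i<n. N i \<subset> N (Suc i))"
      unfolding subchain_def by (elim exE, rule_tac x=N in exI) simp
  next
    assume "\<exists>N :: nat \<Rightarrow> 'c set. (\<forall>i\<le>n. submodule (N i) R M) \<and> (\<forall>i<n. N i \<subset> N (Suc i))"
    then obtain N where N: "\<forall>i\<le>n. submodule (N i) R M" "\<forall>i<n. N i \<subset> N (Suc i)" by blast
    show "subchain R M {\<zero>\<^bsub>M\<^esub>} (carrier M) n"
      by (rule subchainI[of _ N]) (use N submodule_zero_mem submodule_subset in auto)
  qed
  thus ?thesis unfolding module_length_def sublen_def by simp
qed

end

text \<open>The image formula for the projection, with \<open>V = 0\<close>. It turns the lengths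
  that occur in the definitions into values of \<open>sublen\<close>.\<close>

lemma module_length_quot:
  assumes "module R M" and N: "submodule N R M"
  shows "module_length R (quot_module M N) = sublen R M N (carrier M)"
proof -
  interpret M: module R M by fact
  interpret Q: module R "quot_module M N" by (rule M.module_quot[OF N])
  let ?f = "\<lambda>x. N +>\<^bsub>M\<^esub> x"
  have f: "?f \<in> lin_maps R M (quot_module M N)" by (rule M.quot_lin_map[OF N])
  have fN: "?f x = N \<longleftrightarrow> x \<in> N" if "x \<in> carrier M" for x
    using M.a_rcos_eq_iff[OF N that M.M.zero_closed] M.quot_zero[OF N] that M.M.r_zero M.M.add.inv_one by (simp add: M.M.minus_eq a_inv_def)
  have imN: "?f ` N = {\<zero>\<^bsub>quot_module M N\<^esub>}"
    using fN M.submodule_mem_carrier[OF N] M.submodule_zero_mem[OF N] by auto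
  note z = Q.zero_set_add
  have imM: "?f ` carrier M = carrier (quot_module M N)" by (simp add: M.quot_carrier)
  have "sublen R (quot_module M N) ({\<zero>\<^bsub>quot_module M N\<^esub>} <+>\<^bsub>quot_module M N\<^esub> ?f ` N)
    ({\<zero>\<^bsub>quot_module M N\<^esub>} <+>\<^bsub>quot_module M N\<^esub> ?f ` carrier M) = sublen R M N (carrier M)"
  proof (rule sublen_lin_image_eq[OF assms(1) Q.module_axioms f M.carrier_is_submodule N M.submodule_subset[OF N] Q.zero_submodule])
    fix u assume u: "u \<in> carrier M" "?f u \<in> {\<zero>\<^bsub>quot_module M N\<^esub>} <+>\<^bsub>quot_module M N\<^esub> ?f ` N"
    thus "u \<in> N" using fN[of u] unfolding imN z[OF Q.zero_submodule] by simp
  qed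
  thus ?thesis
    unfolding imN imM z[OF Q.zero_submodule] z[OF Q.carrier_is_submodule] Q.module_length_eq_sublen .
qed

section \<open>Change of rings along a surjection\<close>

lemma descend_module_simps [simp]:
  "carrier (descend_module A l N) = carrier N" "\<zero>\<^bsub>descend_module A l N\<^esub> = \<zero>\<^bsub>N\<^esub>"
  "add (descend_module A l N) = add N"
  by (simp_all add: descend_module_def)

text \<open>The assumption \<open>ker\<close> makes the preimage chosen by \<open>inv_into\<close>
  immaterial, so stability under one ring of scalars is stability under the other.\<close>

lemma submodule_descend_iff:
  assumes "module A N" and l: "l ` carrier A = carrier Q"
    and ker: "\<And>a b x. \<lbrakk>a \<in> carrier A; b \<in> carrier A; l a = l b; x \<in> carrier N\<rbrakk> \<Longrightarrow> a \<odot>\<^bsub>N\<^esub> x = b \<odot>\<^bsub>N\<^esub> x"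
  shows "submodule H Q (descend_module A l N) \<longleftrightarrow> submodule H A N"
proof -
  have sm: "smult (descend_module A l N) c = smult N (inv_into (carrier A) l c)" for c
    by (simp add: descend_module_def)
  have inv: "inv_into (carrier A) l c \<in> carrier A" "l (inv_into (carrier A) l c) = c" if "c \<in> carrier Q" for c
    using that l by (metis inv_into_into, metis f_inv_into_f)
  have sg: "subgroup H (add_monoid (descend_module A l N)) \<longleftrightarrow> subgroup H (add_monoid N)"
    by (simp add: subgroup_def m_inv_def)
  have "(\<forall>c\<in>carrier Q. \<forall>x\<in>H. c \<odot>\<^bsub>descend_module A l N\<^esub> x \<in> H) \<longleftrightarrow> (\<forall>a\<in>carrier A. \<forall>x\<in>H. a \<odot>\<^bsub>N\<^esub> x \<in> H)"
    if "H \<subseteq> carrier N"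
  proof (intro iffI ballI)
    fix a x assume *: "\<forall>c\<in>carrier Q. \<forall>x\<in>H. c \<odot>\<^bsub>descend_module A l N\<^esub> x \<in> H" "a \<in> carrier A" "x \<in> H"
    have la: "l a \<in> carrier Q" using * l by auto
    have "a \<odot>\<^bsub>N\<^esub> x = inv_into (carrier A) l (l a) \<odot>\<^bsub>N\<^esub> x"
      by (rule ker) (use * that inv[OF la] in auto)
    also have "\<dots> = l a \<odot>\<^bsub>descend_module A l N\<^esub> x" by (simp add: sm)
    also have "\<dots> \<in> H" using *(1,3) la by blast
    finally show "a \<odot>\<^bsub>N\<^esub> x \<in> H" .
  next
    fix c x assume *: "\<forall>a\<in>carrier A. \<forall>x\<in>H. a \<odot>\<^bsub>N\<^esub> x \<in> H" "c \<in> carrier Q" "x \<in> H"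
    thus "c \<odot>\<^bsub>descend_module A l N\<^esub> x \<in> H" unfolding sm using inv(1)[of c] by blast
  qed
  moreover have "subgroup H (add_monoid N) \<Longrightarrow> H \<subseteq> carrier N" by (simp add: subgroup_def)
  moreover have "submodule_axioms H Q (descend_module A l N) \<longleftrightarrow> (\<forall>c\<in>carrier Q. \<forall>x\<in>H. c \<odot>\<^bsub>descend_module A l N\<^esub> x \<in> H)"
    "submodule_axioms H A N \<longleftrightarrow> (\<forall>a\<in>carrier A. \<forall>x\<in>H. a \<odot>\<^bsub>N\<^esub> x \<in> H)"
    unfolding submodule_axioms_def Ball_def by blast+
  ultimately show ?thesis unfolding submodule_def sg by metis
qed

text \<open>Length depends only on the lattice of submodules, which the change of rings
  preserves.\<close>

lemma module_length_descend:
  assumes "module A N" and l: "l ` carrier A = carrier Q"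
    and ker: "\<And>a b x. \<lbrakk>a \<in> carrier A; b \<in> carrier A; l a = l b; x \<in> carrier N\<rbrakk> \<Longrightarrow> a \<odot>\<^bsub>N\<^esub> x = b \<odot>\<^bsub>N\<^esub> x"
  shows "module_length Q (descend_module A l N) = module_length A N"
proof -
  have "(\<lambda>H. submodule H Q (descend_module A l N)) = (\<lambda>H. submodule H A N)"
    by (rule ext, rule submodule_descend_iff[OF assms(1,2)], rule ker)
  thus ?thesis unfolding module_length_def fun_eq_iff by (simp only:)
qed

section \<open>Noetherian rings and finitely generated submodules\<close>

definition fg_sub :: "('a, 'm) ring_scheme \<Rightarrow> ('a, 'b, 'n) module_scheme \<Rightarrow> 'b set \<Rightarrow> bool" where
  "fg_sub R M U \<longleftrightarrow> (\<exists>S. finite S \<and> S \<subseteq> carrier M \<and> module_span R M S = U)"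

lemma (in module) fg_sub_submodule: "fg_sub R M U \<Longrightarrow> submodule U R M"
  unfolding fg_sub_def using span_submodule by auto

lemma (in cring) span_regular_eq_genideal:
  assumes "S \<subseteq> carrier R"
  shows "module_span R (regular_module R) S = genideal R S"
  unfolding module_span_def genideal_def submodule_regular_iff by auto

context module
begin

text \<open>The coefficients at \<open>g\<close> that occur in elements of \<open>N\<close> lying in
  \<open>R g + H\<close>. They record what \<open>N\<close> contains beyond \<open>H\<close> when
  one generator is added.\<close>

definition coeff_ideal :: "'c \<Rightarrow> 'c set \<Rightarrow> 'c set \<Rightarrow> 'a set" where
  "coeff_ideal g H N = {a \<in> carrier R. \<exists>n\<in>N. \<exists>h\<in>H. n = a \<odot>\<^bsub>M\<^esub> g \<oplus>\<^bsub>M\<^esub> h}"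

lemma ideal_coeff_ideal:
  assumes g: "g \<in> carrier M" and H: "submodule H R M" and N: "submodule N R M"
  shows "ideal (coeff_ideal g H N) R"
proof -
  have "submodule (coeff_ideal g H N) R (regular_module R)"
  proof (rule module.submoduleI2[OF module_regular])
    show "coeff_ideal g H N \<subseteq> carrier (regular_module R)" by (auto simp: coeff_ideal_def)
    have "\<zero>\<^bsub>M\<^esub> = \<zero>\<^bsub>R\<^esub> \<odot>\<^bsub>M\<^esub> g \<oplus>\<^bsub>M\<^esub> \<zero>\<^bsub>M\<^esub>" using g by simp
    thus "\<zero>\<^bsub>regular_module R\<^esub> \<in> coeff_ideal g H N" using submodule_zero_mem[OF N] submodule_zero_mem[OF H]
      unfolding coeff_ideal_def by auto
  next
    fix a b assume "a \<in> coeff_ideal g H N" "b \<in> coeff_ideal g H N"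
    then obtain n h n' h' where *: "a \<in> carrier R" "b \<in> carrier R" "n \<in> N" "n' \<in> N" "h \<in> H"
      "h' \<in> H" "n = a \<odot>\<^bsub>M\<^esub> g \<oplus>\<^bsub>M\<^esub> h" "n' = b \<odot>\<^bsub>M\<^esub> g \<oplus>\<^bsub>M\<^esub> h'" unfolding coeff_ideal_def by blast
    have "h \<in> carrier M" "h' \<in> carrier M" using * submodule_mem_carrier[OF H] by auto
    hence "n \<oplus>\<^bsub>M\<^esub> n' = (a \<oplus>\<^bsub>R\<^esub> b) \<odot>\<^bsub>M\<^esub> g \<oplus>\<^bsub>M\<^esub> (h \<oplus>\<^bsub>M\<^esub> h')"
      using * g by (simp add: smult_l_distr M.a_ac)
    moreover have "n \<oplus>\<^bsub>M\<^esub> n' \<in> N" "h \<oplus>\<^bsub>M\<^esub> h' \<in> H" "a \<oplus>\<^bsub>R\<^esub> b \<in> carrier R"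
      using * submodule_add_mem[OF N] submodule_add_mem[OF H] by auto
    ultimately show "a \<oplus>\<^bsub>regular_module R\<^esub> b \<in> coeff_ideal g H N"
      unfolding coeff_ideal_def regular_module_simps by blast
  next
    fix a b assume a: "a \<in> carrier R" and "b \<in> coeff_ideal g H N"
    then obtain n h where *: "b \<in> carrier R" "n \<in> N" "h \<in> H" "n = b \<odot>\<^bsub>M\<^esub> g \<oplus>\<^bsub>M\<^esub> h"
      unfolding coeff_ideal_def by blast
    have "h \<in> carrier M" using * submodule_mem_carrier[OF H] by auto
    hence "a \<odot>\<^bsub>M\<^esub> n = (a \<otimes>\<^bsub>R\<^esub> b) \<odot>\<^bsub>M\<^esub> g \<oplus>\<^bsub>M\<^esub> (a \<odot>\<^bsub>M\<^esub> h)"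
      using * g a by (simp add: smult_r_distr smult_assoc1)
    moreover have "a \<odot>\<^bsub>M\<^esub> n \<in> N" "a \<odot>\<^bsub>M\<^esub> h \<in> H" "a \<otimes>\<^bsub>R\<^esub> b \<in> carrier R"
      using * a submodule_smult_mem[OF N] submodule_smult_mem[OF H] by auto
    ultimately show "a \<odot>\<^bsub>regular_module R\<^esub> b \<in> coeff_ideal g H N"
      unfolding coeff_ideal_def regular_module_simps by blast
  qed
  thus ?thesis by (simp add: submodule_regular_iff)
qed

text \<open>Induction on the generators: the coefficients at \<open>g\<close> form a finitely
  generated ideal \<open>J\<close>, lifts of generators of \<open>J\<close> account for
  \<open>N\<close> modulo the span of \<open>S\<close>, and what is left lies in the intersection of
  \<open>N\<close> with that span.\<close>

lemma fg_sub_of_span: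
  assumes noeth: "noetherian_ring R" and "finite S" "S \<subseteq> carrier M"
    and "submodule N R M" "N \<subseteq> module_span R M S"
  shows "fg_sub R M N"
  using assms(2-)
proof (induction S arbitrary: N rule: finite_induct)
  case empty
  hence "N = {\<zero>\<^bsub>M\<^esub>}" using submodule_zero_mem span_empty by blast
  thus ?case unfolding fg_sub_def using span_empty by blast
next
  case (insert g S)
  interpret noeth: noetherian_ring R by fact
  have g: "g \<in> carrier M" "S \<subseteq> carrier M" using insert.prems by auto
  have sp: "module_span R M (insert g S) = cyc g <+>\<^bsub>M\<^esub> module_span R M S" by (rule span_insert[OF g])
  have spS: "submodule (module_span R M S) R M" by (rule span_submodule[OF g(2)])
  note N = insert.prems(2)
  define J where "J = coeff_ideal g (module_span R M S) N"
  have "ideal J R" unfolding J_def by (rule ideal_coeff_ideal[OF g(1) spS N])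
  then obtain A where A: "A \<subseteq> carrier R" "finite A" "J = Idl A" using noeth.finetely_gen by blast
  have "A \<subseteq> J" using A genideal_self by simp
  hence "\<forall>a\<in>A. \<exists>n\<in>N. \<exists>h\<in>module_span R M S. n = a \<odot>\<^bsub>M\<^esub> g \<oplus>\<^bsub>M\<^esub> h" unfolding J_def coeff_ideal_def by auto
  then obtain n h where nh: "\<And>a. a \<in> A \<Longrightarrow> n a \<in> N \<and> h a \<in> module_span R M S \<and> n a = a \<odot>\<^bsub>M\<^esub> g \<oplus>\<^bsub>M\<^esub> h a" by metis
  have "fg_sub R M (N \<inter> module_span R M S)"
    using insert.IH[OF g(2) submodule_Int[OF N spS]] by auto
  then obtain T where T: "finite T" "T \<subseteq> carrier M" "module_span R M T = N \<inter> module_span R M S" unfolding fg_sub_def by auto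
  have nN: "n ` A \<subseteq> N" using nh by (metis image_subsetI)
  have TA: "T \<union> n ` A \<subseteq> carrier M" "finite (T \<union> n ` A)" using T A nN submodule_subset[OF N] by auto
  define W where "W = module_span R M (T \<union> n ` A)"
  have W: "submodule W R M" unfolding W_def by (rule span_submodule[OF TA(1)])
  have WT: "N \<inter> module_span R M S \<subseteq> W" unfolding W_def T(3)[symmetric] by (rule span_mono) auto
  have Wn: "n a \<in> W" if "a \<in> A" for a unfolding W_def using that by (intro set_mp[OF span_superset]) auto
  have WN: "W \<subseteq> N" unfolding W_def using span_superset[of T] T(3) nN by (intro span_least[OF N]) auto
  \<comment> \<open>The coefficients reached from \<open>W\<close> form an ideal that contains the
    generators of \<open>J\<close>, hence all of \<open>J\<close>.\<close>
  have key: "\<exists>w\<in>W. \<exists>h\<in>module_span R M S. w = a \<odot>\<^bsub>M\<^esub> g \<oplus>\<^bsub>M\<^esub> h" if "a \<in> J" for a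
  proof -
    define J' where "J' = coeff_ideal g (module_span R M S) W"
    have "ideal J' R" unfolding J'_def by (rule ideal_coeff_ideal[OF g(1) spS W])
    moreover have "A \<subseteq> J'" using nh Wn A(1) unfolding J'_def coeff_ideal_def by blast
    ultimately have "J \<subseteq> J'" using A(3) genideal_minimal by simp
    thus ?thesis using that unfolding J'_def coeff_ideal_def by auto
  qed
  have "N \<subseteq> W"
  proof
    fix x assume x: "x \<in> N"
    then obtain a h where ah: "a \<in> carrier R" "h \<in> module_span R M S" "x = a \<odot>\<^bsub>M\<^esub> g \<oplus>\<^bsub>M\<^esub> h"
      using insert.prems(3) sp by (auto simp: mem_set_add cyc_def subset_iff)
    hence "a \<in> J" using x unfolding J_def coeff_ideal_def by auto
    from key[OF this] obtain w k where wk: "w \<in> W" "k \<in> module_span R M S" "w = a \<odot>\<^bsub>M\<^esub> g \<oplus>\<^bsub>M\<^esub> k" by blast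
    have hk: "h \<in> carrier M" "k \<in> carrier M" "w \<in> carrier M" "x \<in> carrier M"
      using wk ah x submodule_mem_carrier[OF spS] submodule_mem_carrier[OF W] submodule_mem_carrier[OF N] by auto
    have "x \<ominus>\<^bsub>M\<^esub> w = h \<ominus>\<^bsub>M\<^esub> k"
      using hk ah wk g by (simp add: M.minus_eq M.minus_add M.a_ac M.r_neg1 M.r_neg)
    moreover have "x \<ominus>\<^bsub>M\<^esub> w \<in> N" using submodule_diff_mem[OF N x] wk(1) WN by auto
    ultimately have "x \<ominus>\<^bsub>M\<^esub> w \<in> N \<inter> module_span R M S"
      using submodule_diff_mem[OF spS ah(2) wk(2)] by simp
    hence "x \<ominus>\<^bsub>M\<^esub> w \<in> W" using WT by auto
    hence "(x \<ominus>\<^bsub>M\<^esub> w) \<oplus>\<^bsub>M\<^esub> w \<in> W" using submodule_add_mem[OF W] wk by auto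
    thus "x \<in> W" using hk by (simp add: M.minus_eq M.a_assoc M.l_neg)
  qed
  hence "module_span R M (T \<union> n ` A) = N" using WN W_def by auto
  thus ?case unfolding fg_sub_def using TA by blast
qed

end

section \<open>Ideals in commutative noetherian rings\<close>

context cring
begin

lemma idealI2:
  assumes "J \<subseteq> carrier R" "\<zero> \<in> J" "\<And>a b. a \<in> J \<Longrightarrow> b \<in> J \<Longrightarrow> a \<oplus> b \<in> J"
    "\<And>a x. a \<in> carrier R \<Longrightarrow> x \<in> J \<Longrightarrow> a \<otimes> x \<in> J"
  shows "ideal J R"
  using module.submoduleI2[OF module_regular, of J] assms by (simp add: submodule_regular_iff)

lemmas ideal_carr = module.submodule_mem_carrier[OF module_regular,
  unfolded submodule_regular_iff regular_module_simps regular_module_a_inv regular_module_minus]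
lemmas ideal_zero = module.submodule_zero_mem[OF module_regular,
  unfolded submodule_regular_iff regular_module_simps regular_module_a_inv regular_module_minus]
lemmas ideal_add = module.submodule_add_mem[OF module_regular,
  unfolded submodule_regular_iff regular_module_simps regular_module_a_inv regular_module_minus]
lemmas ideal_neg = module.submodule_neg_mem[OF module_regular,
  unfolded submodule_regular_iff regular_module_simps regular_module_a_inv regular_module_minus]
lemmas ideal_mult = module.submodule_smult_mem[OF module_regular,
  unfolded submodule_regular_iff regular_module_simps regular_module_a_inv regular_module_minus]
lemmas ideal_diff = module.submodule_diff_mem[OF module_regular,
  unfolded submodule_regular_iff regular_module_simps regular_module_a_inv regular_module_minus]
lemmas ideal_cancel = module.submodule_add_cancel[OF module_regular,
  unfolded submodule_regular_iff regular_module_simps regular_module_a_inv regular_module_minus]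

lemma ideal_mult_r: "ideal J R \<Longrightarrow> a \<in> carrier R \<Longrightarrow> x \<in> J \<Longrightarrow> x \<otimes> a \<in> J"
  using ideal_mult ideal_carr m_comm by metis

lemma ideal_diff_cancel: "ideal J R \<Longrightarrow> x \<in> carrier R \<Longrightarrow> y \<in> J \<Longrightarrow> x \<ominus> y \<in> J \<Longrightarrow> x \<in> J"
proof -
  assume *: "ideal J R" "x \<in> carrier R" "y \<in> J" "x \<ominus> y \<in> J"
  have "y \<in> carrier R" using * ideal_carr by blast
  hence "x = (x \<ominus> y) \<oplus> y" using * by (simp add: minus_eq a_assoc l_neg)
  thus "x \<in> J" using * ideal_add by metis
qed

lemma proper_ideal: "ideal J R \<Longrightarrow> J \<noteq> carrier R \<longleftrightarrow> \<one> \<notin> J"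
  using ideal.one_imp_carrier one_closed by metis

definition ins_ideal :: "'a set \<Rightarrow> 'a \<Rightarrow> 'a set" where
  "ins_ideal J a = {x. \<exists>j\<in>J. \<exists>r\<in>carrier R. x = j \<oplus> r \<otimes> a}"

lemma ins_idealI: "j \<in> J \<Longrightarrow> r \<in> carrier R \<Longrightarrow> x = j \<oplus> r \<otimes> a \<Longrightarrow> x \<in> ins_ideal J a"
  unfolding ins_ideal_def by blast

lemma ins_ideal_cases:
  assumes "x \<in> ins_ideal J a" obtains j r where "j \<in> J" "r \<in> carrier R" "x = j \<oplus> r \<otimes> a"
  using assms unfolding ins_ideal_def by blast

lemma ins_ideal_ideal: assumes J: "ideal J R" and a: "a \<in> carrier R" shows "ideal (ins_ideal J a) R"
proof (rule idealI2)
  note c = ideal_carr[OF J]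
  show "ins_ideal J a \<subseteq> carrier R" using c a by (auto simp: ins_ideal_def)
  have "\<zero> = \<zero> \<oplus> \<zero> \<otimes> a" using a by simp
  thus "\<zero> \<in> ins_ideal J a" by (rule ins_idealI[OF ideal_zero[OF J] zero_closed])
next
  note c = ideal_carr[OF J]
  fix x y assume "x \<in> ins_ideal J a" "y \<in> ins_ideal J a"
  then obtain j r j' r' where *: "j \<in> J" "r \<in> carrier R" "x = j \<oplus> r \<otimes> a" "j' \<in> J" "r' \<in> carrier R" "y = j' \<oplus> r' \<otimes> a"
    by (metis ins_ideal_cases)
  hence "x \<oplus> y = (j \<oplus> j') \<oplus> (r \<oplus> r') \<otimes> a" using c a by (simp add: l_distr a_ac)
  moreover have "j \<oplus> j' \<in> J" "r \<oplus> r' \<in> carrier R" using * ideal_add[OF J] by auto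
  ultimately show "x \<oplus> y \<in> ins_ideal J a" by (metis ins_idealI)
next
  note c = ideal_carr[OF J]
  fix b x assume b: "b \<in> carrier R" and "x \<in> ins_ideal J a"
  then obtain j r where *: "j \<in> J" "r \<in> carrier R" "x = j \<oplus> r \<otimes> a" by (metis ins_ideal_cases)
  hence "b \<otimes> x = b \<otimes> j \<oplus> (b \<otimes> r) \<otimes> a" using c a b by (simp add: r_distr m_assoc)
  moreover have "b \<otimes> j \<in> J" "b \<otimes> r \<in> carrier R" using * b ideal_mult[OF J] by auto
  ultimately show "b \<otimes> x \<in> ins_ideal J a" by (metis ins_idealI)
qed

lemma ins_ideal_superset: "ideal J R \<Longrightarrow> a \<in> carrier R \<Longrightarrow> J \<subseteq> ins_ideal J a"
proof
  fix x assume "ideal J R" "a \<in> carrier R" "x \<in> J"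
  hence "x = x \<oplus> \<zero> \<otimes> a" using ideal_carr by simp
  thus "x \<in> ins_ideal J a" by (rule ins_idealI[OF \<open>x \<in> J\<close> zero_closed])
qed

lemma ins_ideal_self: "ideal J R \<Longrightarrow> a \<in> carrier R \<Longrightarrow> a \<in> ins_ideal J a"
proof -
  assume *: "ideal J R" "a \<in> carrier R"
  hence "a = \<zero> \<oplus> \<one> \<otimes> a" by simp
  thus "a \<in> ins_ideal J a" by (rule ins_idealI[OF ideal_zero[OF *(1)] one_closed])
qed

lemma colon_ideal: assumes J: "ideal J R" and a: "a \<in> carrier R" shows "ideal {r \<in> carrier R. r \<otimes> a \<in> J} R"
proof (rule idealI2)
  show "\<zero> \<in> {r \<in> carrier R. r \<otimes> a \<in> J}" using a ideal_zero[OF J] by simp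
  show "\<And>x y. x \<in> {r \<in> carrier R. r \<otimes> a \<in> J} \<Longrightarrow> y \<in> {r \<in> carrier R. r \<otimes> a \<in> J} \<Longrightarrow> x \<oplus> y \<in> {r \<in> carrier R. r \<otimes> a \<in> J}"
    using a ideal_add[OF J] by (simp add: l_distr)
  show "\<And>b x. b \<in> carrier R \<Longrightarrow> x \<in> {r \<in> carrier R. r \<otimes> a \<in> J} \<Longrightarrow> b \<otimes> x \<in> {r \<in> carrier R. r \<otimes> a \<in> J}"
    using a ideal_mult[OF J] by (simp add: m_assoc)
qed auto

lemma PIdl_mem: "x \<in> PIdl a \<longleftrightarrow> (\<exists>r\<in>carrier R. x = r \<otimes> a)"
  unfolding cgenideal_def by auto

lemma prime_mult: "primeideal q R \<Longrightarrow> a \<in> carrier R \<Longrightarrow> b \<in> carrier R \<Longrightarrow> a \<otimes> b \<in> q \<longleftrightarrow> a \<in> q \<or> b \<in> q"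
  using primeideal.I_prime[of q R a b] ideal_mult[OF primeideal.axioms(1)] ideal_mult_r[OF primeideal.axioms(1)] by blast

lemma prime_one: "primeideal q R \<Longrightarrow> \<one> \<notin> q"
  using primeideal.I_notcarr primeideal.axioms(1) proper_ideal by blast

lemma prime_pow: "primeideal q R \<Longrightarrow> a \<in> carrier R \<Longrightarrow> a [^] (n::nat) \<in> q \<Longrightarrow> a \<in> q"
  by (induction n) (auto simp: prime_one prime_mult)

end

context noetherian_ring
begin

lemma noeth_max:
  assumes "\<F> \<noteq> {}" "\<And>J. J \<in> \<F> \<Longrightarrow> ideal J R"
  shows "\<exists>J\<in>\<F>. \<forall>K\<in>\<F>. J \<subseteq> K \<longrightarrow> K = J"
proof (rule subset_Zorn_nonempty[OF assms(1)])
  fix \<C> assume *: "\<C> \<noteq> {}" "subset.chain \<F> \<C>"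
  have "subset.chain {I. ideal I R} \<C>" using * assms(2) by (auto simp: subset.chain_def)
  from ideal_chain_is_trivial[OF *(1) this] have "\<Union>\<C> \<in> \<C>" .
  thus "\<Union>\<C> \<in> \<F>" using *(2) by (auto simp: subset.chain_def)
qed

lemma noeth_max_such:
  assumes "P J0" "\<And>J. P J \<Longrightarrow> ideal J R"
  obtains J where "P J" "\<And>K. P K \<Longrightarrow> J \<subseteq> K \<Longrightarrow> K = J"
proof -
  have ne: "{J. P J} \<noteq> {}" using assms(1) by auto
  have "\<exists>J\<in>{J. P J}. \<forall>K\<in>{J. P J}. J \<subseteq> K \<longrightarrow> K = J" by (rule noeth_max[OF ne]) (simp add: assms(2))
  then obtain J where "P J" "\<forall>K. P K \<longrightarrow> J \<subseteq> K \<longrightarrow> K = J" by auto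
  thus ?thesis using that by auto
qed

text \<open>Noetherian induction: a maximal counterexample contradicts \<open>step\<close>. It
  serves as a substitute for induction on the length of R/J.\<close>

lemma ideal_induct [consumes 1, case_names step]:
  assumes "ideal J R" and step: "\<And>J. ideal J R \<Longrightarrow> (\<And>K. ideal K R \<Longrightarrow> J \<subset> K \<Longrightarrow> P K) \<Longrightarrow> P J"
  shows "P J"
proof (rule ccontr)
  assume "\<not> P J"
  hence 1: "ideal J R \<and> \<not> P J" using assms(1) by simp
  obtain K where K: "ideal K R \<and> \<not> P K" "\<And>L. ideal L R \<and> \<not> P L \<Longrightarrow> K \<subseteq> L \<Longrightarrow> L = K"
    using noeth_max_such[of "\<lambda>J. ideal J R \<and> \<not> P J", OF 1] by auto
  have "P K"
  proof (rule step)
    fix L assume "ideal L R" "K \<subset> L" thus "P L" using K(2)[of L] by auto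
  qed (use K in simp)
  thus False using K by simp
qed

lemma ideal_chain_stab:
  assumes "\<And>n::nat. ideal (J n) R" "\<And>n. J n \<subseteq> J (Suc n)"
  shows "\<exists>n. J (Suc n) = J n"
proof -
  have "range J \<noteq> {}" by simp
  from noeth_max[OF this] assms(1) obtain n where "\<forall>K\<in>range J. J n \<subseteq> K \<longrightarrow> K = J n" by blast
  thus ?thesis using assms(2)[of n] by blast
qed

end

section \<open>Nakayama's lemma\<close>

context module
begin

lemma cyc_lin_map: "g \<in> carrier M \<Longrightarrow> (\<lambda>a. a \<odot>\<^bsub>M\<^esub> g) \<in> lin_maps R (regular_module R) M"
  unfolding lin_maps_def by (auto simp: smult_l_distr smult_assoc1)

lemma submodule_ideal_smult_elem:
  "g \<in> carrier M \<Longrightarrow> ideal J R \<Longrightarrow> submodule ((\<lambda>a. a \<odot>\<^bsub>M\<^esub> g) ` J) R M"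
  by (rule submodule_lin_image[OF module_regular module_axioms cyc_lin_map]) (simp_all add: submodule_regular_iff)

lemma idmul_cyc_add:
  assumes J: "ideal J R" and g: "g \<in> carrier M" and U: "submodule U R M"
  shows "idmul J (cyc g <+>\<^bsub>M\<^esub> U) \<subseteq> (\<lambda>a. a \<odot>\<^bsub>M\<^esub> g) ` J <+>\<^bsub>M\<^esub> idmul J U"
proof (rule idmul_least)
  have Jc: "J \<subseteq> carrier R" using ideal_carr[OF J] by blast
  show "submodule ((\<lambda>a. a \<odot>\<^bsub>M\<^esub> g) ` J <+>\<^bsub>M\<^esub> idmul J U) R M"
    by (intro submodule_set_add submodule_ideal_smult_elem submodule_idmul g J Jc submodule_subset[OF U])
  fix a x assume a: "a \<in> J" and "x \<in> cyc g <+>\<^bsub>M\<^esub> U"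
  then obtain r u where ru: "r \<in> carrier R" "u \<in> U" "x = r \<odot>\<^bsub>M\<^esub> g \<oplus>\<^bsub>M\<^esub> u" by (auto simp: mem_set_add cyc_def)
  have ac: "a \<in> carrier R" using Jc a by blast
  have "a \<odot>\<^bsub>M\<^esub> x = (a \<otimes>\<^bsub>R\<^esub> r) \<odot>\<^bsub>M\<^esub> g \<oplus>\<^bsub>M\<^esub> a \<odot>\<^bsub>M\<^esub> u"
    using ru ac g submodule_mem_carrier[OF U] by (simp add: smult_r_distr smult_assoc1)
  moreover have "a \<otimes>\<^bsub>R\<^esub> r \<in> J" using ideal_mult_r[OF J ru(1) a] .
  moreover have "a \<odot>\<^bsub>M\<^esub> u \<in> idmul J U" using idmul_mem[OF a ru(2)] .
  ultimately show "a \<odot>\<^bsub>M\<^esub> x \<in> (\<lambda>a. a \<odot>\<^bsub>M\<^esub> g) ` J <+>\<^bsub>M\<^esub> idmul J U" unfolding mem_set_add by blast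
qed

text \<open>Elimination of one generator at a time replaces the determinant argument.\<close>

lemma nakayama_prime_span:
  assumes q: "primeideal q R" and N': "submodule N' R M" and "finite S" "S \<subseteq> carrier M"
    "s \<in> carrier R" "s \<notin> q"
    "\<And>x. x \<in> module_span R M S \<Longrightarrow> s \<odot>\<^bsub>M\<^esub> x \<in> idmul q (module_span R M S) <+>\<^bsub>M\<^esub> N'"
  shows "\<exists>u\<in>carrier R. u \<notin> q \<and> (\<forall>x\<in>module_span R M S. u \<odot>\<^bsub>M\<^esub> x \<in> N')"
  using assms(3-)
proof (induction S arbitrary: s rule: finite_induct)
  case empty
  show ?case using submodule_zero_mem[OF N'] prime_one[OF q] by (intro bexI[of _ "\<one>\<^bsub>R\<^esub>"]) (auto simp: span_empty)
next
  case (insert g T)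
  have qi: "ideal q R" using q by (rule primeideal.axioms(1))
  have qc: "q \<subseteq> carrier R" using ideal_carr[OF qi] by blast
  have g: "g \<in> carrier M" "T \<subseteq> carrier M" using insert.prems by auto
  define U where "U = module_span R M T"
  have U: "submodule U R M" unfolding U_def by (rule span_submodule[OF g(2)])
  have sp: "module_span R M (insert g T) = cyc g <+>\<^bsub>M\<^esub> U" unfolding U_def by (rule span_insert[OF g])
  have qU: "submodule (idmul q U) R M" by (rule submodule_idmul[OF qc submodule_subset[OF U]])
  have qUU: "idmul q U \<subseteq> U" by (rule idmul_subset[OF qc U])
  have qN: "submodule (idmul q U <+>\<^bsub>M\<^esub> N') R M" by (rule submodule_set_add[OF qU N'])
  note s = insert.prems(2,3)
  have dec: "\<exists>a\<in>q. \<exists>h\<in>idmul q U <+>\<^bsub>M\<^esub> N'. s \<odot>\<^bsub>M\<^esub> x = a \<odot>\<^bsub>M\<^esub> g \<oplus>\<^bsub>M\<^esub> h" if x: "x \<in> cyc g <+>\<^bsub>M\<^esub> U" for x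
  proof -
    have "s \<odot>\<^bsub>M\<^esub> x \<in> idmul q (cyc g <+>\<^bsub>M\<^esub> U) <+>\<^bsub>M\<^esub> N'" using insert.prems(4) x unfolding sp by blast
    also have "\<dots> \<subseteq> ((\<lambda>a. a \<odot>\<^bsub>M\<^esub> g) ` q <+>\<^bsub>M\<^esub> idmul q U) <+>\<^bsub>M\<^esub> N'"
      by (rule set_add_mono[OF idmul_cyc_add[OF qi g(1) U] order_refl])
    also have "\<dots> = (\<lambda>a. a \<odot>\<^bsub>M\<^esub> g) ` q <+>\<^bsub>M\<^esub> (idmul q U <+>\<^bsub>M\<^esub> N')"
      by (rule submodule_set_add_assoc[OF submodule_ideal_smult_elem[OF g(1) qi] qU N'])
    finally show ?thesis unfolding mem_set_add by blast
  qed
  have "g \<in> cyc g <+>\<^bsub>M\<^esub> U" using cyc_self[OF g(1)] set_add_upper1[OF submodule_cyc[OF g(1)] U] by blast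
  from dec[OF this] obtain a h where ah: "a \<in> q" "h \<in> idmul q U <+>\<^bsub>M\<^esub> N'" "s \<odot>\<^bsub>M\<^esub> g = a \<odot>\<^bsub>M\<^esub> g \<oplus>\<^bsub>M\<^esub> h" by blast
  have ac: "a \<in> carrier R" and hc: "h \<in> carrier M" using ah qc submodule_mem_carrier[OF qN] by auto
  \<comment> \<open>Since \<open>a\<close> lies in \<open>q\<close>, \<open>v\<close> is still
    outside \<open>q\<close>, and \<open>v g\<close> equals \<open>h\<close>, which involves only
    the other generators and \<open>N'\<close>: the generator \<open>g\<close> is
    eliminated.\<close>
  define v where "v = s \<ominus>\<^bsub>R\<^esub> a"
  have vc: "v \<in> carrier R" using s ac by (simp add: v_def)
  have vq: "v \<notin> q" using ideal_diff_cancel[OF qi s(1) ah(1)] s(2) unfolding v_def by blast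
  have vg: "v \<odot>\<^bsub>M\<^esub> g = h"
    using ah s ac g hc by (simp add: v_def R.minus_eq smult_l_distr smult_l_minus M.a_ac M.r_neg M.r_neg2)
  have *: "(v \<otimes>\<^bsub>R\<^esub> s) \<odot>\<^bsub>M\<^esub> x \<in> idmul q U <+>\<^bsub>M\<^esub> N'" if x: "x \<in> U" for x
  proof -
    have "x \<in> cyc g <+>\<^bsub>M\<^esub> U" using x set_add_upper2[OF submodule_cyc[OF g(1)] U] by blast
    from dec[OF this] obtain b k where bk: "b \<in> q" "k \<in> idmul q U <+>\<^bsub>M\<^esub> N'" "s \<odot>\<^bsub>M\<^esub> x = b \<odot>\<^bsub>M\<^esub> g \<oplus>\<^bsub>M\<^esub> k" by blast
    have bc: "b \<in> carrier R" "k \<in> carrier M" using bk qc submodule_mem_carrier[OF qN] by auto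
    have "(v \<otimes>\<^bsub>R\<^esub> s) \<odot>\<^bsub>M\<^esub> x = v \<odot>\<^bsub>M\<^esub> (b \<odot>\<^bsub>M\<^esub> g) \<oplus>\<^bsub>M\<^esub> v \<odot>\<^bsub>M\<^esub> k"
      using vc s bc bk g submodule_mem_carrier[OF U x] by (simp add: smult_assoc1 smult_r_distr)
    also have "v \<odot>\<^bsub>M\<^esub> (b \<odot>\<^bsub>M\<^esub> g) = b \<odot>\<^bsub>M\<^esub> h"
      using vg vc bc g by (metis smult_assoc1 R.m_comm)
    finally show ?thesis
      using submodule_add_mem[OF qN submodule_smult_mem[OF qN bc(1) ah(2)] submodule_smult_mem[OF qN vc bk(2)]] by simp
  qed
  have vs: "v \<otimes>\<^bsub>R\<^esub> s \<in> carrier R" "v \<otimes>\<^bsub>R\<^esub> s \<notin> q" using vc s vq prime_mult[OF q vc s(1)] by auto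
  obtain u where u: "u \<in> carrier R" "u \<notin> q" "\<And>x. x \<in> U \<Longrightarrow> u \<odot>\<^bsub>M\<^esub> x \<in> N'"
    using insert.IH[OF g(2) vs] * unfolding U_def by blast
  have uh: "u \<odot>\<^bsub>M\<^esub> h \<in> N'"
  proof -
    obtain h1 h2 where h12: "h1 \<in> idmul q U" "h2 \<in> N'" "h = h1 \<oplus>\<^bsub>M\<^esub> h2" using ah(2) by (auto simp: mem_set_add)
    have "u \<odot>\<^bsub>M\<^esub> h = u \<odot>\<^bsub>M\<^esub> h1 \<oplus>\<^bsub>M\<^esub> u \<odot>\<^bsub>M\<^esub> h2"
      using h12 u submodule_mem_carrier[OF qU] submodule_mem_carrier[OF N'] by (simp add: smult_r_distr)
    thus ?thesis using u(3)[of h1] h12 qUU submodule_smult_mem[OF N' u(1) h12(2)] submodule_add_mem[OF N'] by auto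
  qed
  show ?case
  proof (intro bexI conjI ballI)
    show "u \<otimes>\<^bsub>R\<^esub> v \<in> carrier R" "u \<otimes>\<^bsub>R\<^esub> v \<notin> q" using u vc vq prime_mult[OF q u(1) vc] by auto
    fix x assume "x \<in> module_span R M (insert g T)"
    then obtain r y where ry: "r \<in> carrier R" "y \<in> U" "x = r \<odot>\<^bsub>M\<^esub> g \<oplus>\<^bsub>M\<^esub> y" unfolding sp by (auto simp: mem_set_add cyc_def)
    have yc: "y \<in> carrier M" using submodule_mem_carrier[OF U ry(2)] .
    have "(u \<otimes>\<^bsub>R\<^esub> v) \<odot>\<^bsub>M\<^esub> x = (u \<otimes>\<^bsub>R\<^esub> v \<otimes>\<^bsub>R\<^esub> r) \<odot>\<^bsub>M\<^esub> g \<oplus>\<^bsub>M\<^esub> (u \<otimes>\<^bsub>R\<^esub> v) \<odot>\<^bsub>M\<^esub> y"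
      using ry u vc g yc by (simp add: smult_r_distr smult_assoc1)
    also have "u \<otimes>\<^bsub>R\<^esub> v \<otimes>\<^bsub>R\<^esub> r = r \<otimes>\<^bsub>R\<^esub> u \<otimes>\<^bsub>R\<^esub> v" using ry u vc by (simp add: R.m_ac)
    also have "(r \<otimes>\<^bsub>R\<^esub> u \<otimes>\<^bsub>R\<^esub> v) \<odot>\<^bsub>M\<^esub> g = r \<odot>\<^bsub>M\<^esub> (u \<odot>\<^bsub>M\<^esub> h)"
      using vg ry u vc g hc by (simp add: smult_assoc1)
    also have "(u \<otimes>\<^bsub>R\<^esub> v) \<odot>\<^bsub>M\<^esub> y = v \<odot>\<^bsub>M\<^esub> (u \<odot>\<^bsub>M\<^esub> y)" using u vc yc by (metis smult_assoc1 R.m_comm)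
    finally show "(u \<otimes>\<^bsub>R\<^esub> v) \<odot>\<^bsub>M\<^esub> x \<in> N'"
      using submodule_add_mem[OF N' submodule_smult_mem[OF N' ry(1) uh] submodule_smult_mem[OF N' vc u(3)[OF ry(2)]]] by simp
  qed
qed

text \<open>Nakayama's lemma over the localization at \<open>q\<close>, with \<open>s\<close> and
  \<open>u\<close> as denominators so that no localization is formed. It is used at \<mm> with
  \<open>s = 1\<close> and at the kernel \<open>p\<close> with a power of a uniformizer as
  \<open>s\<close>.\<close>

lemma nakayama_prime:
  assumes "primeideal q R" "fg_sub R M N" "submodule N' R M" "s \<in> carrier R" "s \<notin> q"
    "\<And>x. x \<in> N \<Longrightarrow> s \<odot>\<^bsub>M\<^esub> x \<in> idmul q N <+>\<^bsub>M\<^esub> N'"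
  shows "\<exists>u\<in>carrier R. u \<notin> q \<and> (\<forall>x\<in>N. u \<odot>\<^bsub>M\<^esub> x \<in> N')"
proof -
  obtain S where S: "finite S" "S \<subseteq> carrier M" "module_span R M S = N" using assms(2) unfolding fg_sub_def by blast
  show ?thesis using nakayama_prime_span[OF assms(1,3) S(1,2) assms(4,5)] assms(6) unfolding S(3) by blast
qed

end

section \<open>Noetherian local rings\<close>

locale noeth_local = noetherian_ring R + cring R for R (structure) +
  assumes unique_max: "\<exists>!I. maximalideal I R"
begin

abbreviation "\<mm> \<equiv> max_ideal R"

lemma max_maximal: "maximalideal \<mm> R"
  unfolding max_ideal_def using theI'[OF unique_max] .

lemma max_unique: "maximalideal J R \<Longrightarrow> J = \<mm>"
  using unique_max max_maximal by blast

lemma max_ideal_ideal: "ideal \<mm> R"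
  using max_maximal by (rule maximalideal.axioms(1))

lemma max_one: "\<one> \<notin> \<mm>"
  using max_maximal maximalideal.I_notcarr max_ideal_ideal proper_ideal by blast

lemma max_carr: "x \<in> \<mm> \<Longrightarrow> x \<in> carrier R"
  using ideal_carr[OF max_ideal_ideal] .

lemma max_prime: "primeideal \<mm> R"
  using max_maximal by (rule maximalideal_prime)

lemma proper_subset_max:
  assumes J: "ideal J R" "\<one> \<notin> J" shows "J \<subseteq> \<mm>"
proof -
  have "ideal J R \<and> J \<subseteq> J \<and> \<one> \<notin> J" using J by simp
  then obtain K where K0: "ideal K R \<and> J \<subseteq> K \<and> \<one> \<notin> K"
    and mx: "\<And>L. ideal L R \<and> J \<subseteq> L \<and> \<one> \<notin> L \<Longrightarrow> K \<subseteq> L \<Longrightarrow> L = K"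
    by (rule noeth_max_such) auto
  hence K: "ideal K R" "J \<subseteq> K" "\<one> \<notin> K" by auto
  have "maximalideal K R"
  proof (rule maximalidealI[OF K(1)])
    show "carrier R \<noteq> K" using K(3) one_closed by blast
    fix L assume L: "ideal L R" "K \<subseteq> L" "L \<subseteq> carrier R"
    show "L = K \<or> L = carrier R"
      using mx[of L] L(1) order_trans[OF K(2) L(2)] L(2) proper_ideal[OF L(1)] by auto
  qed
  thus ?thesis using max_unique K(2) by blast
qed

lemma unit_of_not_max:
  assumes "a \<in> carrier R" "a \<notin> \<mm>" obtains b where "b \<in> carrier R" "b \<otimes> a = \<one>" "a \<otimes> b = \<one>"
proof -
  have "ideal (PIdl a) R" using cgenideal_ideal[OF assms(1)] .
  moreover have "a \<in> PIdl a" using cgenideal_self[OF assms(1)] .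
  ultimately have "\<one> \<in> PIdl a" using proper_subset_max assms(2) by blast
  then obtain b where "b \<in> carrier R" "\<one> = b \<otimes> a" unfolding PIdl_mem by blast
  thus ?thesis using that m_comm assms(1) by metis
qed

lemma one_minus_not_max: "y \<in> \<mm> \<Longrightarrow> \<one> \<ominus> y \<notin> \<mm>"
  using ideal_diff_cancel[OF max_ideal_ideal one_closed] max_one by blast

lemma mult_one_minus_mem:
  assumes J: "ideal J R" and "y \<in> \<mm>" "a \<in> carrier R" "(\<one> \<ominus> y) \<otimes> a \<in> J" shows "a \<in> J"
proof -
  have "\<one> \<ominus> y \<in> carrier R" using assms max_carr by simp
  then obtain b where b: "b \<in> carrier R" "b \<otimes> (\<one> \<ominus> y) = \<one>" using unit_of_not_max one_minus_not_max[OF assms(2)] by metis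
  have "a = b \<otimes> ((\<one> \<ominus> y) \<otimes> a)" using b assms(3) \<open>\<one> \<ominus> y \<in> carrier R\<close> by (simp add: m_assoc[symmetric])
  thus ?thesis using ideal_mult[OF J b(1) assms(4)] by simp
qed

text \<open>\<open>\<mm>\<close> lies in the radical of \<open>J\<close>; for \<open>J \<noteq> R\<close> this says that \<open>R/J\<close> has finite length.\<close>

definition max_rad :: "'a set \<Rightarrow> bool" where
  "max_rad J \<longleftrightarrow> (\<forall>y\<in>\<mm>. \<exists>n::nat. y [^] n \<in> J)"

lemma max_rad_mono: "max_rad J \<Longrightarrow> J \<subseteq> K \<Longrightarrow> max_rad K"
  unfolding max_rad_def by blast

text \<open>The ideals \<open>J : y^n\<close> become stationary. If \<open>y^n\<close> were outside
  \<open>J\<close>, then \<open>s\<close> would be \<open>b y^n\<close> modulo \<open>J\<close>; as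
  \<open>y s\<close> lies in \<open>J\<close>, stationarity would put \<open>b y^n\<close>, hence
  \<open>s\<close>, into \<open>J\<close>.\<close>

lemma max_rad_of_essential_socle:
  assumes J: "ideal J R" and s: "s \<in> carrier R" "s \<notin> J" "\<And>y. y \<in> \<mm> \<Longrightarrow> y \<otimes> s \<in> J"
    and ess: "\<And>a. a \<in> carrier R \<Longrightarrow> a \<notin> J \<Longrightarrow> s \<in> ins_ideal J a"
  shows "max_rad J"
  unfolding max_rad_def
proof
  fix y assume y: "y \<in> \<mm>"
  have yc: "y \<in> carrier R" using max_carr[OF y] .
  define K where "K = (\<lambda>n::nat. {r \<in> carrier R. r \<otimes> y [^] n \<in> J})"
  have "K n \<subseteq> K (Suc n)" for n
    using yc ideal_mult_r[OF J yc] unfolding K_def by (auto simp: m_assoc[symmetric])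
  moreover have "ideal (K n) R" for n unfolding K_def using colon_ideal[OF J] yc by simp
  ultimately obtain n where n: "K (Suc n) = K n" using ideal_chain_stab[of K] by blast
  have "y [^] n \<in> J"
  proof (rule ccontr)
    assume "y [^] n \<notin> J"
    then obtain j b where jb: "j \<in> J" "b \<in> carrier R" "s = j \<oplus> b \<otimes> y [^] n"
      using ess[of "y [^] n"] yc by (auto elim: ins_ideal_cases)
    have jc: "j \<in> carrier R" using ideal_carr[OF J jb(1)] .
    have "y \<otimes> s = y \<otimes> j \<oplus> b \<otimes> y [^] Suc n" using jb jc yc by (simp add: r_distr m_ac)
    hence "b \<otimes> y [^] Suc n \<in> J"
      using s(3)[OF y] ideal_cancel[OF J ideal_mult[OF J yc jb(1)]] jb yc by simp
    hence "b \<in> K n" using n jb unfolding K_def by blast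
    hence "s \<in> J" using jb ideal_add[OF J jb(1)] unfolding K_def by simp
    thus False using s by simp
  qed
  thus "\<exists>n::nat. y [^] n \<in> J" ..
qed

text \<open>Take \<open>J\<close> maximal among the ideals that contain \<open>J0\<close> and avoid
  \<open>a\<close>. By maximality \<open>a\<close> lies in every strictly larger ideal, so it spans
  an essential socle. This reduces questions about \<open>a \<notin> J0\<close> to quotients of
  finite length.\<close>

lemma exists_max_avoiding:
  assumes J0: "ideal J0 R" and a: "a \<in> carrier R" "a \<notin> J0"
  obtains J where "ideal J R" "J0 \<subseteq> J" "a \<notin> J" "\<And>y. y \<in> \<mm> \<Longrightarrow> y \<otimes> a \<in> J" "max_rad J"
proof -
  have "ideal J0 R \<and> J0 \<subseteq> J0 \<and> a \<notin> J0" using assms by simp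
  then obtain J where Ja: "ideal J R \<and> J0 \<subseteq> J \<and> a \<notin> J"
    and mx: "\<And>K. ideal K R \<and> J0 \<subseteq> K \<and> a \<notin> K \<Longrightarrow> J \<subseteq> K \<Longrightarrow> K = J"
    by (rule noeth_max_such) auto
  hence J: "ideal J R" "J0 \<subseteq> J" "a \<notin> J" by auto
  have ess: "a \<in> ins_ideal J c" if c: "c \<in> carrier R" "c \<notin> J" for c
    using mx[of "ins_ideal J c"] ins_ideal_ideal[OF J(1) c(1)] order_trans[OF J(2) ins_ideal_superset[OF J(1) c(1)]]
      ins_ideal_superset[OF J(1) c(1)] ins_ideal_self[OF J(1) c(1)] c(2) by auto
  \<comment> \<open>If \<open>y a\<close> were outside \<open>J\<close>, then \<open>a\<close> would
    be \<open>r y a\<close> modulo \<open>J\<close>, and the unit \<open>1 - r y\<close> would force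
    \<open>a\<close> into \<open>J\<close>.\<close>
  have soc: "y \<otimes> a \<in> J" if y: "y \<in> \<mm>" for y
  proof (rule ccontr)
    assume n: "y \<otimes> a \<notin> J"
    have yc: "y \<in> carrier R" using max_carr[OF y] .
    obtain j r where jr: "j \<in> J" "r \<in> carrier R" "a = j \<oplus> r \<otimes> (y \<otimes> a)"
      using ess[OF _ n] yc a by (auto elim: ins_ideal_cases)
    have jc: "j \<in> carrier R" using ideal_carr[OF J(1) jr(1)] .
    define z where "z = (r \<otimes> y) \<otimes> a"
    have zc: "z \<in> carrier R" and az: "a = j \<oplus> z" using jr yc a by (simp_all add: z_def m_assoc)
    have "(\<one> \<ominus> r \<otimes> y) \<otimes> a = a \<ominus> z" using yc a jr(2) by (simp add: z_def minus_eq l_distr l_minus)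
    also have "\<dots> = j" using az jc zc by (simp add: minus_eq a_assoc r_neg)
    finally have "a \<in> J" using mult_one_minus_mem[OF J(1) _ a(1)] ideal_mult[OF max_ideal_ideal jr(2) y] jr(1) by simp
    thus False using J(3) by simp
  qed
  show ?thesis using that[OF J soc] max_rad_of_essential_socle[OF J(1) a(1) J(3) soc ess] by blast
qed

text \<open>Choose \<open>b\<close> outside \<open>J\<close> with \<open>J : b\<close> maximal. For
  \<open>y\<close> in \<mm> the last \<open>y^i b\<close> outside \<open>J\<close> has the same
  colon ideal by maximality, and that ideal contains \<open>y\<close>.\<close>

lemma max_rad_socle:
  assumes J: "ideal J R" "\<one> \<notin> J" "max_rad J"
  obtains b where "b \<in> carrier R" "b \<notin> J" "\<And>y. y \<in> \<mm> \<Longrightarrow> y \<otimes> b \<in> J"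
proof -
  define C where "C = (\<lambda>b. {r \<in> carrier R. r \<otimes> b \<in> J})"
  have "\<exists>b. b \<in> carrier R \<and> b \<notin> J \<and> C \<one> = C b" using J(2) by auto
  then obtain K where K: "\<exists>b. b \<in> carrier R \<and> b \<notin> J \<and> K = C b"
    and mxK: "\<And>L. \<exists>b. b \<in> carrier R \<and> b \<notin> J \<and> L = C b \<Longrightarrow> K \<subseteq> L \<Longrightarrow> L = K"
    by (rule noeth_max_such) (auto simp: C_def colon_ideal[OF J(1)])
  then obtain b where b: "b \<in> carrier R" "b \<notin> J" "K = C b" by auto
  have mx: "C c = C b" if "c \<in> carrier R" "c \<notin> J" "C b \<subseteq> C c" for c
    using mxK[of "C c"] that b(3) by auto
  have "y \<otimes> b \<in> J" if y: "y \<in> \<mm>" for y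
  proof -
    have yc: "y \<in> carrier R" using max_carr[OF y] .
    define n where "n = (LEAST n::nat. y [^] n \<otimes> b \<in> J)"
    obtain k :: nat where "y [^] k \<in> J" using J(3) y unfolding max_rad_def by blast
    hence "y [^] k \<otimes> b \<in> J" using ideal_mult_r[OF J(1) b(1)] by simp
    hence n: "y [^] n \<otimes> b \<in> J" unfolding n_def by (rule LeastI)
    have "n \<noteq> 0" using n b by (intro notI) simp
    then obtain i where i: "n = Suc i" by (cases n) auto
    have ni: "y [^] i \<otimes> b \<notin> J" using not_less_Least[of i "\<lambda>n. y [^] n \<otimes> b \<in> J"] i unfolding n_def by simp
    have "C b \<subseteq> C (y [^] i \<otimes> b)"
    proof
      fix r assume "r \<in> C b"
      hence r: "r \<in> carrier R" "r \<otimes> b \<in> J" unfolding C_def by auto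
      have "r \<otimes> (y [^] i \<otimes> b) = y [^] i \<otimes> (r \<otimes> b)" using r yc b by (simp add: m_ac)
      thus "r \<in> C (y [^] i \<otimes> b)" using r ideal_mult[OF J(1) _ r(2)] yc unfolding C_def by simp
    qed
    hence "C (y [^] i \<otimes> b) = C b" using mx[OF _ ni] yc b by simp
    moreover have "y \<otimes> (y [^] i \<otimes> b) = y [^] n \<otimes> b" using i yc b by (simp add: m_ac)
    hence "y \<in> C (y [^] i \<otimes> b)" using n yc unfolding C_def by simp
    ultimately show ?thesis unfolding C_def by blast
  qed
  thus ?thesis using that b by blast
qed

end

locale noeth_local_module = noeth_local R + module R M for R (structure) and M (structure)
begin

lemma nakayama:
  assumes "fg_sub R M N" "submodule N' R M" "N \<subseteq> idmul \<mm> N <+>\<^bsub>M\<^esub> N'"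
  shows "N \<subseteq> N'"
proof
  fix x assume x: "x \<in> N"
  have N: "submodule N R M" by (rule fg_sub_submodule[OF assms(1)])
  have "\<exists>u\<in>carrier R. u \<notin> \<mm> \<and> (\<forall>x\<in>N. u \<odot>\<^bsub>M\<^esub> x \<in> N')"
    by (rule nakayama_prime[OF max_prime assms(1,2) one_closed max_one])
      (use assms(3) submodule_mem_carrier[OF N] in auto)
  then obtain u where u: "u \<in> carrier R" "u \<notin> \<mm>" "u \<odot>\<^bsub>M\<^esub> x \<in> N'" using x by blast
  then obtain b where b: "b \<in> carrier R" "b \<otimes> u = \<one>" using unit_of_not_max by metis
  have "x = b \<odot>\<^bsub>M\<^esub> (u \<odot>\<^bsub>M\<^esub> x)" using b u submodule_mem_carrier[OF N x] by (simp add: smult_assoc1[symmetric])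
  thus "x \<in> N'" using submodule_smult_mem[OF assms(2) b(1) u(3)] by simp
qed

end

section \<open>Lengths over local rings\<close>

context module
begin

text \<open>A strictly descending chain, read backwards from any of its terms, would give ascending
  chains of every length.\<close>

lemma desc_chain_stab:
  assumes U: "submodule U R M" and fin: "sublen R M U V < \<infinity>"
    and N: "\<And>i::nat. submodule (N i) R M" "\<And>i. U \<subseteq> N i" "\<And>i. N i \<subseteq> V" "\<And>i. N (Suc i) \<subseteq> N i"
  shows "\<exists>i. N (Suc i) = N i"
proof (rule ccontr)
  assume "\<not> ?thesis"
  hence st: "N (Suc i) \<subset> N i" for i using N(4)[of i] by blast
  have "subchain R M U V n" for n
  proof (rule subchainI[of _ "\<lambda>i. N (n - i)"])
    fix i assume "i < n"
    hence "n - i = Suc (n - Suc i)" by simp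
    thus "N (n - i) \<subset> N (n - Suc i)" using st by simp
  qed (use N in simp)
  moreover have "U \<subseteq> V" using N(2,3) by blast
  ultimately have "enat n \<le> sublen R M U V" for n using enat_le_sublen_iff[OF U] by blast
  hence "sublen R M U V = \<infinity>" by (metis enat_ord_simps(1) enat.exhaust n_not_Suc_n Suc_n_not_le_n)
  thus False using fin by simp
qed

lemma submodule_set_add_comm:
  "submodule H R M \<Longrightarrow> submodule K R M \<Longrightarrow> H <+>\<^bsub>M\<^esub> K = K <+>\<^bsub>M\<^esub> H"
  by (intro equalityI set_add_least submodule_set_add set_add_upper1 set_add_upper2)

lemma regular_submodule: "ideal J R \<Longrightarrow> submodule J R (regular_module R)"
  by (simp add: submodule_regular_iff)

lemma ideal_subset_carrier: "ideal J R \<Longrightarrow> J \<subseteq> carrier R"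
  using ideal_carr by blast

text \<open>By \<open>JV\<close>, the map \<open>a \<mapsto> a g\<close> induces a surjection of R/J
  onto the quotient of \<open>V + R g\<close> by \<open>V\<close>.\<close>

lemma sublen_cyc_le:
  assumes J: "ideal J R" and g: "g \<in> carrier M" and V: "submodule V R M"
    and JV: "\<And>a. a \<in> J \<Longrightarrow> a \<odot>\<^bsub>M\<^esub> g \<in> V"
  shows "sublen R M V (V <+>\<^bsub>M\<^esub> cyc g) \<le> sublen R (regular_module R) J (carrier R)"
proof -
  have "V <+>\<^bsub>M\<^esub> (\<lambda>a. a \<odot>\<^bsub>M\<^esub> g) ` J = V"
    by (rule set_add_absorb[OF V submodule_ideal_smult_elem[OF g J]]) (use JV in auto)
  thus ?thesis
    using sublen_lin_image_le[OF module_regular module_axioms cyc_lin_map[OF g]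
        regular_submodule[OF R.oneideal] regular_submodule[OF J] ideal_subset_carrier[OF J] V]
    by (simp add: cyc_def)
qed

lemma sublen_span_le:
  assumes J: "ideal J R" and V: "submodule V R M" and "finite S" "S \<subseteq> carrier M"
    and "\<And>a g. a \<in> J \<Longrightarrow> g \<in> S \<Longrightarrow> a \<odot>\<^bsub>M\<^esub> g \<in> V"
  shows "sublen R M V (V <+>\<^bsub>M\<^esub> module_span R M S) \<le> enat (card S) * sublen R (regular_module R) J (carrier R)"
  using assms(3-)
proof (induction S rule: finite_induct)
  case empty
  show ?case using sublen_refl[OF V] set_add_zero[OF V] by (simp add: span_empty)
next
  case (insert g S)
  have g: "g \<in> carrier M" "S \<subseteq> carrier M" using insert.prems by auto
  let ?L = "sublen R (regular_module R) J (carrier R)"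
  let ?W = "V <+>\<^bsub>M\<^esub> module_span R M S"
  have sp: "submodule (module_span R M S) R M" by (rule span_submodule[OF g(2)])
  have W: "submodule ?W R M" by (rule submodule_set_add[OF V sp])
  have c: "submodule (cyc g) R M" by (rule submodule_cyc[OF g(1)])
  have "V <+>\<^bsub>M\<^esub> module_span R M (insert g S) = ?W <+>\<^bsub>M\<^esub> cyc g"
    unfolding span_insert[OF g] submodule_set_add_assoc[OF V sp c]
    by (simp add: submodule_set_add_comm[OF c sp])
  moreover have "sublen R M V (?W <+>\<^bsub>M\<^esub> cyc g) = sublen R M V ?W + sublen R M ?W (?W <+>\<^bsub>M\<^esub> cyc g)"
    by (rule sublen_additive[OF V W submodule_set_add[OF W c] set_add_upper1[OF V sp] set_add_upper1[OF W c]])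
  moreover have "sublen R M V ?W \<le> enat (card S) * ?L" using insert.IH[OF g(2)] insert.prems(2) by simp
  moreover have "sublen R M ?W (?W <+>\<^bsub>M\<^esub> cyc g) \<le> ?L"
    by (rule sublen_cyc_le[OF J g(1) W]) (use insert.prems(2) set_add_upper1[OF V sp] in auto)
  moreover have "enat (card (insert g S)) * ?L = enat (card S) * ?L + ?L"
    using insert.hyps by (simp add: eSuc_enat[symmetric] mult_eSuc add.commute)
  ultimately show ?case by (metis add_mono)
qed

text \<open>The assumptions say that the \<open>f y\<close> form a basis, over R/J, of the module
  they span modulo \<open>V\<close>. Adding them one at a time contributes one copy of R/J
  each.\<close>

lemma sublen_basis:
  assumes J: "ideal J R" and V: "submodule V R M" and "finite Y" "f \<in> Y \<rightarrow> carrier M"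
    and "\<And>a y. a \<in> J \<Longrightarrow> y \<in> Y \<Longrightarrow> a \<odot>\<^bsub>M\<^esub> f y \<in> V"
    and "\<And>c y. c \<in> Y \<rightarrow> carrier R \<Longrightarrow> (\<Oplus>\<^bsub>M\<^esub>y\<in>Y. c y \<odot>\<^bsub>M\<^esub> f y) \<in> V \<Longrightarrow> y \<in> Y \<Longrightarrow> c y \<in> J"
  shows "sublen R M V (V <+>\<^bsub>M\<^esub> module_span R M (f ` Y)) = enat (card Y) * sublen R (regular_module R) J (carrier R)"
  using assms(3-)
proof (induction Y rule: finite_induct)
  case empty
  show ?case using sublen_refl[OF V] set_add_zero[OF V] by (simp add: span_empty zero_enat_def[symmetric])
next
  case (insert z Y)
  let ?g = "f z"
  have g: "?g \<in> carrier M" "f ` Y \<subseteq> carrier M" "f \<in> Y \<rightarrow> carrier M" using insert.prems(1) by auto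
  let ?L = "sublen R (regular_module R) J (carrier R)"
  let ?W = "V <+>\<^bsub>M\<^esub> module_span R M (f ` Y)"
  have sp: "submodule (module_span R M (f ` Y)) R M" by (rule span_submodule[OF g(2)])
  have W: "submodule ?W R M" by (rule submodule_set_add[OF V sp])
  have c: "submodule (cyc ?g) R M" by (rule submodule_cyc[OF g(1)])
  have fc: "c y \<odot>\<^bsub>M\<^esub> f y \<in> carrier M" if "c \<in> insert z Y \<rightarrow> carrier R" "y \<in> insert z Y" for c y
    using that insert.prems(1) by (auto simp: Pi_iff)
  have split: "(\<Oplus>\<^bsub>M\<^esub>y\<in>insert z Y. c y \<odot>\<^bsub>M\<^esub> f y) = c z \<odot>\<^bsub>M\<^esub> f z \<oplus>\<^bsub>M\<^esub> (\<Oplus>\<^bsub>M\<^esub>y\<in>Y. c y \<odot>\<^bsub>M\<^esub> f y)"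
    if "c \<in> insert z Y \<rightarrow> carrier R" for c
    using insert.hyps fc[OF that] by (intro M.finsum_insert) auto
  have IH: "sublen R M V ?W = enat (card Y) * ?L"
  proof (rule insert.IH[OF g(3)])
    show "\<And>a y. a \<in> J \<Longrightarrow> y \<in> Y \<Longrightarrow> a \<odot>\<^bsub>M\<^esub> f y \<in> V" using insert.prems(2) by simp
    fix c y assume cy: "c \<in> Y \<rightarrow> carrier R" "(\<Oplus>\<^bsub>M\<^esub>y\<in>Y. c y \<odot>\<^bsub>M\<^esub> f y) \<in> V" "y \<in> Y"
    let ?c = "c(z := \<zero>\<^bsub>R\<^esub>)"
    have c': "?c \<in> insert z Y \<rightarrow> carrier R" using cy(1) by auto
    have eq: "(\<Oplus>\<^bsub>M\<^esub>y\<in>Y. ?c y \<odot>\<^bsub>M\<^esub> f y) = (\<Oplus>\<^bsub>M\<^esub>y\<in>Y. c y \<odot>\<^bsub>M\<^esub> f y)"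
      using insert.hyps cy(1) g(3) by (intro M.finsum_cong') (auto simp: Pi_iff)
    have "(\<Oplus>\<^bsub>M\<^esub>y\<in>Y. c y \<odot>\<^bsub>M\<^esub> f y) \<in> carrier M" using cy(2) submodule_mem_carrier[OF V] by blast
    hence "(\<Oplus>\<^bsub>M\<^esub>y\<in>insert z Y. ?c y \<odot>\<^bsub>M\<^esub> f y) \<in> V" using split[OF c'] eq g(1) cy(2) by simp
    hence "?c y \<in> J" using insert.prems(3)[OF c'] cy(3) by simp
    thus "c y \<in> J" using cy(3) insert.hyps by (auto split: if_splits)
  qed
  have JW: "a \<odot>\<^bsub>M\<^esub> ?g \<in> ?W" if "a \<in> J" for a using insert.prems(2)[OF that] set_add_upper1[OF V sp] by auto
  have absorb: "?W <+>\<^bsub>M\<^esub> (\<lambda>a. a \<odot>\<^bsub>M\<^esub> ?g) ` J = ?W"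
    by (rule set_add_absorb[OF W submodule_ideal_smult_elem[OF g(1) J]]) (use JW in auto)
  have step: "sublen R M (?W <+>\<^bsub>M\<^esub> (\<lambda>a. a \<odot>\<^bsub>M\<^esub> ?g) ` J) (?W <+>\<^bsub>M\<^esub> (\<lambda>a. a \<odot>\<^bsub>M\<^esub> ?g) ` carrier R) = ?L"
  proof (rule sublen_lin_image_eq[OF module_regular module_axioms cyc_lin_map[OF g(1)]
        regular_submodule[OF R.oneideal] regular_submodule[OF J] ideal_subset_carrier[OF J] W])
    fix a assume a: "a \<in> carrier R" "a \<odot>\<^bsub>M\<^esub> ?g \<in> ?W <+>\<^bsub>M\<^esub> (\<lambda>a. a \<odot>\<^bsub>M\<^esub> ?g) ` J"
    then obtain v h where vh: "v \<in> V" "h \<in> module_span R M (f ` Y)" "a \<odot>\<^bsub>M\<^esub> ?g = v \<oplus>\<^bsub>M\<^esub> h"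
      unfolding absorb by (auto simp: mem_set_add)
    obtain d where d: "d \<in> Y \<rightarrow> carrier R" "h = (\<Oplus>\<^bsub>M\<^esub>y\<in>Y. d y \<odot>\<^bsub>M\<^esub> f y)"
      using vh(2) span_image_finsum[OF insert.hyps(1) g(3)] by blast
    \<comment> \<open>The coefficients of \<open>a g - h\<close>, which equals \<open>v\<close> and
      therefore lies in \<open>V\<close>.\<close>
    let ?c = "\<lambda>y. if y = z then a else \<ominus> d y"
    have c': "?c \<in> insert z Y \<rightarrow> carrier R" using a(1) d(1) by (auto simp: Pi_iff)
    have hc: "h \<in> carrier M" "v \<in> carrier M" using vh submodule_mem_carrier[OF sp] submodule_mem_carrier[OF V] by auto
    have dfc: "(\<lambda>y. d y \<odot>\<^bsub>M\<^esub> f y) \<in> Y \<rightarrow> carrier M" using d(1) g(3) by (auto simp: Pi_iff)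
    have "(\<Oplus>\<^bsub>M\<^esub>y\<in>Y. ?c y \<odot>\<^bsub>M\<^esub> f y) = (\<Oplus>\<^bsub>M\<^esub>y\<in>Y. (\<ominus> \<one>) \<odot>\<^bsub>M\<^esub> (d y \<odot>\<^bsub>M\<^esub> f y))"
      using insert.hyps d(1) g(3) by (intro M.finsum_cong') (auto simp: Pi_iff smult_l_minus)
    also have "\<dots> = (\<ominus> \<one>) \<odot>\<^bsub>M\<^esub> h"
      unfolding d(2) by (rule finsum_smult_ldistr[OF insert.hyps(1) _ dfc, symmetric]) simp
    also have "\<dots> = \<ominus>\<^bsub>M\<^esub> h" using hc by (simp add: smult_l_minus)
    finally have "(\<Oplus>\<^bsub>M\<^esub>y\<in>insert z Y. ?c y \<odot>\<^bsub>M\<^esub> f y) = (v \<oplus>\<^bsub>M\<^esub> h) \<oplus>\<^bsub>M\<^esub> \<ominus>\<^bsub>M\<^esub> h"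
      unfolding split[OF c'] using vh(3) by simp
    also have "\<dots> = v" using hc by (simp add: M.a_assoc M.r_neg)
    finally have "(\<Oplus>\<^bsub>M\<^esub>y\<in>insert z Y. ?c y \<odot>\<^bsub>M\<^esub> f y) \<in> V" using vh(1) by simp
    from insert.prems(3)[OF c' this, of z] show "a \<in> J" by simp
  qed
  have "V <+>\<^bsub>M\<^esub> module_span R M (f ` insert z Y) = ?W <+>\<^bsub>M\<^esub> cyc ?g"
    unfolding image_insert span_insert[OF g(1,2)] submodule_set_add_assoc[OF V sp c]
    by (simp add: submodule_set_add_comm[OF c sp])
  moreover have "sublen R M V (?W <+>\<^bsub>M\<^esub> cyc ?g) = sublen R M V ?W + sublen R M ?W (?W <+>\<^bsub>M\<^esub> cyc ?g)"
    by (rule sublen_additive[OF V W submodule_set_add[OF W c] set_add_upper1[OF V sp] set_add_upper1[OF W c]])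
  moreover have "sublen R M ?W (?W <+>\<^bsub>M\<^esub> cyc ?g) = ?L" using step absorb by (simp add: cyc_def)
  moreover have "enat (card (insert z Y)) * ?L = enat (card Y) * ?L + ?L"
    using insert.hyps by (simp add: eSuc_enat[symmetric] mult_eSuc add.commute)
  ultimately show ?case using IH by simp
qed

end

section \<open>Finite length of the ring modulo an ideal\<close>

context noeth_local
begin

lemma fg_sub_ideal: "ideal J R \<Longrightarrow> fg_sub R (regular_module R) J"
proof -
  assume J: "ideal J R"
  then obtain A where A: "A \<subseteq> carrier R" "finite A" "J = Idl A" using finetely_gen by blast
  thus ?thesis unfolding fg_sub_def using span_regular_eq_genideal[OF A(1)] by auto
qed

lemma noeth_local_module_regular: "noeth_local_module R (regular_module R)"
  by (intro noeth_local_module.intro noeth_local_axioms module_regular)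

sublocale RM: noeth_local_module R "regular_module R"
  by (rule noeth_local_module_regular)

lemma sublen_max_ideal: "sublen R (regular_module R) \<mm> (carrier R) = 1"
proof (rule antisym)
  have mS: "submodule \<mm> R (regular_module R)" by (simp add: submodule_regular_iff max_ideal_ideal)
  have cS: "submodule (carrier R) R (regular_module R)" by (simp add: submodule_regular_iff oneideal)
  have sub: "\<mm> \<subset> carrier R" using max_carr max_one one_closed by blast
  show "1 \<le> sublen R (regular_module R) \<mm> (carrier R)" by (rule RM.sublen_pos[OF mS cS sub])
  have "\<not> subchain R (regular_module R) \<mm> (carrier R) 2"
  proof
    assume "subchain R (regular_module R) \<mm> (carrier R) 2"
    then obtain N where N: "\<And>i. i \<le> 2 \<Longrightarrow> submodule (N i) R (regular_module R) \<and> \<mm> \<subseteq> N i \<and> N i \<subseteq> carrier R"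
      "\<And>i. i < 2 \<Longrightarrow> N i \<subset> N (Suc i)" unfolding subchain_def by auto
    have 1: "ideal (N 1) R" "\<mm> \<subset> N 1" using N(1)[of 1] N(1)[of 0] N(2)[of 0] by (auto simp: submodule_regular_iff)
    hence "\<one> \<in> N 1" using proper_subset_max by blast
    hence "N 1 = carrier R" using proper_ideal[OF 1(1)] by blast
    thus False using N(2)[of 1] N(1)[of 2] by (auto simp: numeral_2_eq_2)
  qed
  hence "\<not> enat 2 \<le> sublen R (regular_module R) \<mm> (carrier R)"
    using enat_le_sublen_iff[OF mS, of "carrier R"] sub by blast
  thus "sublen R (regular_module R) \<mm> (carrier R) \<le> 1"
    by (cases "sublen R (regular_module R) \<mm> (carrier R)") (auto simp: one_enat_def)
qed

text \<open>Noetherian induction on \<open>J\<close>: a socle element \<open>b\<close> of R/J adds a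
  piece of length at most one, and the ideal \<open>J + R b\<close> is covered by the induction
  hypothesis.\<close>

lemma sublen_finite_of_max_rad:
  assumes "ideal J R" "max_rad J" shows "sublen R (regular_module R) J (carrier R) < \<infinity>"
  using assms
proof (induction J rule: ideal_induct)
  case (step J)
  have cS: "submodule (carrier R) R (regular_module R)" by (simp add: submodule_regular_iff oneideal)
  have JS: "submodule J R (regular_module R)" by (simp add: submodule_regular_iff step.hyps)
  show ?case
  proof (cases "\<one> \<in> J")
    case True
    hence "J = carrier R" using proper_ideal[OF step.hyps] by blast
    thus ?thesis using RM.sublen_refl[OF cS] by simp
  next
    case False
    then obtain b where b: "b \<in> carrier R" "b \<notin> J" "\<And>y. y \<in> \<mm> \<Longrightarrow> y \<otimes> b \<in> J"
      using max_rad_socle[OF step.hyps _ step.prems] by blast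
    let ?K = "J <+>\<^bsub>regular_module R\<^esub> RM.cyc b"
    have cy: "submodule (RM.cyc b) R (regular_module R)" using RM.submodule_cyc b by simp
    have KS: "submodule ?K R (regular_module R)" using RM.submodule_set_add[OF JS cy] by simp
    have JK: "J \<subseteq> ?K" using RM.set_add_upper1[OF JS cy] by simp
    have "b \<in> ?K" using RM.set_add_upper2[OF JS cy] RM.cyc_self b by auto
    hence "J \<subset> ?K" using JK b by blast
    hence "sublen R (regular_module R) ?K (carrier R) < \<infinity>"
      using step.IH[of ?K] KS max_rad_mono[OF step.prems JK] by (simp add: submodule_regular_iff)
    moreover have "sublen R (regular_module R) J ?K \<le> 1"
      using RM.sublen_cyc_le[OF max_ideal_ideal _ JS, of b] b sublen_max_ideal by simp
    moreover have "sublen R (regular_module R) J (carrier R)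
      = sublen R (regular_module R) J ?K + sublen R (regular_module R) ?K (carrier R)"
      by (rule RM.sublen_additive[OF JS KS cS JK]) (use RM.submodule_subset[OF KS] in simp)
    ultimately show ?thesis
      by (cases "sublen R (regular_module R) J ?K"; cases "sublen R (regular_module R) ?K (carrier R)")
        (auto simp: one_enat_def)
  qed
qed

section \<open>Regular elements\<close>

lemma ideal_ann: "a \<in> carrier R \<Longrightarrow> ideal {r \<in> carrier R. r \<otimes> a = \<zero>} R"
  using colon_ideal[OF zeroideal, of a] by simp

text \<open>If the element \<open>x\<close> found for \<open>F\<close> happens to lie in
  \<open>P\<close>, it is corrected by an element of \<mm> that lies in every prime of
  \<open>F\<close> but not in \<open>P\<close>.\<close>

lemma prime_avoidance_incomparable:
  assumes "finite F" "\<And>P. P \<in> F \<Longrightarrow> primeideal P R" "\<And>P. P \<in> F \<Longrightarrow> \<not> \<mm> \<subseteq> P"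
    and "\<And>P Q. P \<in> F \<Longrightarrow> Q \<in> F \<Longrightarrow> P \<subseteq> Q \<Longrightarrow> P = Q"
  shows "\<exists>t\<in>\<mm>. \<forall>P\<in>F. t \<notin> P"
  using assms
proof (induction F rule: finite_induct)
  case empty
  show ?case using ideal_zero[OF max_ideal_ideal] by blast
next
  case (insert P F)
  have P: "primeideal P R" "ideal P R" using insert.prems(1) primeideal.axioms(1) by auto
  obtain x where x: "x \<in> \<mm>" "\<And>Q. Q \<in> F \<Longrightarrow> x \<notin> Q" using insert by (metis insertCI)
  show ?case
  proof (cases "x \<in> P")
    case False thus ?thesis using x by blast
  next
    case True
    \<comment> \<open>A product of elements, one from each prime of \<open>F\<close> and none of
      them in \<open>P\<close>; incomparability supplies the factors.\<close>
    have "\<exists>z\<in>carrier R. z \<notin> P \<and> (\<forall>Q\<in>F. z \<in> Q)"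
    proof -
      have "finite G \<Longrightarrow> G \<subseteq> F \<Longrightarrow> \<exists>z\<in>carrier R. z \<notin> P \<and> (\<forall>Q\<in>G. z \<in> Q)" for G
      proof (induction G rule: finite_induct)
        case empty show ?case using prime_one[OF P(1)] one_closed by blast
      next
        case (insert Q G)
        have Q: "Q \<in> F" "ideal Q R" using insert(4) \<open>\<And>P'. P' \<in> insert P F \<Longrightarrow> primeideal P' R\<close> primeideal.axioms(1) by auto
        obtain z where z: "z \<in> carrier R" "z \<notin> P" "\<forall>Q\<in>G. z \<in> Q" using insert by auto
        have "Q \<noteq> P" using Q \<open>P \<notin> F\<close> by auto
        hence "\<not> Q \<subseteq> P" using \<open>\<And>P' Q'. P' \<in> insert P F \<Longrightarrow> Q' \<in> insert P F \<Longrightarrow> P' \<subseteq> Q' \<Longrightarrow> P' = Q'\<close>[of Q P] Q by auto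
        then obtain w where w: "w \<in> Q" "w \<notin> P" by auto
        have wc: "w \<in> carrier R" using ideal_carr[OF Q(2) w(1)] .
        have "w \<otimes> z \<notin> P" using prime_mult[OF P(1) wc z(1)] w z by simp
        moreover have "w \<otimes> z \<in> Q" using ideal_mult_r[OF Q(2) z(1) w(1)] .
        moreover have "w \<otimes> z \<in> Q'" if "Q' \<in> G" for Q'
        proof -
          have "ideal Q' R" using that insert(4) \<open>\<And>P'. P' \<in> insert P F \<Longrightarrow> primeideal P' R\<close> primeideal.axioms(1) by auto
          thus ?thesis using ideal_mult[OF _ wc] z(3) that by auto
        qed
        ultimately show ?case using wc z(1) by (intro bexI[of _ "w \<otimes> z"]) auto
      qed
      thus ?thesis using insert.hyps(1) by auto
    qed
    then obtain z where z: "z \<in> carrier R" "z \<notin> P" "\<And>Q. Q \<in> F \<Longrightarrow> z \<in> Q" by auto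
    obtain w where w: "w \<in> \<mm>" "w \<notin> P" using insert.prems(2)[of P] by auto
    have wc: "w \<in> carrier R" using max_carr[OF w(1)] .
    let ?y = "w \<otimes> z"
    have y: "?y \<in> \<mm>" "?y \<notin> P" using ideal_mult_r[OF max_ideal_ideal z(1) w(1)] prime_mult[OF P(1) wc z(1)] w z by auto
    have yc: "?y \<in> carrier R" using wc z by simp
    have "x \<oplus> ?y \<in> \<mm>" using ideal_add[OF max_ideal_ideal x(1) y(1)] .
    moreover have "x \<oplus> ?y \<notin> P" using ideal_cancel[OF P(2) True yc] y(2) by blast
    moreover have "x \<oplus> ?y \<notin> Q" if Q: "Q \<in> F" for Q
    proof
      assume xy: "x \<oplus> ?y \<in> Q"
      have Qi: "ideal Q R" using insert.prems(1) Q primeideal.axioms(1) by auto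
      have "?y \<in> Q" using ideal_mult[OF Qi wc z(3)[OF Q]] .
      moreover have "?y \<oplus> x \<in> Q" using xy max_carr[OF x(1)] yc by (simp add: a_comm)
      ultimately have "x \<in> Q" using ideal_cancel[OF Qi _ max_carr[OF x(1)]] by blast
      thus False using x(2)[OF Q] by simp
    qed
    ultimately show ?thesis by (intro bexI[of _ "x \<oplus> ?y"]) auto
  qed
qed

text \<open>The associated primes which are maximal among annihilators of elements: they are finitely many
  since an infinite sequence of them would give a strictly increasing chain \<open>(a\<^sub>0, \<dots>, a\<^sub>n)\<close>.\<close>

lemma exists_regular:
  assumes depth: "\<And>s. s \<in> carrier R \<Longrightarrow> (\<And>y. y \<in> \<mm> \<Longrightarrow> y \<otimes> s = \<zero>) \<Longrightarrow> s = \<zero>"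
  shows "\<exists>t\<in>\<mm>. \<forall>a\<in>carrier R. t \<otimes> a = \<zero> \<longrightarrow> a = \<zero>"
proof -
  define Ann where "Ann a = {r \<in> carrier R. r \<otimes> a = \<zero>}" for a
  have Ann: "ideal (Ann a) R" if "a \<in> carrier R" for a unfolding Ann_def by (rule ideal_ann[OF that])
  define isann where "isann P \<longleftrightarrow> (\<exists>a\<in>carrier R. a \<noteq> \<zero> \<and> P = Ann a)" for P
  have isann_ideal: "isann P \<Longrightarrow> ideal P R" for P unfolding isann_def using Ann by auto
  define F where "F = {P. isann P \<and> (\<forall>Q. isann Q \<longrightarrow> P \<subseteq> Q \<longrightarrow> Q = P)}"
  have FD: "\<exists>a\<in>carrier R. a \<noteq> \<zero> \<and> P = Ann a" "\<And>Q. isann Q \<Longrightarrow> P \<subseteq> Q \<Longrightarrow> Q = P" if "P \<in> F" for P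
    using that unfolding F_def isann_def by auto
  have prime: "primeideal P R" if PF: "P \<in> F" for P
  proof -
    obtain a where a: "a \<in> carrier R" "a \<noteq> \<zero>" "P = Ann a" using FD(1)[OF PF] by auto
    show ?thesis
    proof (rule primeidealI)
      show "ideal P R" using Ann a by simp
      show "cring R" by (rule is_cring)
      show "carrier R \<noteq> P"
      proof
        assume "carrier R = P"
        hence "\<one> \<in> Ann a" using a(3) by auto
        thus False using a by (simp add: Ann_def)
      qed
      fix b c assume bc: "b \<in> carrier R" "c \<in> carrier R" "b \<otimes> c \<in> P"
      show "b \<in> P \<or> c \<in> P"
      proof (cases "c \<otimes> a = \<zero>")
        case True thus ?thesis using a bc by (simp add: Ann_def)
      next
        case False
        \<comment> \<open>The annihilator of \<open>c a\<close> contains \<open>P\<close>, so by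
          maximality it is \<open>P\<close>; and it contains \<open>b\<close>.\<close>
        have "isann (Ann (c \<otimes> a))" unfolding isann_def using False bc a by auto
        moreover have "P \<subseteq> Ann (c \<otimes> a)"
        proof
          fix r assume "r \<in> P"
          hence r: "r \<in> carrier R" "r \<otimes> a = \<zero>" using a(3) by (auto simp: Ann_def)
          have "r \<otimes> (c \<otimes> a) = c \<otimes> (r \<otimes> a)" using r(1) bc a by (simp add: m_ac)
          thus "r \<in> Ann (c \<otimes> a)" using r bc by (simp add: Ann_def)
        qed
        ultimately have eq: "Ann (c \<otimes> a) = P" using FD(2)[OF PF] by simp
        have "b \<otimes> (c \<otimes> a) = \<zero>" using bc a by (simp add: Ann_def m_assoc)
        hence "b \<in> Ann (c \<otimes> a)" using bc by (simp add: Ann_def)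
        thus ?thesis using eq by simp
      qed
    qed
  qed
  have inc: "P = Q" if "P \<in> F" "Q \<in> F" "P \<subseteq> Q" for P Q
    using that FD(2)[OF that(1), of Q] unfolding F_def by auto
  have "finite F"
  proof (rule ccontr)
    assume "infinite F"
    then obtain P :: "nat \<Rightarrow> 'a set" where P: "inj P" "range P \<subseteq> F" using infinite_countable_subset by blast
    have PF: "P n \<in> F" for n using P(2) by auto
    have "\<exists>a. a \<in> carrier R \<and> a \<noteq> \<zero> \<and> P n = Ann a" for n using FD(1)[OF PF] by auto
    then obtain a where a: "\<And>n. a n \<in> carrier R" "\<And>n. P n = Ann (a n)" by metis
    define J where "J = rec_nat {\<zero>} (\<lambda>n J. ins_ideal J (a n))"
    have J0: "J 0 = {\<zero>}" and JS: "J (Suc n) = ins_ideal (J n) (a n)" for n unfolding J_def by auto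
    have Ji: "ideal (J n) R" for n by (induction n) (auto simp: J0 JS zeroideal ins_ideal_ideal a)
    have "J n \<subseteq> J (Suc n)" for n unfolding JS by (rule ins_ideal_superset[OF Ji a(1)])
    then obtain n where n: "J (Suc n) = J n" using ideal_chain_stab[of J] Ji by blast
    \<comment> \<open>The witness is a product of elements of the \<open>P i\<close> with
      \<open>i < n\<close>, each chosen outside \<open>P m\<close>. For \<open>m = n\<close> it
      kills \<open>J n\<close> but not \<open>a n\<close>, so the chain \<open>J\<close> cannot
      stop.\<close>
    have ann: "n \<le> m \<Longrightarrow> \<exists>c\<in>carrier R. c \<notin> P m \<and> (\<forall>x\<in>J n. c \<otimes> x = \<zero>)" for n m
    proof (induction n)
      case 0 show ?case using prime_one[OF prime[OF PF]] by (intro bexI[of _ \<one>]) (auto simp: J0)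
    next
      case (Suc n)
      then obtain c where c: "c \<in> carrier R" "c \<notin> P m" "\<And>x. x \<in> J n \<Longrightarrow> c \<otimes> x = \<zero>" by auto
      have "P n \<noteq> P m" using P(1) Suc.prems by (auto simp: inj_eq)
      hence "\<not> P n \<subseteq> P m" using inc PF by blast
      then obtain b where b: "b \<in> P n" "b \<notin> P m" by auto
      have bc: "b \<in> carrier R" "b \<otimes> a n = \<zero>" using b(1) a by (auto simp: Ann_def)
      have "(b \<otimes> c) \<otimes> x = \<zero>" if xJ: "x \<in> J (Suc n)" for x
      proof -
        obtain j r where jr: "j \<in> J n" "r \<in> carrier R" "x = j \<oplus> r \<otimes> a n" using xJ unfolding JS by (elim ins_ideal_cases)
        have jc: "j \<in> carrier R" using ideal_carr[OF Ji jr(1)] .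
        have "(b \<otimes> c) \<otimes> x = b \<otimes> (c \<otimes> j) \<oplus> (c \<otimes> r) \<otimes> (b \<otimes> a n)"
          using bc(1) c(1) jc jr a(1)[of n] by (simp add: r_distr m_ac)
        thus ?thesis using c(3)[OF jr(1)] bc c(1) jr(2) by simp
      qed
      moreover have "b \<otimes> c \<notin> P m" using prime_mult[OF prime[OF PF] bc(1) c(1)] b c by simp
      ultimately show ?case using bc c by (intro bexI[of _ "b \<otimes> c"]) auto
    qed
    obtain c where c: "c \<in> carrier R" "c \<notin> P n" "\<And>x. x \<in> J n \<Longrightarrow> c \<otimes> x = \<zero>" using ann[of n n] by auto
    have "a n \<in> J n" using n ins_ideal_self[OF Ji a(1)] unfolding JS by auto
    hence "c \<in> P n" using c(1,3) a by (auto simp: Ann_def)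
    thus False using c by simp
  qed
  moreover have "\<not> \<mm> \<subseteq> P" if PF: "P \<in> F" for P
  proof
    assume mP: "\<mm> \<subseteq> P"
    obtain a where a: "a \<in> carrier R" "a \<noteq> \<zero>" "P = Ann a" using FD(1)[OF PF] by auto
    have "y \<otimes> a = \<zero>" if "y \<in> \<mm>" for y using mP that a(3) by (auto simp: Ann_def)
    thus False using depth[OF a(1)] a(2) by simp
  qed
  ultimately obtain t where t: "t \<in> \<mm>" "\<And>P. P \<in> F \<Longrightarrow> t \<notin> P"
    using prime_avoidance_incomparable[of F] prime inc by blast
  have "a = \<zero>" if a: "a \<in> carrier R" "t \<otimes> a = \<zero>" for a
  proof (rule ccontr)
    assume "a \<noteq> \<zero>"
    hence "isann (Ann a) \<and> Ann a \<subseteq> Ann a" using a unfolding isann_def by auto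
    then obtain P where P: "isann P \<and> Ann a \<subseteq> P" "\<And>Q. isann Q \<and> Ann a \<subseteq> Q \<Longrightarrow> P \<subseteq> Q \<Longrightarrow> Q = P"
      by (rule noeth_max_such) (auto simp: isann_ideal)
    have "P \<in> F" unfolding F_def using P by auto
    moreover have "t \<in> Ann a" using a t max_carr by (simp add: Ann_def)
    ultimately show False using t(2) P(1) by auto
  qed
  thus ?thesis using t(1) by blast
qed

section \<open>Dimension one\<close>

text \<open>Krull's principal ideal theorem for a parameter \<open>t\<close>. The ideals \<open>W i\<close> are the contractions of
  \<open>x\<^sup>i R + q0\<close> from the localization at \<open>q1\<close>.\<close>

lemma prime_below_max_minimal:
  assumes t: "t \<in> \<mm>" "max_rad (PIdl t)" and q0: "primeideal q0 R" and q1: "primeideal q1 R"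
    and sub: "q0 \<subset> q1" and nm: "q1 \<noteq> \<mm>"
  shows False
proof -
  have tc: "t \<in> carrier R" using max_carr[OF t(1)] .
  have q0i: "ideal q0 R" and q1i: "ideal q1 R" using q0 q1 primeideal.axioms(1) by auto
  have Pt: "ideal (PIdl t) R" by (rule cgenideal_ideal[OF tc])
  \<comment> \<open>Every element of \<mm> has a power in \<open>t R\<close>, so \<open>t\<close> in
    \<open>q1\<close> would force \<open>q1 = \<mm>\<close>.\<close>
  have tq: "t \<notin> q1"
  proof
    assume "t \<in> q1"
    hence Ptq: "PIdl t \<subseteq> q1" unfolding PIdl_mem subset_iff using ideal_mult[OF q1i] by auto
    have "\<mm> \<subseteq> q1"
    proof
      fix y assume y: "y \<in> \<mm>"
      then obtain n :: nat where "y [^] n \<in> PIdl t" using t(2) unfolding max_rad_def by blast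
      thus "y \<in> q1" using prime_pow[OF q1 max_carr[OF y]] Ptq by blast
    qed
    thus False using nm proper_subset_max[OF q1i prime_one[OF q1]] by blast
  qed
  obtain x where x: "x \<in> q1" "x \<notin> q0" using sub by blast
  have xc: "x \<in> carrier R" using ideal_carr[OF q1i x(1)] .
  define W where "W i = {a \<in> carrier R. \<exists>s\<in>carrier R. s \<notin> q1 \<and> s \<otimes> a \<in> ins_ideal q0 (x [^] i)}" for i :: nat
  have ii: "ideal (ins_ideal q0 (x [^] i)) R" for i :: nat using ins_ideal_ideal[OF q0i] xc by simp
  have Wi: "ideal (W i) R" for i
  proof (rule idealI2)
    show "W i \<subseteq> carrier R" by (auto simp: W_def)
    show "\<zero> \<in> W i" using prime_one[OF q1] ideal_zero[OF ii] unfolding W_def by (auto intro!: bexI[of _ \<one>])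
    { fix a b assume "a \<in> W i" "b \<in> W i"
      then obtain s s' where s: "a \<in> carrier R" "b \<in> carrier R" "s \<in> carrier R" "s' \<in> carrier R" "s \<notin> q1" "s' \<notin> q1"
        "s \<otimes> a \<in> ins_ideal q0 (x [^] i)" "s' \<otimes> b \<in> ins_ideal q0 (x [^] i)" unfolding W_def by auto
      have "(s \<otimes> s') \<otimes> (a \<oplus> b) = s' \<otimes> (s \<otimes> a) \<oplus> s \<otimes> (s' \<otimes> b)" using s(1-4) by (simp add: r_distr m_ac)
      also have "\<dots> \<in> ins_ideal q0 (x [^] i)" using ideal_add[OF ii ideal_mult[OF ii s(4,7)] ideal_mult[OF ii s(3,8)]] .
      finally have "(s \<otimes> s') \<otimes> (a \<oplus> b) \<in> ins_ideal q0 (x [^] i)" .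
      moreover have "s \<otimes> s' \<notin> q1" using prime_mult[OF q1 s(3,4)] s by simp
      ultimately show "a \<oplus> b \<in> W i" using s(1-4) unfolding W_def by (auto intro!: bexI[of _ "s \<otimes> s'"]) }
    { fix b a assume b: "b \<in> carrier R" and "a \<in> W i"
      then obtain s where s: "a \<in> carrier R" "s \<in> carrier R" "s \<notin> q1" "s \<otimes> a \<in> ins_ideal q0 (x [^] i)" unfolding W_def by auto
      have "s \<otimes> (b \<otimes> a) = b \<otimes> (s \<otimes> a)" using s b by (simp add: m_ac)
      hence "s \<otimes> (b \<otimes> a) \<in> ins_ideal q0 (x [^] i)" using ideal_mult[OF ii b s(4)] by simp
      thus "b \<otimes> a \<in> W i" using s b unfolding W_def by auto }
  qed
  have WS: "W (Suc i) \<subseteq> W i" for i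
  proof -
    have "ins_ideal q0 (x [^] Suc i) \<subseteq> ins_ideal q0 (x [^] i)"
    proof
      fix y assume "y \<in> ins_ideal q0 (x [^] Suc i)"
      then obtain j r where jr: "j \<in> q0" "r \<in> carrier R" "y = j \<oplus> r \<otimes> x [^] Suc i" by (elim ins_ideal_cases)
      hence "y = j \<oplus> (r \<otimes> x) \<otimes> x [^] i" using xc by (simp add: m_ac)
      thus "y \<in> ins_ideal q0 (x [^] i)" using jr xc by (intro ins_idealI[of j _ "r \<otimes> x"]) auto
    qed
    thus ?thesis unfolding W_def by blast
  qed
  have sm: "submodule (W i) R (regular_module R)" "submodule (PIdl t) R (regular_module R)" for i
    using Wi Pt by (auto simp: submodule_regular_iff)
  let ?V = "\<lambda>i. W i <+>\<^bsub>regular_module R\<^esub> PIdl t"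
  have Vs: "submodule (?V i) R (regular_module R)" for i using RM.submodule_set_add[OF sm] by simp
  \<comment> \<open>R/tR has finite length, so the descending ideals \<open>W i + t R\<close> become
    stationary.\<close>
  have "\<exists>i. ?V (Suc i) = ?V i"
  proof (rule RM.desc_chain_stab[OF sm(2), of "carrier R"])
    show "sublen R (regular_module R) (PIdl t) (carrier R) < \<infinity>" by (rule sublen_finite_of_max_rad[OF Pt t(2)])
    show "PIdl t \<subseteq> ?V i" for i using RM.set_add_upper2[OF sm] by simp
    show "?V i \<subseteq> carrier R" for i using RM.submodule_subset[OF Vs] by simp
    show "?V (Suc i) \<subseteq> ?V i" for i using RM.set_add_mono[OF WS order_refl] by simp
  qed (rule Vs)
  then obtain i where i: "?V (Suc i) = ?V i" by blast
  have fgW: "fg_sub R (regular_module R) (W i)"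
    using RM.fg_sub_of_span[OF noetherian_ring_axioms, of "{\<one>}" "W i"] sm(1)[of i]
      RM.submodule_subset[OF sm(1)] RM.span_insert[of \<one> "{}"] RM.set_add_upper1[OF RM.submodule_cyc[of \<one>] RM.zero_submodule]
    by (auto simp: RM.span_empty RM.cyc_def)
  have "W i \<subseteq> RM.idmul \<mm> (W i) <+>\<^bsub>regular_module R\<^esub> W (Suc i)"
  proof
    fix a assume a: "a \<in> W i"
    have ac: "a \<in> carrier R" using ideal_carr[OF Wi a] .
    have "a \<in> ?V (Suc i)" unfolding i using a RM.set_add_upper1[OF sm] by auto
    then obtain b c where bc: "b \<in> W (Suc i)" "c \<in> carrier R" "a = b \<oplus> c \<otimes> t"
      by (auto simp: RM.mem_set_add[unfolded regular_module_simps regular_module_set_add] PIdl_mem)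
    have bW: "b \<in> W i" "b \<in> carrier R" using bc(1) WS ideal_carr[OF Wi] by auto
    \<comment> \<open>\<open>W i\<close> is contracted from the localization at \<open>q1\<close>,
      where \<open>t\<close> is a unit. Hence \<open>c t\<close> in \<open>W i\<close> gives
      \<open>c\<close> in \<open>W i\<close>, and \<open>c t\<close> lies in \<mm> times
      \<open>W i\<close>.\<close>
    have "c \<otimes> t \<in> W i" using ideal_cancel[OF Wi bW(1)] a bc tc by simp
    then obtain s where s: "s \<in> carrier R" "s \<notin> q1" "s \<otimes> (c \<otimes> t) \<in> ins_ideal q0 (x [^] i)" unfolding W_def by auto
    have "(s \<otimes> t) \<otimes> c \<in> ins_ideal q0 (x [^] i)" using s bc tc by (simp add: m_ac)
    moreover have "s \<otimes> t \<notin> q1" using prime_mult[OF q1 s(1) tc] s tq by simp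
    ultimately have cW: "c \<in> W i" using bc(2) s(1) tc unfolding W_def by auto
    have "t \<otimes> c \<in> RM.idmul \<mm> (W i)" using RM.idmul_mem[OF t(1) cW] by simp
    hence "a = (t \<otimes> c) \<oplus> b" "t \<otimes> c \<in> RM.idmul \<mm> (W i)" using bc tc bW by (simp_all add: a_comm m_comm)
    thus "a \<in> RM.idmul \<mm> (W i) <+>\<^bsub>regular_module R\<^esub> W (Suc i)" using bc(1) unfolding RM.mem_set_add by auto
  qed
  from RM.nakayama[OF fgW sm(1) this] have WW: "W i \<subseteq> W (Suc i)" .
  \<comment> \<open>Now \<open>x^i\<close> is a multiple of \<open>x^(i+1)\<close> in the
    localization of the domain R/q0 at \<open>q1\<close>. Cancelling makes \<open>x\<close> a unit
    there, although \<open>x\<close> lies in \<open>q1\<close>.\<close>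
  have "x [^] i \<in> W i" using xc prime_one[OF q1] ins_ideal_self[OF q0i] unfolding W_def by (auto intro!: bexI[of _ \<one>])
  hence "x [^] i \<in> W (Suc i)" using WW by blast
  then obtain s where s: "s \<in> carrier R" "s \<notin> q1" "s \<otimes> x [^] i \<in> ins_ideal q0 (x [^] Suc i)" unfolding W_def by auto
  then obtain j r where jr: "j \<in> q0" "r \<in> carrier R" "s \<otimes> x [^] i = j \<oplus> r \<otimes> x [^] Suc i" by (elim ins_ideal_cases)
  have jc: "j \<in> carrier R" using ideal_carr[OF q0i jr(1)] .
  have "(s \<ominus> r \<otimes> x) \<otimes> x [^] i = s \<otimes> x [^] i \<ominus> r \<otimes> x [^] Suc i"
  proof -
    have "r \<otimes> x [^] Suc i = (r \<otimes> x) \<otimes> x [^] i" using jr(2) xc by (simp add: m_ac)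
    thus ?thesis using s(1) jr(2) xc by (simp add: minus_eq l_distr l_minus)
  qed
  also have "\<dots> = j" using jr(2,3) jc xc by (simp add: minus_eq a_assoc r_neg)
  finally have "(s \<ominus> r \<otimes> x) \<otimes> x [^] i \<in> q0" using jr by simp
  hence "s \<ominus> r \<otimes> x \<in> q0" using prime_mult[OF q0, of "s \<ominus> r \<otimes> x" "x [^] i"] prime_pow[OF q0 xc] x(2) s jr xc by auto
  hence "s \<ominus> r \<otimes> x \<in> q1" using sub by auto
  hence "s \<in> q1" using ideal_diff_cancel[OF q1i s(1) ideal_mult[OF q1i jr(2) x(1)]] by simp
  thus False using s by simp
qed

text \<open>In a chain of three primes the middle one differs from \<mm>, which
  \<open>prime_below_max_minimal\<close> excludes; \<open>p\<close> below \<mm> gives the lower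
  bound.\<close>

lemma krull_dim_eq_1:
  assumes "t \<in> \<mm>" "max_rad (PIdl t)" and p: "primeideal p R" "p \<noteq> \<mm>"
  shows "krull_dim R = 1"
proof (rule antisym)
  have ps: "p \<subset> \<mm>" using p proper_subset_max[OF primeideal.axioms(1)[OF p(1)] prime_one[OF p(1)]] by blast
  have "\<exists>P. (\<forall>i\<le>1::nat. primeideal (P i) R) \<and> (\<forall>i<1. P i \<subset> P (Suc i))"
    by (rule exI[of _ "\<lambda>i. if i = 0 then p else \<mm>"]) (use p ps max_prime in auto)
  thus "1 \<le> krull_dim R" unfolding krull_dim_def one_enat_def by (intro Sup_upper) auto
  show "krull_dim R \<le> 1" unfolding krull_dim_def
  proof (rule Sup_least)
    fix e assume "e \<in> {enat n |n. \<exists>P. (\<forall>i\<le>n. primeideal (P i) R) \<and> (\<forall>i<n. P i \<subset> P (Suc i))}"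
    then obtain n P where e: "e = enat n" and P: "\<And>i. i \<le> n \<Longrightarrow> primeideal (P i) R" "\<And>i. i < n \<Longrightarrow> P i \<subset> P (Suc i)" by auto
    have "n \<le> 1"
    proof (rule ccontr)
      assume n: "\<not> n \<le> 1"
      have "P 2 \<subseteq> \<mm>" using P(1)[of 2] n proper_subset_max[OF primeideal.axioms(1) prime_one] by auto
      hence "P 1 \<noteq> \<mm>" using P(2)[of 1] n by (auto simp: numeral_2_eq_2)
      thus False using prime_below_max_minimal[OF assms(1,2), of "P 0" "P 1"] P(1)[of 0] P(1)[of 1] P(2)[of 0] n by auto
    qed
    thus "e \<le> 1" using e by (simp add: one_enat_def)
  qed
qed

end

section \<open>Finite injective dimension\<close>

text \<open>An extension of \<open>f\<close> to the whole ring is determined by its value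
  \<open>e\<close> at \<open>\<one>\<close>. The ideal becomes a module on the type of the ring, as
  \<open>injective_module\<close> requires.\<close>

lemma injective_module_baer:
  assumes "injective_module R E" and R: "cring R" and J: "ideal J R"
    and f: "f \<in> J \<rightarrow> carrier E" "\<And>x y. x \<in> J \<Longrightarrow> y \<in> J \<Longrightarrow> f (x \<oplus>\<^bsub>R\<^esub> y) = f x \<oplus>\<^bsub>E\<^esub> f y"
      "\<And>a x. a \<in> carrier R \<Longrightarrow> x \<in> J \<Longrightarrow> f (a \<otimes>\<^bsub>R\<^esub> x) = a \<odot>\<^bsub>E\<^esub> f x"
  shows "\<exists>e\<in>carrier E. \<forall>x\<in>J. f x = x \<odot>\<^bsub>E\<^esub> e"
proof -
  interpret cring R by fact
  interpret E: module R E using assms(1) unfolding injective_module_def by blast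
  let ?A = "regular_module R"
  let ?N = "?A\<lparr>carrier := J\<rparr>"
  have Js: "submodule J R ?A" using J by (simp add: submodule_regular_iff)
  have N: "module R ?N" by (rule submodule.submodule_is_module[OF Js module_regular])
  have Jc: "J \<subseteq> carrier R" using ideal_carr[OF J] by blast
  have id: "(\<lambda>x. x) \<in> lin_maps R ?N ?A" using Jc by (auto simp: lin_maps_def)
  have fl: "f \<in> lin_maps R ?N E" using f by (auto simp: lin_maps_def)
  have inj: "inj_on (\<lambda>x. x) (carrier ?N)" by simp
  obtain g where g: "g \<in> lin_maps R ?A E" "\<forall>x\<in>carrier ?N. g x = f x"
    using assms(1) N module_regular id inj fl unfolding injective_module_def by blast
  have "f x = x \<odot>\<^bsub>E\<^esub> g \<one>\<^bsub>R\<^esub>" if "x \<in> J" for x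
  proof -
    have "f x = g (x \<otimes>\<^bsub>R\<^esub> \<one>\<^bsub>R\<^esub>)" using that Jc g(2) by auto
    also have "\<dots> = x \<odot>\<^bsub>E\<^esub> g \<one>\<^bsub>R\<^esub>" using lin_mapsD(3)[OF g(1), of x "\<one>\<^bsub>R\<^esub>"] that Jc by auto
    finally show ?thesis .
  qed
  moreover have "g \<one>\<^bsub>R\<^esub> \<in> carrier E" using lin_mapsD(1)[OF g(1), of "\<one>\<^bsub>R\<^esub>"] by simp
  ultimately show ?thesis by blast
qed

locale finite_injective_resolution = noeth_local R for R (structure) +
  fixes E :: "nat \<Rightarrow> ('a, 'e) module" and \<eta> and \<delta> and n :: nat
  assumes res: "injective_resolution R (regular_module R) E \<eta> \<delta>"
    and vanish: "\<And>i. i > n \<Longrightarrow> carrier (E i) = {\<zero>\<^bsub>E i\<^esub>}"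
begin

lemma inj_E: "injective_module R (E i)"
  using res unfolding injective_resolution_def by blast

lemma mod_E: "module R (E i)"
  using inj_E unfolding injective_module_def by blast

sublocale E: module R "E i" for i
  by (rule mod_E)

lemma \<eta>_lin: "\<eta> \<in> lin_maps R (regular_module R) (E 0)"
  and \<delta>_lin: "\<delta> i \<in> lin_maps R (E i) (E (Suc i))"
  using res unfolding injective_resolution_def by blast+

lemma \<eta>_carr: "a \<in> carrier R \<Longrightarrow> \<eta> a \<in> carrier (E 0)"
  and \<eta>_add: "a \<in> carrier R \<Longrightarrow> b \<in> carrier R \<Longrightarrow> \<eta> (a \<oplus> b) = \<eta> a \<oplus>\<^bsub>E 0\<^esub> \<eta> b"
  and \<eta>_mult: "a \<in> carrier R \<Longrightarrow> b \<in> carrier R \<Longrightarrow> \<eta> (a \<otimes> b) = a \<odot>\<^bsub>E 0\<^esub> \<eta> b"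
  using lin_mapsD[OF \<eta>_lin] by auto

lemma \<eta>_diff: "a \<in> carrier R \<Longrightarrow> b \<in> carrier R \<Longrightarrow> \<eta> (a \<ominus> b) = \<eta> a \<ominus>\<^bsub>E 0\<^esub> \<eta> b"
  using lin_maps_diff[OF module_regular mod_E \<eta>_lin] by simp

lemma \<eta>_inj: "a \<in> carrier R \<Longrightarrow> b \<in> carrier R \<Longrightarrow> \<eta> a = \<eta> b \<Longrightarrow> a = b"
  using res unfolding injective_resolution_def inj_on_def by simp

lemma \<eta>_zero: "\<eta> \<zero> = \<zero>\<^bsub>E 0\<^esub>"
  using lin_maps_zero[OF module_regular mod_E \<eta>_lin] by simp

lemma \<delta>_carr: "x \<in> carrier (E i) \<Longrightarrow> \<delta> i x \<in> carrier (E (Suc i))"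
  and \<delta>_add: "x \<in> carrier (E i) \<Longrightarrow> y \<in> carrier (E i) \<Longrightarrow> \<delta> i (x \<oplus>\<^bsub>E i\<^esub> y) = \<delta> i x \<oplus>\<^bsub>E (Suc i)\<^esub> \<delta> i y"
  and \<delta>_smult: "a \<in> carrier R \<Longrightarrow> x \<in> carrier (E i) \<Longrightarrow> \<delta> i (a \<odot>\<^bsub>E i\<^esub> x) = a \<odot>\<^bsub>E (Suc i)\<^esub> \<delta> i x"
  using lin_mapsD[OF \<delta>_lin] by auto

lemma \<delta>_diff: "x \<in> carrier (E i) \<Longrightarrow> y \<in> carrier (E i) \<Longrightarrow> \<delta> i (x \<ominus>\<^bsub>E i\<^esub> y) = \<delta> i x \<ominus>\<^bsub>E (Suc i)\<^esub> \<delta> i y"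
  using lin_maps_diff[OF mod_E mod_E \<delta>_lin] by simp

lemma \<delta>_zero: "\<delta> i \<zero>\<^bsub>E i\<^esub> = \<zero>\<^bsub>E (Suc i)\<^esub>"
  using lin_maps_zero[OF mod_E mod_E \<delta>_lin] by simp

lemma exact_E0: "x \<in> carrier (E 0) \<Longrightarrow> \<delta> 0 x = \<zero>\<^bsub>E 1\<^esub> \<Longrightarrow> \<exists>a\<in>carrier R. x = \<eta> a"
  and exact_E: "z \<in> carrier (E (Suc i)) \<Longrightarrow> \<delta> (Suc i) z = \<zero>\<^bsub>E (Suc (Suc i))\<^esub> \<Longrightarrow> \<exists>x\<in>carrier (E i). \<delta> i x = z"
proof -
  have "\<eta> ` carrier R = {x \<in> carrier (E 0). \<delta> 0 x = \<zero>\<^bsub>E 1\<^esub>}"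
    using res unfolding injective_resolution_def by simp
  thus "x \<in> carrier (E 0) \<Longrightarrow> \<delta> 0 x = \<zero>\<^bsub>E 1\<^esub> \<Longrightarrow> \<exists>a\<in>carrier R. x = \<eta> a" by blast
  have *: "\<delta> i ` carrier (E i) = {x \<in> carrier (E (Suc i)). \<delta> (Suc i) x = \<zero>\<^bsub>E (Suc (Suc i))\<^esub>}"
    using res unfolding injective_resolution_def by blast
  assume "z \<in> carrier (E (Suc i))" "\<delta> (Suc i) z = \<zero>\<^bsub>E (Suc (Suc i))\<^esub>"
  hence "z \<in> \<delta> i ` carrier (E i)" unfolding * by simp
  thus "\<exists>x\<in>carrier (E i). \<delta> i x = z" by auto
qed

lemma \<delta>_\<eta>: "a \<in> carrier R \<Longrightarrow> \<delta> 0 (\<eta> a) = \<zero>\<^bsub>E 1\<^esub>"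
  and \<delta>_\<delta>: "x \<in> carrier (E i) \<Longrightarrow> \<delta> (Suc i) (\<delta> i x) = \<zero>\<^bsub>E (Suc (Suc i))\<^esub>"
proof -
  have "\<eta> ` carrier R = {x \<in> carrier (E 0). \<delta> 0 x = \<zero>\<^bsub>E 1\<^esub>}"
    using res unfolding injective_resolution_def by simp
  thus "a \<in> carrier R \<Longrightarrow> \<delta> 0 (\<eta> a) = \<zero>\<^bsub>E 1\<^esub>" by blast
  have "\<delta> i ` carrier (E i) = {x \<in> carrier (E (Suc i)). \<delta> (Suc i) x = \<zero>\<^bsub>E (Suc (Suc i))\<^esub>}"
    using res unfolding injective_resolution_def by blast
  thus "x \<in> carrier (E i) \<Longrightarrow> \<delta> (Suc i) (\<delta> i x) = \<zero>\<^bsub>E (Suc (Suc i))\<^esub>" by blast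
qed

section \<open>Extending homomorphisms from ideals into the terms of the resolution\<close>

lemma E_minus_eq_0:
  assumes "x \<in> carrier (E i)" "y \<in> carrier (E i)" "x \<ominus>\<^bsub>E i\<^esub> y = \<zero>\<^bsub>E i\<^esub>" shows "x = y"
proof -
  have "x = (x \<ominus>\<^bsub>E i\<^esub> y) \<oplus>\<^bsub>E i\<^esub> y" using assms(1,2) by (simp add: E.M.minus_eq E.M.a_assoc E.M.l_neg)
  thus ?thesis using assms by simp
qed

lemma E_smult_diff: "a \<in> carrier R \<Longrightarrow> x \<in> carrier (E i) \<Longrightarrow> y \<in> carrier (E i) \<Longrightarrow>
    a \<odot>\<^bsub>E i\<^esub> (x \<ominus>\<^bsub>E i\<^esub> y) = a \<odot>\<^bsub>E i\<^esub> x \<ominus>\<^bsub>E i\<^esub> a \<odot>\<^bsub>E i\<^esub> y"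
  by (simp add: E.M.minus_eq E.smult_r_distr E.smult_r_minus)

text \<open>The rule \<open>j + r a \<mapsto> r z\<close> is well defined on \<open>J + R a\<close>
  because of \<open>wd\<close>, and injectivity realizes it as multiplication of an element
  \<open>w\<close>.\<close>

lemma extend_from_ideal:
  assumes J: "ideal J R" and a: "a \<in> carrier R" and z: "z \<in> carrier (E i)"
    and wd: "\<And>r. r \<in> carrier R \<Longrightarrow> r \<otimes> a \<in> J \<Longrightarrow> r \<odot>\<^bsub>E i\<^esub> z = \<zero>\<^bsub>E i\<^esub>"
  shows "\<exists>w\<in>carrier (E i). (\<forall>y\<in>J. y \<odot>\<^bsub>E i\<^esub> w = \<zero>\<^bsub>E i\<^esub>) \<and> a \<odot>\<^bsub>E i\<^esub> w = z"
proof -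
  define r where "r x = (SOME r. r \<in> carrier R \<and> x \<ominus> r \<otimes> a \<in> J)" for x
  have r: "r x \<in> carrier R \<and> x \<ominus> r x \<otimes> a \<in> J" if x: "x \<in> ins_ideal J a" for x
  proof -
    obtain j s where js: "j \<in> J" "s \<in> carrier R" "x = j \<oplus> s \<otimes> a" using x by (elim ins_ideal_cases)
    have "x \<ominus> s \<otimes> a = j" using js a ideal_carr[OF J js(1)] by (simp add: minus_eq a_assoc r_neg)
    hence "s \<in> carrier R \<and> x \<ominus> s \<otimes> a \<in> J" using js by simp
    thus ?thesis unfolding r_def by (rule someI)
  qed
  \<comment> \<open>Two coefficients of the same \<open>x\<close> differ by an element that carries
    \<open>a\<close> into \<open>J\<close>, and such an element kills \<open>z\<close>.\<close>
  have uniq: "r x \<odot>\<^bsub>E i\<^esub> z = s \<odot>\<^bsub>E i\<^esub> z" if x: "x \<in> ins_ideal J a" and s: "s \<in> carrier R" "x \<ominus> s \<otimes> a \<in> J" for x s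
  proof -
    have xc: "x \<in> carrier R" using ideal_carr[OF ins_ideal_ideal[OF J a] x] .
    have rc: "r x \<in> carrier R" using r[OF x] by simp
    have "(x \<ominus> s \<otimes> a) \<ominus> (x \<ominus> r x \<otimes> a) \<in> J" using ideal_diff[OF J s(2)] r[OF x] by blast
    also have "(x \<ominus> s \<otimes> a) \<ominus> (x \<ominus> r x \<otimes> a) = (r x \<ominus> s) \<otimes> a"
      using xc s rc a by (simp add: minus_eq minus_add l_distr l_minus a_ac r_neg1 r_neg2 r_neg)
    finally have "(r x \<ominus> s) \<odot>\<^bsub>E i\<^esub> z = \<zero>\<^bsub>E i\<^esub>" using wd rc s by simp
    moreover have "(r x \<ominus> s) \<odot>\<^bsub>E i\<^esub> z = r x \<odot>\<^bsub>E i\<^esub> z \<ominus>\<^bsub>E i\<^esub> s \<odot>\<^bsub>E i\<^esub> z"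
      using rc s z by (simp add: minus_eq E.M.minus_eq E.smult_l_distr E.smult_l_minus)
    ultimately show ?thesis using E_minus_eq_0[of "r x \<odot>\<^bsub>E i\<^esub> z" i "s \<odot>\<^bsub>E i\<^esub> z"] rc s z by simp
  qed
  have I: "ideal (ins_ideal J a) R" by (rule ins_ideal_ideal[OF J a])
  have "\<exists>w\<in>carrier (E i). \<forall>x\<in>ins_ideal J a. r x \<odot>\<^bsub>E i\<^esub> z = x \<odot>\<^bsub>E i\<^esub> w"
  proof (rule injective_module_baer[OF inj_E is_cring I])
    show "(\<lambda>x. r x \<odot>\<^bsub>E i\<^esub> z) \<in> ins_ideal J a \<rightarrow> carrier (E i)" using r z by auto
    fix x y assume x: "x \<in> ins_ideal J a" and y: "y \<in> ins_ideal J a"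
    have c: "x \<in> carrier R" "y \<in> carrier R" "r x \<in> carrier R" "r y \<in> carrier R" using ideal_carr[OF I] x y r by auto
    have "(x \<oplus> y) \<ominus> (r x \<oplus> r y) \<otimes> a = (x \<ominus> r x \<otimes> a) \<oplus> (y \<ominus> r y \<otimes> a)"
      using c a by (simp add: minus_eq l_distr minus_add a_ac)
    hence "(x \<oplus> y) \<ominus> (r x \<oplus> r y) \<otimes> a \<in> J" using ideal_add[OF J] r[OF x] r[OF y] by simp
    hence "r (x \<oplus> y) \<odot>\<^bsub>E i\<^esub> z = (r x \<oplus> r y) \<odot>\<^bsub>E i\<^esub> z" using uniq[OF ideal_add[OF I x y]] c by simp
    thus "r (x \<oplus> y) \<odot>\<^bsub>E i\<^esub> z = r x \<odot>\<^bsub>E i\<^esub> z \<oplus>\<^bsub>E i\<^esub> r y \<odot>\<^bsub>E i\<^esub> z" using c z by (simp add: E.smult_l_distr)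
  next
    fix b x assume b: "b \<in> carrier R" and x: "x \<in> ins_ideal J a"
    have c: "x \<in> carrier R" "r x \<in> carrier R" using ideal_carr[OF I] x r by auto
    have "b \<otimes> x \<ominus> (b \<otimes> r x) \<otimes> a = b \<otimes> (x \<ominus> r x \<otimes> a)"
      using c a b by (simp add: minus_eq r_distr r_minus m_assoc)
    hence "b \<otimes> x \<ominus> (b \<otimes> r x) \<otimes> a \<in> J" using ideal_mult[OF J b] r[OF x] by simp
    hence "r (b \<otimes> x) \<odot>\<^bsub>E i\<^esub> z = (b \<otimes> r x) \<odot>\<^bsub>E i\<^esub> z" using uniq[OF ideal_mult[OF I b x]] c b by simp
    thus "r (b \<otimes> x) \<odot>\<^bsub>E i\<^esub> z = b \<odot>\<^bsub>E i\<^esub> (r x \<odot>\<^bsub>E i\<^esub> z)" using c z b by (simp add: E.smult_assoc1)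
  qed
  then obtain w where w: "w \<in> carrier (E i)" "\<And>x. x \<in> ins_ideal J a \<Longrightarrow> r x \<odot>\<^bsub>E i\<^esub> z = x \<odot>\<^bsub>E i\<^esub> w" by blast
  have "y \<odot>\<^bsub>E i\<^esub> w = \<zero>\<^bsub>E i\<^esub>" if y: "y \<in> J" for y
  proof -
    have yI: "y \<in> ins_ideal J a" using ins_ideal_superset[OF J a] y by blast
    have "y \<ominus> \<zero> \<otimes> a \<in> J" using y a ideal_carr[OF J y] by (simp add: minus_eq)
    thus ?thesis using uniq[OF yI zero_closed] w(2)[OF yI] z by simp
  qed
  moreover have "a \<odot>\<^bsub>E i\<^esub> w = z"
  proof -
    have aI: "a \<in> ins_ideal J a" by (rule ins_ideal_self[OF J a])
    have "a \<ominus> \<one> \<otimes> a \<in> J" using a ideal_zero[OF J] by (simp add: minus_eq r_neg)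
    thus ?thesis using uniq[OF aI one_closed] w(2)[OF aI] z by simp
  qed
  ultimately show ?thesis using w(1) by blast
qed

text \<open>The case \<open>J = 0\<close> of \<open>extend_from_ideal\<close>: for a regular
  \<open>t\<close> the rule \<open>r t \<mapsto> r f\<close> is well defined.\<close>

lemma divisible:
  assumes t: "t \<in> carrier R" "\<And>a. a \<in> carrier R \<Longrightarrow> t \<otimes> a = \<zero> \<Longrightarrow> a = \<zero>" and f: "f \<in> carrier (E i)"
  shows "\<exists>g\<in>carrier (E i). t \<odot>\<^bsub>E i\<^esub> g = f"
proof -
  have "r \<odot>\<^bsub>E i\<^esub> f = \<zero>\<^bsub>E i\<^esub>" if "r \<in> carrier R" "r \<otimes> t \<in> {\<zero>}" for r
  proof -
    have "t \<otimes> r = \<zero>" using that m_comm[OF t(1), of r] by simp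
    hence "r = \<zero>" using t(2) that(1) by simp
    thus ?thesis using f by simp
  qed
  from extend_from_ideal[OF zeroideal t(1) f this] show ?thesis by blast
qed

text \<open>\<open>ext_vanishes i\<close> says \<open>Ext\<^sup>i\<^sup>+\<^sup>1(R/\<mm>, R) = 0\<close>, computed on the given resolution.\<close>

definition ext_vanishes :: "nat \<Rightarrow> bool" where
  "ext_vanishes i \<longleftrightarrow> (\<forall>z\<in>carrier (E (Suc i)). \<delta> (Suc i) z = \<zero>\<^bsub>E (Suc (Suc i))\<^esub> \<longrightarrow>
     (\<forall>y\<in>\<mm>. y \<odot>\<^bsub>E (Suc i)\<^esub> z = \<zero>\<^bsub>E (Suc i)\<^esub>) \<longrightarrow>
     (\<exists>e\<in>carrier (E i). (\<forall>y\<in>\<mm>. y \<odot>\<^bsub>E i\<^esub> e = \<zero>\<^bsub>E i\<^esub>) \<and> \<delta> i e = z))"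

lemma ext_vanishes_large: "n \<le> i \<Longrightarrow> ext_vanishes i"
  unfolding ext_vanishes_def
proof (intro ballI impI)
  fix z assume "n \<le> i" "z \<in> carrier (E (Suc i))"
  hence "z = \<zero>\<^bsub>E (Suc i)\<^esub>" using vanish[of "Suc i"] by auto
  thus "\<exists>e\<in>carrier (E i). (\<forall>y\<in>\<mm>. y \<odot>\<^bsub>E i\<^esub> e = \<zero>\<^bsub>E i\<^esub>) \<and> \<delta> i e = z"
    using \<delta>_zero max_carr by (intro bexI[of _ "\<zero>\<^bsub>E i\<^esub>"]) auto
qed

text \<open>Hence \<open>Ext\<^sup>i\<^sup>+\<^sup>1(R/J, R) = 0\<close> whenever \<open>R/J\<close> has finite length.\<close>

lemma lift_finite_length:
  assumes P: "ext_vanishes i" and J: "ideal J R" "max_rad J"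
    and v: "v \<in> carrier (E (Suc i))" "\<delta> (Suc i) v = \<zero>\<^bsub>E (Suc (Suc i))\<^esub>"
      "\<And>y. y \<in> J \<Longrightarrow> y \<odot>\<^bsub>E (Suc i)\<^esub> v = \<zero>\<^bsub>E (Suc i)\<^esub>"
  shows "\<exists>u\<in>carrier (E i). (\<forall>y\<in>J. y \<odot>\<^bsub>E i\<^esub> u = \<zero>\<^bsub>E i\<^esub>) \<and> \<delta> i u = v"
  using J v
proof (induction J arbitrary: v rule: ideal_induct)
  case (step J)
  note J = step.hyps and v = step.prems(2-4)
  show ?case
  proof (cases "\<one> \<in> J")
    case True
    hence "v = \<zero>\<^bsub>E (Suc i)\<^esub>" using v(3)[OF True] v(1) by simp
    thus ?thesis using \<delta>_zero ideal_carr[OF J] by (intro bexI[of _ "\<zero>\<^bsub>E i\<^esub>"]) auto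
  next
    case False
    obtain b where b: "b \<in> carrier R" "b \<notin> J" "\<And>y. y \<in> \<mm> \<Longrightarrow> y \<otimes> b \<in> J"
      using max_rad_socle[OF J False step.prems(1)] by blast
    \<comment> \<open>The multiple \<open>b v\<close> is killed by \<mm>, so the hypothesis on \<mm>
      supplies its lift \<open>e\<close>. Since \<open>e\<close> is killed by
      \<open>J : b = \<mm>\<close>, it can be divided by \<open>b\<close> inside \<open>E i\<close>,
      with a quotient killed by \<open>J\<close>.\<close>
    have bv: "b \<odot>\<^bsub>E (Suc i)\<^esub> v \<in> carrier (E (Suc i))" using b v by simp
    have "\<delta> (Suc i) (b \<odot>\<^bsub>E (Suc i)\<^esub> v) = \<zero>\<^bsub>E (Suc (Suc i))\<^esub>" using b v by (simp add: \<delta>_smult)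
    moreover have "y \<odot>\<^bsub>E (Suc i)\<^esub> (b \<odot>\<^bsub>E (Suc i)\<^esub> v) = \<zero>\<^bsub>E (Suc i)\<^esub>" if "y \<in> \<mm>" for y
      using v(3)[OF b(3)[OF that]] E.smult_assoc1[of y b v] max_carr[OF that] b v by simp
    ultimately obtain e where e: "e \<in> carrier (E i)" "\<And>y. y \<in> \<mm> \<Longrightarrow> y \<odot>\<^bsub>E i\<^esub> e = \<zero>\<^bsub>E i\<^esub>"
      "\<delta> i e = b \<odot>\<^bsub>E (Suc i)\<^esub> v" using P bv unfolding ext_vanishes_def by blast
    have "r \<odot>\<^bsub>E i\<^esub> e = \<zero>\<^bsub>E i\<^esub>" if r: "r \<in> carrier R" "r \<otimes> b \<in> J" for r
    proof -
      have "r \<in> \<mm>"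
      proof (rule ccontr)
        assume "r \<notin> \<mm>"
        then obtain s where s: "s \<in> carrier R" "s \<otimes> r = \<one>" using unit_of_not_max[OF r(1)] by blast
        have "b = s \<otimes> (r \<otimes> b)" using s r b by (simp add: m_assoc[symmetric])
        thus False using ideal_mult[OF J s(1) r(2)] b(2) by simp
      qed
      thus ?thesis by (rule e(2))
    qed
    from extend_from_ideal[OF J b(1) e(1) this] obtain e0 where e0: "e0 \<in> carrier (E i)"
      "\<And>y. y \<in> J \<Longrightarrow> y \<odot>\<^bsub>E i\<^esub> e0 = \<zero>\<^bsub>E i\<^esub>" "b \<odot>\<^bsub>E i\<^esub> e0 = e" by blast
    \<comment> \<open>Subtracting the coboundary of \<open>e0\<close> gives a cocycle that is killed
      by the larger ideal \<open>J + R b\<close>, where the induction hypothesis applies.\<close>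
    let ?v = "v \<ominus>\<^bsub>E (Suc i)\<^esub> \<delta> i e0" and ?K = "ins_ideal J b"
    have de0: "\<delta> i e0 \<in> carrier (E (Suc i))" using \<delta>_carr[OF e0(1)] .
    have vc: "?v \<in> carrier (E (Suc i))" using v(1) de0 by simp
    have "\<delta> (Suc i) ?v = \<zero>\<^bsub>E (Suc (Suc i))\<^esub>" unfolding \<delta>_diff[OF v(1) de0] using v \<delta>_\<delta>[OF e0(1)] by (simp add: E.M.minus_eq)
    moreover have "y \<odot>\<^bsub>E (Suc i)\<^esub> ?v = \<zero>\<^bsub>E (Suc i)\<^esub>" if y: "y \<in> ?K" for y
    proof -
      obtain j r where jr: "j \<in> J" "r \<in> carrier R" "y = j \<oplus> r \<otimes> b" using y by (elim ins_ideal_cases)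
      have jc: "j \<in> carrier R" using ideal_carr[OF J jr(1)] .
      have "j \<odot>\<^bsub>E (Suc i)\<^esub> \<delta> i e0 = \<zero>\<^bsub>E (Suc i)\<^esub>" using \<delta>_smult[OF jc e0(1)] e0(2)[OF jr(1)] \<delta>_zero by simp
      hence j0: "j \<odot>\<^bsub>E (Suc i)\<^esub> ?v = \<zero>\<^bsub>E (Suc i)\<^esub>"
        using E_smult_diff[OF jc v(1) de0] v(3)[OF jr(1)] by (simp add: E.M.minus_eq)
      have "b \<odot>\<^bsub>E (Suc i)\<^esub> \<delta> i e0 = b \<odot>\<^bsub>E (Suc i)\<^esub> v" using \<delta>_smult[OF b(1) e0(1)] e0(3) e(3) by simp
      hence b0: "b \<odot>\<^bsub>E (Suc i)\<^esub> ?v = \<zero>\<^bsub>E (Suc i)\<^esub>"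
        using E_smult_diff[OF b(1) v(1) de0] bv by (simp add: E.M.minus_eq E.M.r_neg)
      have "y \<odot>\<^bsub>E (Suc i)\<^esub> ?v = j \<odot>\<^bsub>E (Suc i)\<^esub> ?v \<oplus>\<^bsub>E (Suc i)\<^esub> r \<odot>\<^bsub>E (Suc i)\<^esub> (b \<odot>\<^bsub>E (Suc i)\<^esub> ?v)"
        using jc jr b vc by (simp add: E.smult_l_distr E.smult_assoc1)
      thus ?thesis using j0 b0 jr by simp
    qed
    moreover have K: "ideal ?K R" "J \<subset> ?K"
      using ins_ideal_ideal[OF J b(1)] ins_ideal_superset[OF J b(1)] ins_ideal_self[OF J b(1)] b(2) by auto
    moreover have "max_rad ?K" using max_rad_mono[OF step.prems(1)] K(2) by blast
    ultimately obtain u where u: "u \<in> carrier (E i)" "\<And>y. y \<in> ?K \<Longrightarrow> y \<odot>\<^bsub>E i\<^esub> u = \<zero>\<^bsub>E i\<^esub>" "\<delta> i u = ?v"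
      using step.IH[OF K _ vc] by blast
    have "\<delta> i (u \<oplus>\<^bsub>E i\<^esub> e0) = ?v \<oplus>\<^bsub>E (Suc i)\<^esub> \<delta> i e0" using u e0 by (simp add: \<delta>_add)
    also have "\<dots> = v" using v(1) de0 by (simp add: E.M.minus_eq E.M.a_assoc E.M.l_neg)
    finally have "\<delta> i (u \<oplus>\<^bsub>E i\<^esub> e0) = v" .
    moreover have "y \<odot>\<^bsub>E i\<^esub> (u \<oplus>\<^bsub>E i\<^esub> e0) = \<zero>\<^bsub>E i\<^esub>" if y: "y \<in> J" for y
      using y K(2) u(1) u(2)[of y] e0(1) e0(2)[OF y] ideal_carr[OF J y] by (auto simp: E.smult_r_distr)
    ultimately show ?thesis using u e0 by (intro bexI[of _ "u \<oplus>\<^bsub>E i\<^esub> e0"]) auto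
  qed
qed

text \<open>From the exact sequence with terms R/\<mm>, R/J and R/(J + R a), whose first map is
  multiplication of \<open>a\<close>: restriction from Ext^i(R/J, R) to Ext^i(R/\<mm>, R) is onto
  since Ext^(i+1) of the last term vanishes by \<open>lift_finite_length\<close>.\<close>

lemma extend_cocycle:
  assumes P: "ext_vanishes i" and J: "ideal J R" "max_rad J"
    and a: "a \<in> carrier R" "a \<notin> J" "\<And>y. y \<in> \<mm> \<Longrightarrow> y \<otimes> a \<in> J"
    and z: "z \<in> carrier (E i)" "\<delta> i z = \<zero>\<^bsub>E (Suc i)\<^esub>" "\<And>y. y \<in> \<mm> \<Longrightarrow> y \<odot>\<^bsub>E i\<^esub> z = \<zero>\<^bsub>E i\<^esub>"
  shows "\<exists>w\<in>carrier (E i). \<delta> i w = \<zero>\<^bsub>E (Suc i)\<^esub> \<and> (\<forall>y\<in>J. y \<odot>\<^bsub>E i\<^esub> w = \<zero>\<^bsub>E i\<^esub>) \<and> a \<odot>\<^bsub>E i\<^esub> w = z"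
proof -
  have "r \<odot>\<^bsub>E i\<^esub> z = \<zero>\<^bsub>E i\<^esub>" if r: "r \<in> carrier R" "r \<otimes> a \<in> J" for r
  proof -
    have "r \<in> \<mm>"
    proof (rule ccontr)
      assume "r \<notin> \<mm>"
      then obtain s where s: "s \<in> carrier R" "s \<otimes> r = \<one>" using unit_of_not_max[OF r(1)] by blast
      have "a = s \<otimes> (r \<otimes> a)" using s r a by (simp add: m_assoc[symmetric])
      thus False using ideal_mult[OF J(1) s(1) r(2)] a(2) by simp
    qed
    thus ?thesis by (rule z(3))
  qed
  from extend_from_ideal[OF J(1) a(1) z(1) this] obtain w where w: "w \<in> carrier (E i)"
    "\<And>y. y \<in> J \<Longrightarrow> y \<odot>\<^bsub>E i\<^esub> w = \<zero>\<^bsub>E i\<^esub>" "a \<odot>\<^bsub>E i\<^esub> w = z" by blast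
  \<comment> \<open>The coboundary of \<open>w\<close> is killed by \<open>J + R a\<close> and
    represents the obstruction. It equals the coboundary of some \<open>u\<close> killed by the same
    ideal, and \<open>w - u\<close> is the desired cocycle.\<close>
  let ?K = "ins_ideal J a"
  have K: "ideal ?K R" "J \<subseteq> ?K" using ins_ideal_ideal[OF J(1) a(1)] ins_ideal_superset[OF J(1) a(1)] .
  have "y \<odot>\<^bsub>E (Suc i)\<^esub> \<delta> i w = \<zero>\<^bsub>E (Suc i)\<^esub>" if y: "y \<in> ?K" for y
  proof -
    obtain j r where jr: "j \<in> J" "r \<in> carrier R" "y = j \<oplus> r \<otimes> a" using y by (elim ins_ideal_cases)
    have jc: "j \<in> carrier R" using ideal_carr[OF J(1) jr(1)] .
    have "y \<odot>\<^bsub>E i\<^esub> w = j \<odot>\<^bsub>E i\<^esub> w \<oplus>\<^bsub>E i\<^esub> r \<odot>\<^bsub>E i\<^esub> (a \<odot>\<^bsub>E i\<^esub> w)"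
      using jc jr a w(1) by (simp add: E.smult_l_distr E.smult_assoc1)
    also have "\<dots> = r \<odot>\<^bsub>E i\<^esub> z" using w(2)[OF jr(1)] w(3) jr(2) z(1) by simp
    finally have "\<delta> i (y \<odot>\<^bsub>E i\<^esub> w) = \<zero>\<^bsub>E (Suc i)\<^esub>" using jr(2) z by (simp add: \<delta>_smult)
    thus ?thesis using \<delta>_smult[of y w i] w(1) jr jc a by simp
  qed
  from lift_finite_length[OF P K(1) max_rad_mono[OF J(2) K(2)] \<delta>_carr[OF w(1)] \<delta>_\<delta>[OF w(1)] this]
  obtain u where u: "u \<in> carrier (E i)" "\<And>y. y \<in> ?K \<Longrightarrow> y \<odot>\<^bsub>E i\<^esub> u = \<zero>\<^bsub>E i\<^esub>" "\<delta> i u = \<delta> i w" by blast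
  let ?w = "w \<ominus>\<^bsub>E i\<^esub> u"
  have "\<delta> i ?w = \<zero>\<^bsub>E (Suc i)\<^esub>" unfolding \<delta>_diff[OF w(1) u(1)] using u(3) \<delta>_carr[OF w(1)] by (simp add: E.M.minus_eq E.M.r_neg)
  moreover have "y \<odot>\<^bsub>E i\<^esub> ?w = \<zero>\<^bsub>E i\<^esub>" if y: "y \<in> J" for y
    using E_smult_diff[OF ideal_carr[OF J(1) y] w(1) u(1)] w(2)[OF y] u(2)[of y] y K(2) by (auto simp: E.M.minus_eq)
  moreover have "a \<odot>\<^bsub>E i\<^esub> ?w = z"
    using E_smult_diff[OF a(1) w(1) u(1)] w(3) u(2)[OF ins_ideal_self[OF J(1) a(1)]] z(1) by (simp add: E.M.minus_eq)
  ultimately show ?thesis using w(1) u(1) by (intro bexI[of _ ?w]) auto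
qed

text \<open>A cocycle \<open>z\<close> killed by \<mm> is \<open>s w\<close> for a cocycle
  \<open>w\<close> killed by \<open>t\<close>. If \<open>w\<close> lifts to an element
  \<open>e'\<close> that is killed by \<open>t\<close> as well, then \<open>s e'\<close> lifts
  \<open>z\<close> and is killed by \<mm>, because \<mm> carries \<open>s\<close> into
  \<open>t R\<close>.\<close>

lemma ext_vanishes_step:
  assumes P: "ext_vanishes (Suc i)" and t: "t \<in> carrier R"
    and s: "s \<in> carrier R" "s \<notin> PIdl t" "\<And>y. y \<in> \<mm> \<Longrightarrow> y \<otimes> s \<in> PIdl t"
    and lift: "\<And>e. e \<in> carrier (E i) \<Longrightarrow> \<delta> i (t \<odot>\<^bsub>E i\<^esub> e) = \<zero>\<^bsub>E (Suc i)\<^esub> \<Longrightarrow>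
      \<exists>e'\<in>carrier (E i). \<delta> i e' = \<delta> i e \<and> t \<odot>\<^bsub>E i\<^esub> e' = \<zero>\<^bsub>E i\<^esub>"
  shows "ext_vanishes i"
  unfolding ext_vanishes_def
proof (intro ballI impI)
  fix z assume z: "z \<in> carrier (E (Suc i))" "\<delta> (Suc i) z = \<zero>\<^bsub>E (Suc (Suc i))\<^esub>"
    and mz: "\<forall>y\<in>\<mm>. y \<odot>\<^bsub>E (Suc i)\<^esub> z = \<zero>\<^bsub>E (Suc i)\<^esub>"
  obtain J where J: "ideal J R" "PIdl t \<subseteq> J" "s \<notin> J" "\<And>y. y \<in> \<mm> \<Longrightarrow> y \<otimes> s \<in> J" "max_rad J"
    using exists_max_avoiding[OF cgenideal_ideal[OF t] s(1,2)] by blast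
  obtain w where w: "w \<in> carrier (E (Suc i))" "\<delta> (Suc i) w = \<zero>\<^bsub>E (Suc (Suc i))\<^esub>"
    "\<And>y. y \<in> J \<Longrightarrow> y \<odot>\<^bsub>E (Suc i)\<^esub> w = \<zero>\<^bsub>E (Suc i)\<^esub>" "s \<odot>\<^bsub>E (Suc i)\<^esub> w = z"
    using extend_cocycle[OF P J(1,5) s(1) J(3,4) z] mz by blast
  obtain e where e: "e \<in> carrier (E i)" "\<delta> i e = w" using exact_E[OF w(1,2)] by blast
  have "t \<in> J" using J(2) cgenideal_self[OF t] by blast
  hence "\<delta> i (t \<odot>\<^bsub>E i\<^esub> e) = \<zero>\<^bsub>E (Suc i)\<^esub>" using w(3) e t by (simp add: \<delta>_smult)
  then obtain e' where e': "e' \<in> carrier (E i)" "\<delta> i e' = w" "t \<odot>\<^bsub>E i\<^esub> e' = \<zero>\<^bsub>E i\<^esub>" using lift[OF e(1)] e(2) by blast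
  have "y \<odot>\<^bsub>E i\<^esub> (s \<odot>\<^bsub>E i\<^esub> e') = \<zero>\<^bsub>E i\<^esub>" if y: "y \<in> \<mm>" for y
  proof -
    obtain c where c: "c \<in> carrier R" "y \<otimes> s = c \<otimes> t" using s(3)[OF y] unfolding PIdl_mem by blast
    have "y \<odot>\<^bsub>E i\<^esub> (s \<odot>\<^bsub>E i\<^esub> e') = (c \<otimes> t) \<odot>\<^bsub>E i\<^esub> e'"
      using c(2) E.smult_assoc1[of y s e'] max_carr[OF y] s(1) e'(1) by simp
    thus ?thesis using E.smult_assoc1[of c t e'] c(1) t e' by simp
  qed
  moreover have "\<delta> i (s \<odot>\<^bsub>E i\<^esub> e') = z" using w(4) e' s(1) by (simp add: \<delta>_smult)
  ultimately show "\<exists>e\<in>carrier (E i). (\<forall>y\<in>\<mm>. y \<odot>\<^bsub>E i\<^esub> e = \<zero>\<^bsub>E i\<^esub>) \<and> \<delta> i e = z"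
    using e'(1) s(1) by (intro bexI[of _ "s \<odot>\<^bsub>E i\<^esub> e'"]) auto
qed

text \<open>With \<open>t = 0\<close> any lift will do in \<open>ext_vanishes_step\<close>. The
  descent starts where the resolution has ended.\<close>

lemma ext_vanishes_depth_0:
  assumes s: "s \<in> carrier R" "s \<noteq> \<zero>" "\<And>y. y \<in> \<mm> \<Longrightarrow> y \<otimes> s = \<zero>"
  shows "ext_vanishes 0"
proof -
  have PZ: "PIdl \<zero> = {\<zero>}" using genideal_zero cgenideal_eq_genideal[OF zero_closed] by simp
  have step: "ext_vanishes i" if "ext_vanishes (Suc i)" for i
    by (rule ext_vanishes_step[OF that zero_closed s(1)]) (use s PZ in auto)
  have "ext_vanishes i \<Longrightarrow> ext_vanishes 0" for i
    by (induction i) (use step in auto)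
  thus ?thesis using ext_vanishes_large[of n] by simp
qed

text \<open>For a lift \<open>e\<close> with \<open>t e\<close> a cocycle, write \<open>t e\<close>
  as the coboundary of \<open>t g\<close>, using exactness and divisibility, and replace
  \<open>e\<close> by \<open>e\<close> minus the coboundary of \<open>g\<close>. The descent stops
  at 1, because the cocycles in \<open>E 0\<close> form a copy of \<open>R\<close> and are not
  coboundaries.\<close>

lemma ext_vanishes_depth_1:
  assumes t: "t \<in> carrier R" "\<And>a. a \<in> carrier R \<Longrightarrow> t \<otimes> a = \<zero> \<Longrightarrow> a = \<zero>"
    and s: "s \<in> carrier R" "s \<notin> PIdl t" "\<And>y. y \<in> \<mm> \<Longrightarrow> y \<otimes> s \<in> PIdl t"
  shows "ext_vanishes 1"
proof -
  have step: "ext_vanishes (Suc i)" if "ext_vanishes (Suc (Suc i))" for i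
  proof (rule ext_vanishes_step[OF that t(1) s])
    fix e assume e: "e \<in> carrier (E (Suc i))" "\<delta> (Suc i) (t \<odot>\<^bsub>E (Suc i)\<^esub> e) = \<zero>\<^bsub>E (Suc (Suc i))\<^esub>"
    obtain f where f: "f \<in> carrier (E i)" "\<delta> i f = t \<odot>\<^bsub>E (Suc i)\<^esub> e" using exact_E[OF _ e(2)] e(1) t(1) by auto
    obtain g where g: "g \<in> carrier (E i)" "t \<odot>\<^bsub>E i\<^esub> g = f" using divisible[OF t f(1)] by blast
    have dg: "\<delta> i g \<in> carrier (E (Suc i))" "t \<odot>\<^bsub>E (Suc i)\<^esub> \<delta> i g = t \<odot>\<^bsub>E (Suc i)\<^esub> e"
      using \<delta>_carr[OF g(1)] \<delta>_smult[OF t(1) g(1)] f(2) g(2) by auto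
    let ?e = "e \<ominus>\<^bsub>E (Suc i)\<^esub> \<delta> i g"
    have "\<delta> (Suc i) ?e = \<delta> (Suc i) e"
      unfolding \<delta>_diff[OF e(1) dg(1)] using \<delta>_\<delta>[OF g(1)] \<delta>_carr[OF e(1)] by (simp add: E.M.minus_eq)
    moreover have "t \<odot>\<^bsub>E (Suc i)\<^esub> ?e = \<zero>\<^bsub>E (Suc i)\<^esub>"
      using E_smult_diff[OF t(1) e(1) dg(1)] dg(2) e(1) t(1) by (simp add: E.M.minus_eq E.M.r_neg)
    ultimately show "\<exists>e'\<in>carrier (E (Suc i)). \<delta> (Suc i) e' = \<delta> (Suc i) e \<and> t \<odot>\<^bsub>E (Suc i)\<^esub> e' = \<zero>\<^bsub>E (Suc i)\<^esub>"
      using e(1) dg(1) by (intro bexI[of _ ?e]) auto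
  qed
  have "ext_vanishes (Suc i) \<Longrightarrow> ext_vanishes 1" for i
    by (induction i) (use step in auto)
  thus ?thesis using ext_vanishes_large[of "Suc n"] by simp
qed

text \<open>If \<open>\<mm>\<close> killed some \<open>s \<noteq> 0\<close>, then \<open>Ext\<^sup>1(R/\<mm>, R)\<close> would vanish; but the map
  \<open>p + \<pi> b \<mapsto> b x\<close> from \<open>\<mm>\<close> to \<open>R\<close> is not multiplication by an element of \<open>R\<close>.\<close>

lemma depth_positive:
  assumes p: "primeideal p R" and \<pi>: "\<pi> \<in> \<mm>" "\<pi> \<notin> p"
    and mp: "\<And>y. y \<in> \<mm> \<Longrightarrow> \<exists>b\<in>carrier R. y \<ominus> b \<otimes> \<pi> \<in> p"
    and x: "x \<in> carrier R" "\<And>y. y \<in> p \<Longrightarrow> y \<otimes> x = \<zero>"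
      "\<And>a. a \<in> carrier R \<Longrightarrow> (\<And>y. y \<in> p \<Longrightarrow> y \<otimes> a = \<zero>) \<Longrightarrow> x \<noteq> \<pi> \<otimes> a"
    and s: "s \<in> carrier R" "\<And>y. y \<in> \<mm> \<Longrightarrow> y \<otimes> s = \<zero>"
  shows "s = \<zero>"
proof (rule ccontr)
  assume "s \<noteq> \<zero>"
  from ext_vanishes_depth_0[OF s(1) this s(2)] have P: "ext_vanishes 0" .
  have pi: "ideal p R" using p by (rule primeideal.axioms(1))
  have \<pi>c: "\<pi> \<in> carrier R" using max_carr[OF \<pi>(1)] .
  have wd: "r \<odot>\<^bsub>E 0\<^esub> \<eta> x = \<zero>\<^bsub>E 0\<^esub>" if r: "r \<in> carrier R" "r \<otimes> \<pi> \<in> p" for r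
  proof -
    have "r \<in> p" using prime_mult[OF p r(1) \<pi>c] r \<pi> by blast
    thus ?thesis using \<eta>_mult[OF r(1) x(1)] x(2) \<eta>_zero by simp
  qed
  obtain e where e: "e \<in> carrier (E 0)" "\<And>y. y \<in> p \<Longrightarrow> y \<odot>\<^bsub>E 0\<^esub> e = \<zero>\<^bsub>E 0\<^esub>" "\<pi> \<odot>\<^bsub>E 0\<^esub> e = \<eta> x"
    using extend_from_ideal[OF pi \<pi>c \<eta>_carr[OF x(1)] wd] by blast
  have de: "\<delta> 0 e \<in> carrier (E 1)" using \<delta>_carr[OF e(1)] by simp
  have "y \<odot>\<^bsub>E 1\<^esub> \<delta> 0 e = \<zero>\<^bsub>E 1\<^esub>" if y: "y \<in> \<mm>" for y
  proof -
    obtain b where b: "b \<in> carrier R" "y \<ominus> b \<otimes> \<pi> \<in> p" using mp[OF y] by blast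
    have yc: "y \<in> carrier R" using max_carr[OF y] .
    have "y = (y \<ominus> b \<otimes> \<pi>) \<oplus> b \<otimes> \<pi>" using yc b \<pi>c by (simp add: minus_eq a_assoc l_neg)
    hence "y \<odot>\<^bsub>E 0\<^esub> e = (y \<ominus> b \<otimes> \<pi>) \<odot>\<^bsub>E 0\<^esub> e \<oplus>\<^bsub>E 0\<^esub> b \<odot>\<^bsub>E 0\<^esub> (\<pi> \<odot>\<^bsub>E 0\<^esub> e)"
      using yc b \<pi>c e(1) E.smult_l_distr[of "y \<ominus> b \<otimes> \<pi>" "b \<otimes> \<pi>" e 0] by (simp add: E.smult_assoc1)
    also have "\<dots> = \<eta> (b \<otimes> x)" using e(2)[OF b(2)] e(3) b(1) x(1) \<eta>_carr[OF x(1)] by (simp add: \<eta>_mult)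
    finally have "\<delta> 0 (y \<odot>\<^bsub>E 0\<^esub> e) = \<zero>\<^bsub>E 1\<^esub>" using \<delta>_\<eta> b(1) x(1) by simp
    thus ?thesis using \<delta>_smult[OF yc e(1)] by simp
  qed
  then obtain e' where e': "e' \<in> carrier (E 0)" "\<And>y. y \<in> \<mm> \<Longrightarrow> y \<odot>\<^bsub>E 0\<^esub> e' = \<zero>\<^bsub>E 0\<^esub>" "\<delta> 0 e' = \<delta> 0 e"
    using P de \<delta>_\<delta>[OF e(1)] unfolding ext_vanishes_def by auto
  \<comment> \<open>The difference \<open>e - e'\<close> is a cocycle in \<open>E 0\<close> and
    comes from some \<open>a\<close> in \<open>R\<close>. This \<open>a\<close> is killed by
    \<open>p\<close> and satisfies \<open>\<pi> a = x\<close>, against the choice of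
    \<open>x\<close>.\<close>
  have "\<delta> 0 (e \<ominus>\<^bsub>E 0\<^esub> e') = \<zero>\<^bsub>E 1\<^esub>" unfolding \<delta>_diff[OF e(1) e'(1)] using e'(3) de by (simp add: E.M.minus_eq E.M.r_neg)
  then obtain a where a: "a \<in> carrier R" "e \<ominus>\<^bsub>E 0\<^esub> e' = \<eta> a" using exact_E0[of "e \<ominus>\<^bsub>E 0\<^esub> e'"] e(1) e'(1) by auto
  have *: "\<eta> (y \<otimes> a) = y \<odot>\<^bsub>E 0\<^esub> e" if y: "y \<in> \<mm>" for y
    using E_smult_diff[OF max_carr[OF y] e(1) e'(1)] e'(2)[OF y] a \<eta>_mult[OF max_carr[OF y] a(1)] e(1) max_carr[OF y]
    by (simp add: E.M.minus_eq)
  have pm: "p \<subseteq> \<mm>" by (rule proper_subset_max[OF pi prime_one[OF p]])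
  have "y \<otimes> a = \<zero>" if y: "y \<in> p" for y
    using *[of y] e(2)[OF y] pm y \<eta>_zero \<eta>_inj[of "y \<otimes> a" \<zero>] ideal_carr[OF pi y] a(1) by auto
  moreover have "x = \<pi> \<otimes> a" using *[OF \<pi>(1)] e(3) \<eta>_inj[of "\<pi> \<otimes> a" x] \<pi>c a(1) x(1) by simp
  ultimately show False using x(3)[OF a(1)] by blast
qed

text \<open>Every ideal of \<open>R/t\<close> is the annihilator of its annihilator, with the witness detected in the socle.\<close>

lemma double_annihilator:
  assumes t: "t \<in> \<mm>" "\<And>a. a \<in> carrier R \<Longrightarrow> t \<otimes> a = \<zero> \<Longrightarrow> a = \<zero>"
    and s: "s \<in> carrier R" "s \<notin> PIdl t" "\<And>y. y \<in> \<mm> \<Longrightarrow> y \<otimes> s \<in> PIdl t"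
    and J: "ideal J R" "t \<in> J" and a: "a \<in> carrier R" "a \<notin> J"
  shows "\<exists>b\<in>carrier R. (\<forall>y\<in>J. y \<otimes> b \<in> PIdl t) \<and> a \<otimes> b \<ominus> s \<in> PIdl t"
proof -
  have tc: "t \<in> carrier R" using max_carr[OF t(1)] .
  have P: "ext_vanishes 1" by (rule ext_vanishes_depth_1[OF tc t(2) s])
  have cancel: "b = c" if "b \<in> carrier R" "c \<in> carrier R" "t \<otimes> b = t \<otimes> c" for b c
  proof -
    have "t \<otimes> (b \<ominus> c) = \<zero>" using that tc by (simp add: minus_eq r_distr r_minus r_neg)
    thus ?thesis using t(2)[of "b \<ominus> c"] that by simp
  qed
  obtain J1 where J1: "ideal J1 R" "J \<subseteq> J1" "a \<notin> J1" "\<And>y. y \<in> \<mm> \<Longrightarrow> y \<otimes> a \<in> J1" "max_rad J1"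
    using exists_max_avoiding[OF J(1) a] by blast
  \<comment> \<open>\<open>c\<close> divides \<open>y s\<close> by \<open>t\<close>, which is a
    homomorphism from \<mm> to \<open>R\<close>. The element \<open>e\<close> that realizes it in
    \<open>E 0\<close> behaves like the fraction s/t.\<close>
  define c where "c y = (THE c. c \<in> carrier R \<and> y \<otimes> s = t \<otimes> c)" for y
  have c: "c y \<in> carrier R \<and> y \<otimes> s = t \<otimes> c y" if y: "y \<in> \<mm>" for y
  proof -
    obtain b where "b \<in> carrier R" "y \<otimes> s = b \<otimes> t" using s(3)[OF y] unfolding PIdl_mem by blast
    hence "b \<in> carrier R \<and> y \<otimes> s = t \<otimes> b" using tc m_comm by simp
    thus ?thesis unfolding c_def by (rule theI) (use cancel \<open>b \<in> carrier R \<and> y \<otimes> s = t \<otimes> b\<close> in auto)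
  qed
  have cu: "c y = b" if "y \<in> \<mm>" "b \<in> carrier R" "y \<otimes> s = t \<otimes> b" for y b using c[OF that(1)] cancel that by auto
  have "\<exists>e\<in>carrier (E 0). \<forall>y\<in>\<mm>. \<eta> (c y) = y \<odot>\<^bsub>E 0\<^esub> e"
  proof (rule injective_module_baer[OF inj_E is_cring max_ideal_ideal])
    show "(\<lambda>y. \<eta> (c y)) \<in> \<mm> \<rightarrow> carrier (E 0)" using c \<eta>_carr by auto
    fix y z assume yz: "y \<in> \<mm>" "z \<in> \<mm>"
    have "(y \<oplus> z) \<otimes> s = t \<otimes> (c y \<oplus> c z)" using c yz max_carr s(1) tc by (simp add: l_distr r_distr)
    hence "c (y \<oplus> z) = c y \<oplus> c z" using cu[OF ideal_add[OF max_ideal_ideal yz]] c yz by simp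
    thus "\<eta> (c (y \<oplus> z)) = \<eta> (c y) \<oplus>\<^bsub>E 0\<^esub> \<eta> (c z)" using c yz by (simp add: \<eta>_add)
  next
    fix b y assume bY: "b \<in> carrier R" "y \<in> \<mm>"
    have "(b \<otimes> y) \<otimes> s = b \<otimes> (y \<otimes> s)" using bY max_carr s(1) by (simp add: m_assoc)
    also have "\<dots> = t \<otimes> (b \<otimes> c y)" using c[OF bY(2)] bY tc by (simp add: m_lcomm)
    finally have "c (b \<otimes> y) = b \<otimes> c y" using cu[OF ideal_mult[OF max_ideal_ideal bY]] c[OF bY(2)] bY(1) by simp
    thus "\<eta> (c (b \<otimes> y)) = b \<odot>\<^bsub>E 0\<^esub> \<eta> (c y)" using c[OF bY(2)] bY(1) by (simp add: \<eta>_mult)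
  qed
  then obtain e where e: "e \<in> carrier (E 0)" "\<And>y. y \<in> \<mm> \<Longrightarrow> y \<odot>\<^bsub>E 0\<^esub> e = \<eta> (c y)" by metis
  have te: "t \<odot>\<^bsub>E 0\<^esub> e = \<eta> s" using e(2)[OF t(1)] cu[OF t(1) s(1)] by simp
  have de: "\<delta> 0 e \<in> carrier (E 1)" "\<delta> 1 (\<delta> 0 e) = \<zero>\<^bsub>E (Suc 1)\<^esub>" using \<delta>_carr[OF e(1)] \<delta>_\<delta>[OF e(1)] by simp_all
  have mde: "y \<odot>\<^bsub>E 1\<^esub> \<delta> 0 e = \<zero>\<^bsub>E 1\<^esub>" if y: "y \<in> \<mm>" for y
    using \<delta>_smult[OF max_carr[OF y] e(1)] e(2)[OF y] \<delta>_\<eta> c[OF y] by simp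
  \<comment> \<open>The coboundary of \<open>e\<close> is a cocycle killed by \<mm>; it is extended
    along \<open>a\<close> to one killed by \<open>J1\<close>. A preimage \<open>e'\<close> of the
    extension behaves like b/t, so \<open>b\<close> is read off from \<open>t e'\<close>.\<close>
  obtain w where w: "w \<in> carrier (E 1)" "\<delta> 1 w = \<zero>\<^bsub>E (Suc 1)\<^esub>" "\<And>y. y \<in> J1 \<Longrightarrow> y \<odot>\<^bsub>E 1\<^esub> w = \<zero>\<^bsub>E 1\<^esub>" "a \<odot>\<^bsub>E 1\<^esub> w = \<delta> 0 e"
    using extend_cocycle[OF P J1(1,5) a(1) J1(3,4) de mde] by blast
  obtain e' where e': "e' \<in> carrier (E 0)" "\<delta> 0 e' = w" using exact_E[of w 0] w(1,2) by auto
  have "\<exists>b\<in>carrier R. y \<odot>\<^bsub>E 0\<^esub> e' = \<eta> b" if y: "y \<in> J1" for y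
  proof -
    have yc: "y \<in> carrier R" using ideal_carr[OF J1(1) y] .
    have "\<delta> 0 (y \<odot>\<^bsub>E 0\<^esub> e') = \<zero>\<^bsub>E 1\<^esub>" using \<delta>_smult[OF yc e'(1)] e'(2) w(3)[OF y] by simp
    thus ?thesis using exact_E0[of "y \<odot>\<^bsub>E 0\<^esub> e'"] e'(1) yc by simp
  qed
  note lift = this
  obtain b where b: "b \<in> carrier R" "t \<odot>\<^bsub>E 0\<^esub> e' = \<eta> b" using lift[of t] J1(2) J(2) by blast
  have "y \<otimes> b \<in> PIdl t" if y: "y \<in> J" for y
  proof -
    have yc: "y \<in> carrier R" using ideal_carr[OF J(1) y] .
    obtain d where d: "d \<in> carrier R" "y \<odot>\<^bsub>E 0\<^esub> e' = \<eta> d" using lift[of y] J1(2) y by blast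
    have "\<eta> (y \<otimes> b) = y \<odot>\<^bsub>E 0\<^esub> (t \<odot>\<^bsub>E 0\<^esub> e')" using b yc by (simp add: \<eta>_mult)
    also have "\<dots> = t \<odot>\<^bsub>E 0\<^esub> (y \<odot>\<^bsub>E 0\<^esub> e')" using yc tc e'(1) by (metis E.smult_assoc1 m_comm)
    also have "\<dots> = \<eta> (t \<otimes> d)" using d tc by (simp add: \<eta>_mult)
    finally have "y \<otimes> b = t \<otimes> d" using \<eta>_inj yc b d tc by simp
    thus ?thesis using d tc m_comm[of t d] unfolding PIdl_mem by auto
  qed
  moreover have "a \<otimes> b \<ominus> s \<in> PIdl t"
  proof -
    have ae: "a \<odot>\<^bsub>E 0\<^esub> e' \<in> carrier (E 0)" using a(1) e'(1) by simp
    have "\<delta> 0 (a \<odot>\<^bsub>E 0\<^esub> e' \<ominus>\<^bsub>E 0\<^esub> e) = \<zero>\<^bsub>E 1\<^esub>"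
      using \<delta>_diff[OF ae e(1)] \<delta>_smult[OF a(1) e'(1)] e'(2) w(4) de by (simp add: E.M.minus_eq E.M.r_neg)
    then obtain d where d: "d \<in> carrier R" "a \<odot>\<^bsub>E 0\<^esub> e' \<ominus>\<^bsub>E 0\<^esub> e = \<eta> d"
      using exact_E0[of "a \<odot>\<^bsub>E 0\<^esub> e' \<ominus>\<^bsub>E 0\<^esub> e"] ae e(1) by auto
    have "\<eta> (t \<otimes> d) = t \<odot>\<^bsub>E 0\<^esub> (a \<odot>\<^bsub>E 0\<^esub> e') \<ominus>\<^bsub>E 0\<^esub> t \<odot>\<^bsub>E 0\<^esub> e"
      using E_smult_diff[OF tc ae e(1)] d tc by (simp add: \<eta>_mult)
    also have "t \<odot>\<^bsub>E 0\<^esub> (a \<odot>\<^bsub>E 0\<^esub> e') = a \<odot>\<^bsub>E 0\<^esub> (t \<odot>\<^bsub>E 0\<^esub> e')" using a(1) tc e'(1) by (metis E.smult_assoc1 m_comm)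
    also have "a \<odot>\<^bsub>E 0\<^esub> (t \<odot>\<^bsub>E 0\<^esub> e') \<ominus>\<^bsub>E 0\<^esub> t \<odot>\<^bsub>E 0\<^esub> e = \<eta> (a \<otimes> b \<ominus> s)"
      using b te a(1) s(1) by (simp add: \<eta>_mult \<eta>_diff)
    finally have "a \<otimes> b \<ominus> s = t \<otimes> d" using \<eta>_inj a b s d tc by simp
    thus ?thesis using d tc m_comm[of t d] unfolding PIdl_mem by auto
  qed
  ultimately show ?thesis using b(1) by blast
qed

end

section \<open>Gorenstein rings at a minimal prime with discrete valuation quotient\<close>

text \<open>\<open>\<pi>\<close> lifts a uniformizer of \<open>R/p\<close>, and \<open>generic_field\<close> says that the localization at \<open>p\<close> is a field.\<close>

locale gorenstein_dvr_point = finite_injective_resolution R E \<eta> \<delta> n for R (structure) and E \<eta> \<delta> n +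
  fixes p \<pi>
  assumes p_prime: "primeideal p R"
    and \<pi>_max: "\<pi> \<in> \<mm>" and \<pi>_p: "\<pi> \<notin> p"
    and max_p: "\<And>y. y \<in> \<mm> \<Longrightarrow> \<exists>b\<in>carrier R. y \<ominus> b \<otimes> \<pi> \<in> p"
    and generic_field: "\<exists>s\<in>carrier R. s \<notin> p \<and> (\<forall>y\<in>p. y \<otimes> s = \<zero>)"
begin

lemma p_ideal: "ideal p R" using p_prime by (rule primeideal.axioms(1))
lemma p_carr: "y \<in> p \<Longrightarrow> y \<in> carrier R" using ideal_carr[OF p_ideal] .
lemma p_max: "p \<subseteq> \<mm>" by (rule proper_subset_max[OF p_ideal prime_one[OF p_prime]])
lemma \<pi>_carr: "\<pi> \<in> carrier R" using max_carr[OF \<pi>_max] .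
lemma \<pi>_pow_carr: "\<pi> [^] (k::nat) \<in> carrier R" using \<pi>_carr by simp
lemma \<pi>_pow_p: "\<pi> [^] (k::nat) \<notin> p" using prime_pow[OF p_prime \<pi>_carr] \<pi>_p by blast

text \<open>Take \<open>p + R b\<close> maximal with \<open>a\<close> congruent to
  \<open>b \<pi>^k\<close> modulo \<open>p\<close>. If \<open>b\<close> were in \<mm>, it would be
  \<open>c \<pi>\<close> modulo \<open>p\<close>; maximality makes \<open>c\<close> congruent to
  \<open>r \<pi> c\<close>, and the unit \<open>1 - r \<pi>\<close> would put \<open>c\<close>,
  \<open>b\<close> and finally \<open>a\<close> into \<open>p\<close>.\<close>

lemma val_decomp:
  assumes a: "a \<in> carrier R" "a \<notin> p"
  shows "\<exists>k::nat. \<exists>u\<in>carrier R. u \<notin> \<mm> \<and> a \<ominus> u \<otimes> \<pi> [^] k \<in> p"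
proof -
  define Q where "Q K \<longleftrightarrow> (\<exists>b\<in>carrier R. \<exists>k::nat. a \<ominus> b \<otimes> \<pi> [^] k \<in> p \<and> K = ins_ideal p b)" for K
  have "a \<ominus> a \<otimes> \<pi> [^] (0::nat) \<in> p" using a ideal_zero[OF p_ideal] by (simp add: minus_eq r_neg)
  hence Q0: "Q (ins_ideal p a)" unfolding Q_def using a by blast
  obtain K where K: "Q K" "\<And>L. Q L \<Longrightarrow> K \<subseteq> L \<Longrightarrow> L = K"
    using noeth_max_such[of Q, OF Q0] unfolding Q_def using ins_ideal_ideal[OF p_ideal] by metis
  then obtain b k where b: "b \<in> carrier R" "a \<ominus> b \<otimes> \<pi> [^] (k::nat) \<in> p" "K = ins_ideal p b" unfolding Q_def by blast
  have "b \<notin> \<mm>"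
  proof
    assume "b \<in> \<mm>"
    then obtain c where c: "c \<in> carrier R" "b \<ominus> c \<otimes> \<pi> \<in> p" using max_p by blast
    have eq: "a \<ominus> c \<otimes> \<pi> [^] Suc k = (a \<ominus> b \<otimes> \<pi> [^] k) \<oplus> \<pi> [^] k \<otimes> (b \<ominus> c \<otimes> \<pi>)"
    proof -
      have 1: "c \<otimes> \<pi> [^] Suc k = \<pi> [^] k \<otimes> (c \<otimes> \<pi>)" using c(1) \<pi>_carr by (simp add: m_ac)
      have 2: "\<pi> [^] k \<otimes> (b \<ominus> c \<otimes> \<pi>) = b \<otimes> \<pi> [^] k \<ominus> \<pi> [^] k \<otimes> (c \<otimes> \<pi>)"
        using c(1) b(1) \<pi>_carr by (simp add: minus_eq r_distr r_minus m_comm)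
      show ?thesis unfolding 1 2 using a b(1) c(1) \<pi>_carr by (simp add: minus_eq a_assoc r_neg1 r_neg2)
    qed
    have "a \<ominus> c \<otimes> \<pi> [^] Suc k \<in> p"
      unfolding eq by (intro ideal_add[OF p_ideal] b(2) ideal_mult[OF p_ideal _ c(2)] \<pi>_pow_carr)
    hence "Q (ins_ideal p c)" unfolding Q_def using c by blast
    moreover have "K \<subseteq> ins_ideal p c"
    proof
      fix y assume "y \<in> K"
      then obtain j r where jr: "j \<in> p" "r \<in> carrier R" "y = j \<oplus> r \<otimes> b" unfolding b(3) by (elim ins_ideal_cases)
      have "b = (b \<ominus> c \<otimes> \<pi>) \<oplus> \<pi> \<otimes> c" using b(1) c(1) \<pi>_carr by (simp add: minus_eq a_assoc l_neg m_comm)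
      hence "b \<in> ins_ideal p c" using c \<pi>_carr by (intro ins_idealI) auto
      moreover have "j \<in> ins_ideal p c" using ins_ideal_superset[OF p_ideal c(1)] jr(1) by blast
      ultimately show "y \<in> ins_ideal p c"
        unfolding jr(3) by (intro ideal_add ideal_mult ins_ideal_ideal p_ideal c(1) jr(2))
    qed
    ultimately have eqK: "ins_ideal p c = K" using K(2) by blast
    have "c \<in> K" using ins_ideal_self[OF p_ideal c(1)] eqK by simp
    then obtain j r where jr: "j \<in> p" "r \<in> carrier R" "c = j \<oplus> r \<otimes> b" unfolding b(3) by (elim ins_ideal_cases)
    define q where "q = b \<ominus> c \<otimes> \<pi>"
    have q: "q \<in> p" "q \<in> carrier R" using c(2) p_carr unfolding q_def by auto
    have jc: "j \<in> carrier R" using p_carr[OF jr(1)] .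
    have bq: "b = q \<oplus> c \<otimes> \<pi>" unfolding q_def using b(1) c(1) \<pi>_carr by (simp add: minus_eq a_assoc l_neg)
    have "c = j \<oplus> r \<otimes> q \<oplus> (r \<otimes> \<pi>) \<otimes> c"
      using jr(3) jr(2) jc q(2) c(1) \<pi>_carr bq by (simp add: r_distr a_assoc m_ac)
    hence "(\<one> \<ominus> r \<otimes> \<pi>) \<otimes> c = (j \<oplus> r \<otimes> q \<oplus> (r \<otimes> \<pi>) \<otimes> c) \<ominus> (r \<otimes> \<pi>) \<otimes> c"
      using jr(2) c(1) \<pi>_carr by (simp add: minus_eq l_distr l_minus)
    also have "\<dots> = j \<oplus> r \<otimes> q" using jr(2) c(1) \<pi>_carr jc q(2) by (simp add: minus_eq a_assoc r_neg)
    also have "\<dots> \<in> p" by (intro ideal_add[OF p_ideal] jr(1) ideal_mult[OF p_ideal jr(2) q(1)])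
    finally have "c \<in> p"
      using mult_one_minus_mem[OF p_ideal ideal_mult[OF max_ideal_ideal jr(2) \<pi>_max] c(1)] by simp
    hence "b \<in> p" unfolding bq by (intro ideal_add[OF p_ideal] q(1) ideal_mult_r[OF p_ideal \<pi>_carr])
    hence "b \<otimes> \<pi> [^] k \<in> p" by (rule ideal_mult_r[OF p_ideal \<pi>_pow_carr])
    thus False using ideal_diff_cancel[OF p_ideal a(1) _ b(2)] a(2) by blast
  qed
  thus ?thesis using b by blast
qed

section \<open>The annihilator of \<open>p\<close>\<close>

definition I where "I = {a \<in> carrier R. \<forall>y\<in>p. y \<otimes> a = \<zero>}"

lemma I_D: "a \<in> I \<Longrightarrow> a \<in> carrier R" "a \<in> I \<Longrightarrow> y \<in> p \<Longrightarrow> y \<otimes> a = \<zero>"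
  by (auto simp: I_def)

lemma I_ideal: "ideal I R"
proof (rule idealI2)
  show "\<zero> \<in> I" using p_carr by (auto simp: I_def)
  fix a b assume "a \<in> I" "b \<in> I" thus "a \<oplus> b \<in> I" using p_carr by (auto simp: I_def r_distr)
next
  fix a b assume *: "a \<in> carrier R" "b \<in> I"
  have bc: "b \<in> carrier R" using I_D(1)[OF *(2)] .
  have "y \<otimes> (a \<otimes> b) = \<zero>" if "y \<in> p" for y
  proof -
    have "y \<otimes> (a \<otimes> b) = a \<otimes> (y \<otimes> b)" using *(1) bc p_carr[OF that] by (simp add: m_lcomm)
    thus ?thesis using I_D(2)[OF *(2) that] * by simp
  qed
  thus "a \<otimes> b \<in> I" using *(1) bc by (simp add: I_def)
qed (auto simp: I_def)

lemma mult_cong_I: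
  assumes "a \<in> carrier R" "b \<in> carrier R" "a \<ominus> b \<in> p" "x \<in> I" shows "a \<otimes> x = b \<otimes> x"
proof -
  have xc: "x \<in> carrier R" using I_D(1)[OF assms(4)] .
  have "a \<otimes> x = (a \<ominus> b) \<otimes> x \<oplus> b \<otimes> x" using assms xc by (simp add: minus_eq l_distr l_minus a_assoc l_neg)
  thus ?thesis using I_D(2)[OF assms(4,3)] assms xc by simp
qed

text \<open>If \<open>I = \<pi> I\<close>, Nakayama's lemma gives \<open>I = 0\<close>, whereas
  \<open>generic_field\<close> provides an element of \<open>I\<close> outside
  \<open>p\<close>.\<close>

lemma exists_I_primitive: "\<exists>x\<in>I. \<forall>a\<in>I. x \<noteq> \<pi> \<otimes> a"
proof (rule ccontr)
  assume n: "\<not> ?thesis"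
  have IS: "submodule I R (regular_module R)" using I_ideal by (simp add: submodule_regular_iff)
  have "I \<subseteq> RM.idmul \<mm> I <+>\<^bsub>regular_module R\<^esub> {\<zero>\<^bsub>regular_module R\<^esub>}"
  proof
    fix x assume "x \<in> I"
    then obtain a where a: "a \<in> I" "x = \<pi> \<otimes> a" using n by blast
    have "x \<in> RM.idmul \<mm> I" using RM.idmul_mem[OF \<pi>_max a(1)] a(2) by simp
    moreover have "submodule (RM.idmul \<mm> I) R (regular_module R)"
      using RM.submodule_idmul[of \<mm> I] max_carr I_D(1) by auto
    ultimately show "x \<in> RM.idmul \<mm> I <+>\<^bsub>regular_module R\<^esub> {\<zero>\<^bsub>regular_module R\<^esub>}" using RM.set_add_zero by simp
  qed
  from RM.nakayama[OF fg_sub_ideal[OF I_ideal] RM.zero_submodule this] have "I \<subseteq> {\<zero>}" by simp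
  thus False using generic_field ideal_zero[OF p_ideal] by (auto simp: I_def)
qed

lemma depth_pos: "s \<in> carrier R \<Longrightarrow> (\<And>y. y \<in> \<mm> \<Longrightarrow> y \<otimes> s = \<zero>) \<Longrightarrow> s = \<zero>"
proof -
  assume s: "s \<in> carrier R" "\<And>y. y \<in> \<mm> \<Longrightarrow> y \<otimes> s = \<zero>"
  obtain x where x: "x \<in> I" "\<And>a. a \<in> I \<Longrightarrow> x \<noteq> \<pi> \<otimes> a" using exists_I_primitive by blast
  show "s = \<zero>"
    by (rule depth_positive[OF p_prime \<pi>_max \<pi>_p max_p I_D(1)[OF x(1)] I_D(2)[OF x(1)] _ s])
      (auto intro!: x(2) simp: I_def)
qed

text \<open>On \<open>I\<close> every element of \<mm> acts as a multiple of \<open>\<pi>\<close>,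
  so an element killed by \<open>\<pi>\<close> is killed by \<mm>.\<close>

lemma \<pi>_regular_I: "x \<in> I \<Longrightarrow> \<pi> \<otimes> x = \<zero> \<Longrightarrow> x = \<zero>"
proof (rule depth_pos)
  assume x: "x \<in> I" "\<pi> \<otimes> x = \<zero>"
  show xc: "x \<in> carrier R" using I_D(1)[OF x(1)] .
  fix y assume y: "y \<in> \<mm>"
  then obtain b where b: "b \<in> carrier R" "y \<ominus> b \<otimes> \<pi> \<in> p" using max_p by blast
  have "y \<otimes> x = (b \<otimes> \<pi>) \<otimes> x" by (rule mult_cong_I) (use max_carr[OF y] b \<pi>_carr x in auto)
  thus "y \<otimes> x = \<zero>" using x b \<pi>_carr xc by (simp add: m_assoc)
qed

lemma \<pi>_pow_cancel_I:
  assumes "x \<in> I" "y \<in> I" "\<pi> [^] (k::nat) \<otimes> x = \<pi> [^] k \<otimes> y" shows "x = y"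
  using assms
proof (induction k arbitrary: x y)
  case 0 thus ?case using I_D(1) by simp
next
  case (Suc k)
  have c: "x \<in> carrier R" "y \<in> carrier R" using Suc.prems I_D(1) by auto
  have "\<pi> [^] k \<otimes> (\<pi> \<otimes> x) = \<pi> [^] k \<otimes> (\<pi> \<otimes> y)" using Suc.prems(3) c \<pi>_carr by (simp add: m_assoc)
  hence eq: "\<pi> \<otimes> x = \<pi> \<otimes> y" using Suc.IH ideal_mult[OF I_ideal \<pi>_carr] Suc.prems by blast
  have "\<pi> \<otimes> (x \<ominus> y) = \<zero>" using eq c \<pi>_carr by (simp add: minus_eq r_distr r_minus r_neg)
  hence "x \<ominus> y = \<zero>" using \<pi>_regular_I ideal_diff[OF I_ideal] Suc.prems by blast
  thus ?case using c by simp
qed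

section \<open>Regular elements and the socle modulo one of them\<close>

definition reg_elt where "reg_elt t \<longleftrightarrow> t \<in> \<mm> \<and> (\<forall>a\<in>carrier R. t \<otimes> a = \<zero> \<longrightarrow> a = \<zero>)"

lemma reg_elt_D: "reg_elt t \<Longrightarrow> t \<in> \<mm>" "reg_elt t \<Longrightarrow> t \<in> carrier R"
  "reg_elt t \<Longrightarrow> a \<in> carrier R \<Longrightarrow> t \<otimes> a = \<zero> \<Longrightarrow> a = \<zero>"
  using max_carr by (auto simp: reg_elt_def)

lemma exists_reg_elt: "\<exists>t. reg_elt t"
  using exists_regular[OF depth_pos] by (auto simp: reg_elt_def)

lemma reg_elt_mult: "reg_elt s \<Longrightarrow> reg_elt t \<Longrightarrow> reg_elt (s \<otimes> t)"
  using reg_elt_D ideal_mult_r[OF max_ideal_ideal] unfolding reg_elt_def by (metis m_assoc m_closed)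

lemma reg_elt_pow: "reg_elt t \<Longrightarrow> reg_elt (t [^] Suc k)"
  by (induction k) (use reg_elt_D(2) in \<open>auto intro: reg_elt_mult\<close>)

lemma reg_elt_not_p: "reg_elt t \<Longrightarrow> t \<notin> p"
  using generic_field reg_elt_D(3) ideal_zero[OF p_ideal] by metis

text \<open>The exponent is positive because \<open>t\<close> lies in \<mm>. Its predecessor
  \<open>k\<close> is the exponent that produces socle elements modulo \<open>t\<close>.\<close>

lemma reg_elt_val:
  assumes t: "reg_elt t"
  shows "\<exists>k u. u \<in> carrier R \<and> u \<notin> \<mm> \<and> t \<ominus> u \<otimes> \<pi> [^] Suc k \<in> p"
proof -
  obtain k u where ku: "u \<in> carrier R" "u \<notin> \<mm>" "t \<ominus> u \<otimes> \<pi> [^] (k::nat) \<in> p"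
    using val_decomp[OF reg_elt_D(2)[OF t] reg_elt_not_p[OF t]] by blast
  have "k \<noteq> 0"
  proof
    assume "k = 0"
    hence "t \<ominus> u \<in> \<mm>" using ku p_max by auto
    hence "t \<ominus> (t \<ominus> u) \<in> \<mm>" using ideal_diff[OF max_ideal_ideal reg_elt_D(1)[OF t]] by blast
    moreover have "t \<ominus> (t \<ominus> u) = u" using reg_elt_D(2)[OF t] ku(1) by (simp add: minus_eq minus_add r_neg1 a_assoc[symmetric] r_neg)
    ultimately show False using ku(2) by simp
  qed
  thus ?thesis using ku by (metis not0_implies_Suc)
qed

text \<open>On \<open>I\<close> the element \<open>t\<close> acts as \<open>u \<pi>^(k+1)\<close>
  and every element of \<mm> as a multiple of \<open>\<pi>\<close>; hence \<mm> carries
  \<open>\<pi>^k y\<close> into \<open>t R\<close>. If \<open>\<pi>^k y = b t\<close>, then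
  \<open>b\<close> is in \<open>I\<close> since \<open>t\<close> is regular, and cancelling
  \<open>\<pi>^k\<close> shows that \<open>\<pi>\<close> divides \<open>y\<close>.\<close>

lemma socle_elt:
  assumes t: "reg_elt t" and u: "u \<in> carrier R" "u \<notin> \<mm>" "t \<ominus> u \<otimes> \<pi> [^] Suc k \<in> p" and y: "y \<in> I"
  shows "\<And>z. z \<in> \<mm> \<Longrightarrow> z \<otimes> (\<pi> [^] k \<otimes> y) \<in> PIdl t"
    and "\<pi> [^] k \<otimes> y \<in> PIdl t \<Longrightarrow> \<exists>a\<in>I. y = \<pi> \<otimes> a"
proof -
  have tc: "t \<in> carrier R" using reg_elt_D(2)[OF t] .
  have yc: "y \<in> carrier R" using I_D(1)[OF y] .
  have tI: "t \<otimes> x = u \<otimes> (\<pi> [^] Suc k \<otimes> x)" if "x \<in> I" for x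
    using mult_cong_I[OF tc _ u(3) that] u(1) \<pi>_carr I_D(1)[OF that] by (simp add: m_assoc)
  obtain v where v: "v \<in> carrier R" "v \<otimes> u = \<one>" using unit_of_not_max[OF u(1,2)] by blast
  have "\<pi> [^] Suc k \<otimes> y = v \<otimes> (u \<otimes> (\<pi> [^] Suc k \<otimes> y))"
    using v u(1) \<pi>_carr yc by (simp add: m_assoc[symmetric])
  also have "\<dots> = v \<otimes> (t \<otimes> y)" by (simp only: tI[OF y])
  also have "\<dots> = (v \<otimes> y) \<otimes> t" using v(1) yc tc by (simp add: m_ac)
  finally have \<pi>y: "\<pi> [^] Suc k \<otimes> y = (v \<otimes> y) \<otimes> t" .
  show "z \<otimes> (\<pi> [^] k \<otimes> y) \<in> PIdl t" if z: "z \<in> \<mm>" for z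
  proof -
    obtain b where b: "b \<in> carrier R" "z \<ominus> b \<otimes> \<pi> \<in> p" using max_p[OF z] by blast
    have "z \<otimes> (\<pi> [^] k \<otimes> y) = (b \<otimes> \<pi>) \<otimes> (\<pi> [^] k \<otimes> y)"
      by (rule mult_cong_I) (use b z max_carr \<pi>_carr ideal_mult[OF I_ideal _ y] in auto)
    also have "\<dots> = b \<otimes> (\<pi> [^] Suc k \<otimes> y)" using b(1) \<pi>_carr yc by (simp add: m_ac)
    also have "\<dots> = (b \<otimes> (v \<otimes> y)) \<otimes> t" unfolding \<pi>y using b(1) v(1) yc tc by (simp add: m_assoc)
    finally show ?thesis unfolding PIdl_mem using b(1) v(1) yc by blast
  qed
  assume "\<pi> [^] k \<otimes> y \<in> PIdl t"
  then obtain b where b: "b \<in> carrier R" "\<pi> [^] k \<otimes> y = b \<otimes> t" unfolding PIdl_mem by blast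
  have bI: "b \<in> I"
  proof -
    have "q \<otimes> b = \<zero>" if q: "q \<in> p" for q
    proof -
      have qc: "q \<in> carrier R" using p_carr[OF q] .
      have "t \<otimes> (q \<otimes> b) = q \<otimes> (b \<otimes> t)" using qc b(1) tc by (simp add: m_ac)
      also have "\<dots> = q \<otimes> (\<pi> [^] k \<otimes> y)" using b(2) by simp
      also have "\<dots> = \<zero>" using I_D(2)[OF ideal_mult[OF I_ideal \<pi>_pow_carr y] q] .
      finally show ?thesis using reg_elt_D(3)[OF t] qc b(1) by simp
    qed
    thus ?thesis using b(1) by (simp add: I_def)
  qed
  have uI: "u \<otimes> b \<in> I" using ideal_mult[OF I_ideal u(1) bI] .
  have "\<pi> [^] k \<otimes> y = u \<otimes> (\<pi> [^] Suc k \<otimes> b)" using b tI[OF bI] m_comm[OF b(1) tc] by simp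
  also have "\<dots> = \<pi> [^] k \<otimes> (\<pi> \<otimes> (u \<otimes> b))" using b(1) u(1) \<pi>_carr by (simp add: m_ac)
  finally have "y = \<pi> \<otimes> (u \<otimes> b)" by (rule \<pi>_pow_cancel_I[OF y ideal_mult[OF I_ideal \<pi>_carr uI]])
  thus "\<exists>a\<in>I. y = \<pi> \<otimes> a" using uI by blast
qed

lemma double_ann:
  assumes t: "reg_elt t" and s: "s \<in> carrier R" "s \<notin> PIdl t" "\<And>y. y \<in> \<mm> \<Longrightarrow> y \<otimes> s \<in> PIdl t"
    and J: "ideal J R" "t \<in> J" and a: "a \<in> carrier R" "a \<notin> J"
  obtains b where "b \<in> carrier R" "\<And>y. y \<in> J \<Longrightarrow> y \<otimes> b \<in> PIdl t" "a \<otimes> b \<ominus> s \<in> PIdl t"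
  using double_annihilator[OF reg_elt_D(1)[OF t] reg_elt_D(3)[OF t] s J a] by blast

text \<open>By the double annihilator property every nonzero ideal of R/t contains the socle element
  \<open>\<pi>^k x\<close>, so the socle is essential.\<close>

lemma reg_elt_max_rad: assumes t: "reg_elt t" shows "max_rad (PIdl t)"
proof -
  obtain x where x: "x \<in> I" "\<And>a. a \<in> I \<Longrightarrow> x \<noteq> \<pi> \<otimes> a" using exists_I_primitive by blast
  obtain k u where u: "u \<in> carrier R" "u \<notin> \<mm>" "t \<ominus> u \<otimes> \<pi> [^] Suc k \<in> p" using reg_elt_val[OF t] by blast
  let ?s = "\<pi> [^] k \<otimes> x"
  have sc: "?s \<in> carrier R" using I_D(1)[OF x(1)] \<pi>_carr by simp
  have Pt: "ideal (PIdl t) R" "t \<in> PIdl t" using cgenideal_ideal cgenideal_self reg_elt_D(2)[OF t] by auto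
  have s: "?s \<notin> PIdl t" "\<And>y. y \<in> \<mm> \<Longrightarrow> y \<otimes> ?s \<in> PIdl t" using socle_elt[OF t u x(1)] x(2) by blast+
  show ?thesis
  proof (rule max_rad_of_essential_socle[OF Pt(1) sc s])
    fix a assume a: "a \<in> carrier R" "a \<notin> PIdl t"
    obtain b where b: "b \<in> carrier R" "a \<otimes> b \<ominus> ?s \<in> PIdl t" using double_ann[OF t sc s Pt a] by blast
    have I: "ideal (ins_ideal (PIdl t) a) R" by (rule ins_ideal_ideal[OF Pt(1) a(1)])
    have 1: "a \<otimes> b \<in> ins_ideal (PIdl t) a" by (rule ideal_mult_r[OF I b(1) ins_ideal_self[OF Pt(1) a(1)]])
    have 2: "a \<otimes> b \<ominus> ?s \<in> ins_ideal (PIdl t) a" using b(2) ins_ideal_superset[OF Pt(1) a(1)] by blast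
    have "?s = a \<otimes> b \<ominus> (a \<otimes> b \<ominus> ?s)"
      using a b(1) sc by (simp add: minus_eq minus_add r_neg1 a_assoc[symmetric] r_neg)
    thus "?s \<in> ins_ideal (PIdl t) a" using ideal_diff[OF I 1 2] by simp
  qed
qed

lemma krull_dim_1: "krull_dim R = 1"
proof -
  obtain t where t: "reg_elt t" using exists_reg_elt by blast
  show ?thesis
    by (rule krull_dim_eq_1[OF reg_elt_D(1)[OF t] reg_elt_max_rad[OF t] p_prime]) (use \<pi>_max \<pi>_p in blast)
qed

text \<open>The double annihilator makes nonzero socle elements of R/t multiples of each other.
  Applied to \<open>\<pi>^k x\<close> and \<open>\<pi>^k y\<close> this gives \<open>b x - y\<close>
  in \<open>\<pi> I\<close>, and Nakayama's lemma shows that \<open>x\<close> generates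
  \<open>I\<close>.\<close>

lemma exists_I_generator: "\<exists>x\<in>I. I = PIdl x \<and> x \<notin> p \<and> (\<forall>a\<in>I. x \<noteq> \<pi> \<otimes> a)"
proof -
  obtain t where t: "reg_elt t" using exists_reg_elt by blast
  obtain x where x: "x \<in> I" "\<And>a. a \<in> I \<Longrightarrow> x \<noteq> \<pi> \<otimes> a" using exists_I_primitive by blast
  obtain k u where u: "u \<in> carrier R" "u \<notin> \<mm>" "t \<ominus> u \<otimes> \<pi> [^] Suc k \<in> p" using reg_elt_val[OF t] by blast
  have xc: "x \<in> carrier R" using I_D(1)[OF x(1)] .
  have Pt: "ideal (PIdl t) R" "t \<in> PIdl t" using cgenideal_ideal cgenideal_self reg_elt_D(2)[OF t] by auto
  have Px: "ideal (PIdl x) R" by (rule cgenideal_ideal[OF xc])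
  have sm: "submodule (PIdl x) R (regular_module R)" "submodule (RM.idmul \<mm> I) R (regular_module R)"
    using Px RM.submodule_idmul[of \<mm> I] max_carr I_D(1) by (auto simp: submodule_regular_iff)
  have \<pi>I: "\<pi> \<otimes> a \<in> RM.idmul \<mm> I" if "a \<in> I" for a using RM.idmul_mem[OF \<pi>_max that] by simp
  have key: "\<exists>b\<in>carrier R. \<exists>a\<in>I. b \<otimes> x \<ominus> y = \<pi> \<otimes> a" if y: "y \<in> I" for y
  proof (cases "\<exists>a\<in>I. y = \<pi> \<otimes> a")
    case True
    then obtain a where a: "a \<in> I" "y = \<pi> \<otimes> a" by blast
    have "\<zero> \<otimes> x \<ominus> y = \<pi> \<otimes> (\<ominus> a)" using a xc I_D(1)[OF a(1)] \<pi>_carr by (simp add: minus_eq r_minus)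
    thus ?thesis using ideal_neg[OF I_ideal a(1)] by blast
  next
    case False
    have yc: "y \<in> carrier R" using I_D(1)[OF y] .
    let ?a = "\<pi> [^] k \<otimes> x" and ?s = "\<pi> [^] k \<otimes> y"
    have s: "?s \<in> carrier R" "?s \<notin> PIdl t" "\<And>z. z \<in> \<mm> \<Longrightarrow> z \<otimes> ?s \<in> PIdl t"
      using socle_elt[OF t u y] False yc \<pi>_carr by auto
    have a: "?a \<in> carrier R" "?a \<notin> PIdl t" using socle_elt(2)[OF t u x(1)] x(2) xc \<pi>_carr by auto
    obtain b where b: "b \<in> carrier R" "?a \<otimes> b \<ominus> ?s \<in> PIdl t" using double_ann[OF t s Pt a] by blast
    have "?a \<otimes> b \<ominus> ?s = \<pi> [^] k \<otimes> (b \<otimes> x \<ominus> y)"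
    proof -
      have "?a \<otimes> b = \<pi> [^] k \<otimes> (b \<otimes> x)" using b(1) xc \<pi>_carr by (simp add: m_ac)
      thus ?thesis using b(1) xc yc \<pi>_carr by (simp add: minus_eq r_distr r_minus)
    qed
    hence "\<pi> [^] k \<otimes> (b \<otimes> x \<ominus> y) \<in> PIdl t" using b(2) by simp
    from socle_elt(2)[OF t u ideal_diff[OF I_ideal ideal_mult[OF I_ideal b(1) x(1)] y] this] show ?thesis using b(1) by blast
  qed
  have "I \<subseteq> RM.idmul \<mm> I <+>\<^bsub>regular_module R\<^esub> PIdl x"
  proof
    fix y assume y: "y \<in> I"
    have yc: "y \<in> carrier R" using I_D(1)[OF y] .
    obtain b a where ba: "b \<in> carrier R" "a \<in> I" "b \<otimes> x \<ominus> y = \<pi> \<otimes> a" using key[OF y] by blast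
    have "y = \<pi> \<otimes> (\<ominus> a) \<oplus> b \<otimes> x"
    proof -
      have "\<pi> \<otimes> (\<ominus> a) = \<ominus> (b \<otimes> x \<ominus> y)" using ba I_D(1)[OF ba(2)] \<pi>_carr by (simp add: r_minus)
      thus ?thesis using ba(1) xc yc by (simp add: minus_eq minus_add a_ac r_neg1 r_neg l_neg)
    qed
    moreover have "b \<otimes> x \<in> PIdl x" unfolding PIdl_mem using ba(1) by blast
    ultimately show "y \<in> RM.idmul \<mm> I <+>\<^bsub>regular_module R\<^esub> PIdl x"
      using \<pi>I[OF ideal_neg[OF I_ideal ba(2)]] unfolding RM.mem_set_add by auto
  qed
  from RM.nakayama[OF fg_sub_ideal[OF I_ideal] sm(1) this] have "I \<subseteq> PIdl x" .
  moreover have "PIdl x \<subseteq> I" using ideal_mult[OF I_ideal _ x(1)] by (auto simp: PIdl_mem)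
  ultimately have eq: "I = PIdl x" by blast
  \<comment> \<open>\<open>I\<close> is not contained in \<open>p\<close>, so neither is its
    generator.\<close>
  obtain s where s: "s \<in> carrier R" "s \<notin> p" "s \<in> I" using generic_field by (auto simp: I_def)
  then obtain r where "r \<in> carrier R" "s = r \<otimes> x" unfolding eq PIdl_mem by blast
  hence "x \<notin> p" using s ideal_mult[OF p_ideal] by blast
  thus ?thesis using x eq by blast
qed

end

section \<open>Modules of positive depth\<close>

locale depth_one_module = module R M + gorenstein_dvr_point R E \<eta> \<delta> n p \<pi>
  for R :: "('a, 'm) ring_scheme" (structure) and M :: "('a, 'c, 'k) module_scheme" (structure)
    and E :: "nat \<Rightarrow> ('a, 'e) module" and \<eta> \<delta> n p \<pi> +
  assumes fin_gen: "fg_sub R M (carrier M)"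
    and depth: "\<exists>t\<in>\<mm>. \<forall>y\<in>carrier M. t \<odot>\<^bsub>M\<^esub> y = \<zero>\<^bsub>M\<^esub> \<longrightarrow> y = \<zero>\<^bsub>M\<^esub>"
begin

lemma nakayamaM:
  assumes "fg_sub R M N" "submodule N' R M" "N \<subseteq> idmul \<mm> N <+>\<^bsub>M\<^esub> N'" shows "N \<subseteq> N'"
  by (rule noeth_local_module.nakayama[OF noeth_local_module.intro[OF noeth_local_axioms module_axioms] assms])

lemma fg_submodule: "submodule N R M \<Longrightarrow> fg_sub R M N"
  using fin_gen fg_sub_of_span[OF noetherian_ring_axioms] submodule_subset unfolding fg_sub_def by metis

lemma smult_diff_l: "a \<in> carrier R \<Longrightarrow> b \<in> carrier R \<Longrightarrow> x \<in> carrier M \<Longrightarrow>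
    (a \<ominus> b) \<odot>\<^bsub>M\<^esub> x = a \<odot>\<^bsub>M\<^esub> x \<ominus>\<^bsub>M\<^esub> b \<odot>\<^bsub>M\<^esub> x"
  by (simp add: R.minus_eq M.minus_eq smult_l_distr smult_l_minus)

lemma smult_diff_r: "a \<in> carrier R \<Longrightarrow> x \<in> carrier M \<Longrightarrow> y \<in> carrier M \<Longrightarrow>
    a \<odot>\<^bsub>M\<^esub> (x \<ominus>\<^bsub>M\<^esub> y) = a \<odot>\<^bsub>M\<^esub> x \<ominus>\<^bsub>M\<^esub> a \<odot>\<^bsub>M\<^esub> y"
  by (simp add: M.minus_eq smult_r_distr smult_r_minus)

lemma M_minus_eq_0: "x \<in> carrier M \<Longrightarrow> y \<in> carrier M \<Longrightarrow> x \<ominus>\<^bsub>M\<^esub> y = \<zero>\<^bsub>M\<^esub> \<Longrightarrow> x = y"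
proof -
  assume *: "x \<in> carrier M" "y \<in> carrier M" "x \<ominus>\<^bsub>M\<^esub> y = \<zero>\<^bsub>M\<^esub>"
  have "x = (x \<ominus>\<^bsub>M\<^esub> y) \<oplus>\<^bsub>M\<^esub> y" using *(1,2) by (simp add: M.minus_eq M.a_assoc M.l_neg)
  thus "x = y" using * by simp
qed

text \<open>Elements of \<mm> are nilpotent modulo \<open>t\<close>, so a power of the
  \<open>M\<close>-regular element supplied by \<open>depth\<close> is a multiple of
  \<open>t\<close>.\<close>

lemma reg_elt_M:
  assumes t: "reg_elt t" and y: "y \<in> carrier M" "t \<odot>\<^bsub>M\<^esub> y = \<zero>\<^bsub>M\<^esub>" shows "y = \<zero>\<^bsub>M\<^esub>"
proof -
  obtain t1 where t1: "t1 \<in> \<mm>" "\<And>y. y \<in> carrier M \<Longrightarrow> t1 \<odot>\<^bsub>M\<^esub> y = \<zero>\<^bsub>M\<^esub> \<Longrightarrow> y = \<zero>\<^bsub>M\<^esub>" using depth by blast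
  have t1c: "t1 \<in> carrier R" using max_carr[OF t1(1)] .
  obtain k :: nat and r where r: "r \<in> carrier R" "t1 [^] k = r \<otimes> t"
    using reg_elt_max_rad[OF t] t1(1) unfolding max_rad_def PIdl_mem by blast
  have "(t1 [^] k) \<odot>\<^bsub>M\<^esub> y = r \<odot>\<^bsub>M\<^esub> (t \<odot>\<^bsub>M\<^esub> y)" unfolding r(2) using r(1) reg_elt_D(2)[OF t] y(1) by (simp add: smult_assoc1)
  hence 0: "(t1 [^] k) \<odot>\<^bsub>M\<^esub> y = \<zero>\<^bsub>M\<^esub>" using y r by simp
  have "z \<in> carrier M \<Longrightarrow> (t1 [^] k) \<odot>\<^bsub>M\<^esub> z = \<zero>\<^bsub>M\<^esub> \<Longrightarrow> z = \<zero>\<^bsub>M\<^esub>" for z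
  proof (induction k arbitrary: z)
    case 0 thus ?case by simp
  next
    case (Suc k)
    hence "(t1 [^] k) \<odot>\<^bsub>M\<^esub> (t1 \<odot>\<^bsub>M\<^esub> z) = \<zero>\<^bsub>M\<^esub>" using t1c by (simp add: smult_assoc1)
    hence "t1 \<odot>\<^bsub>M\<^esub> z = \<zero>\<^bsub>M\<^esub>" using Suc.IH t1c Suc.prems(1) by simp
    thus ?case using t1(2) Suc.prems(1) by blast
  qed
  thus ?thesis using y(1) 0 by blast
qed

lemma reg_elt_cancel_M:
  assumes "reg_elt t" "x \<in> carrier M" "y \<in> carrier M" "t \<odot>\<^bsub>M\<^esub> x = t \<odot>\<^bsub>M\<^esub> y" shows "x = y"
proof -
  have tc: "t \<in> carrier R" using reg_elt_D(2)[OF assms(1)] .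
  have "t \<odot>\<^bsub>M\<^esub> (x \<ominus>\<^bsub>M\<^esub> y) = \<zero>\<^bsub>M\<^esub>" unfolding smult_diff_r[OF tc assms(2,3)] using assms tc by (simp add: M.minus_eq M.r_neg)
  hence "x \<ominus>\<^bsub>M\<^esub> y = \<zero>\<^bsub>M\<^esub>" using reg_elt_M[OF assms(1)] assms(2,3) by simp
  thus ?thesis using M_minus_eq_0 assms by blast
qed

definition N where "N = {y \<in> carrier M. \<forall>a\<in>p. a \<odot>\<^bsub>M\<^esub> y = \<zero>\<^bsub>M\<^esub>}"

lemma N_D: "y \<in> N \<Longrightarrow> y \<in> carrier M" "y \<in> N \<Longrightarrow> a \<in> p \<Longrightarrow> a \<odot>\<^bsub>M\<^esub> y = \<zero>\<^bsub>M\<^esub>"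
  by (auto simp: N_def)

lemma N_I: "y \<in> carrier M \<Longrightarrow> (\<And>a. a \<in> p \<Longrightarrow> a \<odot>\<^bsub>M\<^esub> y = \<zero>\<^bsub>M\<^esub>) \<Longrightarrow> y \<in> N"
  by (auto simp: N_def)

lemma N_submodule: "submodule N R M"
proof (rule submoduleI2)
  show "N \<subseteq> carrier M" by (auto simp: N_def)
  show "\<zero>\<^bsub>M\<^esub> \<in> N" by (rule N_I) (auto simp: p_carr)
  show "x \<oplus>\<^bsub>M\<^esub> y \<in> N" if "x \<in> N" "y \<in> N" for x y
    using N_D[OF that(1)] N_D[OF that(2)] p_carr by (intro N_I) (auto simp: smult_r_distr)
  show "a \<odot>\<^bsub>M\<^esub> x \<in> N" if "a \<in> carrier R" "x \<in> N" for a x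
  proof (rule N_I)
    show "a \<odot>\<^bsub>M\<^esub> x \<in> carrier M" using that N_D(1) by simp
    fix b assume b: "b \<in> p"
    have "b \<odot>\<^bsub>M\<^esub> (a \<odot>\<^bsub>M\<^esub> x) = a \<odot>\<^bsub>M\<^esub> (b \<odot>\<^bsub>M\<^esub> x)" using that(1) N_D(1)[OF that(2)] p_carr[OF b] by (metis smult_assoc1 m_comm)
    thus "b \<odot>\<^bsub>M\<^esub> (a \<odot>\<^bsub>M\<^esub> x) = \<zero>\<^bsub>M\<^esub>" using N_D(2)[OF that(2) b] that(1) by simp
  qed
qed

lemma N_smult: "a \<in> carrier R \<Longrightarrow> x \<in> N \<Longrightarrow> a \<odot>\<^bsub>M\<^esub> x \<in> N"
  using submodule_smult_mem[OF N_submodule] .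

lemma smult_cong_N:
  assumes "a \<in> carrier R" "b \<in> carrier R" "a \<ominus> b \<in> p" "x \<in> N" shows "a \<odot>\<^bsub>M\<^esub> x = b \<odot>\<^bsub>M\<^esub> x"
  using smult_diff_l[OF assms(1,2) N_D(1)[OF assms(4)]] N_D(2)[OF assms(4,3)] M_minus_eq_0 assms(1,2) N_D(1)[OF assms(4)]
  by simp

lemma max_smult_N:
  assumes "a \<in> \<mm>" "x \<in> N" shows "\<exists>b\<in>carrier R. a \<odot>\<^bsub>M\<^esub> x = \<pi> \<odot>\<^bsub>M\<^esub> (b \<odot>\<^bsub>M\<^esub> x)"
proof -
  obtain b where b: "b \<in> carrier R" "a \<ominus> b \<otimes> \<pi> \<in> p" using max_p[OF assms(1)] by blast
  have "a \<odot>\<^bsub>M\<^esub> x = (b \<otimes> \<pi>) \<odot>\<^bsub>M\<^esub> x"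
    by (rule smult_cong_N) (use assms b max_carr \<pi>_carr in auto)
  also have "\<dots> = (\<pi> \<otimes> b) \<odot>\<^bsub>M\<^esub> x" using b(1) \<pi>_carr by (simp add: m_comm)
  finally show ?thesis using b(1) \<pi>_carr N_D(1)[OF assms(2)] by (auto simp: smult_assoc1)
qed

text \<open>The \<open>M\<close>-regular element supplied by \<open>depth\<close> acts on
  \<open>N\<close> as a multiple of \<open>\<pi>\<close>.\<close>

lemma \<pi>_regular_N:
  assumes x: "x \<in> N" "\<pi> \<odot>\<^bsub>M\<^esub> x = \<zero>\<^bsub>M\<^esub>" shows "x = \<zero>\<^bsub>M\<^esub>"
proof -
  obtain t1 where t1: "t1 \<in> \<mm>" "\<And>y. y \<in> carrier M \<Longrightarrow> t1 \<odot>\<^bsub>M\<^esub> y = \<zero>\<^bsub>M\<^esub> \<Longrightarrow> y = \<zero>\<^bsub>M\<^esub>" using depth by blast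
  obtain b where b: "b \<in> carrier R" "t1 \<odot>\<^bsub>M\<^esub> x = \<pi> \<odot>\<^bsub>M\<^esub> (b \<odot>\<^bsub>M\<^esub> x)" using max_smult_N[OF t1(1) x(1)] by blast
  have "\<pi> \<odot>\<^bsub>M\<^esub> (b \<odot>\<^bsub>M\<^esub> x) = b \<odot>\<^bsub>M\<^esub> (\<pi> \<odot>\<^bsub>M\<^esub> x)" using b(1) \<pi>_carr N_D(1)[OF x(1)] by (metis smult_assoc1 m_comm)
  hence "t1 \<odot>\<^bsub>M\<^esub> x = \<zero>\<^bsub>M\<^esub>" using b x(2) by simp
  thus ?thesis using t1(2) N_D(1)[OF x(1)] by blast
qed

lemma \<pi>_pow_regular_N: "x \<in> N \<Longrightarrow> (\<pi> [^] (k::nat)) \<odot>\<^bsub>M\<^esub> x = \<zero>\<^bsub>M\<^esub> \<Longrightarrow> x = \<zero>\<^bsub>M\<^esub>"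
proof (induction k arbitrary: x)
  case 0 thus ?case using N_D(1) by simp
next
  case (Suc k)
  hence "(\<pi> [^] k) \<odot>\<^bsub>M\<^esub> (\<pi> \<odot>\<^bsub>M\<^esub> x) = \<zero>\<^bsub>M\<^esub>" using \<pi>_carr N_D(1) by (simp add: smult_assoc1)
  hence "\<pi> \<odot>\<^bsub>M\<^esub> x = \<zero>\<^bsub>M\<^esub>" using Suc.IH N_smult[OF \<pi>_carr Suc.prems(1)] by blast
  thus ?case using \<pi>_regular_N Suc.prems(1) by blast
qed

section \<open>Rank over the discrete valuation quotient\<close>

text \<open>For vectors in \<open>N\<close> this is linear independence over R/p, phrased with
  coefficients in \<open>R\<close>: a relation need only have its coefficients in
  \<open>p\<close>.\<close>

definition indep :: "'i set \<Rightarrow> ('i \<Rightarrow> 'c) \<Rightarrow> bool" where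
  "indep F f \<longleftrightarrow> (\<forall>c. c \<in> F \<rightarrow> carrier R \<longrightarrow> (\<Oplus>\<^bsub>M\<^esub>i\<in>F. c i \<odot>\<^bsub>M\<^esub> f i) = \<zero>\<^bsub>M\<^esub> \<longrightarrow> (\<forall>i\<in>F. c i \<in> p))"

lemma indepD: "indep F f \<Longrightarrow> c \<in> F \<rightarrow> carrier R \<Longrightarrow> (\<Oplus>\<^bsub>M\<^esub>i\<in>F. c i \<odot>\<^bsub>M\<^esub> f i) = \<zero>\<^bsub>M\<^esub> \<Longrightarrow> i \<in> F \<Longrightarrow> c i \<in> p"
  unfolding indep_def by blast

lemma finsum_smult_mem: "c \<in> F \<rightarrow> carrier R \<Longrightarrow> f \<in> F \<rightarrow> carrier M \<Longrightarrow> (\<lambda>i. c i \<odot>\<^bsub>M\<^esub> f i) \<in> F \<rightarrow> carrier M"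
  by (auto simp: Pi_iff)

lemma finsum_smult_add:
  assumes "c \<in> F \<rightarrow> carrier R" "d \<in> F \<rightarrow> carrier R" "f \<in> F \<rightarrow> carrier M"
  shows "(\<Oplus>\<^bsub>M\<^esub>i\<in>F. (c i \<oplus> d i) \<odot>\<^bsub>M\<^esub> f i) = (\<Oplus>\<^bsub>M\<^esub>i\<in>F. c i \<odot>\<^bsub>M\<^esub> f i) \<oplus>\<^bsub>M\<^esub> (\<Oplus>\<^bsub>M\<^esub>i\<in>F. d i \<odot>\<^bsub>M\<^esub> f i)"
proof -
  have "(\<Oplus>\<^bsub>M\<^esub>i\<in>F. (c i \<oplus> d i) \<odot>\<^bsub>M\<^esub> f i) = (\<Oplus>\<^bsub>M\<^esub>i\<in>F. c i \<odot>\<^bsub>M\<^esub> f i \<oplus>\<^bsub>M\<^esub> d i \<odot>\<^bsub>M\<^esub> f i)"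
    using assms by (intro M.finsum_cong') (auto simp: Pi_iff smult_l_distr)
  also have "\<dots> = (\<Oplus>\<^bsub>M\<^esub>i\<in>F. c i \<odot>\<^bsub>M\<^esub> f i) \<oplus>\<^bsub>M\<^esub> (\<Oplus>\<^bsub>M\<^esub>i\<in>F. d i \<odot>\<^bsub>M\<^esub> f i)"
    using assms by (intro M.finsum_addf finsum_smult_mem)
  finally show ?thesis .
qed

lemma finsum_smult_mult:
  assumes "finite F" "a \<in> carrier R" "c \<in> F \<rightarrow> carrier R" "f \<in> F \<rightarrow> carrier M"
  shows "(\<Oplus>\<^bsub>M\<^esub>i\<in>F. (a \<otimes> c i) \<odot>\<^bsub>M\<^esub> f i) = a \<odot>\<^bsub>M\<^esub> (\<Oplus>\<^bsub>M\<^esub>i\<in>F. c i \<odot>\<^bsub>M\<^esub> f i)"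
proof -
  have "(\<Oplus>\<^bsub>M\<^esub>i\<in>F. (a \<otimes> c i) \<odot>\<^bsub>M\<^esub> f i) = (\<Oplus>\<^bsub>M\<^esub>i\<in>F. a \<odot>\<^bsub>M\<^esub> (c i \<odot>\<^bsub>M\<^esub> f i))"
    using assms by (intro M.finsum_cong') (auto simp: Pi_iff smult_assoc1)
  also have "\<dots> = a \<odot>\<^bsub>M\<^esub> (\<Oplus>\<^bsub>M\<^esub>i\<in>F. c i \<odot>\<^bsub>M\<^esub> f i)"
    using finsum_smult_ldistr[OF assms(1,2) finsum_smult_mem[OF assms(3,4)]] by simp
  finally show ?thesis .
qed

lemma finsum_smult_diff:
  assumes "finite F" "c \<in> F \<rightarrow> carrier R" "d \<in> F \<rightarrow> carrier R" "f \<in> F \<rightarrow> carrier M"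
  shows "(\<Oplus>\<^bsub>M\<^esub>i\<in>F. (c i \<ominus> d i) \<odot>\<^bsub>M\<^esub> f i) = (\<Oplus>\<^bsub>M\<^esub>i\<in>F. c i \<odot>\<^bsub>M\<^esub> f i) \<ominus>\<^bsub>M\<^esub> (\<Oplus>\<^bsub>M\<^esub>i\<in>F. d i \<odot>\<^bsub>M\<^esub> f i)"
proof -
  have d': "(\<lambda>i. (\<ominus> \<one>) \<otimes> d i) \<in> F \<rightarrow> carrier R" using assms(3) by (auto simp: Pi_iff)
  have s: "(\<Oplus>\<^bsub>M\<^esub>i\<in>F. d i \<odot>\<^bsub>M\<^esub> f i) \<in> carrier M" by (rule M.finsum_closed[OF finsum_smult_mem[OF assms(3,4)]])
  have "(\<Oplus>\<^bsub>M\<^esub>i\<in>F. (c i \<ominus> d i) \<odot>\<^bsub>M\<^esub> f i) = (\<Oplus>\<^bsub>M\<^esub>i\<in>F. (c i \<oplus> (\<ominus> \<one>) \<otimes> d i) \<odot>\<^bsub>M\<^esub> f i)"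
    using assms by (intro M.finsum_cong') (auto simp: Pi_iff R.minus_eq l_minus)
  also have "\<dots> = (\<Oplus>\<^bsub>M\<^esub>i\<in>F. c i \<odot>\<^bsub>M\<^esub> f i) \<oplus>\<^bsub>M\<^esub> (\<ominus> \<one>) \<odot>\<^bsub>M\<^esub> (\<Oplus>\<^bsub>M\<^esub>i\<in>F. d i \<odot>\<^bsub>M\<^esub> f i)"
    using finsum_smult_add[OF assms(2) d' assms(4)] finsum_smult_mult[OF assms(1) _ assms(3,4), of "\<ominus> \<one>"] by simp
  finally show ?thesis using s by (simp add: M.minus_eq smult_l_minus)
qed

lemma finsum_smult_zero:
  assumes "finite F" "\<And>i. i \<in> F \<Longrightarrow> c i \<odot>\<^bsub>M\<^esub> f i = \<zero>\<^bsub>M\<^esub>"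
  shows "(\<Oplus>\<^bsub>M\<^esub>i\<in>F. c i \<odot>\<^bsub>M\<^esub> f i) = \<zero>\<^bsub>M\<^esub>"
proof -
  have "(\<Oplus>\<^bsub>M\<^esub>i\<in>F. c i \<odot>\<^bsub>M\<^esub> f i) = (\<Oplus>\<^bsub>M\<^esub>i\<in>F. \<zero>\<^bsub>M\<^esub>)" using assms(2) by (intro M.finsum_cong') auto
  thus ?thesis by (simp add: M.finsum_zero)
qed

text \<open>Elimination without fractions: with a pivot coefficient \<open>a j\<close> outside
  \<open>p\<close>, the combinations \<open>a j f i - a i f j\<close> no longer involve
  \<open>g\<close>, and they stay independent because \<open>p\<close> is prime.\<close>

lemma indep_card_le:
  assumes "finite G" "G \<subseteq> N" "finite F" "f \<in> F \<rightarrow> module_span R M G" "indep F f"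
  shows "card F \<le> card G"
  using assms
proof (induction G arbitrary: F f rule: finite_induct)
  case empty
  have "F = {}"
  proof (rule ccontr)
    assume "F \<noteq> {}"
    then obtain i where i: "i \<in> F" by blast
    have "f j = \<zero>\<^bsub>M\<^esub>" if "j \<in> F" for j using empty.prems(3) that by (auto simp: span_empty)
    hence "(\<Oplus>\<^bsub>M\<^esub>i\<in>F. \<one> \<odot>\<^bsub>M\<^esub> f i) = \<zero>\<^bsub>M\<^esub>" by (intro finsum_smult_zero[OF empty.prems(2)]) simp
    hence "\<one> \<in> p" using indepD[OF empty.prems(4), of "\<lambda>_. \<one>" i] i by simp
    thus False using prime_one[OF p_prime] by simp
  qed
  thus ?case by simp
next
  case (insert g G)
  have GN: "G \<subseteq> N" "g \<in> N" using insert.prems(1) by auto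
  have Gc: "g \<in> carrier M" "G \<subseteq> carrier M" using GN N_D(1) by auto
  let ?S = "module_span R M G"
  have S: "submodule ?S R M" by (rule span_submodule[OF Gc(2)])
  have SN: "?S \<subseteq> N" by (rule span_least[OF N_submodule GN(1)])
  have "\<exists>a h. a \<in> carrier R \<and> h \<in> ?S \<and> f i = a \<odot>\<^bsub>M\<^esub> g \<oplus>\<^bsub>M\<^esub> h" if "i \<in> F" for i
    using insert.prems(3) that unfolding span_insert[OF Gc] by (auto simp: Pi_iff mem_set_add cyc_def)
  then obtain a h where ah: "\<And>i. i \<in> F \<Longrightarrow> a i \<in> carrier R" "\<And>i. i \<in> F \<Longrightarrow> h i \<in> ?S"
    "\<And>i. i \<in> F \<Longrightarrow> f i = a i \<odot>\<^bsub>M\<^esub> g \<oplus>\<^bsub>M\<^esub> h i" by metis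
  have hc: "h i \<in> carrier M" if "i \<in> F" for i using ah(2)[OF that] submodule_mem_carrier[OF S] by blast
  have fc: "f i \<in> carrier M" if "i \<in> F" for i using ah that hc Gc by simp
  show ?case
  proof (cases "\<forall>i\<in>F. a i \<in> p")
    case True
    have "f \<in> F \<rightarrow> ?S"
    proof
      fix i assume i: "i \<in> F"
      have "a i \<odot>\<^bsub>M\<^esub> g = \<zero>\<^bsub>M\<^esub>" using True i N_D(2)[OF GN(2)] by blast
      thus "f i \<in> ?S" using ah[OF i] hc[OF i] by simp
    qed
    from insert.IH[OF GN(1) insert.prems(2) this insert.prems(4)] show ?thesis using insert.hyps by simp
  next
    case False
    then obtain j where j: "j \<in> F" "a j \<notin> p" by blast
    let ?F = "F - {j}" let ?f = "\<lambda>i. a j \<odot>\<^bsub>M\<^esub> f i \<ominus>\<^bsub>M\<^esub> a i \<odot>\<^bsub>M\<^esub> f j"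
    have aj: "a j \<in> carrier R" using ah j by simp
    have fS: "?f i = a j \<odot>\<^bsub>M\<^esub> h i \<ominus>\<^bsub>M\<^esub> a i \<odot>\<^bsub>M\<^esub> h j" if i: "i \<in> F" for i
    proof -
      have 1: "a j \<odot>\<^bsub>M\<^esub> f i = (a j \<otimes> a i) \<odot>\<^bsub>M\<^esub> g \<oplus>\<^bsub>M\<^esub> a j \<odot>\<^bsub>M\<^esub> h i"
        using ah(1)[OF i] ah(3)[OF i] aj hc[OF i] Gc by (simp add: smult_r_distr smult_assoc1)
      have 2: "a i \<odot>\<^bsub>M\<^esub> f j = (a j \<otimes> a i) \<odot>\<^bsub>M\<^esub> g \<oplus>\<^bsub>M\<^esub> a i \<odot>\<^bsub>M\<^esub> h j"
        using ah(1)[OF i] ah(3)[OF j(1)] aj hc[OF j(1)] Gc by (simp add: smult_r_distr smult_assoc1[symmetric] m_comm)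
      show ?thesis unfolding 1 2 using ah(1)[OF i] aj hc[OF i] hc[OF j(1)] Gc
        by (simp add: M.minus_eq M.minus_add M.a_ac M.r_neg1 M.r_neg)
    qed
    have "?f \<in> ?F \<rightarrow> ?S"
      using fS ah(1,2) aj j submodule_smult_mem[OF S] submodule_diff_mem[OF S] by auto
    moreover have "indep ?F ?f"
      unfolding indep_def
    proof (intro allI impI ballI)
      fix c i assume c: "c \<in> ?F \<rightarrow> carrier R" and 0: "(\<Oplus>\<^bsub>M\<^esub>i\<in>?F. c i \<odot>\<^bsub>M\<^esub> ?f i) = \<zero>\<^bsub>M\<^esub>" and i: "i \<in> ?F"
      define b where "b = (\<Oplus>\<^bsub>R\<^esub>i\<in>?F. c i \<otimes> a i)"
      have fin: "finite ?F" using insert.prems(2) by simp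
      have ca: "c i \<otimes> a i \<in> carrier R" "c i \<otimes> a j \<in> carrier R" "c i \<in> carrier R" if "i \<in> ?F" for i using c ah(1) aj that by (auto simp: Pi_iff)
      have bc: "b \<in> carrier R" unfolding b_def using ca by (intro R.finsum_closed) auto
      have s1: "(\<Oplus>\<^bsub>M\<^esub>i\<in>?F. (c i \<otimes> a i) \<odot>\<^bsub>M\<^esub> f j) = b \<odot>\<^bsub>M\<^esub> f j"
      proof -
        have "finite H \<Longrightarrow> H \<subseteq> ?F \<Longrightarrow> (\<Oplus>\<^bsub>M\<^esub>i\<in>H. (c i \<otimes> a i) \<odot>\<^bsub>M\<^esub> f j) = (\<Oplus>\<^bsub>R\<^esub>i\<in>H. c i \<otimes> a i) \<odot>\<^bsub>M\<^esub> f j" for H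
        proof (induction H rule: finite_induct)
          case empty show ?case using fc[OF j(1)] by simp
        next
          case (insert z H)
          have 1: "(\<lambda>i. c i \<otimes> a i) \<in> H \<rightarrow> carrier R" "c z \<otimes> a z \<in> carrier R" using ca insert.prems by auto
          hence 2: "(\<lambda>i. (c i \<otimes> a i) \<odot>\<^bsub>M\<^esub> f j) \<in> H \<rightarrow> carrier M" "(c z \<otimes> a z) \<odot>\<^bsub>M\<^esub> f j \<in> carrier M" using fc[OF j(1)] by auto
          show ?case
            using M.finsum_insert[OF insert.hyps 2] R.finsum_insert[OF insert.hyps 1] insert.IH insert.prems
              smult_l_distr[OF 1(2) R.finsum_closed[OF 1(1)] fc[OF j(1)]] by simp
        qed
        thus ?thesis unfolding b_def using fin by blast
      qed
      have "(\<Oplus>\<^bsub>M\<^esub>i\<in>?F. c i \<odot>\<^bsub>M\<^esub> ?f i) = (\<Oplus>\<^bsub>M\<^esub>i\<in>?F. (c i \<otimes> a j) \<odot>\<^bsub>M\<^esub> f i \<oplus>\<^bsub>M\<^esub> (\<ominus> \<one>) \<odot>\<^bsub>M\<^esub> ((c i \<otimes> a i) \<odot>\<^bsub>M\<^esub> f j))"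
        using ca ah(1) aj fc j(1) by (intro M.finsum_cong')
          (auto simp: smult_diff_r M.minus_eq smult_assoc1 smult_l_minus smult_r_minus smult_r_distr)
      also have "\<dots> = (\<Oplus>\<^bsub>M\<^esub>i\<in>?F. (c i \<otimes> a j) \<odot>\<^bsub>M\<^esub> f i) \<oplus>\<^bsub>M\<^esub> (\<Oplus>\<^bsub>M\<^esub>i\<in>?F. (\<ominus> \<one>) \<odot>\<^bsub>M\<^esub> ((c i \<otimes> a i) \<odot>\<^bsub>M\<^esub> f j))"
        using ca fc j(1) by (intro M.finsum_addf) auto
      also have "(\<Oplus>\<^bsub>M\<^esub>i\<in>?F. (\<ominus> \<one>) \<odot>\<^bsub>M\<^esub> ((c i \<otimes> a i) \<odot>\<^bsub>M\<^esub> f j)) = (\<ominus> \<one>) \<odot>\<^bsub>M\<^esub> (\<Oplus>\<^bsub>M\<^esub>i\<in>?F. (c i \<otimes> a i) \<odot>\<^bsub>M\<^esub> f j)"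
        using ca fc j(1) by (intro finsum_smult_ldistr[OF fin, symmetric]) auto
      also have "\<dots> = (\<ominus> b) \<odot>\<^bsub>M\<^esub> f j" unfolding s1 using bc fc[OF j(1)] by (simp add: smult_l_minus)
      finally have eq: "(\<Oplus>\<^bsub>M\<^esub>i\<in>?F. (c i \<otimes> a j) \<odot>\<^bsub>M\<^esub> f i) \<oplus>\<^bsub>M\<^esub> (\<ominus> b) \<odot>\<^bsub>M\<^esub> f j = \<zero>\<^bsub>M\<^esub>" using 0 by simp
      \<comment> \<open>The same relation in terms of the original family; \<open>b\<close> collects
        what the eliminations contribute at the pivot.\<close>
      let ?e = "\<lambda>i. if i = j then \<ominus> b else c i \<otimes> a j"
      have e: "?e \<in> F \<rightarrow> carrier R" using ca bc by auto
      have "(\<Oplus>\<^bsub>M\<^esub>i\<in>F. ?e i \<odot>\<^bsub>M\<^esub> f i) = (\<Oplus>\<^bsub>M\<^esub>i\<in>insert j ?F. ?e i \<odot>\<^bsub>M\<^esub> f i)" using j(1) by (simp add: insert_absorb)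
      also have "\<dots> = ?e j \<odot>\<^bsub>M\<^esub> f j \<oplus>\<^bsub>M\<^esub> (\<Oplus>\<^bsub>M\<^esub>i\<in>?F. ?e i \<odot>\<^bsub>M\<^esub> f i)"
        using fin ca fc j(1) bc by (intro M.finsum_insert) auto
      also have "(\<Oplus>\<^bsub>M\<^esub>i\<in>?F. ?e i \<odot>\<^bsub>M\<^esub> f i) = (\<Oplus>\<^bsub>M\<^esub>i\<in>?F. (c i \<otimes> a j) \<odot>\<^bsub>M\<^esub> f i)"
        using ca fc by (intro M.finsum_cong') auto
      also have "?e j \<odot>\<^bsub>M\<^esub> f j \<oplus>\<^bsub>M\<^esub> \<dots> = \<zero>\<^bsub>M\<^esub>"
      proof -
        have "(\<Oplus>\<^bsub>M\<^esub>i\<in>?F. (c i \<otimes> a j) \<odot>\<^bsub>M\<^esub> f i) \<in> carrier M" using ca fc by (intro M.finsum_closed) auto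
        thus ?thesis using eq bc fc[OF j(1)] by (simp add: M.a_comm)
      qed
      finally have "?e i \<in> p" using indepD[OF insert.prems(4) e, of i] i by blast
      hence "c i \<otimes> a j \<in> p" using i by simp
      thus "c i \<in> p" using prime_mult[OF p_prime ca(3)[OF i] aj] j(2) by blast
    qed
    ultimately have "card ?F \<le> card G" using insert.IH[OF GN(1)] insert.prems(2) by simp
    thus ?thesis using insert.hyps insert.prems(2) j(1) by (simp add: card_Diff_singleton_if)
  qed
qed

definition basis_N where
  "basis_N Y \<longleftrightarrow> finite Y \<and> Y \<subseteq> N \<and> module_span R M Y = N \<and> indep Y (\<lambda>y. y)"

text \<open>A generating set of minimal cardinality is a basis, since a relation over a discrete valuation
  ring can be divided until one of its coefficients is a unit.\<close>

lemma exists_basis_N: "\<exists>Y. basis_N Y"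
proof -
  define Q where "Q k \<longleftrightarrow> (\<exists>Y. finite Y \<and> Y \<subseteq> N \<and> module_span R M Y = N \<and> card Y = k)" for k
  obtain S where S: "finite S" "S \<subseteq> carrier M" "module_span R M S = N"
    using fg_submodule[OF N_submodule] unfolding fg_sub_def by blast
  hence "Q (card S)" using span_superset[of S] unfolding Q_def by blast
  hence "Q (LEAST k. Q k)" by (rule LeastI)
  then obtain Y where Y: "finite Y" "Y \<subseteq> N" "module_span R M Y = N" "card Y = (LEAST k. Q k)" unfolding Q_def by blast
  have min: "card Y \<le> card Z" if "finite Z" "Z \<subseteq> N" "module_span R M Z = N" for Z
    unfolding Y(4) by (rule Least_le) (use that in \<open>auto simp: Q_def\<close>)
  have Yc: "y \<in> carrier M" if "y \<in> Y" for y using Y(2) that N_D(1) by blast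
  have idY: "(\<lambda>y. y) \<in> Y \<rightarrow> carrier M" using Yc by auto
  have "indep Y (\<lambda>y. y)"
    unfolding indep_def
  proof (intro allI impI ballI, rule ccontr)
    fix c z assume c: "c \<in> Y \<rightarrow> carrier R" and 0: "(\<Oplus>\<^bsub>M\<^esub>y\<in>Y. c y \<odot>\<^bsub>M\<^esub> y) = \<zero>\<^bsub>M\<^esub>" and z: "z \<in> Y" "c z \<notin> p"
    have cc: "c y \<in> carrier R" if "y \<in> Y" for y using c that by auto
    \<comment> \<open>The least such \<open>k\<close> is the smallest valuation of a coefficient,
      attained at \<open>y0\<close> with unit \<open>u0\<close>.\<close>
    define K where "K k \<longleftrightarrow> (\<exists>y\<in>Y. \<exists>u\<in>carrier R. u \<notin> \<mm> \<and> c y \<ominus> u \<otimes> \<pi> [^] k \<in> p)" for k :: nat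
    have "\<exists>k. K k" using val_decomp[OF cc[OF z(1)] z(2)] z(1) unfolding K_def by blast
    hence "K (LEAST k. K k)" by (rule LeastI_ex)
    then obtain k y0 u0 where k: "k = (LEAST k. K k)" and y0: "y0 \<in> Y" and u0: "u0 \<in> carrier R" "u0 \<notin> \<mm>" "c y0 \<ominus> u0 \<otimes> \<pi> [^] k \<in> p"
      unfolding K_def by blast
    have ex: "\<exists>b\<in>carrier R. c y \<ominus> b \<otimes> \<pi> [^] k \<in> p" if y: "y \<in> Y" for y
    proof (cases "c y \<in> p")
      case True
      thus ?thesis using cc[OF y] \<pi>_carr by (intro bexI[of _ \<zero>]) (auto simp: R.minus_eq)
    next
      case False
      then obtain l :: nat and u where l: "u \<in> carrier R" "u \<notin> \<mm>" "c y \<ominus> u \<otimes> \<pi> [^] l \<in> p" using val_decomp[OF cc[OF y]] by blast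
      hence "K l" unfolding K_def using y by blast
      hence "k \<le> l" unfolding k by (rule Least_le)
      hence "u \<otimes> \<pi> [^] l = (u \<otimes> \<pi> [^] (l - k)) \<otimes> \<pi> [^] k"
        using l(1) \<pi>_carr by (simp add: m_assoc nat_pow_mult)
      thus ?thesis using l \<pi>_carr by (intro bexI[of _ "u \<otimes> \<pi> [^] (l - k)"]) auto
    qed
    have "\<exists>b. \<forall>y\<in>Y. b y \<in> carrier R \<and> c y \<ominus> b y \<otimes> \<pi> [^] k \<in> p" using ex by (intro bchoice) blast
    then obtain b0 where b0: "\<And>y. y \<in> Y \<Longrightarrow> b0 y \<in> carrier R \<and> c y \<ominus> b0 y \<otimes> \<pi> [^] k \<in> p" by blast
    define b where "b = b0(y0 := u0)"
    have b: "b y \<in> carrier R" "c y \<ominus> b y \<otimes> \<pi> [^] k \<in> p" if "y \<in> Y" for y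
      using b0[OF that] u0 unfolding b_def by auto
    have bY: "b \<in> Y \<rightarrow> carrier R" using b(1) by auto
    let ?s = "\<Oplus>\<^bsub>M\<^esub>y\<in>Y. b y \<odot>\<^bsub>M\<^esub> y"
    have sN: "?s \<in> N" by (rule finsum_mem_submodule[OF N_submodule Y(1)]) (use b(1) Y(2) N_smult in auto)
    have "(\<pi> [^] k) \<odot>\<^bsub>M\<^esub> ?s = (\<Oplus>\<^bsub>M\<^esub>y\<in>Y. (\<pi> [^] k \<otimes> b y) \<odot>\<^bsub>M\<^esub> y)"
      using finsum_smult_mult[OF Y(1) \<pi>_pow_carr bY idY] by simp
    also have "\<dots> = (\<Oplus>\<^bsub>M\<^esub>y\<in>Y. c y \<odot>\<^bsub>M\<^esub> y)"
    proof (rule M.finsum_cong'[OF refl finsum_smult_mem[OF c idY]])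
      fix y assume y: "y \<in> Y"
      have "c y \<odot>\<^bsub>M\<^esub> y = (b y \<otimes> \<pi> [^] k) \<odot>\<^bsub>M\<^esub> y"
        by (rule smult_cong_N) (use y cc b Y(2) \<pi>_carr in auto)
      thus "(\<pi> [^] k \<otimes> b y) \<odot>\<^bsub>M\<^esub> y = c y \<odot>\<^bsub>M\<^esub> y" using b(1)[OF y] \<pi>_pow_carr by (simp add: m_comm)
    qed
    finally have s0: "?s = \<zero>\<^bsub>M\<^esub>" using \<pi>_pow_regular_N[OF sN] 0 by metis
    let ?Z = "Y - {y0}"
    have Zc: "?Z \<subseteq> carrier M" using Yc by auto
    have ZS: "submodule (module_span R M ?Z) R M" by (rule span_submodule[OF Zc])
    let ?r = "\<Oplus>\<^bsub>M\<^esub>y\<in>?Z. b y \<odot>\<^bsub>M\<^esub> y"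
    have rS: "?r \<in> module_span R M ?Z"
      by (rule finsum_mem_submodule[OF ZS]) (use Y(1) b(1) span_superset[of ?Z] submodule_smult_mem[OF ZS] in auto)
    have rc: "?r \<in> carrier M" using submodule_mem_carrier[OF ZS rS] .
    have "?s = (\<Oplus>\<^bsub>M\<^esub>y\<in>insert y0 ?Z. b y \<odot>\<^bsub>M\<^esub> y)" using y0 by (simp add: insert_absorb)
    also have "\<dots> = b y0 \<odot>\<^bsub>M\<^esub> y0 \<oplus>\<^bsub>M\<^esub> ?r" using Y(1) b(1) Yc y0 by (intro M.finsum_insert) auto
    finally have "u0 \<odot>\<^bsub>M\<^esub> y0 \<oplus>\<^bsub>M\<^esub> ?r = \<zero>\<^bsub>M\<^esub>" using s0 by (simp add: b_def)
    hence "?r \<oplus>\<^bsub>M\<^esub> u0 \<odot>\<^bsub>M\<^esub> y0 \<in> module_span R M ?Z"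
      using rc u0(1) Yc[OF y0] submodule_zero_mem[OF ZS] by (simp add: M.a_comm)
    hence uy: "u0 \<odot>\<^bsub>M\<^esub> y0 \<in> module_span R M ?Z" using submodule_add_cancel[OF ZS rS] u0(1) Yc[OF y0] by simp
    obtain v where v: "v \<in> carrier R" "v \<otimes> u0 = \<one>" using unit_of_not_max[OF u0(1,2)] by blast
    have "y0 = v \<odot>\<^bsub>M\<^esub> (u0 \<odot>\<^bsub>M\<^esub> y0)" using v u0(1) Yc[OF y0] by (simp add: smult_assoc1[symmetric])
    hence "y0 \<in> module_span R M ?Z" using submodule_smult_mem[OF ZS v(1) uy] by simp
    hence "Y \<subseteq> module_span R M ?Z" using span_superset[of ?Z] by blast
    hence "N \<subseteq> module_span R M ?Z" unfolding Y(3)[symmetric] by (rule span_least[OF ZS])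
    moreover have "module_span R M ?Z \<subseteq> N" by (rule span_least[OF N_submodule]) (use Y(2) in auto)
    ultimately have "module_span R M ?Z = N" by blast
    moreover have "finite ?Z" "?Z \<subseteq> N" using Y(1,2) by auto
    ultimately have "card Y \<le> card ?Z" using min by blast
    thus False using y0 Y(1) by (metis card_Diff1_less not_less)
  qed
  thus ?thesis using Y unfolding basis_N_def by blast
qed

end

section \<open>The length of the congruence module\<close>

context gorenstein_dvr_point
begin

definition "x0 = (SOME x. x \<in> I \<and> I = PIdl x \<and> x \<notin> p \<and> (\<forall>a\<in>I. x \<noteq> \<pi> \<otimes> a))"

lemma x0: "x0 \<in> I" "I = PIdl x0" "x0 \<notin> p" "a \<in> I \<Longrightarrow> x0 \<noteq> \<pi> \<otimes> a"
proof -
  have "\<exists>x. x \<in> I \<and> I = PIdl x \<and> x \<notin> p \<and> (\<forall>a\<in>I. x \<noteq> \<pi> \<otimes> a)" using exists_I_generator by blast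
  from someI_ex[OF this] show "x0 \<in> I" "I = PIdl x0" "x0 \<notin> p" "a \<in> I \<Longrightarrow> x0 \<noteq> \<pi> \<otimes> a"
    unfolding x0_def[symmetric] by blast+
qed

lemma x0_carr: "x0 \<in> carrier R" using I_D(1)[OF x0(1)] .

text \<open>The valuation of the generator \<open>x0\<close> in the quotient by \<open>p\<close>. It
  turns out to be the length of the congruence module of the ring, see
  \<open>regular_congruence_length\<close>.\<close>

definition "cval = (SOME k :: nat. \<exists>u\<in>carrier R. u \<notin> \<mm> \<and> x0 \<ominus> u \<otimes> \<pi> [^] k \<in> p)"

lemma cval: "\<exists>u\<in>carrier R. u \<notin> \<mm> \<and> x0 \<ominus> u \<otimes> \<pi> [^] cval \<in> p"
  unfolding cval_def by (rule someI_ex[OF val_decomp[OF x0_carr x0(3)]])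

end

context depth_one_module
begin

abbreviation mulM :: "'a \<Rightarrow> 'c set \<Rightarrow> 'c set" where
  "mulM a U \<equiv> (\<lambda>y. a \<odot>\<^bsub>M\<^esub> y) ` U"

lemma mulM_submodule: "a \<in> carrier R \<Longrightarrow> submodule U R M \<Longrightarrow> submodule (mulM a U) R M"
  by (rule submodule_smult_image)

lemma sublen_mulM_eq:
  assumes a: "a \<in> carrier R" and U: "submodule U R M" "submodule U' R M" "U' \<subseteq> U"
    and inj: "\<And>u. u \<in> U \<Longrightarrow> a \<odot>\<^bsub>M\<^esub> u \<in> mulM a U' \<Longrightarrow> u \<in> U'"
  shows "sublen R M (mulM a U') (mulM a U) = sublen R M U' U"
  using sublen_lin_image_eq[OF module_axioms module_axioms smult_lin_map[OF a] U zero_submodule]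
    inj zero_set_add[OF mulM_submodule[OF a U(1)]] zero_set_add[OF mulM_submodule[OF a U(2)]] by simp

lemma basis_N_D:
  assumes "basis_N Y" shows "finite Y" "Y \<subseteq> N" "module_span R M Y = N" "indep Y (\<lambda>y. y)" "(\<lambda>y. y) \<in> Y \<rightarrow> carrier M"
  using assms N_D(1) unfolding basis_N_def by auto

lemma basis_N_repr:
  assumes Y: "basis_N Y" and w: "w \<in> N"
  shows "\<exists>c. c \<in> Y \<rightarrow> carrier R \<and> w = (\<Oplus>\<^bsub>M\<^esub>y\<in>Y. c y \<odot>\<^bsub>M\<^esub> y)"
  using span_image_finsum[OF basis_N_D(1)[OF Y] basis_N_D(5)[OF Y], of w] w basis_N_D(3)[OF Y] by simp

lemma basis_N_unique:
  assumes Y: "basis_N Y" and c: "c \<in> Y \<rightarrow> carrier R" "d \<in> Y \<rightarrow> carrier R"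
    and eq: "(\<Oplus>\<^bsub>M\<^esub>y\<in>Y. c y \<odot>\<^bsub>M\<^esub> y) = (\<Oplus>\<^bsub>M\<^esub>y\<in>Y. d y \<odot>\<^bsub>M\<^esub> y)" and y: "y \<in> Y"
  shows "c y \<ominus> d y \<in> p"
proof -
  note Yd = basis_N_D[OF Y]
  have "(\<Oplus>\<^bsub>M\<^esub>y\<in>Y. (c y \<ominus> d y) \<odot>\<^bsub>M\<^esub> y) = \<zero>\<^bsub>M\<^esub>"
    using finsum_smult_diff[OF Yd(1) c Yd(5)] eq M.finsum_closed[OF finsum_smult_mem[OF c(2) Yd(5)]]
    by (simp add: M.minus_eq M.r_neg)
  moreover have "(\<lambda>y. c y \<ominus> d y) \<in> Y \<rightarrow> carrier R" using c by (auto simp: Pi_iff)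
  ultimately show ?thesis using indepD[OF Yd(4), of "\<lambda>y. c y \<ominus> d y" y] y by blast
qed

text \<open>An instance of \<open>sublen_basis\<close> with \<open>J = \<mm>\<close>: the quotient
  of \<open>N\<close> by \<open>\<pi> N\<close> is a vector space over R/\<mm> with basis
  \<open>Y\<close>.\<close>

lemma sublen_\<pi>_N:
  assumes Y: "basis_N Y" shows "sublen R M (mulM \<pi> N) N = enat (card Y)"
proof -
  note Yd = basis_N_D[OF Y]
  have V: "submodule (mulM \<pi> N) R M" by (rule mulM_submodule[OF \<pi>_carr N_submodule])
  have VN: "mulM \<pi> N \<subseteq> N" using N_smult[OF \<pi>_carr] by auto
  have "sublen R M (mulM \<pi> N) (mulM \<pi> N <+>\<^bsub>M\<^esub> module_span R M ((\<lambda>y. y) ` Y))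
    = enat (card Y) * sublen R (regular_module R) \<mm> (carrier R)"
  proof (rule sublen_basis[OF max_ideal_ideal V Yd(1,5)])
    fix a y assume "a \<in> \<mm>" "y \<in> Y"
    hence "y \<in> N" "a \<in> \<mm>" using Yd(2) by auto
    then obtain b where "b \<in> carrier R" "a \<odot>\<^bsub>M\<^esub> y = \<pi> \<odot>\<^bsub>M\<^esub> (b \<odot>\<^bsub>M\<^esub> y)" using max_smult_N by blast
    thus "a \<odot>\<^bsub>M\<^esub> y \<in> mulM \<pi> N" using N_smult \<open>y \<in> N\<close> by auto
  next
    fix c y assume c: "c \<in> Y \<rightarrow> carrier R" and s: "(\<Oplus>\<^bsub>M\<^esub>y\<in>Y. c y \<odot>\<^bsub>M\<^esub> y) \<in> mulM \<pi> N" and y: "y \<in> Y"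
    obtain w where w: "w \<in> N" "(\<Oplus>\<^bsub>M\<^esub>y\<in>Y. c y \<odot>\<^bsub>M\<^esub> y) = \<pi> \<odot>\<^bsub>M\<^esub> w" using s by auto
    obtain d where d: "d \<in> Y \<rightarrow> carrier R" "w = (\<Oplus>\<^bsub>M\<^esub>y\<in>Y. d y \<odot>\<^bsub>M\<^esub> y)" using basis_N_repr[OF Y w(1)] by blast
    have d': "(\<lambda>y. \<pi> \<otimes> d y) \<in> Y \<rightarrow> carrier R" using d(1) \<pi>_carr by (auto simp: Pi_iff)
    have "(\<Oplus>\<^bsub>M\<^esub>y\<in>Y. c y \<odot>\<^bsub>M\<^esub> y) = (\<Oplus>\<^bsub>M\<^esub>y\<in>Y. (\<pi> \<otimes> d y) \<odot>\<^bsub>M\<^esub> y)"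
      using w(2) d finsum_smult_mult[OF Yd(1) \<pi>_carr d(1) Yd(5)] by simp
    from basis_N_unique[OF Y c d' this y] have "c y \<ominus> \<pi> \<otimes> d y \<in> \<mm>" using p_max by blast
    moreover have "\<pi> \<otimes> d y \<in> \<mm>" using ideal_mult_r[OF max_ideal_ideal _ \<pi>_max] d(1) y by (auto simp: Pi_iff)
    ultimately show "c y \<in> \<mm>" using ideal_diff_cancel[OF max_ideal_ideal] c y by (auto simp: Pi_iff)
  qed
  moreover have "mulM \<pi> N <+>\<^bsub>M\<^esub> N = N"
    using submodule_set_add_comm[OF V N_submodule] set_add_absorb[OF N_submodule V VN] by simp
  ultimately show ?thesis using Yd(3) sublen_max_ideal by simp
qed

text \<open>\<open>\<pi>\<close> is regular on \<open>N\<close>, so all graded pieces of the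
  filtration by powers of \<open>\<pi>\<close> have the length of the first one.\<close>

lemma sublen_\<pi>_pow_N:
  assumes Y: "basis_N Y" shows "sublen R M (mulM (\<pi> [^] (k::nat)) N) N = enat (k * card Y)"
proof (induction k)
  case 0
  have "mulM (\<pi> [^] (0::nat)) N = N" using N_D(1) by (auto simp: image_iff)
  thus ?case using sublen_refl[OF N_submodule] by (simp add: zero_enat_def)
next
  case (Suc k)
  let ?f = "mulM (\<pi> [^] k)"
  have V: "submodule (mulM \<pi> N) R M" by (rule mulM_submodule[OF \<pi>_carr N_submodule])
  have VN: "mulM \<pi> N \<subseteq> N" using N_smult[OF \<pi>_carr] by auto
  have eq: "mulM (\<pi> [^] Suc k) N = ?f (mulM \<pi> N)"
    using N_D(1) \<pi>_carr by (auto simp: image_iff smult_assoc1)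
  have "sublen R M (?f (mulM \<pi> N)) (?f N) = sublen R M (mulM \<pi> N) N"
  proof (rule sublen_mulM_eq[OF \<pi>_pow_carr N_submodule V VN])
    fix u assume u: "u \<in> N" "(\<pi> [^] k) \<odot>\<^bsub>M\<^esub> u \<in> ?f (mulM \<pi> N)"
    then obtain w where w: "w \<in> mulM \<pi> N" "(\<pi> [^] k) \<odot>\<^bsub>M\<^esub> u = (\<pi> [^] k) \<odot>\<^bsub>M\<^esub> w" by auto
    have wN: "w \<in> N" using w(1) VN by blast
    have c: "u \<in> carrier M" "w \<in> carrier M" using N_D(1) u(1) wN by auto
    have "(\<pi> [^] k) \<odot>\<^bsub>M\<^esub> (u \<ominus>\<^bsub>M\<^esub> w) = \<zero>\<^bsub>M\<^esub>"
      unfolding smult_diff_r[OF \<pi>_pow_carr c] w(2) using c \<pi>_pow_carr by (simp add: M.minus_eq M.r_neg)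
    hence "u \<ominus>\<^bsub>M\<^esub> w = \<zero>\<^bsub>M\<^esub>" using \<pi>_pow_regular_N submodule_diff_mem[OF N_submodule u(1) wN] by blast
    thus "u \<in> mulM \<pi> N" using M_minus_eq_0[OF c] w(1) by simp
  qed
  moreover have fN: "submodule (?f N) R M" "submodule (?f (mulM \<pi> N)) R M" "?f (mulM \<pi> N) \<subseteq> ?f N" "?f N \<subseteq> N"
    using mulM_submodule[OF \<pi>_pow_carr] N_submodule V VN N_smult[OF \<pi>_pow_carr] by auto
  moreover have "sublen R M (?f (mulM \<pi> N)) N = sublen R M (?f (mulM \<pi> N)) (?f N) + sublen R M (?f N) N"
    by (rule sublen_additive[OF fN(2,1) N_submodule fN(3,4)])
  ultimately show ?case using Suc.IH sublen_\<pi>_N[OF Y] unfolding eq by simp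
qed

lemma x0_smult_N: "y \<in> carrier M \<Longrightarrow> x0 \<odot>\<^bsub>M\<^esub> y \<in> N"
proof (rule N_I)
  assume y: "y \<in> carrier M"
  thus "x0 \<odot>\<^bsub>M\<^esub> y \<in> carrier M" using x0_carr by simp
  fix a assume a: "a \<in> p"
  show "a \<odot>\<^bsub>M\<^esub> (x0 \<odot>\<^bsub>M\<^esub> y) = \<zero>\<^bsub>M\<^esub>"
    using I_D(2)[OF x0(1) a] smult_assoc1[OF p_carr[OF a] x0_carr y] y by simp
qed

lemma x0_N_eq: "mulM x0 N = mulM (\<pi> [^] cval) N"
proof -
  obtain u where u: "u \<in> carrier R" "u \<notin> \<mm>" "x0 \<ominus> u \<otimes> \<pi> [^] cval \<in> p" using cval by blast
  obtain v where v: "v \<in> carrier R" "v \<otimes> u = \<one>" using unit_of_not_max[OF u(1,2)] by blast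
  have xu: "x0 \<odot>\<^bsub>M\<^esub> y = (\<pi> [^] cval) \<odot>\<^bsub>M\<^esub> (u \<odot>\<^bsub>M\<^esub> y)" if y: "y \<in> N" for y
  proof -
    have "x0 \<odot>\<^bsub>M\<^esub> y = (u \<otimes> \<pi> [^] cval) \<odot>\<^bsub>M\<^esub> y"
      by (rule smult_cong_N) (use u x0_carr \<pi>_carr y in auto)
    also have "\<dots> = (\<pi> [^] cval \<otimes> u) \<odot>\<^bsub>M\<^esub> y" using u(1) \<pi>_pow_carr by (simp add: m_comm)
    finally show ?thesis using u(1) \<pi>_pow_carr N_D(1)[OF y] by (simp add: smult_assoc1)
  qed
  show ?thesis
  proof
    show "mulM x0 N \<subseteq> mulM (\<pi> [^] cval) N" using xu N_smult[OF u(1)] by auto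
    show "mulM (\<pi> [^] cval) N \<subseteq> mulM x0 N"
    proof
      fix z assume "z \<in> mulM (\<pi> [^] cval) N"
      then obtain y where y: "y \<in> N" "z = (\<pi> [^] cval) \<odot>\<^bsub>M\<^esub> y" by auto
      have "u \<odot>\<^bsub>M\<^esub> (v \<odot>\<^bsub>M\<^esub> y) = (v \<otimes> u) \<odot>\<^bsub>M\<^esub> y" using u(1) v(1) N_D(1)[OF y(1)] by (simp add: smult_assoc1[symmetric] m_comm)
      hence "u \<odot>\<^bsub>M\<^esub> (v \<odot>\<^bsub>M\<^esub> y) = y" using v(2) N_D(1)[OF y(1)] by simp
      hence "z = x0 \<odot>\<^bsub>M\<^esub> (v \<odot>\<^bsub>M\<^esub> y)" using xu[OF N_smult[OF v(1) y(1)]] y(2) by simp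
      thus "z \<in> mulM x0 N" using N_smult[OF v(1) y(1)] by blast
    qed
  qed
qed

lemma ann_I_eq: "ann_in M I = {y \<in> carrier M. x0 \<odot>\<^bsub>M\<^esub> y = \<zero>\<^bsub>M\<^esub>}"
proof -
  have "a \<odot>\<^bsub>M\<^esub> y = \<zero>\<^bsub>M\<^esub>" if *: "y \<in> carrier M" "x0 \<odot>\<^bsub>M\<^esub> y = \<zero>\<^bsub>M\<^esub>" "a \<in> I" for a y
  proof -
    obtain r where "r \<in> carrier R" "a = r \<otimes> x0" using *(3) x0(2) PIdl_mem by blast
    thus ?thesis using * x0_carr by (simp add: smult_assoc1)
  qed
  thus ?thesis using x0(1) by (auto simp: ann_in_def)
qed

lemma ann_I_submodule: "submodule (ann_in M I) R M"
proof -
  have "submodule {u \<in> carrier M. x0 \<odot>\<^bsub>M\<^esub> u \<in> {\<zero>\<^bsub>M\<^esub>}} R M"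
    by (rule submodule_lin_vimage[OF module_axioms module_axioms smult_lin_map[OF x0_carr] carrier_is_submodule zero_submodule])
  thus ?thesis by (simp add: ann_I_eq)
qed

lemma x0_M_submodule: "submodule (mulM x0 (carrier M)) R M" "mulM x0 (carrier M) \<subseteq> N"
  using mulM_submodule[OF x0_carr carrier_is_submodule] x0_smult_N by auto

text \<open>Multiplication by \<open>x0\<close> identifies \<open>M/(M[p] + M[I])\<close> with \<open>x0 M / x0 M[p]\<close>, and \<open>x0\<close> acts on \<open>M[p]\<close> as
  \<open>\<pi> [^] cval\<close> up to a unit.\<close>

lemma congruence_length:
  assumes Y: "basis_N Y"
  shows "sublen R M (N <+>\<^bsub>M\<^esub> ann_in M I) (carrier M) + sublen R M (mulM x0 (carrier M)) N = enat (cval * card Y)"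
proof -
  let ?U = "N <+>\<^bsub>M\<^esub> ann_in M I"
  have U: "submodule ?U R M" by (rule submodule_set_add[OF N_submodule ann_I_submodule])
  have im: "mulM x0 ?U = mulM x0 N"
  proof
    show "mulM x0 N \<subseteq> mulM x0 ?U" by (rule image_mono[OF set_add_upper1[OF N_submodule ann_I_submodule]])
    show "mulM x0 ?U \<subseteq> mulM x0 N"
    proof
      fix z assume "z \<in> mulM x0 ?U"
      then obtain y k where yk: "y \<in> N" "k \<in> ann_in M I" "z = x0 \<odot>\<^bsub>M\<^esub> (y \<oplus>\<^bsub>M\<^esub> k)" by (auto simp: mem_set_add)
      hence "z = x0 \<odot>\<^bsub>M\<^esub> y" using x0_carr N_D(1)[OF yk(1)] by (simp add: ann_I_eq smult_r_distr)
      thus "z \<in> mulM x0 N" using yk(1) by blast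
    qed
  qed
  have "sublen R M (mulM x0 ?U) (mulM x0 (carrier M)) = sublen R M ?U (carrier M)"
  proof (rule sublen_mulM_eq[OF x0_carr carrier_is_submodule U submodule_subset[OF U]])
    fix u assume u: "u \<in> carrier M" "x0 \<odot>\<^bsub>M\<^esub> u \<in> mulM x0 ?U"
    then obtain y where y: "y \<in> N" "x0 \<odot>\<^bsub>M\<^esub> u = x0 \<odot>\<^bsub>M\<^esub> y" unfolding im by auto
    have yc: "y \<in> carrier M" using N_D(1)[OF y(1)] .
    have "x0 \<odot>\<^bsub>M\<^esub> (u \<ominus>\<^bsub>M\<^esub> y) = \<zero>\<^bsub>M\<^esub>"
      unfolding smult_diff_r[OF x0_carr u(1) yc] y(2) using x0_carr yc by (simp add: M.minus_eq M.r_neg)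
    hence "u \<ominus>\<^bsub>M\<^esub> y \<in> ann_in M I" using u(1) yc by (simp add: ann_I_eq)
    moreover have "u = y \<oplus>\<^bsub>M\<^esub> (u \<ominus>\<^bsub>M\<^esub> y)" using u(1) yc by (simp add: M.minus_eq M.a_ac M.r_neg1 M.r_neg2 M.r_neg)
    ultimately show "u \<in> ?U" using y(1) unfolding mem_set_add by blast
  qed
  moreover have "sublen R M (mulM x0 N) N = sublen R M (mulM x0 N) (mulM x0 (carrier M)) + sublen R M (mulM x0 (carrier M)) N"
    by (rule sublen_additive[OF mulM_submodule[OF x0_carr N_submodule] x0_M_submodule(1) N_submodule _ x0_M_submodule(2)])
      (use N_D(1) in auto)
  ultimately show ?thesis using sublen_\<pi>_pow_N[OF Y, of cval] unfolding im x0_N_eq[symmetric] by simp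
qed

text \<open>The two lengths in \<open>congruence_length\<close> have a finite sum, so
  \<open>the_enat\<close> is faithful here. The inequality says that the second one is zero.\<close>

lemma congruence_length_ge_iff:
  assumes Y: "basis_N Y"
  shows "cval * card Y \<le> the_enat (sublen R M (N <+>\<^bsub>M\<^esub> ann_in M I) (carrier M)) \<longleftrightarrow> mulM x0 (carrier M) = N"
proof -
  obtain i j where ij: "sublen R M (N <+>\<^bsub>M\<^esub> ann_in M I) (carrier M) = enat i" "sublen R M (mulM x0 (carrier M)) N = enat j"
    using congruence_length[OF Y] by (metis enat.exhaust plus_enat_simps(2,3) enat.distinct(1))
  have sum: "i + j = cval * card Y" using congruence_length[OF Y] ij by simp
  have "j = 0 \<longleftrightarrow> mulM x0 (carrier M) = N"
  proof
    assume "j = 0"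
    thus "mulM x0 (carrier M) = N"
      using sublen_eq_0[OF x0_M_submodule(1) N_submodule x0_M_submodule(2)] ij(2) by (simp add: zero_enat_def)
  next
    assume "mulM x0 (carrier M) = N"
    thus "j = 0" using ij(2) sublen_refl[OF N_submodule] by (simp add: zero_enat_def)
  qed
  thus ?thesis using sum ij by auto
qed

section \<open>Lifting a basis\<close>

context
  fixes Y g
  assumes Y: "basis_N Y" and g: "\<And>y. y \<in> Y \<Longrightarrow> g y \<in> carrier M \<and> x0 \<odot>\<^bsub>M\<^esub> g y = y"
begin

lemma finY: "finite Y" and YN: "Y \<subseteq> N" and idY: "(\<lambda>y. y) \<in> Y \<rightarrow> carrier M" and gY: "g \<in> Y \<rightarrow> carrier M"
  using basis_N_D[OF Y] g by auto

abbreviation comb :: "('c \<Rightarrow> 'a) \<Rightarrow> 'c" where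
  "comb a \<equiv> \<Oplus>\<^bsub>M\<^esub>y\<in>Y. a y \<odot>\<^bsub>M\<^esub> g y"

lemma comb_carr: "a \<in> Y \<rightarrow> carrier R \<Longrightarrow> comb a \<in> carrier M"
  by (rule M.finsum_closed[OF finsum_smult_mem[OF _ gY]])

text \<open>A relation modulo \<open>t\<close> can be moved into the socle of \<open>R/t\<close>, where it becomes a relation in \<open>M[p]\<close>.\<close>

lemma comb_mem_tM:
  assumes t: "reg_elt t" and a: "a \<in> Y \<rightarrow> carrier R" and w0: "comb a \<in> mulM t (carrier M)" and j: "j \<in> Y"
  shows "a j \<in> PIdl t"
proof (rule ccontr)
  assume n: "a j \<notin> PIdl t"
  have tc: "t \<in> carrier R" using reg_elt_D(2)[OF t] .
  have ac: "a y \<in> carrier R" if "y \<in> Y" for y using a that by auto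
  have Pt: "ideal (PIdl t) R" "t \<in> PIdl t" using cgenideal_ideal cgenideal_self tc by auto
  obtain k u where u: "u \<in> carrier R" "u \<notin> \<mm>" "t \<ominus> u \<otimes> \<pi> [^] Suc k \<in> p" using reg_elt_val[OF t] by blast
  define s where "s = \<pi> [^] k \<otimes> x0"
  have s: "s \<in> carrier R" "s \<notin> PIdl t" "\<And>z. z \<in> \<mm> \<Longrightarrow> z \<otimes> s \<in> PIdl t"
    using socle_elt[OF t u x0(1)] x0(4) x0_carr \<pi>_carr unfolding s_def by auto
  define D where "D = module_span R (regular_module R) (a ` Y)"
  have aY: "a ` Y \<subseteq> carrier (regular_module R)" using ac by auto
  have D: "submodule D R (regular_module R)" unfolding D_def by (rule RM.span_submodule[OF aY])
  have Dfg: "fg_sub R (regular_module R) D" unfolding fg_sub_def D_def using finY aY by blast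
  have aD: "a y \<in> D" if "y \<in> Y" for y unfolding D_def using that by (intro set_mp[OF RM.span_superset]) auto
  have mD: "submodule (RM.idmul \<mm> D) R (regular_module R)"
    using RM.submodule_idmul[of \<mm> D] max_carr RM.submodule_subset[OF D] by auto
  have Ps: "submodule (PIdl t) R (regular_module R)" using Pt by (simp add: submodule_regular_iff)
  \<comment> \<open>Modulo \<open>t\<close>, \<open>J\<close> is \<mm> times the ideal
    \<open>D\<close> of all coefficients. By Nakayama's lemma some coefficient stays outside, and an
    element \<open>b\<close> that carries \<open>J\<close> into \<open>t R\<close> moves all
    coefficients into the socle modulo \<open>t\<close>.\<close>
  define J where "J = RM.idmul \<mm> D <+>\<^bsub>regular_module R\<^esub> PIdl t"
  have Js: "submodule J R (regular_module R)" unfolding J_def by (rule RM.submodule_set_add[OF mD Ps])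
  hence Ji: "ideal J R" by (simp add: submodule_regular_iff)
  have PJ: "PIdl t \<subseteq> J" unfolding J_def by (rule RM.set_add_upper2[OF mD Ps])
  have "\<exists>j'\<in>Y. a j' \<notin> J"
  proof (rule ccontr)
    assume "\<not> ?thesis"
    hence "a ` Y \<subseteq> J" by auto
    hence "D \<subseteq> RM.idmul \<mm> D <+>\<^bsub>regular_module R\<^esub> PIdl t"
      unfolding J_def[symmetric] using RM.span_least[OF Js] unfolding D_def by blast
    from RM.nakayama[OF Dfg Ps this] show False using aD[OF j] n by blast
  qed
  then obtain j' where j': "j' \<in> Y" "a j' \<notin> J" by blast
  obtain b where b: "b \<in> carrier R" "\<And>z. z \<in> J \<Longrightarrow> z \<otimes> b \<in> PIdl t" "a j' \<otimes> b \<ominus> s \<in> PIdl t"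
    using double_ann[OF t s Ji set_mp[OF PJ Pt(2)] ac[OF j'(1)] j'(2)] by blast
  have soc: "z \<otimes> (a y \<otimes> b) \<in> PIdl t" if z: "z \<in> \<mm>" and y: "y \<in> Y" for z y
  proof -
    have "z \<otimes> a y \<in> J" unfolding J_def using RM.idmul_mem[OF z aD[OF y]] RM.set_add_upper1[OF mD Ps] by auto
    thus ?thesis using b(2)[of "z \<otimes> a y"] max_carr[OF z] ac[OF y] b(1) by (simp add: m_assoc)
  qed
  \<comment> \<open>The socle modulo \<open>t\<close> is generated by \<open>s\<close>, again by the
    double annihilator, so each new coefficient is a multiple \<open>e y\<close> of
    \<open>s\<close>.\<close>
  have ex: "\<exists>e\<in>carrier R. a y \<otimes> b \<ominus> e \<otimes> s \<in> PIdl t" if y: "y \<in> Y" for y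
  proof (cases "a y \<otimes> b \<in> PIdl t")
    case True
    thus ?thesis using s(1) ac[OF y] b(1) by (intro bexI[of _ \<zero>]) (auto simp: R.minus_eq)
  next
    case False
    have ab: "a y \<otimes> b \<in> carrier R" using ac[OF y] b(1) by simp
    obtain b' where b': "b' \<in> carrier R" "(a y \<otimes> b) \<otimes> b' \<ominus> s \<in> PIdl t" using double_ann[OF t s Pt ab False] by blast
    have "b' \<notin> \<mm>"
    proof
      assume "b' \<in> \<mm>"
      hence "(a y \<otimes> b) \<otimes> b' \<in> PIdl t" using soc[OF _ y] m_comm[OF ab b'(1)] by simp
      hence "(a y \<otimes> b) \<otimes> b' \<ominus> ((a y \<otimes> b) \<otimes> b' \<ominus> s) \<in> PIdl t" using ideal_diff[OF Pt(1) _ b'(2)] by blast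
      moreover have "(a y \<otimes> b) \<otimes> b' \<ominus> ((a y \<otimes> b) \<otimes> b' \<ominus> s) = s"
        using ab b'(1) s(1) by (simp add: R.minus_eq R.minus_add R.a_assoc[symmetric] R.r_neg)
      ultimately show False using s(2) by simp
    qed
    then obtain v where v: "v \<in> carrier R" "b' \<otimes> v = \<one>" using unit_of_not_max[OF b'(1)] by blast
    have "((a y \<otimes> b) \<otimes> b' \<ominus> s) \<otimes> v = a y \<otimes> b \<ominus> v \<otimes> s"
    proof -
      have "((a y \<otimes> b) \<otimes> b') \<otimes> v = a y \<otimes> b" using v ab b'(1) by (simp add: m_assoc[of "a y \<otimes> b" b' v])
      thus ?thesis using ab b'(1) v(1) s(1) m_comm[OF s(1) v(1)] by (simp add: R.minus_eq l_distr l_minus)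
    qed
    hence "a y \<otimes> b \<ominus> v \<otimes> s \<in> PIdl t" using ideal_mult_r[OF Pt(1) v(1) b'(2)] by simp
    thus ?thesis using v(1) by blast
  qed
  then obtain e where e: "\<And>y. y \<in> Y \<Longrightarrow> e y \<in> carrier R \<and> a y \<otimes> b \<ominus> e y \<otimes> s \<in> PIdl t" by metis
  have ej: "e j' \<notin> \<mm>"
  proof
    assume "e j' \<in> \<mm>"
    hence "e j' \<otimes> s \<in> PIdl t" by (rule s(3))
    moreover have "a j' \<otimes> b \<ominus> e j' \<otimes> s \<in> PIdl t" using e[OF j'(1)] by blast
    moreover have "a j' \<otimes> b \<in> carrier R" using ac[OF j'(1)] b(1) by simp
    ultimately have "a j' \<otimes> b \<in> PIdl t" using ideal_diff_cancel[OF Pt(1)] by blast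
    hence "a j' \<otimes> b \<ominus> (a j' \<otimes> b \<ominus> s) \<in> PIdl t" using ideal_diff[OF Pt(1) _ b(3)] by blast
    moreover have "a j' \<otimes> b \<ominus> (a j' \<otimes> b \<ominus> s) = s"
      using ac[OF j'(1)] b(1) s(1) by (simp add: R.minus_eq R.minus_add R.a_assoc[symmetric] R.r_neg)
    ultimately show False using s(2) by simp
  qed
  have tM: "submodule (mulM t (carrier M)) R M" by (rule mulM_submodule[OF tc carrier_is_submodule])
  have ab: "(\<lambda>y. b \<otimes> a y) \<in> Y \<rightarrow> carrier R" "(\<lambda>y. e y \<otimes> s) \<in> Y \<rightarrow> carrier R" using ac b(1) e s(1) by auto
  have "comb (\<lambda>y. b \<otimes> a y) = b \<odot>\<^bsub>M\<^esub> comb a" by (rule finsum_smult_mult[OF finY b(1) a gY])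
  hence 1: "comb (\<lambda>y. b \<otimes> a y) \<in> mulM t (carrier M)" using submodule_smult_mem[OF tM b(1) w0] by simp
  have "comb (\<lambda>y. b \<otimes> a y \<ominus> e y \<otimes> s) \<in> mulM t (carrier M)"
  proof (rule finsum_mem_submodule[OF tM finY])
    fix y assume y: "y \<in> Y"
    have "b \<otimes> a y \<ominus> e y \<otimes> s \<in> PIdl t" using e[OF y] m_comm[OF b(1) ac[OF y]] by simp
    then obtain r where r: "r \<in> carrier R" "b \<otimes> a y \<ominus> e y \<otimes> s = r \<otimes> t" unfolding PIdl_mem by blast
    have "(r \<otimes> t) \<odot>\<^bsub>M\<^esub> g y = t \<odot>\<^bsub>M\<^esub> (r \<odot>\<^bsub>M\<^esub> g y)" using r(1) tc g[OF y] by (metis smult_assoc1 m_comm)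
    thus "(b \<otimes> a y \<ominus> e y \<otimes> s) \<odot>\<^bsub>M\<^esub> g y \<in> mulM t (carrier M)" unfolding r(2) using r(1) g[OF y] by auto
  qed
  hence "comb (\<lambda>y. b \<otimes> a y) \<ominus>\<^bsub>M\<^esub> comb (\<lambda>y. e y \<otimes> s) \<in> mulM t (carrier M)"
    using finsum_smult_diff[OF finY ab gY] by simp
  hence "comb (\<lambda>y. b \<otimes> a y) \<ominus>\<^bsub>M\<^esub> (comb (\<lambda>y. b \<otimes> a y) \<ominus>\<^bsub>M\<^esub> comb (\<lambda>y. e y \<otimes> s)) \<in> mulM t (carrier M)"
    using submodule_diff_mem[OF tM 1] by blast
  moreover have "comb (\<lambda>y. b \<otimes> a y) \<ominus>\<^bsub>M\<^esub> (comb (\<lambda>y. b \<otimes> a y) \<ominus>\<^bsub>M\<^esub> comb (\<lambda>y. e y \<otimes> s)) = comb (\<lambda>y. e y \<otimes> s)"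
    using comb_carr[OF ab(1)] comb_carr[OF ab(2)] by (simp add: M.minus_eq M.minus_add M.a_assoc[symmetric] M.r_neg)
  ultimately obtain w where w: "w \<in> carrier M" "comb (\<lambda>y. e y \<otimes> s) = t \<odot>\<^bsub>M\<^esub> w" by auto
  \<comment> \<open>From \<open>s = \<pi>^k x0\<close> and \<open>x0 g y = y\<close>, the
    combination of the lifts becomes a combination of the basis of \<open>N\<close>.\<close>
  let ?d = "\<lambda>y. e y \<otimes> \<pi> [^] k"
  have d: "?d \<in> Y \<rightarrow> carrier R" using e \<pi>_carr by auto
  have "comb (\<lambda>y. e y \<otimes> s) = (\<Oplus>\<^bsub>M\<^esub>y\<in>Y. ?d y \<odot>\<^bsub>M\<^esub> y)"
  proof (rule M.finsum_cong'[OF refl finsum_smult_mem[OF d idY]])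
    fix y assume y: "y \<in> Y"
    have "e y \<otimes> s = ?d y \<otimes> x0" unfolding s_def using e[OF y] \<pi>_carr x0_carr by (simp add: m_assoc)
    thus "(e y \<otimes> s) \<odot>\<^bsub>M\<^esub> g y = ?d y \<odot>\<^bsub>M\<^esub> y" using g[OF y] e[OF y] \<pi>_carr x0_carr by (simp add: smult_assoc1)
  qed
  hence w2: "(\<Oplus>\<^bsub>M\<^esub>y\<in>Y. ?d y \<odot>\<^bsub>M\<^esub> y) = t \<odot>\<^bsub>M\<^esub> w" using w(2) by simp
  have twN: "t \<odot>\<^bsub>M\<^esub> w \<in> N" unfolding w2[symmetric]
    by (rule finsum_mem_submodule[OF N_submodule finY]) (use d YN N_smult in \<open>auto simp: Pi_iff\<close>)
  \<comment> \<open>\<open>p\<close> kills \<open>t w\<close>, and \<open>t\<close> is regular on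
    \<open>M\<close>.\<close>
  have wN: "w \<in> N"
  proof (rule N_I[OF w(1)])
    fix q assume q: "q \<in> p"
    have qc: "q \<in> carrier R" using p_carr[OF q] .
    have "t \<odot>\<^bsub>M\<^esub> (q \<odot>\<^bsub>M\<^esub> w) = q \<odot>\<^bsub>M\<^esub> (t \<odot>\<^bsub>M\<^esub> w)" using qc tc w(1) by (metis smult_assoc1 m_comm)
    hence "t \<odot>\<^bsub>M\<^esub> (q \<odot>\<^bsub>M\<^esub> w) = \<zero>\<^bsub>M\<^esub>" using N_D(2)[OF twN q] by simp
    thus "q \<odot>\<^bsub>M\<^esub> w = \<zero>\<^bsub>M\<^esub>" using reg_elt_M[OF t] qc w(1) by simp
  qed
  obtain f where f: "f \<in> Y \<rightarrow> carrier R" "w = (\<Oplus>\<^bsub>M\<^esub>y\<in>Y. f y \<odot>\<^bsub>M\<^esub> y)" using basis_N_repr[OF Y wN] by blast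
  have uk: "u \<otimes> \<pi> [^] Suc k \<in> carrier R" using u(1) \<pi>_carr by simp
  have "t \<odot>\<^bsub>M\<^esub> w = (u \<otimes> \<pi> [^] Suc k) \<odot>\<^bsub>M\<^esub> w" by (rule smult_cong_N[OF tc uk u(3) wN])
  hence "(\<Oplus>\<^bsub>M\<^esub>y\<in>Y. ?d y \<odot>\<^bsub>M\<^esub> y) = (\<Oplus>\<^bsub>M\<^esub>y\<in>Y. (u \<otimes> \<pi> [^] Suc k \<otimes> f y) \<odot>\<^bsub>M\<^esub> y)"
    using w2 f(2) finsum_smult_mult[OF finY uk f(1) idY] by simp
  \<comment> \<open>On \<open>N\<close> the element \<open>t\<close> has valuation
    \<open>k + 1\<close>, one more than the factor \<open>\<pi>^k\<close> on the other side. So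
    \<open>e j'\<close> would be divisible by \<open>\<pi>\<close> modulo \<open>p\<close>, although
    it is a unit.\<close>
  from basis_N_unique[OF Y d _ this j'(1)] have
    "e j' \<otimes> \<pi> [^] k \<ominus> u \<otimes> \<pi> [^] Suc k \<otimes> f j' \<in> p" using uk f(1) by (auto simp: Pi_iff)
  moreover have fj: "f j' \<in> carrier R" "e j' \<in> carrier R" using f(1) e j'(1) by auto
  have "e j' \<otimes> \<pi> [^] k \<ominus> u \<otimes> \<pi> [^] Suc k \<otimes> f j' = (e j' \<ominus> \<pi> \<otimes> (u \<otimes> f j')) \<otimes> \<pi> [^] k"
  proof -
    have "u \<otimes> \<pi> [^] Suc k \<otimes> f j' = \<pi> \<otimes> (u \<otimes> f j') \<otimes> \<pi> [^] k" using fj u(1) \<pi>_carr by (simp add: m_ac)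
    thus ?thesis using fj u(1) \<pi>_carr by (simp add: R.minus_eq l_distr l_minus)
  qed
  ultimately have "(e j' \<ominus> \<pi> \<otimes> (u \<otimes> f j')) \<otimes> \<pi> [^] k \<in> p" by simp
  hence "e j' \<ominus> \<pi> \<otimes> (u \<otimes> f j') \<in> p" using prime_mult[OF p_prime _ \<pi>_pow_carr] fj u(1) \<pi>_carr \<pi>_pow_p by auto
  hence "e j' \<ominus> \<pi> \<otimes> (u \<otimes> f j') \<in> \<mm>" using p_max by blast
  moreover have "\<pi> \<otimes> (u \<otimes> f j') \<in> \<mm>" using ideal_mult_r[OF max_ideal_ideal _ \<pi>_max] fj u(1) by simp
  ultimately have "e j' \<in> \<mm>" using ideal_diff_cancel[OF max_ideal_ideal fj(2)] by blast
  thus False using ej by simp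
qed

text \<open>The coefficients at \<open>j\<close> of all relations form an ideal \<open>L\<close>. By
  \<open>comb_mem_tM\<close> each relation is \<open>t\<close> times another one, so
  \<open>L\<close> is contained in \<mm> times \<open>L\<close> and vanishes by Nakayama's
  lemma.\<close>

lemma comb_independent:
  assumes a: "a \<in> Y \<rightarrow> carrier R" "comb a = \<zero>\<^bsub>M\<^esub>" and j: "j \<in> Y" shows "a j = \<zero>"
proof -
  obtain t where t: "reg_elt t" using exists_reg_elt by blast
  have tc: "t \<in> carrier R" using reg_elt_D(2)[OF t] .
  define L where "L = {a j |a. a \<in> Y \<rightarrow> carrier R \<and> comb a = \<zero>\<^bsub>M\<^esub>}"
  have L_I: "c j \<in> L" if "c \<in> Y \<rightarrow> carrier R" "comb c = \<zero>\<^bsub>M\<^esub>" for c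
    unfolding L_def using that by blast
  have Lc: "L \<subseteq> carrier R" using j by (auto simp: L_def)
  have L: "ideal L R"
  proof (rule idealI2[OF Lc])
    have "comb (\<lambda>_. \<zero>) = \<zero>\<^bsub>M\<^esub>" by (rule finsum_smult_zero[OF finY]) (use g in auto)
    thus "\<zero> \<in> L" unfolding L_def by (auto intro!: exI[of _ "\<lambda>_. \<zero>"])
    { fix x y assume "x \<in> L" "y \<in> L"
      then obtain a b where ab: "a \<in> Y \<rightarrow> carrier R" "comb a = \<zero>\<^bsub>M\<^esub>" "x = a j" "b \<in> Y \<rightarrow> carrier R" "comb b = \<zero>\<^bsub>M\<^esub>" "y = b j"
        unfolding L_def by blast
      have "comb (\<lambda>y. a y \<oplus> b y) = \<zero>\<^bsub>M\<^esub>" using finsum_smult_add[OF ab(1,4) gY] ab by simp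
      moreover have "(\<lambda>y. a y \<oplus> b y) \<in> Y \<rightarrow> carrier R" using ab by (auto simp: Pi_iff)
      ultimately show "x \<oplus> y \<in> L" unfolding ab(3,6) using L_I[of "\<lambda>y. a y \<oplus> b y"] by simp }
    { fix r x assume r: "r \<in> carrier R" and "x \<in> L"
      then obtain a where ab: "a \<in> Y \<rightarrow> carrier R" "comb a = \<zero>\<^bsub>M\<^esub>" "x = a j" unfolding L_def by blast
      have "comb (\<lambda>y. r \<otimes> a y) = \<zero>\<^bsub>M\<^esub>" using finsum_smult_mult[OF finY r ab(1) gY] ab r by simp
      moreover have "(\<lambda>y. r \<otimes> a y) \<in> Y \<rightarrow> carrier R" using ab r by (auto simp: Pi_iff)
      ultimately show "r \<otimes> x \<in> L" unfolding ab(3) using L_I[of "\<lambda>y. r \<otimes> a y"] by simp }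
  qed
  have Ls: "submodule L R (regular_module R)" using L by (simp add: submodule_regular_iff)
  have mL: "submodule (RM.idmul \<mm> L) R (regular_module R)" using RM.submodule_idmul[of \<mm> L] max_carr Lc by auto
  have "L \<subseteq> RM.idmul \<mm> L <+>\<^bsub>regular_module R\<^esub> {\<zero>\<^bsub>regular_module R\<^esub>}"
  proof
    fix x assume "x \<in> L"
    then obtain a where a: "a \<in> Y \<rightarrow> carrier R" "comb a = \<zero>\<^bsub>M\<^esub>" "x = a j" unfolding L_def by blast
    have "t \<odot>\<^bsub>M\<^esub> \<zero>\<^bsub>M\<^esub> = \<zero>\<^bsub>M\<^esub>" using tc by simp
    hence "comb a \<in> mulM t (carrier M)" unfolding a(2) by (metis M.zero_closed imageI)
    hence "\<exists>r\<in>carrier R. a y = t \<otimes> r" if "y \<in> Y" for y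
      using comb_mem_tM[OF t a(1) _ that] m_comm[OF tc] unfolding PIdl_mem by auto
    then obtain r where r: "\<And>y. y \<in> Y \<Longrightarrow> r y \<in> carrier R \<and> a y = t \<otimes> r y" by metis
    have rY: "r \<in> Y \<rightarrow> carrier R" using r by auto
    have "t \<odot>\<^bsub>M\<^esub> comb r = comb (\<lambda>y. t \<otimes> r y)" using finsum_smult_mult[OF finY tc rY gY] by simp
    also have "\<dots> = comb a" using r g tc by (intro M.finsum_cong') auto
    finally have "comb r = \<zero>\<^bsub>M\<^esub>" using reg_elt_M[OF t comb_carr[OF rY]] a(2) by simp
    hence "r j \<in> L" unfolding L_def using rY by blast
    hence "x \<in> RM.idmul \<mm> L" using RM.idmul_mem[OF reg_elt_D(1)[OF t]] r[OF j] a(3) by simp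
    thus "x \<in> RM.idmul \<mm> L <+>\<^bsub>regular_module R\<^esub> {\<zero>\<^bsub>regular_module R\<^esub>}" using RM.set_add_zero[OF mL] by simp
  qed
  from RM.nakayama[OF fg_sub_ideal[OF L] RM.zero_submodule this] have "L \<subseteq> {\<zero>}" by simp
  thus ?thesis using a unfolding L_def by blast
qed

text \<open>If \<open>a j\<close> were outside \<open>Q\<close>, a double annihilator
  \<open>b\<close> would carry \<open>Q\<close> into \<open>t R\<close> and \<open>a j\<close> to
  the socle element \<open>s\<close> modulo \<open>t\<close>. Then \<open>b\<close> times the
  combination lies in \<open>t M\<close> while its coefficient \<open>b a j\<close> is not in
  \<open>t R\<close>, against \<open>comb_mem_tM\<close>.\<close>

lemma comb_mem_idmul:
  assumes Q: "ideal Q R" and t: "reg_elt t" "t \<in> Q" and a: "a \<in> Y \<rightarrow> carrier R"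
    and mem: "comb a \<in> idmul Q (carrier M)" and j: "j \<in> Y"
  shows "a j \<in> Q"
proof (rule ccontr)
  assume n: "a j \<notin> Q"
  have tc: "t \<in> carrier R" using reg_elt_D(2)[OF t(1)] .
  have ac: "a y \<in> carrier R" if "y \<in> Y" for y using a that by auto
  have Pt: "ideal (PIdl t) R" using cgenideal_ideal tc by auto
  obtain k u where u: "u \<in> carrier R" "u \<notin> \<mm>" "t \<ominus> u \<otimes> \<pi> [^] Suc k \<in> p" using reg_elt_val[OF t(1)] by blast
  define s where "s = \<pi> [^] k \<otimes> x0"
  have s: "s \<in> carrier R" "s \<notin> PIdl t" "\<And>z. z \<in> \<mm> \<Longrightarrow> z \<otimes> s \<in> PIdl t"
    using socle_elt[OF t(1) u x0(1)] x0(4) x0_carr \<pi>_carr unfolding s_def by auto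
  obtain b where b: "b \<in> carrier R" "\<And>z. z \<in> Q \<Longrightarrow> z \<otimes> b \<in> PIdl t" "a j \<otimes> b \<ominus> s \<in> PIdl t"
    using double_ann[OF t(1) s Q t(2) ac[OF j] n] by blast
  have tM: "submodule (mulM t (carrier M)) R M" by (rule mulM_submodule[OF tc carrier_is_submodule])
  have "submodule {z \<in> carrier M. b \<odot>\<^bsub>M\<^esub> z \<in> mulM t (carrier M)} R M"
    by (rule submodule_lin_vimage[OF module_axioms module_axioms smult_lin_map[OF b(1)] carrier_is_submodule tM])
  hence "idmul Q (carrier M) \<subseteq> {z \<in> carrier M. b \<odot>\<^bsub>M\<^esub> z \<in> mulM t (carrier M)}"
  proof (rule idmul_least)
    fix q x assume q: "q \<in> Q" and x: "x \<in> carrier M"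
    have qc: "q \<in> carrier R" using ideal_carr[OF Q q] .
    obtain r where r: "r \<in> carrier R" "q \<otimes> b = r \<otimes> t" using b(2)[OF q] unfolding PIdl_mem by blast
    have "b \<odot>\<^bsub>M\<^esub> (q \<odot>\<^bsub>M\<^esub> x) = (q \<otimes> b) \<odot>\<^bsub>M\<^esub> x" using b(1) qc x by (simp add: smult_assoc1[symmetric] m_comm)
    also have "\<dots> = t \<odot>\<^bsub>M\<^esub> (r \<odot>\<^bsub>M\<^esub> x)" unfolding r(2) using r(1) tc x by (metis smult_assoc1 m_comm)
    finally show "q \<odot>\<^bsub>M\<^esub> x \<in> {z \<in> carrier M. b \<odot>\<^bsub>M\<^esub> z \<in> mulM t (carrier M)}" using qc x r(1) by auto
  qed
  hence "b \<odot>\<^bsub>M\<^esub> comb a \<in> mulM t (carrier M)" using mem by blast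
  moreover have "comb (\<lambda>y. b \<otimes> a y) = b \<odot>\<^bsub>M\<^esub> comb a" by (rule finsum_smult_mult[OF finY b(1) a gY])
  moreover have "(\<lambda>y. b \<otimes> a y) \<in> Y \<rightarrow> carrier R" using ac b(1) by auto
  ultimately have "b \<otimes> a j \<in> PIdl t" using comb_mem_tM[OF t(1) _ _ j, of "\<lambda>y. b \<otimes> a y"] by simp
  hence "a j \<otimes> b \<in> PIdl t" using m_comm[OF b(1) ac[OF j]] by simp
  hence "a j \<otimes> b \<ominus> (a j \<otimes> b \<ominus> s) \<in> PIdl t" using ideal_diff[OF Pt _ b(3)] by blast
  moreover have "a j \<otimes> b \<ominus> (a j \<otimes> b \<ominus> s) = s"
    using ac[OF j] b(1) s(1) by (simp add: R.minus_eq R.minus_add R.a_assoc[symmetric] R.r_neg)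
  ultimately show False using s(2) by simp
qed

text \<open>By \<open>comb_mem_tM\<close> all coefficients of \<open>t z\<close> are divisible by
  \<open>t\<close>, and \<open>t\<close> cancels on \<open>M\<close>.\<close>

lemma span_lift_saturated:
  assumes t: "reg_elt t" and z: "z \<in> carrier M" "t \<odot>\<^bsub>M\<^esub> z \<in> module_span R M (g ` Y)"
  shows "z \<in> module_span R M (g ` Y)"
proof -
  have tc: "t \<in> carrier R" using reg_elt_D(2)[OF t] .
  obtain a where a: "a \<in> Y \<rightarrow> carrier R" "t \<odot>\<^bsub>M\<^esub> z = comb a" using z(2) span_image_finsum[OF finY gY] by blast
  have "comb a \<in> mulM t (carrier M)" unfolding a(2)[symmetric] using z(1) by auto
  hence "\<exists>r\<in>carrier R. a y = t \<otimes> r" if "y \<in> Y" for y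
    using comb_mem_tM[OF t a(1) _ that] m_comm[OF tc] unfolding PIdl_mem by auto
  then obtain r where r: "\<And>y. y \<in> Y \<Longrightarrow> r y \<in> carrier R \<and> a y = t \<otimes> r y" by metis
  have rY: "r \<in> Y \<rightarrow> carrier R" using r by auto
  have "t \<odot>\<^bsub>M\<^esub> comb r = comb (\<lambda>y. t \<otimes> r y)" using finsum_smult_mult[OF finY tc rY gY] by simp
  also have "\<dots> = comb a" using r g tc by (intro M.finsum_cong') auto
  finally have "z = comb r" using reg_elt_cancel_M[OF t z(1) comb_carr[OF rY]] a(2) by simp
  thus ?thesis using span_image_finsum[OF finY gY] rY by blast
qed

end

end

section \<open>Hilbert functions that are bounded\<close>

lemma antitone_nat_eventually_const:
  fixes s :: "nat \<Rightarrow> nat"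
  assumes "\<And>n. n \<ge> m \<Longrightarrow> s (Suc n) \<le> s n"
  shows "\<exists>c n0. \<forall>n\<ge>n0. s n = c"
proof -
  define k where "k = (LEAST k. \<exists>n\<ge>m. s n = k)"
  have "\<exists>n\<ge>m. s n = k" unfolding k_def by (rule LeastI[of _ "s m"]) auto
  then obtain n0 where n0: "n0 \<ge> m" "s n0 = k" by blast
  have "s n = k" if "n \<ge> n0" for n
    using that
  proof (induction n rule: dec_induct)
    case base show ?case by (rule n0(2))
  next
    case (step n)
    have "m \<le> Suc n" using n0(1) step.hyps(1) by simp
    hence "\<exists>i\<ge>m. s i = s (Suc n)" by (rule exI[of _ "Suc n", OF conjI]) simp
    hence "k \<le> s (Suc n)" unfolding k_def by (rule Least_le)
    thus ?case using assms[of n] step n0 by simp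
  qed
  thus ?thesis by blast
qed

text \<open>The bound forces a row with limit zero, and by monotonicity all later rows vanish from a
  common column \<open>T\<close> on. A long diagonal then has nonzero entries only in finitely many
  rows, at their limits, and in finitely many columns, along which the entries decrease.\<close>

lemma eventually_const_diagonal:
  fixes q :: "nat \<Rightarrow> nat \<Rightarrow> nat"
  assumes ev: "\<And>j. \<exists>c n0. \<forall>n\<ge>n0. q j n = c" and anti: "\<And>j n. q (Suc j) n \<le> q j n"
    and bound: "\<And>n. (\<Sum>j\<le>n. q j (n - j)) \<le> L"
  shows "\<exists>c n0. \<forall>n\<ge>n0. (\<Sum>j\<le>n. q j (n - j)) = c"
proof -
  obtain c th where c: "\<And>j n. n \<ge> th j \<Longrightarrow> q j n = c j" using ev by metis
  \<comment> \<open>If the \<open>L + 1\<close> rows up to \<open>L\<close> had positive limits, a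
    late diagonal would have sum at least \<open>L + 1\<close>.\<close>
  have "\<exists>J\<le>L. c J = 0"
  proof (rule ccontr)
    assume "\<not> ?thesis"
    hence pos: "1 \<le> c j" if "j \<le> L" for j using that by (metis One_nat_def Suc_leI neq0_conv)
    define n where "n = L + (\<Sum>j\<le>L. th j)"
    have "1 \<le> q j (n - j)" if j: "j \<le> L" for j
    proof -
      have "th j \<le> (\<Sum>j\<le>L. th j)" by (rule member_le_sum) (use j in auto)
      hence "q j (n - j) = c j" using j by (intro c) (auto simp: n_def)
      thus ?thesis using pos[OF j] by simp
    qed
    hence "(\<Sum>j\<le>L. 1) \<le> (\<Sum>j\<le>L. q j (n - j))" by (intro sum_mono) auto
    also have "\<dots> \<le> (\<Sum>j\<le>n. q j (n - j))" by (rule sum_mono2) (auto simp: n_def)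
    also have "\<dots> \<le> L" by (rule bound)
    finally show False by simp
  qed
  then obtain J where J: "c J = 0" by blast
  define T where "T = th J"
  have q0: "q j n = 0" if "j \<ge> J" "n \<ge> T" for j n
    using that
  proof (induction j rule: dec_induct)
    case base thus ?case using c[of J n] J by (simp add: T_def)
  next
    case (step j) thus ?case using anti[of j n] by simp
  qed
  \<comment> \<open>The part of the \<open>n\<close>-th diagonal in the columns below
    \<open>T\<close>. It is antitone in \<open>n\<close> because the entries decrease with the
    row.\<close>
  define s where "s n = (\<Sum>i<T. q (n - i) i)" for n
  have "\<exists>d n0. \<forall>n\<ge>n0. s n = d"
  proof (rule antitone_nat_eventually_const[of T])
    fix n assume n: "n \<ge> T"
    show "s (Suc n) \<le> s n" unfolding s_def
    proof (rule sum_mono)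
      fix i assume "i \<in> {..<T}"
      hence "Suc n - i = Suc (n - i)" using n by auto
      thus "q (Suc n - i) i \<le> q (n - i) i" using anti[of "n - i" i] by simp
    qed
  qed
  then obtain d n0 where d: "\<And>n. n \<ge> n0 \<Longrightarrow> s n = d" by blast
  have "(\<Sum>j\<le>n. q j (n - j)) = (\<Sum>j<J. c j) + d" if n: "n \<ge> n0 + J + T + (\<Sum>j<J. th j)" for n
  proof -
    have "(\<Sum>j\<le>n. q j (n - j)) = (\<Sum>j\<in>{..<J} \<union> {J..n - T} \<union> {n - T<..n}. q j (n - j))"
      by (rule sum.cong) (use n in auto)
    also have "\<dots> = (\<Sum>j\<in>{..<J} \<union> {J..n - T}. q j (n - j)) + (\<Sum>j\<in>{n - T<..n}. q j (n - j))"
      by (rule sum.union_disjoint) (use n in auto)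
    also have "(\<Sum>j\<in>{..<J} \<union> {J..n - T}. q j (n - j)) = (\<Sum>j<J. q j (n - j)) + (\<Sum>j\<in>{J..n - T}. q j (n - j))"
      by (rule sum.union_disjoint) auto
    also have "(\<Sum>j\<in>{J..n - T}. q j (n - j)) = 0" by (intro sum.neutral ballI q0) (use n in auto)
    also have "(\<Sum>j<J. q j (n - j)) = (\<Sum>j<J. c j)"
    proof (rule sum.cong[OF refl])
      fix j assume j: "j \<in> {..<J}"
      have "th j \<le> (\<Sum>j<J. th j)" by (rule member_le_sum) (use j in auto)
      thus "q j (n - j) = c j" using n j by (intro c) auto
    qed
    also have "(\<Sum>j\<in>{n - T<..n}. q j (n - j)) = s n" unfolding s_def
      by (rule sum.reindex_bij_witness[of _ "\<lambda>i. n - i" "\<lambda>j. n - j"]) (use n in auto)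
    also have "s n = d" using n by (intro d) auto
    finally show ?thesis by simp
  qed
  thus ?thesis by blast
qed

text \<open>From \<open>n0\<close> on, \<open>f\<close> is affine with slope
  \<open>c\<close>.\<close>

lemma eventually_const_average:
  fixes f H :: "nat \<Rightarrow> nat"
  assumes f: "\<And>n. f (Suc n) = f n + H n" and H: "\<And>n. n \<ge> n0 \<Longrightarrow> H n = c"
  shows "(\<lambda>n. real (f n) / real n) \<longlonglongrightarrow> real c"
proof -
  define b where "b = real (f n0) - real n0 * real c"
  have fn: "real (f n) = b + real n * real c" if "n \<ge> n0" for n
    using that
  proof (induction n rule: dec_induct)
    case base show ?case by (simp add: b_def)
  next
    case (step n) thus ?case using f[of n] H[of n] by (simp add: algebra_simps)
  qed
  have "(\<lambda>n. b * inverse (real n) + real c) \<longlonglongrightarrow> b * 0 + real c"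
    by (intro tendsto_intros lim_inverse_n)
  moreover have "\<forall>\<^sub>F n in sequentially. b * inverse (real n) + real c = real (f n) / real n"
    using eventually_ge_at_top[of "max n0 1"]
    by eventually_elim (auto simp: fn field_simps)
  ultimately show ?thesis using Lim_transform_eventually by fastforce
qed

section \<open>Graded modules generated by commuting operators\<close>

context module
begin

abbreviation mulset :: "'a \<Rightarrow> 'c set \<Rightarrow> 'c set" where
  "mulset a U \<equiv> (\<lambda>y. a \<odot>\<^bsub>M\<^esub> y) ` U"

text \<open>A list of operators, because the argument on Hilbert functions splits off one operator
  at a time.\<close>

fun gsum :: "'a list \<Rightarrow> 'c set \<Rightarrow> 'c set" where
  "gsum [] U = {\<zero>\<^bsub>M\<^esub>}"
| "gsum (x # xs) U = mulset x U <+>\<^bsub>M\<^esub> gsum xs U"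

lemma gsum_submodule: "set xs \<subseteq> carrier R \<Longrightarrow> submodule U R M \<Longrightarrow> submodule (gsum xs U) R M"
  by (induction xs) (auto intro: zero_submodule submodule_set_add submodule_smult_image)

lemma gsum_mono: "U \<subseteq> V \<Longrightarrow> gsum xs U \<subseteq> gsum xs V"
  by (induction xs) (simp_all add: set_add_mono image_mono)

lemma gsum_mem: "set xs \<subseteq> carrier R \<Longrightarrow> submodule U R M \<Longrightarrow> x \<in> set xs \<Longrightarrow> y \<in> U \<Longrightarrow> x \<odot>\<^bsub>M\<^esub> y \<in> gsum xs U"
proof (induction xs)
  case (Cons z xs)
  have s: "submodule (mulset z U) R M" "submodule (gsum xs U) R M"
    using Cons.prems gsum_submodule submodule_smult_image by auto
  show ?case
    using Cons set_add_upper1[OF s] set_add_upper2[OF s] by auto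
qed simp

lemma mulset_gsum:
  assumes "set xs \<subseteq> carrier R" "a \<in> carrier R" "submodule U R M"
  shows "mulset a (gsum xs U) \<subseteq> gsum xs (mulset a U)"
  using assms(1)
proof (induction xs)
  case Nil thus ?case using assms(2) by simp
next
  case (Cons z xs)
  show ?case
  proof
    fix w assume "w \<in> mulset a (gsum (z # xs) U)"
    then obtain u v where uv: "u \<in> U" "v \<in> gsum xs U" "w = a \<odot>\<^bsub>M\<^esub> (z \<odot>\<^bsub>M\<^esub> u \<oplus>\<^bsub>M\<^esub> v)" by (auto simp: mem_set_add)
    have c: "u \<in> carrier M" "v \<in> carrier M" "z \<in> carrier R"
      using uv submodule_mem_carrier[OF assms(3)] submodule_mem_carrier[OF gsum_submodule[OF _ assms(3)]] Cons.prems by auto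
    have "w = z \<odot>\<^bsub>M\<^esub> (a \<odot>\<^bsub>M\<^esub> u) \<oplus>\<^bsub>M\<^esub> a \<odot>\<^bsub>M\<^esub> v"
      using uv(3) c assms(2) by (simp add: smult_r_distr smult_assoc1[symmetric] R.m_comm)
    moreover have "a \<odot>\<^bsub>M\<^esub> v \<in> gsum xs (mulset a U)" using Cons uv(2) by auto
    ultimately show "w \<in> gsum (z # xs) (mulset a U)" using uv(1) by (auto simp: mem_set_add)
  qed
qed

lemma mulset_set_add:
  assumes "a \<in> carrier R" "submodule U R M" "submodule V R M"
  shows "mulset a (U <+>\<^bsub>M\<^esub> V) = mulset a U <+>\<^bsub>M\<^esub> mulset a V"
proof -
  have d: "a \<odot>\<^bsub>M\<^esub> (u \<oplus>\<^bsub>M\<^esub> v) = a \<odot>\<^bsub>M\<^esub> u \<oplus>\<^bsub>M\<^esub> a \<odot>\<^bsub>M\<^esub> v" if "u \<in> U" "v \<in> V" for u v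
    using smult_r_distr assms submodule_mem_carrier that by blast
  show ?thesis
  proof (intro equalityI subsetI)
    fix w assume "w \<in> mulset a (U <+>\<^bsub>M\<^esub> V)"
    then obtain u v where "u \<in> U" "v \<in> V" "w = a \<odot>\<^bsub>M\<^esub> (u \<oplus>\<^bsub>M\<^esub> v)" by (auto simp: mem_set_add)
    thus "w \<in> mulset a U <+>\<^bsub>M\<^esub> mulset a V" using d by (auto simp: mem_set_add)
  next
    fix w assume "w \<in> mulset a U <+>\<^bsub>M\<^esub> mulset a V"
    then obtain u v where uv: "u \<in> U" "v \<in> V" "w = a \<odot>\<^bsub>M\<^esub> u \<oplus>\<^bsub>M\<^esub> a \<odot>\<^bsub>M\<^esub> v" by (auto simp: mem_set_add)
    hence "w = a \<odot>\<^bsub>M\<^esub> (u \<oplus>\<^bsub>M\<^esub> v)" using d by simp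
    moreover have "u \<oplus>\<^bsub>M\<^esub> v \<in> U <+>\<^bsub>M\<^esub> V" using uv by (auto simp: mem_set_add)
    ultimately show "w \<in> mulset a (U <+>\<^bsub>M\<^esub> V)" by blast
  qed
qed

lemma mulset_pow_Suc:
  assumes "x \<in> carrier R" "submodule U R M"
  shows "mulset (x [^] Suc j) U = mulset x (mulset (x [^] (j::nat)) U)"
proof -
  have "(x [^] Suc j) \<odot>\<^bsub>M\<^esub> u = x \<odot>\<^bsub>M\<^esub> ((x [^] j) \<odot>\<^bsub>M\<^esub> u)" if "u \<in> U" for u
  proof -
    have "x [^] Suc j = x \<otimes> x [^] j" using assms(1) by (simp add: R.m_comm)
    thus ?thesis using assms submodule_mem_carrier that by (simp add: smult_assoc1)
  qed
  thus ?thesis by (auto simp: image_iff)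
qed

lemma set_add_sub_left: "submodule H R M \<Longrightarrow> submodule K R M \<Longrightarrow> A \<subseteq> H \<Longrightarrow> A \<subseteq> H <+>\<^bsub>M\<^esub> K"
  and set_add_sub_right: "submodule H R M \<Longrightarrow> submodule K R M \<Longrightarrow> A \<subseteq> K \<Longrightarrow> A \<subseteq> H <+>\<^bsub>M\<^esub> K"
  using set_add_upper1 set_add_upper2 by blast+

text \<open>A graded module generated in degree \<open>0\<close> by commuting operators, presented as \<open>U n / V n\<close>. The
  filtration by the powers of one operator \<open>x\<close> has graded pieces generated by the remaining ones.\<close>

lemma bounded_hilbert_eventually_const:
  assumes "set xs \<subseteq> carrier R"
    and "\<And>n::nat. submodule (U n) R M" "\<And>n. submodule (V n) R M" "\<And>n. V n \<subseteq> U n"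
    and "\<And>n x. x \<in> set xs \<Longrightarrow> mulset x (U n) \<subseteq> U (Suc n)" "\<And>n x. x \<in> set xs \<Longrightarrow> mulset x (V n) \<subseteq> V (Suc n)"
    and "\<And>n. U (Suc n) \<subseteq> gsum xs (U n) <+>\<^bsub>M\<^esub> V (Suc n)"
    and "\<And>n. sublen R M (V n) (U n) \<le> enat L"
  shows "\<exists>c n0. \<forall>n\<ge>n0. sublen R M (V n) (U n) = enat c"
  using assms
proof (induction xs arbitrary: U V)
  case Nil
  have "sublen R M (V n) (U n) = enat 0" if n: "n \<ge> 1" for n
  proof -
    obtain m where m: "n = Suc m" using n by (cases n) auto
    have "U n \<subseteq> V n" using Nil.prems(7)[of m] zero_set_add[OF Nil.prems(3)] m by simp
    hence "U n = V n" using Nil.prems(4) by blast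
    thus ?thesis using sublen_refl[OF Nil.prems(3)] by (simp add: zero_enat_def)
  qed
  thus ?case by blast
next
  case (Cons x xs)
  note xs = Cons.prems(1) and U = Cons.prems(2) and V = Cons.prems(3) and VU = Cons.prems(4)
    and mU = Cons.prems(5) and mV = Cons.prems(6) and gen = Cons.prems(7) and bound = Cons.prems(8)
  have xc: "x \<in> carrier R" "set xs \<subseteq> carrier R" using xs by auto
  have xjc: "x [^] (j::nat) \<in> carrier R" for j using xc by simp
  \<comment> \<open>The quotient of \<open>P j n\<close> by \<open>Q j n\<close> is the piece of
    degree \<open>n + j\<close> in \<open>x^j\<close> times the module modulo \<open>x^(j+1)\<close>
    times the module. For \<open>n = 0\<close> no further factor \<open>x\<close> is possible,
    whence \<open>Q j 0 = V j\<close>.\<close>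
  define P where "P j n = mulset (x [^] j) (U n) <+>\<^bsub>M\<^esub> V (n + j)" for j n
  define Q where "Q j n = (case n of 0 \<Rightarrow> V j | Suc k \<Rightarrow> P (Suc j) k)" for j n
  have Q0: "Q j 0 = V j" and QS: "Q j (Suc k) = P (Suc j) k" for j k by (simp_all add: Q_def)
  have xU: "submodule (mulset (x [^] (j::nat)) (U n)) R M" for j n by (rule submodule_smult_image[OF xjc U])
  have Ps: "submodule (P j n) R M" for j n unfolding P_def by (rule submodule_set_add[OF xU V])
  have Qs: "submodule (Q j n) R M" for j n by (cases n) (simp_all add: Q0 QS V Ps)
  have powU: "mulset (x [^] j) (U n) \<subseteq> U (n + j)" for j n
  proof (induction j)
    case 0 thus ?case using submodule_mem_carrier[OF U] by auto
  next
    case (Suc j)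
    have "mulset x (mulset (x [^] j) (U n)) \<subseteq> mulset x (U (n + j))" by (rule image_mono[OF Suc])
    thus ?case using mU[of x "n + j"] unfolding mulset_pow_Suc[OF xc(1) U] by simp
  qed
  have PU: "P j n \<subseteq> U (n + j)" for j n unfolding P_def by (rule set_add_least[OF U powU VU])
  have VP: "V (n + j) \<subseteq> P j n" for j n unfolding P_def by (rule set_add_upper2[OF xU V])
  have Psub: "P (Suc j) k \<subseteq> P j (Suc k)" for j k
  proof -
    have "mulset (x [^] Suc j) (U k) \<subseteq> mulset (x [^] j) (U (Suc k))"
    proof
      fix w assume "w \<in> mulset (x [^] Suc j) (U k)"
      then obtain u where u: "u \<in> U k" "w = (x [^] Suc j) \<odot>\<^bsub>M\<^esub> u" by auto
      have "w = (x [^] j) \<odot>\<^bsub>M\<^esub> (x \<odot>\<^bsub>M\<^esub> u)" using u xc submodule_mem_carrier[OF U] by (simp add: smult_assoc1)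
      thus "w \<in> mulset (x [^] j) (U (Suc k))" using mU[of x k] u(1) by auto
    qed
    thus ?thesis unfolding P_def by (intro set_add_mono) auto
  qed
  have VQ: "V (n + j) \<subseteq> Q j n" for j n
  proof (cases n)
    case 0 thus ?thesis by (simp add: Q0)
  next
    case (Suc k) thus ?thesis using VP[of k "Suc j"] by (simp add: QS)
  qed
  have QP: "Q j n \<subseteq> P j n" for j n
  proof (cases n)
    case 0 thus ?thesis using VP[of 0 j] by (simp add: Q0)
  next
    case (Suc k) thus ?thesis using Psub by (simp add: QS)
  qed
  have yP: "mulset y (P j n) \<subseteq> P j (Suc n)" if y: "y \<in> set xs" for y j n
  proof -
    have yc: "y \<in> carrier R" using xc(2) y by auto
    have "mulset y (mulset (x [^] j) (U n)) \<subseteq> mulset (x [^] j) (U (Suc n))"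
    proof
      fix w assume "w \<in> mulset y (mulset (x [^] j) (U n))"
      then obtain u where u: "u \<in> U n" "w = y \<odot>\<^bsub>M\<^esub> ((x [^] j) \<odot>\<^bsub>M\<^esub> u)" by auto
      have "w = (x [^] j) \<odot>\<^bsub>M\<^esub> (y \<odot>\<^bsub>M\<^esub> u)"
        using u xjc yc submodule_mem_carrier[OF U] by (simp add: smult_assoc1[symmetric] R.m_comm)
      thus "w \<in> mulset (x [^] j) (U (Suc n))" using mU[of y n] y u(1) by auto
    qed
    moreover have "mulset y (V (n + j)) \<subseteq> V (Suc n + j)" using mV[of y "n + j"] y by simp
    ultimately show ?thesis unfolding P_def mulset_set_add[OF yc xU V] by (rule set_add_mono)
  qed
  have yQ: "mulset y (Q j n) \<subseteq> Q j (Suc n)" if y: "y \<in> set xs" for y j n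
  proof (cases n)
    case 0
    have "mulset y (V j) \<subseteq> V (Suc j)" using mV[of y j] y by simp
    also have "\<dots> \<subseteq> P (Suc j) 0" using VP[of 0 "Suc j"] by simp
    finally show ?thesis using 0 by (simp add: Q0 QS)
  next
    case (Suc k) thus ?thesis using yP[OF y] by (simp add: QS)
  qed
  \<comment> \<open>The part coming from \<open>x\<close> falls into \<open>Q\<close>, so the
    remaining operators generate the graded piece and the induction hypothesis applies.\<close>
  have genP: "P j (Suc n) \<subseteq> gsum xs (P j n) <+>\<^bsub>M\<^esub> Q j (Suc n)" for j n
  proof -
    let ?T = "gsum xs (P j n) <+>\<^bsub>M\<^esub> Q j (Suc n)"
    have gs: "submodule (gsum xs (P j n)) R M" by (rule gsum_submodule[OF xc(2) Ps])
    have T: "submodule ?T R M" by (rule submodule_set_add[OF gs Qs])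
    have QT: "Q j (Suc n) \<subseteq> ?T" by (rule set_add_upper2[OF gs Qs])
    have "mulset (x [^] j) (U (Suc n)) \<subseteq> ?T"
    proof
      fix w assume "w \<in> mulset (x [^] j) (U (Suc n))"
      then obtain u where u: "u \<in> U (Suc n)" "w = (x [^] j) \<odot>\<^bsub>M\<^esub> u" by auto
      obtain a b v where abv: "a \<in> U n" "b \<in> gsum xs (U n)" "v \<in> V (Suc n)" "u = (x \<odot>\<^bsub>M\<^esub> a \<oplus>\<^bsub>M\<^esub> b) \<oplus>\<^bsub>M\<^esub> v"
        using gen[of n] u(1) by (fastforce simp: mem_set_add)
      have c: "a \<in> carrier M" "b \<in> carrier M" "v \<in> carrier M"
        using abv submodule_mem_carrier[OF U] submodule_mem_carrier[OF V]
          submodule_mem_carrier[OF gsum_submodule[OF xc(2) U]] by auto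
      have w: "w = ((x [^] Suc j) \<odot>\<^bsub>M\<^esub> a \<oplus>\<^bsub>M\<^esub> (x [^] j) \<odot>\<^bsub>M\<^esub> b) \<oplus>\<^bsub>M\<^esub> (x [^] j) \<odot>\<^bsub>M\<^esub> v"
        using u(2) abv(4) c xc(1) by (simp add: smult_r_distr smult_assoc1)
      have "(x [^] Suc j) \<odot>\<^bsub>M\<^esub> a \<in> mulset (x [^] Suc j) (U n)" using abv(1) by blast
      hence 1: "(x [^] Suc j) \<odot>\<^bsub>M\<^esub> a \<in> ?T"
        using set_add_upper1[OF xU[of "Suc j" n] V[of "n + Suc j"]] QT unfolding QS P_def by blast
      have "(x [^] j) \<odot>\<^bsub>M\<^esub> b \<in> gsum xs (mulset (x [^] j) (U n))" using mulset_gsum[OF xc(2) xjc U] abv(2) by blast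
      hence "(x [^] j) \<odot>\<^bsub>M\<^esub> b \<in> gsum xs (P j n)"
        using gsum_mono[of "mulset (x [^] j) (U n)" "P j n" xs] set_add_upper1[OF xU[of j n] V[of "n + j"]] unfolding P_def by blast
      hence 2: "(x [^] j) \<odot>\<^bsub>M\<^esub> b \<in> ?T" using set_add_upper1[OF gs Qs] by blast
      have "(x [^] j) \<odot>\<^bsub>M\<^esub> v \<in> V (Suc n + j)"
      proof (induction j)
        case 0 show ?case using abv(3) c by simp
      next
        case (Suc j)
        have "(x [^] Suc j) \<odot>\<^bsub>M\<^esub> v = x \<odot>\<^bsub>M\<^esub> ((x [^] j) \<odot>\<^bsub>M\<^esub> v)"
          using c(3) xc(1) by (simp add: smult_assoc1[symmetric] R.m_comm)
        thus ?case using mV[of x "Suc n + j"] Suc by auto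
      qed
      hence 3: "(x [^] j) \<odot>\<^bsub>M\<^esub> v \<in> ?T" using VQ[of "Suc n" j] QT by blast
      show "w \<in> ?T" unfolding w by (intro submodule_add_mem[OF T] 1 2 3)
    qed
    moreover have "V (Suc n + j) \<subseteq> ?T" using VQ[of "Suc n" j] QT by blast
    ultimately show ?thesis unfolding P_def[of j "Suc n"] by (intro set_add_least[OF T])
  qed
  have bd: "sublen R M (Q j n) (P j n) \<le> enat L" for j n
    using sublen_mono[OF Qs Ps V U VQ QP PU] bound[of "n + j"] order_trans by blast
  have "\<exists>c n0. \<forall>n\<ge>n0. sublen R M (Q j n) (P j n) = enat c" for j
    by (rule Cons.IH[of "P j" "Q j", OF xc(2) Ps Qs QP yP yQ genP bd])
  note ev = this
  define q where "q j n = the_enat (sublen R M (Q j n) (P j n))" for j n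
  have q: "sublen R M (Q j n) (P j n) = enat (q j n)" for j n
    using bd[of j n] unfolding q_def by (cases "sublen R M (Q j n) (P j n)") auto
  \<comment> \<open>Multiplication by \<open>x\<close> maps each graded piece of the filtration onto
    the next one.\<close>
  have anti: "q (Suc j) n \<le> q j n" for j n
  proof -
    let ?V = "V (n + Suc j)"
    have xV: "mulset x (V (n + j)) \<subseteq> ?V" using mV[of x "n + j"] by simp
    have VxV: "?V <+>\<^bsub>M\<^esub> mulset x (V (n + j)) = ?V"
      by (rule set_add_absorb[OF V submodule_smult_image[OF xc(1) V] xV])
    have red: "?V <+>\<^bsub>M\<^esub> mulset x (mulset (x [^] i) (U m) <+>\<^bsub>M\<^esub> V (n + j)) = mulset (x [^] Suc i) (U m) <+>\<^bsub>M\<^esub> ?V" for i m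
    proof -
      note s1 = submodule_smult_image[OF xc(1) V] and s2 = submodule_smult_image[OF xc(1) xU]
      have "?V <+>\<^bsub>M\<^esub> mulset x (mulset (x [^] i) (U m) <+>\<^bsub>M\<^esub> V (n + j))
          = ?V <+>\<^bsub>M\<^esub> (mulset x (mulset (x [^] i) (U m)) <+>\<^bsub>M\<^esub> mulset x (V (n + j)))"
        by (simp only: mulset_set_add[OF xc(1) xU V])
      also have "\<dots> = ?V <+>\<^bsub>M\<^esub> (mulset x (V (n + j)) <+>\<^bsub>M\<^esub> mulset x (mulset (x [^] i) (U m)))"
        by (simp only: submodule_set_add_comm[OF s2 s1])
      also have "\<dots> = ?V <+>\<^bsub>M\<^esub> mulset x (mulset (x [^] i) (U m))"
        by (simp only: submodule_set_add_assoc[OF V s1 s2, symmetric] VxV)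
      also have "\<dots> = mulset (x [^] Suc i) (U m) <+>\<^bsub>M\<^esub> ?V"
        by (simp only: submodule_set_add_comm[OF V s2] mulset_pow_Suc[OF xc(1) U])
      finally show ?thesis .
    qed
    have top: "?V <+>\<^bsub>M\<^esub> mulset x (P j n) = P (Suc j) n" unfolding P_def by (rule red)
    have bot: "?V <+>\<^bsub>M\<^esub> mulset x (Q j n) = Q (Suc j) n"
    proof (cases n)
      case 0 thus ?thesis using VxV by (simp add: Q0)
    next
      case (Suc k)
      have "Q j n = mulset (x [^] Suc j) (U k) <+>\<^bsub>M\<^esub> V (n + j)" using Suc by (simp add: QS P_def)
      hence "?V <+>\<^bsub>M\<^esub> mulset x (Q j n) = mulset (x [^] Suc (Suc j)) (U k) <+>\<^bsub>M\<^esub> ?V" by (simp only: red)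
      also have "\<dots> = Q (Suc j) n" using Suc by (simp add: QS P_def)
      finally show ?thesis .
    qed
    have "sublen R M (?V <+>\<^bsub>M\<^esub> mulset x (Q j n)) (?V <+>\<^bsub>M\<^esub> mulset x (P j n)) \<le> sublen R M (Q j n) (P j n)"
      by (rule sublen_lin_image_le[OF module_axioms module_axioms smult_lin_map[OF xc(1)] Ps Qs QP V])
    thus ?thesis unfolding top bot q by simp
  qed
  \<comment> \<open>Inside \<open>U n\<close> the filtration runs along a diagonal: the
    \<open>k\<close>-th term has its base in degree \<open>n - k\<close>.\<close>
  have tele: "k \<le> n \<Longrightarrow> sublen R M (P k (n - k)) (U n) = enat (\<Sum>j<k. q j (n - j))" for k n
  proof (induction k)
    case 0
    have "P 0 n = U n"
    proof -
      have "mulset (x [^] (0::nat)) (U n) = U n" using submodule_mem_carrier[OF U] by (auto simp: image_iff)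
      thus ?thesis unfolding P_def using set_add_absorb[OF U V VU] by simp
    qed
    thus ?case using sublen_refl[OF U] by (simp add: zero_enat_def)
  next
    case (Suc k)
    have eq: "Q k (n - k) = P (Suc k) (n - Suc k)" using Suc.prems by (simp add: QS[symmetric] Suc_diff_Suc)
    have "P k (n - k) \<subseteq> U n" using PU[of k "n - k"] Suc.prems by simp
    hence "sublen R M (Q k (n - k)) (U n) = sublen R M (Q k (n - k)) (P k (n - k)) + sublen R M (P k (n - k)) (U n)"
      by (intro sublen_additive Qs Ps U QP)
    thus ?case using Suc unfolding eq[symmetric] q by simp
  qed
  have h: "sublen R M (V n) (U n) = enat (\<Sum>j\<le>n. q j (n - j))" for n
  proof -
    have 1: "V n \<subseteq> P n 0" using VP[of 0 n] by simp
    have 2: "P n 0 \<subseteq> U n" using PU[of n 0] by simp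
    have "sublen R M (V n) (U n) = sublen R M (V n) (P n 0) + sublen R M (P n 0) (U n)"
      by (rule sublen_additive[OF V Ps U 1 2])
    also have "\<dots> = enat (q n 0) + enat (\<Sum>j<n. q j (n - j))" using q[of n 0] tele[of n n] by (simp add: Q0)
    also have "\<dots> = enat (\<Sum>j\<le>n. q j (n - j))" by (simp add: lessThan_Suc_atMost[symmetric])
    finally show ?thesis .
  qed
  have "\<exists>c n0. \<forall>n\<ge>n0. (\<Sum>j\<le>n. q j (n - j)) = c"
  proof (rule eventually_const_diagonal[of q, where L = L])
    show "q (Suc j) n \<le> q j n" for j n by (rule anti)
    show "\<exists>c n0. \<forall>n\<ge>n0. q j n = c" for j using ev[of j] unfolding q by simp
    show "(\<Sum>j\<le>n. q j (n - j)) \<le> L" for n using bound[of n] unfolding h by simp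
  qed
  thus ?case unfolding h by simp
qed

end

section \<open>Multiplicities\<close>

context noeth_local
begin

definition mpow :: "nat \<Rightarrow> 'a set" where
  "mpow k = \<mm> [^]\<^bsub>ideals_set R\<^esub> k"

lemma mpow_0: "mpow 0 = carrier R"
  by (simp add: mpow_def nat_pow_def ideals_set_def)

lemma mpow_Suc: "mpow (Suc k) = mpow k \<cdot> \<mm>"
  by (simp add: mpow_def nat_pow_def ideals_set_def)

lemma mpow_ideal: "ideal (mpow k) R"
  by (induction k) (simp_all add: mpow_0 mpow_Suc oneideal ideal_prod_is_ideal max_ideal_ideal)

lemma pow_mem_mpow: "y \<in> \<mm> \<Longrightarrow> y [^] k \<in> mpow k"
  by (induction k) (auto simp: mpow_0 mpow_Suc intro: ideal_prod.prod)

lemma mpow_max_rad: "max_rad (mpow k)"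
  unfolding max_rad_def using pow_mem_mpow by blast

lemma idmul_regular_mpow: "RM.idmul (mpow k) (carrier R) = mpow k"
proof
  have s: "submodule (mpow k) R (regular_module R)" by (simp add: submodule_regular_iff mpow_ideal)
  show "RM.idmul (mpow k) (carrier R) \<subseteq> mpow k"
    by (rule RM.idmul_least[OF s]) (simp add: ideal_mult_r[OF mpow_ideal])
  show "mpow k \<subseteq> RM.idmul (mpow k) (carrier R)"
  proof
    fix x assume x: "x \<in> mpow k"
    have "x \<otimes> \<one> \<in> RM.idmul (mpow k) (carrier R)" using RM.idmul_mem[OF x one_closed] by simp
    thus "x \<in> RM.idmul (mpow k) (carrier R)" using ideal_carr[OF mpow_ideal x] by simp
  qed
qed

end

context depth_one_module
begin

lemma mpowM_submodule: "submodule (idmul (mpow k) (carrier M)) R M"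
  by (rule submodule_idmul[OF _ order_refl]) (use ideal_carr[OF mpow_ideal] in blast)

lemma mpowM_Suc_subset: "idmul (mpow (Suc k)) (carrier M) \<subseteq> idmul \<mm> (idmul (mpow k) (carrier M))"
proof (rule idmul_least)
  show T: "submodule (idmul \<mm> (idmul (mpow k) (carrier M))) R M"
    using submodule_idmul[OF _ submodule_subset[OF mpowM_submodule]] max_carr by blast
  fix a x assume a: "a \<in> mpow (Suc k)" and x: "x \<in> carrier M"
  from a have "a \<in> mpow k \<cdot> \<mm>" by (simp add: mpow_Suc)
  thus "a \<odot>\<^bsub>M\<^esub> x \<in> idmul \<mm> (idmul (mpow k) (carrier M))"
  proof (induction a rule: ideal_prod.induct)
    case (prod i j)
    have c: "i \<in> carrier R" "j \<in> carrier R" using prod ideal_carr[OF mpow_ideal] max_carr by auto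
    have "(i \<otimes> j) \<odot>\<^bsub>M\<^esub> x = j \<odot>\<^bsub>M\<^esub> (i \<odot>\<^bsub>M\<^esub> x)" using c x by (simp add: smult_assoc1[symmetric] m_comm)
    thus ?case using idmul_mem[OF prod(2) idmul_mem[OF prod(1) x]] by simp
  next
    case (sum s1 s2)
    have c: "s1 \<in> carrier R" "s2 \<in> carrier R"
      using sum(1,2) ideal_prod_in_carrier[OF mpow_ideal max_ideal_ideal] by auto
    thus ?case using sum submodule_add_mem[OF T] x by (simp add: smult_l_distr)
  qed
qed

lemma mult_mpowM: "a \<in> \<mm> \<Longrightarrow> z \<in> idmul (mpow k) (carrier M) \<Longrightarrow> a \<odot>\<^bsub>M\<^esub> z \<in> idmul (mpow (Suc k)) (carrier M)"
proof -
  assume a: "a \<in> \<mm>" and z: "z \<in> idmul (mpow k) (carrier M)"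
  have ac: "a \<in> carrier R" using max_carr[OF a] .
  have "submodule {z \<in> carrier M. a \<odot>\<^bsub>M\<^esub> z \<in> idmul (mpow (Suc k)) (carrier M)} R M"
    by (rule submodule_lin_vimage[OF module_axioms module_axioms smult_lin_map[OF ac] carrier_is_submodule mpowM_submodule])
  hence "idmul (mpow k) (carrier M) \<subseteq> {z \<in> carrier M. a \<odot>\<^bsub>M\<^esub> z \<in> idmul (mpow (Suc k)) (carrier M)}"
  proof (rule idmul_least)
    fix q x assume q: "q \<in> mpow k" and x: "x \<in> carrier M"
    have qc: "q \<in> carrier R" using ideal_carr[OF mpow_ideal q] .
    have "a \<odot>\<^bsub>M\<^esub> (q \<odot>\<^bsub>M\<^esub> x) = (q \<otimes> a) \<odot>\<^bsub>M\<^esub> x" using ac qc x by (simp add: smult_assoc1[symmetric] m_comm)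
    moreover have "q \<otimes> a \<in> mpow (Suc k)" unfolding mpow_Suc by (rule ideal_prod.prod[OF q a])
    ultimately show "q \<odot>\<^bsub>M\<^esub> x \<in> {z \<in> carrier M. a \<odot>\<^bsub>M\<^esub> z \<in> idmul (mpow (Suc k)) (carrier M)}"
      using qc x idmul_mem by auto
  qed
  thus ?thesis using z by blast
qed

lemma mpowM_Suc_sub: "idmul (mpow (Suc k)) (carrier M) \<subseteq> idmul (mpow k) (carrier M)"
  using mpowM_Suc_subset[of k] idmul_subset[OF _ mpowM_submodule, of \<mm> k] max_carr by blast

lemma sublen_idmul_finite:
  assumes Q: "ideal Q R" "max_rad Q" shows "sublen R M (idmul Q (carrier M)) (carrier M) < \<infinity>"
proof -
  obtain S where S: "finite S" "S \<subseteq> carrier M" "module_span R M S = carrier M" using fin_gen unfolding fg_sub_def by blast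
  have V: "submodule (idmul Q (carrier M)) R M" by (rule submodule_idmul[OF _ order_refl]) (use ideal_carr[OF Q(1)] in blast)
  have "sublen R M (idmul Q (carrier M)) (idmul Q (carrier M) <+>\<^bsub>M\<^esub> module_span R M S)
    \<le> enat (card S) * sublen R (regular_module R) Q (carrier R)"
    by (rule sublen_span_le[OF Q(1) V S(1,2)]) (use idmul_mem S(2) in blast)
  moreover have "idmul Q (carrier M) <+>\<^bsub>M\<^esub> module_span R M S = carrier M"
    unfolding S(3) submodule_set_add_comm[OF V carrier_is_submodule]
    by (rule set_add_absorb[OF carrier_is_submodule V submodule_subset[OF V]])
  moreover have "enat (card S) * sublen R (regular_module R) Q (carrier R) < \<infinity>"
    using sublen_finite_of_max_rad[OF Q] by (cases "sublen R (regular_module R) Q (carrier R)") auto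
  ultimately show ?thesis by (metis order_le_less_trans)
qed

definition hfun :: "nat \<Rightarrow> nat" where
  "hfun k = the_enat (sublen R M (idmul (mpow k) (carrier M)) (carrier M))"

lemma hfun: "sublen R M (idmul (mpow k) (carrier M)) (carrier M) = enat (hfun k)"
  unfolding hfun_def using sublen_idmul_finite[OF mpow_ideal mpow_max_rad, of k]
  by (cases "sublen R M (idmul (mpow k) (carrier M)) (carrier M)") auto

text \<open>With \<open>U = \<mm>^k M\<close> for the power at hand, compute the length of M/tU
  through \<open>U\<close> and through \<open>t M\<close>. As \<open>t\<close> is regular, tM/tU has
  the length of M/U, so U/tU has the length of M/tM, and it surjects onto the \<open>k\<close>-th
  graded piece.\<close>

lemma hilbert_bound:
  "\<exists>L. \<forall>k. sublen R M (idmul (mpow (Suc k)) (carrier M)) (idmul (mpow k) (carrier M)) \<le> enat L"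
proof -
  obtain t where t: "reg_elt t" using exists_reg_elt by blast
  have tc: "t \<in> carrier R" using reg_elt_D(2)[OF t] .
  have Pt: "ideal (PIdl t) R" by (rule cgenideal_ideal[OF tc])
  let ?U = "\<lambda>k. idmul (mpow k) (carrier M)"
  have tM: "submodule (mulM t (carrier M)) R M" by (rule mulM_submodule[OF tc carrier_is_submodule])
  have tU: "submodule (mulM t (?U k)) R M" for k by (rule mulM_submodule[OF tc mpowM_submodule])
  have "idmul (PIdl t) (carrier M) \<subseteq> mulM t (carrier M)"
  proof (rule idmul_least[OF tM])
    fix a x assume "a \<in> PIdl t" and x: "x \<in> carrier M"
    then obtain r where r: "r \<in> carrier R" "a = r \<otimes> t" unfolding PIdl_mem by blast
    have "a \<odot>\<^bsub>M\<^esub> x = t \<odot>\<^bsub>M\<^esub> (r \<odot>\<^bsub>M\<^esub> x)" using r tc x by (simp add: smult_assoc1[symmetric] m_comm)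
    thus "a \<odot>\<^bsub>M\<^esub> x \<in> mulM t (carrier M)" using r x by auto
  qed
  hence "sublen R M (mulM t (carrier M)) (carrier M) \<le> sublen R M (idmul (PIdl t) (carrier M)) (carrier M)"
    by (intro sublen_mono tM carrier_is_submodule submodule_idmul order_refl submodule_subset[OF tM])
      (use ideal_carr[OF Pt] in blast)
  hence "sublen R M (mulM t (carrier M)) (carrier M) < \<infinity>"
    using sublen_idmul_finite[OF Pt reg_elt_max_rad[OF t]] by (rule order_le_less_trans)
  then obtain L where L: "sublen R M (mulM t (carrier M)) (carrier M) = enat L" by auto
  have "sublen R M (?U (Suc k)) (?U k) \<le> enat L" for k
  proof -
    have Uc: "?U k \<subseteq> carrier M" by (rule submodule_subset[OF mpowM_submodule])
    have tUU: "mulM t (?U k) \<subseteq> ?U (Suc k)" using mult_mpowM[OF reg_elt_D(1)[OF t]] by auto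
    have eq: "sublen R M (mulM t (?U k)) (mulM t (carrier M)) = sublen R M (?U k) (carrier M)"
    proof (rule sublen_mulM_eq[OF tc carrier_is_submodule mpowM_submodule Uc])
      fix u assume u: "u \<in> carrier M" "t \<odot>\<^bsub>M\<^esub> u \<in> mulM t (?U k)"
      then obtain w where w: "w \<in> ?U k" "t \<odot>\<^bsub>M\<^esub> u = t \<odot>\<^bsub>M\<^esub> w" by auto
      thus "u \<in> ?U k" using reg_elt_cancel_M[OF t u(1) _ w(2)] Uc by auto
    qed
    have "sublen R M (mulM t (?U k)) (?U k) + sublen R M (?U k) (carrier M) = sublen R M (mulM t (?U k)) (carrier M)"
      by (rule sublen_additive[OF tU mpowM_submodule carrier_is_submodule _ Uc, symmetric])
        (use tUU mpowM_Suc_sub in blast)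
    also have "\<dots> = sublen R M (mulM t (?U k)) (mulM t (carrier M)) + sublen R M (mulM t (carrier M)) (carrier M)"
      by (rule sublen_additive[OF tU tM carrier_is_submodule image_mono[OF Uc] submodule_subset[OF tM]])
    finally have "sublen R M (mulM t (?U k)) (?U k) + enat (hfun k) = enat (hfun k) + enat L"
      unfolding eq hfun L .
    hence "sublen R M (mulM t (?U k)) (?U k) = enat L"
      by (cases "sublen R M (mulM t (?U k)) (?U k)") auto
    moreover have "sublen R M (?U (Suc k)) (?U k) \<le> sublen R M (mulM t (?U k)) (?U k)"
      by (rule sublen_mono[OF mpowM_submodule mpowM_submodule tU mpowM_submodule tUU mpowM_Suc_sub order_refl])
    ultimately show ?thesis by simp
  qed
  thus ?thesis by blast
qed

text \<open>The associated graded module of the \<mm>-adic filtration is generated in degree zero by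
  the operators given by generators of \<mm>.\<close>

lemma hilbert_eventually_const:
  "\<exists>c n0. \<forall>k\<ge>n0. sublen R M (idmul (mpow (Suc k)) (carrier M)) (idmul (mpow k) (carrier M)) = enat c"
proof -
  obtain L where L: "\<And>k. sublen R M (idmul (mpow (Suc k)) (carrier M)) (idmul (mpow k) (carrier M)) \<le> enat L"
    using hilbert_bound by blast
  obtain A where A: "A \<subseteq> carrier R" "finite A" "\<mm> = Idl A" using finetely_gen[OF max_ideal_ideal] by blast
  obtain xs where xs: "set xs = A" using finite_list[OF A(2)] by blast
  have xsm: "x \<in> \<mm>" if "x \<in> set xs" for x using that A(3) genideal_self[OF A(1)] xs by auto
  have xsc: "set xs \<subseteq> carrier R" using A(1) xs by simp
  let ?U = "\<lambda>k. idmul (mpow k) (carrier M)"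
  have gen: "?U (Suc k) \<subseteq> gsum xs (?U k)" for k
  proof -
    have G: "submodule (gsum xs (?U k)) R M" by (rule gsum_submodule[OF xsc mpowM_submodule])
    have "ideal {a \<in> carrier R. \<forall>u\<in>?U k. a \<odot>\<^bsub>M\<^esub> u \<in> gsum xs (?U k)} R" (is "ideal ?K R")
    proof (rule idealI2)
      have uc: "u \<in> carrier M" if "u \<in> ?U k" for u using submodule_mem_carrier[OF mpowM_submodule that] .
      show "\<zero> \<in> ?K" using submodule_zero_mem[OF G] uc by simp
      show "a \<oplus> b \<in> ?K" if "a \<in> ?K" "b \<in> ?K" for a b
        using that uc submodule_add_mem[OF G] by (simp add: smult_l_distr)
      show "a \<otimes> b \<in> ?K" if "a \<in> carrier R" "b \<in> ?K" for a b
        using that uc submodule_smult_mem[OF G] by (simp add: smult_assoc1)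
    qed auto
    moreover have "A \<subseteq> ?K" using gsum_mem[OF xsc mpowM_submodule] A(1) xs by auto
    ultimately have "\<mm> \<subseteq> ?K" unfolding A(3) by (rule genideal_minimal)
    hence "idmul \<mm> (?U k) \<subseteq> gsum xs (?U k)" by (intro idmul_least[OF G]) blast
    thus ?thesis using mpowM_Suc_subset[of k] by blast
  qed
  show ?thesis
  proof (rule bounded_hilbert_eventually_const[where xs = xs and U = ?U and V = "\<lambda>k. ?U (Suc k)", OF xsc])
    show "mulset x (?U k) \<subseteq> ?U (Suc k)" "mulset x (?U (Suc k)) \<subseteq> ?U (Suc (Suc k))" if "x \<in> set xs" for k x
      using mult_mpowM[OF xsm[OF that]] by auto
    show "?U (Suc k) \<subseteq> gsum xs (?U k) <+>\<^bsub>M\<^esub> ?U (Suc (Suc k))" for k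
      by (rule set_add_sub_left[OF gsum_submodule[OF xsc mpowM_submodule] mpowM_submodule gen])
  qed (rule mpowM_submodule mpowM_Suc_sub L)+
qed

text \<open>In dimension one the normalizing factor is 1/k. The convergence is needed to identify
  the value of \<open>lim\<close> in the definition.\<close>

lemma hs_limit: "(\<lambda>k. real (hfun k) / real k) \<longlonglongrightarrow> hs_multiplicity R M"
proof -
  obtain c n0 where c: "\<And>k. k \<ge> n0 \<Longrightarrow> sublen R M (idmul (mpow (Suc k)) (carrier M)) (idmul (mpow k) (carrier M)) = enat c"
    using hilbert_eventually_const by blast
  define H where "H k = the_enat (sublen R M (idmul (mpow (Suc k)) (carrier M)) (idmul (mpow k) (carrier M)))" for k
  have add: "enat (hfun (Suc k)) = sublen R M (idmul (mpow (Suc k)) (carrier M)) (idmul (mpow k) (carrier M)) + enat (hfun k)" for k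
    unfolding hfun[symmetric]
    by (rule sublen_additive[OF mpowM_submodule mpowM_submodule carrier_is_submodule mpowM_Suc_sub submodule_subset[OF mpowM_submodule]])
  have "hfun (Suc k) = hfun k + H k" for k
    using add[of k] unfolding H_def
    by (cases "sublen R M (idmul (mpow (Suc k)) (carrier M)) (idmul (mpow k) (carrier M))") auto
  moreover have "H k = c" if "k \<ge> n0" for k using c[OF that] by (simp add: H_def)
  ultimately have lim: "(\<lambda>k. real (hfun k) / real k) \<longlonglongrightarrow> real c" by (rule eventually_const_average)
  have "(\<lambda>k. fact (the_enat (krull_dim R)) / real k ^ the_enat (krull_dim R) *
      real (the_enat (module_length R (quot_module M (ideal_smult R M (\<mm> [^]\<^bsub>ideals_set R\<^esub> k)))))) = (\<lambda>k. real (hfun k) / real k)"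
    unfolding mpow_def[symmetric] by (simp add: krull_dim_1 one_enat_def ideal_smult_eq_idmul module_length_quot[OF module_axioms mpowM_submodule] hfun)
  hence "hs_multiplicity R M = lim (\<lambda>k. real (hfun k) / real k)" by (simp add: hs_multiplicity_def)
  thus ?thesis using lim limI by metis
qed

text \<open>The results on \<open>M\<close> thus apply to the ring itself, with which both
  inequalities compare it.\<close>

lemma regular_depth_one_module: "depth_one_module R (regular_module R) E \<eta> \<delta> n p \<pi>"
proof (intro depth_one_module.intro module_regular gorenstein_dvr_point_axioms depth_one_module_axioms.intro)
  show "fg_sub R (regular_module R) (carrier (regular_module R))" using fg_sub_ideal[OF oneideal] by simp
  obtain t where "reg_elt t" using exists_reg_elt by blast
  thus "\<exists>t\<in>\<mm>. \<forall>y\<in>carrier (regular_module R). t \<odot>\<^bsub>regular_module R\<^esub> y = \<zero>\<^bsub>regular_module R\<^esub> \<longrightarrow> y = \<zero>\<^bsub>regular_module R\<^esub>"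
    using reg_elt_D unfolding regular_module_simps by blast
qed

end

section \<open>Padding of relations and finite support of combinations\<close>

context module
begin

lemma finsum_smult_extend:
  assumes Y: "finite Y" "Z \<subseteq> Y" and c: "c \<in> Z \<rightarrow> carrier R" and f: "f \<in> Y \<rightarrow> carrier M"
  shows "(\<Oplus>\<^bsub>M\<^esub>y\<in>Y. (if y \<in> Z then c y else \<zero>) \<odot>\<^bsub>M\<^esub> f y) = (\<Oplus>\<^bsub>M\<^esub>y\<in>Z. c y \<odot>\<^bsub>M\<^esub> f y)"
proof -
  let ?h = "\<lambda>y. (if y \<in> Z then c y else \<zero>) \<odot>\<^bsub>M\<^esub> f y"
  have fin: "finite Z" "finite (Y - Z)" using Y finite_subset by auto
  have hc: "?h \<in> Z \<rightarrow> carrier M" "?h \<in> (Y - Z) \<rightarrow> carrier M" using c f Y(2) by (auto simp: Pi_iff subset_iff)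
  have "finsum M ?h Y = finsum M ?h (Z \<union> (Y - Z))" using Y(2) by (simp add: Un_absorb1)
  also have "\<dots> = finsum M ?h Z \<oplus>\<^bsub>M\<^esub> finsum M ?h (Y - Z)"
    by (rule M.finsum_Un_disjoint[OF fin _ hc]) auto
  also have "finsum M ?h (Y - Z) = finsum M (\<lambda>_. \<zero>\<^bsub>M\<^esub>) (Y - Z)"
    by (rule M.finsum_cong') (use f in \<open>auto simp: Pi_iff\<close>)
  also have "finsum M ?h Z = (\<Oplus>\<^bsub>M\<^esub>y\<in>Z. c y \<odot>\<^bsub>M\<^esub> f y)"
    by (rule M.finsum_cong') (use c f Y(2) in \<open>auto simp: Pi_iff subset_iff\<close>)
  finally show ?thesis using M.finsum_closed[of "\<lambda>y. c y \<odot>\<^bsub>M\<^esub> f y" Z] c f Y(2)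
    by (simp add: M.finsum_zero Pi_iff subset_iff)
qed

text \<open>\<open>free_module\<close> allows an infinite basis, and finite sums need finitely many
  members of it.\<close>

lemma span_finitary:
  assumes "B \<subseteq> carrier M" "z \<in> module_span R M B"
  shows "\<exists>F. finite F \<and> F \<subseteq> B \<and> z \<in> module_span R M F"
proof -
  let ?H = "{z \<in> carrier M. \<exists>F. finite F \<and> F \<subseteq> B \<and> z \<in> module_span R M F}"
  have "submodule ?H R M"
  proof (rule submoduleI2)
    show "\<zero>\<^bsub>M\<^esub> \<in> ?H" using span_empty by auto
    fix x y assume "x \<in> ?H" "y \<in> ?H"
    then obtain F G where FG: "x \<in> carrier M" "y \<in> carrier M" "finite F" "F \<subseteq> B" "x \<in> module_span R M F" "finite G" "G \<subseteq> B" "y \<in> module_span R M G"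
      by auto
    have s: "submodule (module_span R M (F \<union> G)) R M" using FG assms(1) by (intro span_submodule) auto
    have "x \<in> module_span R M (F \<union> G)" "y \<in> module_span R M (F \<union> G)"
      using FG span_mono[of F "F \<union> G"] span_mono[of G "F \<union> G"] by auto
    hence "x \<oplus>\<^bsub>M\<^esub> y \<in> module_span R M (F \<union> G)" by (rule submodule_add_mem[OF s])
    moreover have "finite (F \<union> G)" "F \<union> G \<subseteq> B" using FG by auto
    ultimately have "\<exists>F. finite F \<and> F \<subseteq> B \<and> x \<oplus>\<^bsub>M\<^esub> y \<in> module_span R M F" by (intro exI[of _ "F \<union> G"]) simp
    thus "x \<oplus>\<^bsub>M\<^esub> y \<in> ?H" using FG by simp
  next
    fix a x assume a: "a \<in> carrier R" and "x \<in> ?H"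
    then obtain F where F: "x \<in> carrier M" "finite F" "F \<subseteq> B" "x \<in> module_span R M F" by auto
    have "a \<odot>\<^bsub>M\<^esub> x \<in> module_span R M F" using submodule_smult_mem[OF span_submodule a F(4)] F(3) assms(1) by auto
    thus "a \<odot>\<^bsub>M\<^esub> x \<in> ?H" using F a by auto
  qed auto
  moreover have "B \<subseteq> ?H"
  proof
    fix b assume b: "b \<in> B"
    have "b \<in> module_span R M {b}" using span_superset by auto
    thus "b \<in> ?H" using b assms(1) by (auto intro!: exI[of _ "{b}"])
  qed
  ultimately show ?thesis using span_least[of ?H B] assms(2) by auto
qed

end

section \<open>Freeness and the two conditions extracted from the inequalities\<close>

context depth_one_module
begin

interpretation RR: depth_one_module R "regular_module R" E \<eta> \<delta> n p \<pi>
  by (rule regular_depth_one_module)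

lemma RR_hfun: "sublen R (regular_module R) (mpow k) (carrier R) = enat (RR.hfun k)"
  using RR.hfun[of k] by (simp add: idmul_regular_mpow)

lemma exists_lift:
  assumes Y: "basis_N Y" and full: "mulM x0 (carrier M) = N"
  shows "\<exists>g. \<forall>y\<in>Y. g y \<in> carrier M \<and> x0 \<odot>\<^bsub>M\<^esub> g y = y"
proof -
  have "\<exists>z\<in>carrier M. x0 \<odot>\<^bsub>M\<^esub> z = y" if "y \<in> Y" for y
    using basis_N_D(2)[OF Y] that unfolding full[symmetric] by auto
  thus ?thesis by metis
qed

lemma free_of_inequalities:
  assumes Y: "basis_N Y" and full: "mulM x0 (carrier M) = N"
    and mult: "hs_multiplicity R M \<le> real (card Y) * hs_multiplicity R (regular_module R)"
  shows "free_module R M"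
proof -
  obtain g where g: "\<And>y. y \<in> Y \<Longrightarrow> g y \<in> carrier M \<and> x0 \<odot>\<^bsub>M\<^esub> g y = y" using exists_lift[OF Y full] by blast
  note finY = finY[OF Y g] and gY = gY[OF Y g]
  let ?V = "\<lambda>k. idmul (mpow k) (carrier M)" and ?F = "module_span R M (g ` Y)"
  have gc: "g ` Y \<subseteq> carrier M" using g by auto
  have F: "submodule ?F R M" by (rule span_submodule[OF gc])
  have VF: "submodule (?V k <+>\<^bsub>M\<^esub> ?F) R M" for k by (rule submodule_set_add[OF mpowM_submodule F])
  obtain t where t: "reg_elt t" using exists_reg_elt by blast
  have tc: "t \<in> carrier R" using reg_elt_D(2)[OF t] .
  have "?F = carrier M"
  proof (rule ccontr)
    assume ne: "?F \<noteq> carrier M"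
    have len1: "sublen R M (?V k) (?V k <+>\<^bsub>M\<^esub> ?F) = enat (card Y * RR.hfun k)" for k
    proof -
      have "sublen R M (?V k) (?V k <+>\<^bsub>M\<^esub> ?F) = enat (card Y) * sublen R (regular_module R) (mpow k) (carrier R)"
      proof (rule sublen_basis[OF mpow_ideal mpowM_submodule finY gY])
        show "a \<odot>\<^bsub>M\<^esub> g y \<in> ?V k" if "a \<in> mpow k" "y \<in> Y" for a y using idmul_mem that g by blast
        \<comment> \<open>\<open>comb_mem_idmul\<close> asks for a regular element inside the ideal.
          The exponent \<open>Suc k\<close> keeps it in \<mm> also for \<open>k = 0\<close>.\<close>
        have "t [^] Suc k \<in> mpow k"
          using ideal_mult_r[OF mpow_ideal tc pow_mem_mpow[OF reg_elt_D(1)[OF t]]] by simp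
        from comb_mem_idmul[OF Y g mpow_ideal reg_elt_pow[OF t] this]
        show "c y \<in> mpow k" if "c \<in> Y \<rightarrow> carrier R" "(\<Oplus>\<^bsub>M\<^esub>y\<in>Y. c y \<odot>\<^bsub>M\<^esub> g y) \<in> ?V k" "y \<in> Y" for c y
          using that by blast
      qed
      thus ?thesis by (simp add: RR_hfun)
    qed
    have len2: "enat k \<le> sublen R M (?V k <+>\<^bsub>M\<^esub> ?F) (carrier M)" for k
    proof (induction k)
      case 0 show ?case by (simp add: zero_enat_def[symmetric])
    next
      case (Suc k)
      have sub: "?V (Suc k) <+>\<^bsub>M\<^esub> ?F \<subseteq> ?V k <+>\<^bsub>M\<^esub> ?F" by (intro set_add_mono mpowM_Suc_sub order_refl)
      \<comment> \<open>Equality would put \<open>\<mm>^k M\<close> into \<open>F\<close> by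
        Nakayama's lemma, and then \<open>F = M\<close> because multiplication by \<open>t^k\<close>
        lands in \<open>F\<close> and \<open>F\<close> is saturated with respect to
        \<open>t\<close>.\<close>
      have "?V (Suc k) <+>\<^bsub>M\<^esub> ?F \<noteq> ?V k <+>\<^bsub>M\<^esub> ?F"
      proof
        assume eq: "?V (Suc k) <+>\<^bsub>M\<^esub> ?F = ?V k <+>\<^bsub>M\<^esub> ?F"
        have "?V k \<subseteq> ?V (Suc k) <+>\<^bsub>M\<^esub> ?F" unfolding eq by (rule set_add_upper1[OF mpowM_submodule F])
        also have "\<dots> \<subseteq> idmul \<mm> (?V k) <+>\<^bsub>M\<^esub> ?F" by (intro set_add_mono mpowM_Suc_subset order_refl)
        finally have VkF: "?V k \<subseteq> ?F" using nakayamaM[OF fg_submodule[OF mpowM_submodule] F] by blast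
        have "z \<in> ?F" if z: "z \<in> carrier M" for z
        proof -
          have "(t [^] k) \<odot>\<^bsub>M\<^esub> z \<in> ?F" using idmul_mem[OF pow_mem_mpow[OF reg_elt_D(1)[OF t]] z] VkF by blast
          thus ?thesis
          proof (induction k)
            case 0 thus ?case using z by simp
          next
            case (Suc k)
            have "t \<odot>\<^bsub>M\<^esub> ((t [^] k) \<odot>\<^bsub>M\<^esub> z) \<in> ?F" using Suc.prems z tc by (simp add: smult_assoc1[symmetric] m_comm)
            hence "(t [^] k) \<odot>\<^bsub>M\<^esub> z \<in> ?F" using span_lift_saturated[OF Y g t] z tc by simp
            thus ?case by (rule Suc.IH)
          qed
        qed
        thus False using ne submodule_subset[OF F] by blast
      qed
      hence "1 \<le> sublen R M (?V (Suc k) <+>\<^bsub>M\<^esub> ?F) (?V k <+>\<^bsub>M\<^esub> ?F)" using sub by (intro sublen_pos VF) blast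
      hence "enat (Suc k) \<le> sublen R M (?V (Suc k) <+>\<^bsub>M\<^esub> ?F) (?V k <+>\<^bsub>M\<^esub> ?F) + sublen R M (?V k <+>\<^bsub>M\<^esub> ?F) (carrier M)"
        using add_mono[OF _ Suc] by (fastforce simp: one_enat_def)
      also have "\<dots> = sublen R M (?V (Suc k) <+>\<^bsub>M\<^esub> ?F) (carrier M)"
        by (rule sublen_additive[OF VF VF carrier_is_submodule sub submodule_subset[OF VF], symmetric])
      finally show ?case .
    qed
    have ge: "card Y * RR.hfun k + k \<le> hfun k" for k
    proof -
      have "enat (card Y * RR.hfun k) + enat k \<le> enat (card Y * RR.hfun k) + sublen R M (?V k <+>\<^bsub>M\<^esub> ?F) (carrier M)"
        by (intro add_mono order_refl len2)
      also have "\<dots> = sublen R M (?V k) (carrier M)"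
        unfolding len1[symmetric]
        by (rule sublen_additive[OF mpowM_submodule VF carrier_is_submodule set_add_upper1[OF mpowM_submodule F] submodule_subset[OF VF], symmetric])
      finally show ?thesis by (simp add: hfun)
    qed
    \<comment> \<open>The surplus \<open>k\<close> becomes 1 after division by \<open>k\<close> and
      survives in the limit.\<close>
    have "(\<lambda>k. real (card Y) * (real (RR.hfun k) / real k) + 1) \<longlonglongrightarrow> real (card Y) * hs_multiplicity R (regular_module R) + 1"
      by (intro tendsto_intros RR.hs_limit)
    moreover have "\<exists>k0. \<forall>k\<ge>k0. real (card Y) * (real (RR.hfun k) / real k) + 1 \<le> real (hfun k) / real k"
    proof (rule exI[of _ 1], intro allI impI)
      fix k :: nat assume k: "k \<ge> 1"
      have "real (card Y * RR.hfun k + k) \<le> real (hfun k)" using ge by (simp only: of_nat_le_iff)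
      hence "real (card Y) * real (RR.hfun k) + real k \<le> real (hfun k)" by simp
      thus "real (card Y) * (real (RR.hfun k) / real k) + 1 \<le> real (hfun k) / real k"
      proof -
        assume *: "real (card Y) * real (RR.hfun k) + real k \<le> real (hfun k)"
        have "(real (card Y) * real (RR.hfun k) + real k) / real k \<le> real (hfun k) / real k"
          using * by (intro divide_right_mono) auto
        thus ?thesis using k by (simp add: add_divide_distrib)
      qed
    qed
    ultimately have "real (card Y) * hs_multiplicity R (regular_module R) + 1 \<le> hs_multiplicity R M"
      by (rule LIMSEQ_le[OF _ hs_limit])
    thus False using mult by simp
  qed
  moreover have "lin_independent R M (g ` Y)"
    unfolding lin_independent_def
  proof (intro conjI allI impI gc)
    fix F c assume "finite F \<and> F \<subseteq> g ` Y \<and> c \<in> F \<rightarrow> carrier R \<and> (\<Oplus>\<^bsub>M\<^esub>b\<in>F. c b \<odot>\<^bsub>M\<^esub> b) = \<zero>\<^bsub>M\<^esub>"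
    hence F: "F \<subseteq> g ` Y" "c \<in> F \<rightarrow> carrier R" "(\<Oplus>\<^bsub>M\<^esub>b\<in>F. c b \<odot>\<^bsub>M\<^esub> b) = \<zero>\<^bsub>M\<^esub>" by auto
    \<comment> \<open>The relation is moved from the image to the index set and padded by zero. On
      \<open>Z\<close>, \<open>g\<close> is injective since \<open>x0\<close> recovers
      \<open>y\<close> from \<open>g y\<close>.\<close>
    define Z where "Z = {y \<in> Y. g y \<in> F}"
    have ZF: "g ` Z = F" "Z \<subseteq> Y" using F(1) unfolding Z_def by auto
    have Fc: "F \<subseteq> carrier M" using F(1) gc by blast
    have injg: "inj_on g Z" using g ZF(2) by (metis inj_onI subsetD)
    have cZ: "(\<lambda>y. c (g y)) \<in> Z \<rightarrow> carrier R" using F(2) by (auto simp: Z_def)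
    have "(\<Oplus>\<^bsub>M\<^esub>b\<in>g ` Z. c b \<odot>\<^bsub>M\<^esub> b) = (\<Oplus>\<^bsub>M\<^esub>y\<in>Z. c (g y) \<odot>\<^bsub>M\<^esub> g y)"
      by (rule M.finsum_reindex[OF _ injg]) (unfold ZF(1), use F(2) Fc in auto)
    hence "(\<Oplus>\<^bsub>M\<^esub>y\<in>Y. (if y \<in> Z then c (g y) else \<zero>) \<odot>\<^bsub>M\<^esub> g y) = \<zero>\<^bsub>M\<^esub>"
      using finsum_smult_extend[OF finY ZF(2) cZ gY] F(3) ZF(1) by simp
    from comb_independent[OF Y g _ this] have z: "y \<in> Y \<Longrightarrow> (if y \<in> Z then c (g y) else \<zero>) = \<zero>" for y
      using cZ by (auto simp: Pi_iff)
    show "\<forall>b\<in>F. c b = \<zero>"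
    proof
      fix b assume "b \<in> F"
      then obtain y where y: "y \<in> Z" "b = g y" using ZF(1) by auto
      thus "c b = \<zero>" using z[of y] ZF(2) by auto
    qed
  qed
  ultimately show ?thesis unfolding free_module_def using module_axioms by blast
qed

text \<open>Coefficientwise, an element killed by \<open>p\<close> has coefficients in
  \<open>I = x0 R\<close>, which gives \<open>x0 M = N\<close>. The kernel of \<open>x0\<close> lies
  in \<mm> times \<open>M\<close>, so lifts of \<open>Y\<close> generate \<open>M\<close> by
  Nakayama's lemma; this bounds the multiplicity without comparing \<open>Y\<close> with the given
  basis.\<close>

lemma inequalities_of_free:
  assumes free: "free_module R M" and Y: "basis_N Y"
  shows "mulM x0 (carrier M) = N" "hs_multiplicity R M \<le> real (card Y) * hs_multiplicity R (regular_module R)"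
proof -
  obtain B where B: "lin_independent R M B" "module_span R M B = carrier M" using free unfolding free_module_def by blast
  have Bc: "B \<subseteq> carrier M" using B(1) unfolding lin_independent_def by blast
  have indB: "c b = \<zero>" if "finite F" "F \<subseteq> B" "c \<in> F \<rightarrow> carrier R" "(\<Oplus>\<^bsub>M\<^esub>b\<in>F. c b \<odot>\<^bsub>M\<^esub> b) = \<zero>\<^bsub>M\<^esub>" "b \<in> F" for F c b
    using B(1) that unfolding lin_independent_def by blast
  have repr: "\<exists>F c. finite F \<and> F \<subseteq> B \<and> c \<in> F \<rightarrow> carrier R \<and> (\<lambda>b. b) \<in> F \<rightarrow> carrier M \<and> z = (\<Oplus>\<^bsub>M\<^esub>b\<in>F. c b \<odot>\<^bsub>M\<^esub> b)"
    if z: "z \<in> carrier M" for z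
  proof -
    obtain F where F: "finite F" "F \<subseteq> B" "z \<in> module_span R M F" using span_finitary[OF Bc] z B(2) by blast
    have id: "(\<lambda>b. b) \<in> F \<rightarrow> carrier M" using F(2) Bc by auto
    obtain c where "c \<in> F \<rightarrow> carrier R" "z = (\<Oplus>\<^bsub>M\<^esub>b\<in>F. c b \<odot>\<^bsub>M\<^esub> b)"
      using span_image_finsum[OF F(1) id, of z] F(3) by auto
    thus ?thesis using F id by blast
  qed
  show full: "mulM x0 (carrier M) = N"
  proof (rule equalityI[OF x0_M_submodule(2)], rule subsetI)
    fix z assume z: "z \<in> N"
    obtain F c where F: "finite F" "F \<subseteq> B" "c \<in> F \<rightarrow> carrier R" "(\<lambda>b. b) \<in> F \<rightarrow> carrier M" "z = (\<Oplus>\<^bsub>M\<^esub>b\<in>F. c b \<odot>\<^bsub>M\<^esub> b)"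
      using repr[OF N_D(1)[OF z]] by blast
    have "c b \<in> I" if b: "b \<in> F" for b
    proof -
      have "a \<otimes> c b = \<zero>" if a: "a \<in> p" for a
      proof -
        have ac: "a \<in> carrier R" using p_carr[OF a] .
        have "(\<Oplus>\<^bsub>M\<^esub>b\<in>F. (a \<otimes> c b) \<odot>\<^bsub>M\<^esub> b) = a \<odot>\<^bsub>M\<^esub> z" using finsum_smult_mult[OF F(1) ac F(3,4)] F(5) by simp
        also have "\<dots> = \<zero>\<^bsub>M\<^esub>" using N_D(2)[OF z a] .
        finally have s0: "(\<Oplus>\<^bsub>M\<^esub>b\<in>F. (a \<otimes> c b) \<odot>\<^bsub>M\<^esub> b) = \<zero>\<^bsub>M\<^esub>" .
        have "(\<lambda>b. a \<otimes> c b) \<in> F \<rightarrow> carrier R" using F(3) ac by (auto simp: Pi_iff)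
        from indB[OF F(1,2) this s0 b] show ?thesis .
      qed
      thus ?thesis using F(3) b by (auto simp: I_def)
    qed
    hence "\<exists>e. \<forall>b\<in>F. e b \<in> carrier R \<and> c b = x0 \<otimes> e b"
      using x0(2) m_comm[OF x0_carr] unfolding PIdl_mem set_eq_iff by (intro bchoice) metis
    then obtain e where e: "\<And>b. b \<in> F \<Longrightarrow> e b \<in> carrier R \<and> c b = x0 \<otimes> e b" by blast
    have eF: "e \<in> F \<rightarrow> carrier R" using e by auto
    have "z = (\<Oplus>\<^bsub>M\<^esub>b\<in>F. (x0 \<otimes> e b) \<odot>\<^bsub>M\<^esub> b)"
      unfolding F(5) using e F(4) x0_carr by (intro M.finsum_cong') (auto simp: Pi_iff)
    also have "\<dots> = x0 \<odot>\<^bsub>M\<^esub> (\<Oplus>\<^bsub>M\<^esub>b\<in>F. e b \<odot>\<^bsub>M\<^esub> b)" by (rule finsum_smult_mult[OF F(1) x0_carr eF F(4)])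
    finally show "z \<in> mulM x0 (carrier M)" using M.finsum_closed[OF finsum_smult_mem[OF eF F(4)]] by blast
  qed
  obtain g where g: "\<And>y. y \<in> Y \<Longrightarrow> g y \<in> carrier M \<and> x0 \<odot>\<^bsub>M\<^esub> g y = y" using exists_lift[OF Y full] by blast
  note finY = finY[OF Y g] and gY = gY[OF Y g] and idY = idY[OF Y g]
  let ?F = "module_span R M (g ` Y)"
  have gc: "g ` Y \<subseteq> carrier M" using g by auto
  have F: "submodule ?F R M" by (rule span_submodule[OF gc])
  have mM: "submodule (idmul \<mm> (carrier M)) R M" by (rule submodule_idmul[OF _ order_refl]) (use max_carr in blast)
  \<comment> \<open>The coefficients satisfy \<open>x0 c = 0\<close>, and \<open>x0\<close> is
    outside the prime \<open>p\<close>, so they lie in \<open>p\<close>.\<close>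
  have ker: "z \<in> idmul \<mm> (carrier M)" if z: "z \<in> carrier M" "x0 \<odot>\<^bsub>M\<^esub> z = \<zero>\<^bsub>M\<^esub>" for z
  proof -
    obtain F c where F: "finite F" "F \<subseteq> B" "c \<in> F \<rightarrow> carrier R" "(\<lambda>b. b) \<in> F \<rightarrow> carrier M" "z = (\<Oplus>\<^bsub>M\<^esub>b\<in>F. c b \<odot>\<^bsub>M\<^esub> b)"
      using repr[OF z(1)] by blast
    have s0: "(\<Oplus>\<^bsub>M\<^esub>b\<in>F. (x0 \<otimes> c b) \<odot>\<^bsub>M\<^esub> b) = \<zero>\<^bsub>M\<^esub>" using finsum_smult_mult[OF F(1) x0_carr F(3,4)] F(5) z(2) by simp
    have xc: "(\<lambda>b. x0 \<otimes> c b) \<in> F \<rightarrow> carrier R" using F(3) x0_carr by (auto simp: Pi_iff)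
    show ?thesis unfolding F(5)
    proof (rule finsum_mem_submodule[OF mM F(1)])
      fix b assume b: "b \<in> F"
      have cb: "c b \<in> carrier R" using F(3) b by auto
      have "x0 \<otimes> c b \<in> p" using indB[OF F(1,2) xc s0 b] ideal_zero[OF p_ideal] by simp
      hence "c b \<in> \<mm>" using prime_mult[OF p_prime x0_carr cb] x0(3) p_max by blast
      thus "c b \<odot>\<^bsub>M\<^esub> b \<in> idmul \<mm> (carrier M)" using idmul_mem F(4) b by (auto simp: Pi_iff)
    qed
  qed
  have "carrier M \<subseteq> idmul \<mm> (carrier M) <+>\<^bsub>M\<^esub> ?F"
  proof
    fix z assume z: "z \<in> carrier M"
    obtain d where d: "d \<in> Y \<rightarrow> carrier R" "x0 \<odot>\<^bsub>M\<^esub> z = (\<Oplus>\<^bsub>M\<^esub>y\<in>Y. d y \<odot>\<^bsub>M\<^esub> y)" using basis_N_repr[OF Y x0_smult_N[OF z]] by blast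
    let ?w = "\<Oplus>\<^bsub>M\<^esub>y\<in>Y. d y \<odot>\<^bsub>M\<^esub> g y"
    have wF: "?w \<in> ?F" using span_image_finsum[OF finY gY] d(1) by blast
    have wc: "?w \<in> carrier M" using submodule_mem_carrier[OF F wF] .
    have xd: "(\<lambda>y. x0 \<otimes> d y) \<in> Y \<rightarrow> carrier R" using d(1) x0_carr by (auto simp: Pi_iff)
    have "x0 \<odot>\<^bsub>M\<^esub> ?w = (\<Oplus>\<^bsub>M\<^esub>y\<in>Y. (x0 \<otimes> d y) \<odot>\<^bsub>M\<^esub> g y)" using finsum_smult_mult[OF finY x0_carr d(1) gY] by simp
    also have "\<dots> = (\<Oplus>\<^bsub>M\<^esub>y\<in>Y. d y \<odot>\<^bsub>M\<^esub> y)"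
    proof (rule M.finsum_cong'[OF refl finsum_smult_mem[OF d(1) idY]])
      fix y assume y: "y \<in> Y"
      have dy: "d y \<in> carrier R" using d(1) y by auto
      have "(x0 \<otimes> d y) \<odot>\<^bsub>M\<^esub> g y = (d y \<otimes> x0) \<odot>\<^bsub>M\<^esub> g y" using m_comm[OF x0_carr dy] by simp
      thus "(x0 \<otimes> d y) \<odot>\<^bsub>M\<^esub> g y = d y \<odot>\<^bsub>M\<^esub> y" using g[OF y] dy x0_carr by (simp add: smult_assoc1)
    qed
    finally have eq: "x0 \<odot>\<^bsub>M\<^esub> ?w = x0 \<odot>\<^bsub>M\<^esub> z" using d(2) by simp
    have "x0 \<odot>\<^bsub>M\<^esub> (z \<ominus>\<^bsub>M\<^esub> ?w) = \<zero>\<^bsub>M\<^esub>"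
      unfolding smult_diff_r[OF x0_carr z wc] eq using x0_carr z by (simp add: M.minus_eq M.r_neg)
    hence "z \<ominus>\<^bsub>M\<^esub> ?w \<in> idmul \<mm> (carrier M)" using ker z wc by simp
    moreover have "z = (z \<ominus>\<^bsub>M\<^esub> ?w) \<oplus>\<^bsub>M\<^esub> ?w" using z wc by (simp add: M.minus_eq M.a_assoc M.l_neg)
    ultimately show "z \<in> idmul \<mm> (carrier M) <+>\<^bsub>M\<^esub> ?F" using wF unfolding mem_set_add by blast
  qed
  from nakayamaM[OF fin_gen F this] have FM: "?F = carrier M" using submodule_subset[OF F] by blast
  have le: "hfun k \<le> card Y * RR.hfun k" for k
  proof -
    let ?V = "idmul (mpow k) (carrier M)"
    have "sublen R M ?V (?V <+>\<^bsub>M\<^esub> ?F) \<le> enat (card (g ` Y)) * sublen R (regular_module R) (mpow k) (carrier R)"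
      by (rule sublen_span_le[OF mpow_ideal mpowM_submodule _ gc]) (use finY idmul_mem gc in blast)+
    moreover have "?V <+>\<^bsub>M\<^esub> ?F = carrier M"
      unfolding FM submodule_set_add_comm[OF mpowM_submodule carrier_is_submodule]
      by (rule set_add_absorb[OF carrier_is_submodule mpowM_submodule submodule_subset[OF mpowM_submodule]])
    ultimately have "hfun k \<le> card (g ` Y) * RR.hfun k" by (simp add: RR_hfun hfun)
    also have "\<dots> \<le> card Y * RR.hfun k" by (intro mult_le_mono1 card_image_le finY)
    finally show ?thesis .
  qed
  have "(\<lambda>k. real (card Y) * (real (RR.hfun k) / real k)) \<longlonglongrightarrow> real (card Y) * hs_multiplicity R (regular_module R)"
    by (intro tendsto_intros RR.hs_limit)
  moreover have "\<exists>k0. \<forall>k\<ge>k0. real (hfun k) / real k \<le> real (card Y) * (real (RR.hfun k) / real k)"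
  proof (intro exI allI impI)
    fix k :: nat
    have "real (hfun k) \<le> real (card Y * RR.hfun k)" using le by (simp only: of_nat_le_iff)
    hence "real (hfun k) / real k \<le> real (card Y * RR.hfun k) / real k" by (intro divide_right_mono) auto
    thus "real (hfun k) / real k \<le> real (card Y) * (real (RR.hfun k) / real k)" by simp
  qed
  ultimately show "hs_multiplicity R M \<le> real (card Y) * hs_multiplicity R (regular_module R)"
    by (rule LIMSEQ_le[OF hs_limit])
qed

end

section \<open>Augmentations onto a discrete valuation ring\<close>

lemma (in module) module_restrict: "submodule H R M \<Longrightarrow> module R (M\<lparr>carrier := H\<rparr>)"
  using submodule.submodule_is_module module_axioms by blast

lemma (in module) submodule_restrict_iff:
  assumes U: "submodule U R M"
  shows "submodule H R (M\<lparr>carrier := U\<rparr>) \<longleftrightarrow> submodule H R M \<and> H \<subseteq> U"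
proof -
  have res: "M\<lparr>carrier := U, carrier := H\<rparr> = M\<lparr>carrier := H\<rparr>" by simp
  show ?thesis
  proof
    assume H: "submodule H R (M\<lparr>carrier := U\<rparr>)"
    have HU: "H \<subseteq> U" using module.submodule_subset[OF module_restrict[OF U] H] by simp
    moreover have "submodule H R M"
      by (rule module_incl_imp_submodule)
        (use HU submodule_subset[OF U] module.module_restrict[OF module_restrict[OF U] H] res in auto)
    ultimately show "submodule H R M \<and> H \<subseteq> U" by blast
  next
    assume H: "submodule H R M \<and> H \<subseteq> U"
    show "submodule H R (M\<lparr>carrier := U\<rparr>)"
      by (rule module.module_incl_imp_submodule[OF module_restrict[OF U]])
        (use H module_restrict[of H] res in auto)
  qed
qed

lemma (in module) rcos_eq_self:
  assumes U: "submodule U R M" and x: "x \<in> U" shows "U +>\<^bsub>M\<^esub> x = U"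
  using a_rcos_eq_iff[OF U submodule_mem_carrier[OF U x] M.zero_closed] quot_zero[OF U]
    submodule_diff_mem[OF U x submodule_zero_mem[OF U]] by simp

lemma (in module) sublen_restrict:
  assumes "submodule U R M" shows "sublen R (M\<lparr>carrier := U\<rparr>) V U = sublen R M V U"
  unfolding sublen_def subchain_def submodule_restrict_iff[OF assms] by (simp add: conj_ac)

locale dvr_augmentation = noeth_local R for R (structure) +
  fixes Q :: "('o, 'q) ring_scheme" and l
  assumes dvr: "discrete_valuation_ring Q"
    and hom: "l \<in> ring_hom R Q" and surj: "l ` carrier R = carrier Q"
    and cotangent_finite: "module_length Q (cotangent_module Q R l) < \<infinity>"
begin

abbreviation "p \<equiv> a_kernel R Q l"

lemma Q_principal_domain: "principal_domain Q" and Q_not_field: "\<not> field Q"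
  using dvr by (simp_all add: discrete_valuation_ring_def)

sublocale Q: domain Q
  using Q_principal_domain by (rule principal_domain.axioms(1))

lemma Q_noeth_local: "noeth_local Q"
proof -
  interpret principal_domain Q by (rule Q_principal_domain)
  show ?thesis
    using dvr by (intro noeth_local.intro noetherian_ring_axioms Q.is_cring noeth_local_axioms.intro)
      (simp add: discrete_valuation_ring_def local_ring_def)
qed

lemma l_ring_hom_cring: "ring_hom_cring R Q l"
  by (intro ring_hom_cring.intro ring_hom_cring_axioms.intro is_cring Q.is_cring hom)

lemmas l_hom [simp] = ring_hom_closed[OF hom] ring_hom_mult[OF hom] ring_hom_add[OF hom] ring_hom_one[OF hom]

lemma hom_neg [simp]: "a \<in> carrier R \<Longrightarrow> l (\<ominus> a) = \<ominus>\<^bsub>Q\<^esub> l a"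
proof -
  interpret ring_hom_cring R Q l by (rule l_ring_hom_cring)
  show "a \<in> carrier R \<Longrightarrow> l (\<ominus> a) = \<ominus>\<^bsub>Q\<^esub> l a" by simp
qed

lemma kernel_iff: "a \<in> p \<longleftrightarrow> a \<in> carrier R \<and> l a = \<zero>\<^bsub>Q\<^esub>"
  by (simp add: a_kernel_def')

lemma l_diff: "a \<in> carrier R \<Longrightarrow> b \<in> carrier R \<Longrightarrow> l (a \<ominus> b) = l a \<ominus>\<^bsub>Q\<^esub> l b"
  by (simp add: minus_eq Q.minus_eq)

lemma l_eq_iff: "a \<in> carrier R \<Longrightarrow> b \<in> carrier R \<Longrightarrow> l a = l b \<longleftrightarrow> a \<ominus> b \<in> p"
  by (simp add: kernel_iff l_diff)

lemma l_lift: "c \<in> carrier Q \<Longrightarrow> \<exists>a\<in>carrier R. l a = c"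
  unfolding surj[symmetric] by blast

lemma inv_l: "c \<in> carrier Q \<Longrightarrow> inv_into (carrier R) l c \<in> carrier R"
  "c \<in> carrier Q \<Longrightarrow> l (inv_into (carrier R) l c) = c"
  using surj by (metis inv_into_into, metis f_inv_into_f)

lemma kernel_ideal: "ideal p R"
  by (rule ring_hom_ring.kernel_is_ideal[OF ring_hom_ringI2[OF ring_axioms Q.ring_axioms hom]])

lemma kernel_prime: "primeideal p R"
proof (rule primeidealI[OF kernel_ideal is_cring])
  show "carrier R \<noteq> p" using one_closed by (metis kernel_iff ring_hom_one[OF hom] Q.one_not_zero)
  fix a b assume "a \<in> carrier R" "b \<in> carrier R" "a \<otimes> b \<in> p"
  thus "a \<in> p \<or> b \<in> p" using Q.integral[of "l a" "l b"] by (simp add: kernel_iff)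
qed

text \<open>\<open>\<pi>\<close> lifts a generator of the maximal ideal of \<open>Q\<close>. It
  avoids \<open>p\<close> because that maximal ideal is nonzero, \<open>Q\<close> not being a
  field.\<close>

lemma exists_uniformizer: "\<exists>\<pi>\<in>\<mm>. \<pi> \<notin> p \<and> (\<forall>y\<in>\<mm>. \<exists>b\<in>carrier R. y \<ominus> b \<otimes> \<pi> \<in> p)"
proof -
  have pm: "p \<subseteq> \<mm>" by (rule proper_subset_max[OF kernel_ideal prime_one[OF kernel_prime]])
  note Qmax = noeth_local.max_ideal_ideal[OF Q_noeth_local]
  obtain w where w: "w \<in> carrier Q" "max_ideal Q = PIdl\<^bsub>Q\<^esub> w" 
    using principal_domain.exists_gen[OF Q_principal_domain Qmax] by blast
  obtain \<pi> where \<pi>: "\<pi> \<in> carrier R" "l \<pi> = w" using l_lift[OF w(1)] by blast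
  \<comment> \<open>The map \<open>l\<close> is local: an inverse of \<open>l y\<close> lifts to
    some \<open>b\<close> with \<open>1 - b y\<close> in \<open>p\<close>, and then \<open>1\<close>
    would lie in \<mm>.\<close>
  have lmax: "l y \<in> max_ideal Q" if y: "y \<in> \<mm>" for y
  proof (rule ccontr)
    note yc = max_carr[OF y]
    assume "l y \<notin> max_ideal Q"
    then obtain c where c: "c \<in> carrier Q" "c \<otimes>\<^bsub>Q\<^esub> l y = \<one>\<^bsub>Q\<^esub>" using 
      noeth_local.unit_of_not_max[OF Q_noeth_local, of "l y"] yc by auto
    obtain b where b: "b \<in> carrier R" "l b = c" using l_lift[OF c(1)] by blast
    have "\<one> \<ominus> b \<otimes> y \<in> \<mm>" using l_eq_iff[of \<one> "b \<otimes> y"] pm b c yc by auto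
    moreover have "b \<otimes> y \<in> \<mm>" using ideal_mult[OF max_ideal_ideal b(1) y] .
    ultimately have "\<one> \<in> \<mm>" using ideal_diff_cancel[OF max_ideal_ideal one_closed] by blast
    thus False using max_one by blast
  qed
  have "\<pi> \<in> \<mm>"
  proof (rule ccontr)
    assume "\<pi> \<notin> \<mm>"
    then obtain b where b: "b \<in> carrier R" "b \<otimes> \<pi> = \<one>" using unit_of_not_max[OF \<pi>(1)] by auto
    have "l b \<otimes>\<^bsub>Q\<^esub> w = l (b \<otimes> \<pi>)" using b(1) \<pi> by simp
    hence "l b \<otimes>\<^bsub>Q\<^esub> w = \<one>\<^bsub>Q\<^esub>" using b(2) by simp
    hence "\<one>\<^bsub>Q\<^esub> \<in> max_ideal Q" unfolding w(2) Q.PIdl_mem using b(1) by (metis ring_hom_closed[OF hom])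
    thus False using noeth_local.max_one[OF Q_noeth_local] by blast
  qed
  moreover have "\<pi> \<notin> p"
  proof
    assume "\<pi> \<in> p"
    hence "w = \<zero>\<^bsub>Q\<^esub>" using \<pi>(2) by (simp add: kernel_iff)
    hence "max_ideal Q = {\<zero>\<^bsub>Q\<^esub>}" using w(2) Q.cgenideal_eq_genideal[OF w(1)] Q.genideal_zero by simp
    thus False using noeth_local.max_maximal[OF Q_noeth_local] Q.zeromaximalideal_fieldI Q_not_field by simp
  qed
  moreover have "\<exists>b\<in>carrier R. y \<ominus> b \<otimes> \<pi> \<in> p" if y: "y \<in> \<mm>" for y
  proof -
    obtain r where r: "r \<in> carrier Q" "l y = r \<otimes>\<^bsub>Q\<^esub> w" using lmax[OF y] unfolding w(2) Q.PIdl_mem by blast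
    obtain b where b: "b \<in> carrier R" "l b = r" using l_lift[OF r(1)] by blast
    have "l y = l (b \<otimes> \<pi>)" using r b \<pi> by simp
    thus ?thesis using l_eq_iff[OF max_carr[OF y], of "b \<otimes> \<pi>"] b(1) \<pi>(1) by auto
  qed
  ultimately show ?thesis by blast
qed

lemma length_descend:
  assumes N: "module R N" and kill: "\<And>a x. a \<in> p \<Longrightarrow> x \<in> carrier N \<Longrightarrow> a \<odot>\<^bsub>N\<^esub> x = \<zero>\<^bsub>N\<^esub>"
  shows "module_length Q (descend_module R l N) = module_length R N"
proof (rule module_length_descend[OF N surj])
  interpret N: module R N by fact
  fix a b x assume *: "a \<in> carrier R" "b \<in> carrier R" "l a = l b" "x \<in> carrier N"
  have "a = (a \<ominus> b) \<oplus> b" using *(1,2) by (simp add: minus_eq a_assoc l_neg)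
  hence "a \<odot>\<^bsub>N\<^esub> x = (a \<ominus> b) \<odot>\<^bsub>N\<^esub> x \<oplus>\<^bsub>N\<^esub> b \<odot>\<^bsub>N\<^esub> x" using * by (metis N.smult_l_distr minus_closed)
  thus "a \<odot>\<^bsub>N\<^esub> x = b \<odot>\<^bsub>N\<^esub> x" using kill[of "a \<ominus> b" x] l_eq_iff[of a b] * by simp
qed

lemma kernel_square: "ideal (p \<cdot> p) R" "p \<cdot> p \<subseteq> p" "p \<cdot> p \<subseteq> RM.idmul p p"
proof -
  show "ideal (p \<cdot> p) R" by (rule ideal_prod_is_ideal[OF kernel_ideal kernel_ideal])
  show "p \<cdot> p \<subseteq> p" using ideal_prod_inter[OF kernel_ideal kernel_ideal] by blast
  have pc: "p \<subseteq> carrier R" by (auto simp: kernel_iff)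
  have S: "submodule (RM.idmul p p) R (regular_module R)" by (rule RM.submodule_idmul) (use pc in simp_all)
  show "p \<cdot> p \<subseteq> RM.idmul p p"
  proof
    fix s assume "s \<in> p \<cdot> p"
    thus "s \<in> RM.idmul p p"
    proof (induction s rule: ideal_prod.induct)
      case (prod i j) thus ?case using RM.idmul_mem[of i p j p] by simp
    next
      case (sum s t) thus ?case using RM.submodule_add_mem[OF S] by simp
    qed
  qed
qed

lemma sublen_kernel_square_finite: "sublen R (regular_module R) (p \<cdot> p) p < \<infinity>"
proof -
  let ?P = "(regular_module R)\<lparr>carrier := p\<rparr>"
  have ps: "submodule p R (regular_module R)" by (simp add: submodule_regular_iff kernel_ideal)
  have P: "module R ?P" by (rule RM.module_restrict[OF ps])
  have S: "submodule (p \<cdot> p) R ?P"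
    unfolding RM.submodule_restrict_iff[OF ps] submodule_regular_iff using kernel_square(1,2) by blast
  interpret P: module R ?P by (rule P)
  have "module_length Q (cotangent_module Q R l) = module_length R (quot_module ?P (p \<cdot> p))"
    unfolding cotangent_module_def Let_def
  proof (rule length_descend[OF P.module_quot[OF S]])
    fix a x assume a: "a \<in> p" and "x \<in> carrier (quot_module ?P (p \<cdot> p))"
    then obtain y where y: "y \<in> p" "x = (p \<cdot> p) +>\<^bsub>?P\<^esub> y" by (auto simp: P.quot_carrier)
    have ac: "a \<in> carrier R" using a by (simp add: kernel_iff)
    have "a \<odot>\<^bsub>quot_module ?P (p \<cdot> p)\<^esub> x = (p \<cdot> p) +>\<^bsub>?P\<^esub> (a \<odot>\<^bsub>?P\<^esub> y)"
      unfolding y(2) using P.quot_smult[OF S ac] y(1) by simp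
    also have "\<dots> = p \<cdot> p"
      by (rule P.rcos_eq_self[OF S]) (use ideal_prod.prod[OF a y(1)] in simp)
    finally show "a \<odot>\<^bsub>quot_module ?P (p \<cdot> p)\<^esub> x = \<zero>\<^bsub>quot_module ?P (p \<cdot> p)\<^esub>" by simp
  qed
  also have "\<dots> = sublen R (regular_module R) (p \<cdot> p) p"
    unfolding module_length_quot[OF P S] using RM.sublen_restrict[OF ps] by simp
  finally show ?thesis using cotangent_finite by simp
qed

text \<open>As \<open>p/p\<^sup>2\<close> has finite length, some power of \<open>\<pi>\<close> carries \<open>p\<close> into \<open>p\<^sup>2\<close>; this is Nakayama's lemma
  twice, first at the maximal ideal and then at \<open>p\<close>.\<close>

lemma kernel_generically_zero:
  assumes \<pi>: "\<pi> \<in> \<mm>" "\<pi> \<notin> p"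
  shows "\<exists>s\<in>carrier R. s \<notin> p \<and> (\<forall>y\<in>p. y \<otimes> s = \<zero>)"
proof -
  let ?A = "regular_module R"
  let ?V = "\<lambda>i::nat. (\<lambda>x. (\<pi> [^] i) \<odot>\<^bsub>?A\<^esub> x) ` p"
  let ?N = "\<lambda>i. ?V i <+>\<^bsub>?A\<^esub> (p \<cdot> p)"
  have \<pi>c: "\<pi> \<in> carrier R" using max_carr \<pi>(1) .
  have pc: "x \<in> p \<Longrightarrow> x \<in> carrier R" for x by (simp add: kernel_iff)
  have ps: "submodule p R ?A" "submodule (p \<cdot> p) R ?A" by (simp_all add: submodule_regular_iff kernel_ideal kernel_square)
  have V: "submodule (?V i) R ?A" for i using RM.submodule_smult_image[OF _ ps(1)] \<pi>c by simp
  have VV: "?V (Suc i) \<subseteq> ?V i" for i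
  proof
    fix z assume "z \<in> ?V (Suc i)"
    then obtain x where x: "x \<in> p" "z = \<pi> [^] Suc i \<otimes> x" by auto
    hence "z = \<pi> [^] i \<otimes> (\<pi> \<otimes> x)" using \<pi>c pc by (simp add: m_assoc)
    moreover have "\<pi> \<otimes> x \<in> p" using ideal_mult[OF kernel_ideal \<pi>c x(1)] .
    ultimately show "z \<in> ?V i" by auto
  qed
  have Vp: "?V i \<subseteq> p" for i using ideal_mult[OF kernel_ideal] \<pi>c by auto
  \<comment> \<open>The ideals \<open>\<pi>^i p + p^2\<close> descend between \<open>p^2\<close> and
    \<open>p\<close>, and the length between these two is finite.\<close>
  obtain i where "?N (Suc i) = ?N i"
    using RM.desc_chain_stab[OF ps(2) sublen_kernel_square_finite, of ?N]
      RM.submodule_set_add[OF V ps(2)] RM.set_add_upper2[OF V ps(2)]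
      RM.set_add_least[OF ps(1) Vp kernel_square(2)] RM.set_add_mono[OF VV order_refl] by blast
  hence "?V i \<subseteq> ?N (Suc i)" using RM.set_add_upper1[OF V ps(2), of i] by blast
  also have "\<dots> \<subseteq> RM.idmul \<mm> (?V i) <+>\<^bsub>?A\<^esub> (p \<cdot> p)"
  proof (rule RM.set_add_mono[OF _ order_refl], rule subsetI)
    fix z assume "z \<in> ?V (Suc i)"
    then obtain x where x: "x \<in> p" "z = \<pi> [^] Suc i \<otimes> x" by auto
    have z: "z = \<pi> \<odot>\<^bsub>?A\<^esub> (\<pi> [^] i \<odot>\<^bsub>?A\<^esub> x)"
      using x \<pi>c pc[OF x(1)] m_comm[of "\<pi> [^] i" \<pi>] by (simp add: m_assoc[symmetric])
    show "z \<in> RM.idmul \<mm> (?V i)" unfolding z by (rule RM.idmul_mem[OF \<pi>(1) imageI[OF x(1)]])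
  qed
  finally have "?V i \<subseteq> RM.idmul \<mm> (?V i) <+>\<^bsub>?A\<^esub> (p \<cdot> p)" .
  moreover have "fg_sub R ?A (?V i)" by (rule fg_sub_ideal[OF V[unfolded submodule_regular_iff]])
  ultimately have "?V i \<subseteq> p \<cdot> p" by (intro RM.nakayama[OF _ ps(2)])
  hence sq: "(\<pi> [^] i) \<odot>\<^bsub>?A\<^esub> x \<in> RM.idmul p p" if "x \<in> p" for x using kernel_square(3) that by blast
  have pC: "p \<subseteq> carrier ?A" using pc by auto
  have z: "RM.idmul p p <+>\<^bsub>?A\<^esub> {\<zero>\<^bsub>?A\<^esub>} = RM.idmul p p"
    by (rule RM.set_add_zero[OF RM.submodule_idmul[OF pC[unfolded regular_module_simps] pC]])
  \<comment> \<open>Here \<open>\<pi>^i\<close>, which carries \<open>p\<close> into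
    \<open>p^2\<close> and lies outside \<open>p\<close>, is the denominator
    \<open>s\<close>.\<close>
  have "\<exists>u\<in>carrier R. u \<notin> p \<and> (\<forall>x\<in>p. u \<odot>\<^bsub>?A\<^esub> x \<in> {\<zero>\<^bsub>?A\<^esub>})"
  proof (rule RM.nakayama_prime[OF kernel_prime fg_sub_ideal[OF kernel_ideal] RM.zero_submodule])
    show "\<pi> [^] i \<in> carrier R" using \<pi>c by simp
    show "\<pi> [^] i \<notin> p" using prime_pow[OF kernel_prime \<pi>c] \<pi>(2) by blast
  qed (unfold z, rule sq)
  then obtain u where u: "u \<in> carrier R" "u \<notin> p" "\<forall>x\<in>p. u \<otimes> x = \<zero>" by auto
  have "y \<otimes> u = \<zero>" if "y \<in> p" for y using u(1,3) that m_comm[OF pc[OF that] u(1)] by simp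
  thus ?thesis using u(1,2) by blast
qed

end

section \<open>Rank and congruence module\<close>

lemma (in module) finsum_restrict:
  assumes U: "submodule U R M" and F: "finite F" "f \<in> F \<rightarrow> U"
  shows "finsum (M\<lparr>carrier := U\<rparr>) f F = finsum M f F"
proof -
  have am: "abelian_monoid (M\<lparr>carrier := U\<rparr>)"
    using module.axioms(2)[OF module_restrict[OF U]] by (rule abelian_group.axioms(1))
  have UM: "x \<in> U \<Longrightarrow> x \<in> carrier M" for x using submodule_mem_carrier[OF U] .
  show ?thesis using F
  proof (induction F rule: finite_induct)
    case empty thus ?case using abelian_monoid.finsum_empty[OF am, of f] by simp
  next
    case (insert x F)
    have f: "f \<in> F \<rightarrow> U" "f x \<in> U" using insert.prems by auto
    hence "f \<in> F \<rightarrow> carrier M" "f x \<in> carrier M" using UM by auto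
    thus ?case using insert f abelian_monoid.finsum_insert[OF am insert.hyps, of f] by simp
  qed
qed

lemma finsum_descend: "finsum (descend_module A l N) = finsum N"
  unfolding finsum_def finprod_def by (intro ext) simp

context depth_one_module
begin

lemma ann_in_p: "ann_in M p = N"
  by (simp add: ann_in_def N_def)

lemma ann_in_regular_p: "ann_in (regular_module R) p = I"
  by (simp add: ann_in_def I_def)

context
  fixes Q :: "('o, 'q) ring_scheme" and l
  assumes aug: "dvr_augmentation R Q l" and p: "p = a_kernel R Q l"
begin

text \<open>Coefficients in \<open>Q\<close> are lifted to \<open>R\<close>; two lifts differ by an
  element of \<open>p\<close>, which acts as zero on \<open>N\<close>. Relations over a subset of
  \<open>B\<close> are padded by zero, since \<open>indep\<close> speaks of the whole index
  set.\<close>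

lemma lin_independent_descend_iff:
  assumes B: "finite B" "B \<subseteq> N"
  shows "lin_independent Q (descend_module R l (M\<lparr>carrier := N\<rparr>)) B \<longleftrightarrow> indep B (\<lambda>b. b)"
proof -
  let ?D = "descend_module R l (M\<lparr>carrier := N\<rparr>)"
  let ?i = "inv_into (carrier R) l"
  note inv = dvr_augmentation.inv_l[OF aug] and ker = dvr_augmentation.kernel_iff[OF aug, folded p]
    and eq = dvr_augmentation.l_eq_iff[OF aug, folded p]
  have lc: "a \<in> carrier R \<Longrightarrow> l a \<in> carrier Q" for a using dvr_augmentation.l_hom(1)[OF aug] .
  have sum: "(\<Oplus>\<^bsub>?D\<^esub>b\<in>F. c b \<odot>\<^bsub>?D\<^esub> b) = (\<Oplus>\<^bsub>M\<^esub>b\<in>F. ?i (c b) \<odot>\<^bsub>M\<^esub> b)"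
    if F: "F \<subseteq> B" and c: "c \<in> F \<rightarrow> carrier Q" for F c
  proof -
    have fF: "finite F" using F B(1) finite_subset by blast
    have m: "(\<lambda>b. ?i (c b) \<odot>\<^bsub>M\<^esub> b) \<in> F \<rightarrow> N" using F B(2) c inv(1) N_smult by (auto simp: Pi_iff subset_iff)
    have "c b \<odot>\<^bsub>?D\<^esub> b = ?i (c b) \<odot>\<^bsub>M\<^esub> b" for b by (simp add: descend_module_def)
    thus ?thesis unfolding finsum_descend using finsum_restrict[OF N_submodule fF m] by simp
  qed
  have idB: "(\<lambda>b. b) \<in> B \<rightarrow> carrier M" using B(2) N_D(1) by auto
  show ?thesis
  proof
    assume li: "lin_independent Q ?D B"
    show "indep B (\<lambda>b. b)" unfolding indep_def
    proof (intro allI impI ballI)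
      fix c b assume c: "c \<in> B \<rightarrow> carrier R" "(\<Oplus>\<^bsub>M\<^esub>b\<in>B. c b \<odot>\<^bsub>M\<^esub> b) = \<zero>\<^bsub>M\<^esub>" and b: "b \<in> B"
      have lc': "(\<lambda>b. l (c b)) \<in> B \<rightarrow> carrier Q" using c(1) lc by (auto simp: Pi_iff)
      have "?i (l (c b)) \<odot>\<^bsub>M\<^esub> b = c b \<odot>\<^bsub>M\<^esub> b" if "b \<in> B" for b
      proof -
        have cb: "c b \<in> carrier R" using c(1) that by auto
        show ?thesis
        proof (rule smult_cong_N)
          show "?i (l (c b)) \<ominus> c b \<in> p" using eq[OF inv(1)[OF lc[OF cb]] cb] inv(2)[OF lc[OF cb]] by simp
        qed (use inv(1)[OF lc[OF cb]] cb that B(2) in auto)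
      qed
      hence "(\<Oplus>\<^bsub>M\<^esub>b\<in>B. ?i (l (c b)) \<odot>\<^bsub>M\<^esub> b) = (\<Oplus>\<^bsub>M\<^esub>b\<in>B. c b \<odot>\<^bsub>M\<^esub> b)"
        by (intro M.finsum_cong'[OF refl finsum_smult_mem[OF c(1) idB]])
      hence "(\<Oplus>\<^bsub>?D\<^esub>b\<in>B. l (c b) \<odot>\<^bsub>?D\<^esub> b) = \<zero>\<^bsub>?D\<^esub>" using sum[OF order_refl lc'] c(2) by simp
      hence "l (c b) = \<zero>\<^bsub>Q\<^esub>" using li B(1) lc' b unfolding lin_independent_def by blast
      thus "c b \<in> p" using ker c(1) b by auto
    qed
  next
    assume ind: "indep B (\<lambda>b. b)"
    show "lin_independent Q ?D B" unfolding lin_independent_def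
    proof (intro conjI allI impI ballI)
      show "B \<subseteq> carrier ?D" using B(2) by simp
      fix F c b
      assume "finite F \<and> F \<subseteq> B \<and> c \<in> F \<rightarrow> carrier Q \<and> (\<Oplus>\<^bsub>?D\<^esub>b\<in>F. c b \<odot>\<^bsub>?D\<^esub> b) = \<zero>\<^bsub>?D\<^esub>" and b: "b \<in> F"
      hence F: "F \<subseteq> B" "c \<in> F \<rightarrow> carrier Q" and s0: "(\<Oplus>\<^bsub>?D\<^esub>b\<in>F. c b \<odot>\<^bsub>?D\<^esub> b) = \<zero>\<^bsub>?D\<^esub>" by auto
      have s: "(\<Oplus>\<^bsub>M\<^esub>b\<in>F. ?i (c b) \<odot>\<^bsub>M\<^esub> b) = \<zero>\<^bsub>M\<^esub>" using s0 sum[OF F] by simp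
      have ic: "(\<lambda>b. ?i (c b)) \<in> F \<rightarrow> carrier R" using F(2) inv(1) by (auto simp: Pi_iff)
      let ?e = "\<lambda>y. if y \<in> F then ?i (c y) else \<zero>"
      have "?e \<in> B \<rightarrow> carrier R" using ic by (auto simp: Pi_iff)
      from indepD[OF ind this, of b] have "?i (c b) \<in> p"
        using finsum_smult_extend[OF B(1) F(1) ic idB] s F(1) b by auto
      hence "l (?i (c b)) = \<zero>\<^bsub>Q\<^esub>" using ker by blast
      thus "c b = \<zero>\<^bsub>Q\<^esub>" using inv(2)[OF funcset_mem[OF F(2) b]] by simp
    qed
  qed
qed

lemma aug_rank_eq:
  assumes Y: "basis_N Y" shows "aug_rank Q R l M = card Y"
proof -
  let ?D = "descend_module R l (M\<lparr>carrier := N\<rparr>)"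
  have "module_rank Q ?D = enat (card Y)"
    unfolding module_rank_def
  proof (rule antisym)
    show "(SUP B\<in>{B. finite B \<and> lin_independent Q ?D B}. enat (card B)) \<le> enat (card Y)"
    proof (rule SUP_least)
      fix B assume "B \<in> {B. finite B \<and> lin_independent Q ?D B}"
      hence B: "finite B" "lin_independent Q ?D B" by auto
      hence BN: "B \<subseteq> N" unfolding lin_independent_def by simp
      have "card B \<le> card Y"
        by (rule indep_card_le[OF basis_N_D(1,2)[OF Y] B(1)])
          (use BN basis_N_D(3)[OF Y] B(2) lin_independent_descend_iff[OF B(1) BN] in auto)
      thus "enat (card B) \<le> enat (card Y)" by simp
    qed
    show "enat (card Y) \<le> (SUP B\<in>{B. finite B \<and> lin_independent Q ?D B}. enat (card B))"
      by (rule SUP_upper) (use basis_N_D[OF Y] lin_independent_descend_iff[OF basis_N_D(1,2)[OF Y]] in auto)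
  qed
  thus ?thesis unfolding aug_rank_def p[symmetric] ann_in_p by simp
qed

lemma congruence_module_length:
  "module_length Q (congruence_module Q R l M) = sublen R M (N <+>\<^bsub>M\<^esub> ann_in M I) (carrier M)"
proof -
  let ?U = "N <+>\<^bsub>M\<^esub> ann_in M I"
  have U: "submodule ?U R M" by (rule submodule_set_add[OF N_submodule ann_I_submodule])
  have "module_length Q (congruence_module Q R l M) = module_length R (quot_module M ?U)"
    unfolding congruence_module_def Let_def p[symmetric] ann_in_p ann_in_regular_p
  proof (rule dvr_augmentation.length_descend[OF aug module_quot[OF U], folded p])
    fix a x assume a: "a \<in> p" and "x \<in> carrier (quot_module M ?U)"
    then obtain y where y: "y \<in> carrier M" "x = ?U +>\<^bsub>M\<^esub> y" by (auto simp: quot_carrier)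
    have ac: "a \<in> carrier R" using p_carr[OF a] .
    \<comment> \<open>As \<open>p\<close> kills \<open>x0\<close>, the submodule \<open>p M\<close>
      lies in \<open>M[I]\<close>, so \<open>p\<close> annihilates the quotient.\<close>
    have "x0 \<odot>\<^bsub>M\<^esub> (a \<odot>\<^bsub>M\<^esub> y) = (a \<otimes> x0) \<odot>\<^bsub>M\<^esub> y" using ac x0_carr y(1) by (simp add: smult_assoc1[symmetric] m_comm)
    also have "\<dots> = \<zero>\<^bsub>M\<^esub>" using I_D(2)[OF x0(1) a] y(1) by simp
    finally have "a \<odot>\<^bsub>M\<^esub> y \<in> ann_in M I" using ac y(1) by (simp add: ann_I_eq)
    hence "a \<odot>\<^bsub>M\<^esub> y \<in> ?U" using set_add_upper2[OF N_submodule ann_I_submodule] by blast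
    hence "?U +>\<^bsub>M\<^esub> (a \<odot>\<^bsub>M\<^esub> y) = ?U" by (rule rcos_eq_self[OF U])
    thus "a \<odot>\<^bsub>quot_module M ?U\<^esub> x = \<zero>\<^bsub>quot_module M ?U\<^esub>" unfolding y(2) using quot_smult[OF U ac y(1)] by simp
  qed
  thus ?thesis using module_length_quot[OF module_axioms U] by simp
qed

end

text \<open>For the ring, \<open>N\<close> is \<open>I = x0 R\<close>, and \<open>x0\<close> is
  torsion-free over R/p because it lies outside \<open>p\<close>: the rank is one.\<close>

lemma regular_basis_N: "depth_one_module.basis_N R (regular_module R) p {x0}"
proof -
  interpret RR: depth_one_module R "regular_module R" E \<eta> \<delta> n p \<pi>
    by (rule regular_depth_one_module)
  have N: "RR.N = I" by (simp add: RR.N_def I_def)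
  have "module_span R (regular_module R) {x0} = I"
    using span_regular_eq_genideal[of "{x0}"] cgenideal_eq_genideal[OF x0_carr] x0_carr x0(2) by simp
  moreover have "RR.indep {x0} (\<lambda>y. y)" unfolding RR.indep_def
  proof (intro allI impI ballI)
    fix c i assume c: "c \<in> {x0} \<rightarrow> carrier R" "i \<in> {x0}"
      and "(\<Oplus>\<^bsub>regular_module R\<^esub>i\<in>{x0}. c i \<odot>\<^bsub>regular_module R\<^esub> i) = \<zero>\<^bsub>regular_module R\<^esub>"
    moreover have cx: "c x0 \<in> carrier R" using c by auto
    ultimately have "c x0 \<otimes> x0 = \<zero>" using x0_carr R.finsum_singleton[of x0 "{x0}" "\<lambda>i. c i \<otimes> i"] by simp
    hence "c x0 \<otimes> x0 \<in> p" using ideal_zero[OF p_ideal] by simp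
    thus "c i \<in> p" using prime_mult[OF p_prime cx x0_carr] x0(3) c(2) by auto
  qed
  ultimately show ?thesis unfolding RR.basis_N_def N using x0(1) by simp
qed

text \<open>Multiplication by \<open>x0\<close> maps the ring onto all of \<open>I\<close>, so the
  second summand in \<open>congruence_length\<close> vanishes and \<open>cval\<close> times the rank
  one remains.\<close>

lemma regular_congruence_length:
  "sublen R (regular_module R) (depth_one_module.N (regular_module R) p <+>\<^bsub>regular_module R\<^esub> ann_in (regular_module R) I)
    (carrier (regular_module R)) = enat cval"
proof -
  interpret RR: depth_one_module R "regular_module R" E \<eta> \<delta> n p \<pi>
    by (rule regular_depth_one_module)
  have N: "RR.N = I" by (simp add: RR.N_def I_def)
  have "RR.mulM x0 (carrier (regular_module R)) = RR.N"
    unfolding N x0(2) using m_comm[OF x0_carr] by (auto simp: PIdl_mem)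
  thus ?thesis using RR.congruence_length[OF regular_basis_N] module.sublen_refl[OF module_regular RR.N_submodule] by simp
qed

lemma free_iff_inequalities:
  assumes aug: "dvr_augmentation R Q l" and p: "p = a_kernel R Q l" and d: "d = aug_rank Q R l M"
  shows "free_module R M \<longleftrightarrow>
    wiles_defect Q R l M \<le> int d * wiles_defect Q R l (regular_module R) \<and>
    hs_multiplicity R M \<le> real d * hs_multiplicity R (regular_module R)"
proof -
  obtain Y where Y: "basis_N Y" using exists_basis_N by blast
  note reg = regular_depth_one_module
  have dY: "d = card Y" using aug_rank_eq[OF aug p Y] d by simp
  have d1: "aug_rank Q R l (regular_module R) = 1"
    using depth_one_module.aug_rank_eq[OF reg aug p regular_basis_N] by simp
  have c1: "the_enat (module_length Q (congruence_module Q R l (regular_module R))) = cval"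
    using depth_one_module.congruence_module_length[OF reg aug p] regular_congruence_length by simp
  \<comment> \<open>Both sides contain \<open>d\<close> times the length of the cotangent module.
    After cancellation the inequality bounds the length of the congruence module of \<open>M\<close>
    from below.\<close>
  have "wiles_defect Q R l M \<le> int d * wiles_defect Q R l (regular_module R) \<longleftrightarrow>
      cval * card Y \<le> the_enat (module_length Q (congruence_module Q R l M))"
    unfolding wiles_defect_def d1 c1 d[symmetric] dY
    by (simp add: right_diff_distrib mult.commute flip: of_nat_mult)
  also have "\<dots> \<longleftrightarrow> mulM x0 (carrier M) = N"
    unfolding congruence_module_length[OF aug p] by (rule congruence_length_ge_iff[OF Y])
  finally show ?thesis
    using free_of_inequalities[OF Y] inequalities_of_free[OF _ Y] unfolding dY by blast
qed

end

text \<open>The first member of a nonempty regular sequence serves as \<open>t\<close>. The zero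
  module, of infinite depth, needs its own case: there every element of \<mm> qualifies.\<close>

lemma (in noeth_local_module) exists_regular_of_depth:
  assumes depth: "module_depth R M \<ge> 1"
  shows "\<exists>t\<in>\<mm>. \<forall>y\<in>carrier M. t \<odot>\<^bsub>M\<^esub> y = \<zero>\<^bsub>M\<^esub> \<longrightarrow> y = \<zero>\<^bsub>M\<^esub>"
proof (cases "carrier M = {\<zero>\<^bsub>M\<^esub>}")
  case True
  thus ?thesis using ideal_zero[OF max_ideal_ideal] by auto
next
  case False
  let ?S = "{enat (length xs) |xs. set xs \<subseteq> \<mm> \<and> regular_sequence R M xs}"
  let ?O = "{\<zero>\<^bsub>M\<^esub>}"
  have "\<not> Sup ?S \<le> 0" using depth False by (auto simp: module_depth_def)
  hence "\<exists>k\<in>?S. \<not> k \<le> 0" using Sup_least by blast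
  then obtain xs where xs: "set xs \<subseteq> \<mm>" "regular_sequence R M xs" "xs \<noteq> []" by (auto simp: zero_enat_def)
  define t where "t = xs ! 0"
  have t: "t \<in> \<mm>" using xs(1,3) unfolding t_def by auto
  \<comment> \<open>At the first position \<open>regular_sequence\<close> divides by the ideal
    generated by no elements, so the quotient to be compared with \<open>M\<close> is M/0.\<close>
  have "ideal_smult R M (Idl {}) = ?O"
  proof
    have Z: "Idl {} = {\<zero>}" using span_regular_eq_genideal[of "{}"] module.span_empty[OF module_regular] by simp
    have "submodule (idmul {\<zero>} (carrier M)) R M" by (rule submodule_idmul) auto
    thus "?O \<subseteq> ideal_smult R M (Idl {})" unfolding Z ideal_smult_eq_idmul using submodule_zero_mem by simp
    show "ideal_smult R M (Idl {}) \<subseteq> ?O" unfolding Z ideal_smult_eq_idmul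
      by (rule idmul_least[OF zero_submodule]) auto
  qed
  moreover have "0 < length xs" using xs(3) by simp
  ultimately have reg: "\<forall>x\<in>carrier (quot_module M ?O).
      t \<odot>\<^bsub>quot_module M ?O\<^esub> x = \<zero>\<^bsub>quot_module M ?O\<^esub> \<longrightarrow> x = \<zero>\<^bsub>quot_module M ?O\<^esub>"
    using xs(2) unfolding regular_sequence_def t_def Let_def by (metis take_0 list.set(1))
  have "y = \<zero>\<^bsub>M\<^esub>" if y: "y \<in> carrier M" "t \<odot>\<^bsub>M\<^esub> y = \<zero>\<^bsub>M\<^esub>" for y
  proof -
    have "t \<odot>\<^bsub>quot_module M ?O\<^esub> (?O +>\<^bsub>M\<^esub> y) = ?O"
      using quot_smult[OF zero_submodule max_carr[OF t] y(1)] quot_zero[OF zero_submodule] y(2) by simp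
    hence "?O +>\<^bsub>M\<^esub> y = ?O" using reg y(1) by (simp add: quot_carrier)
    hence "y \<ominus>\<^bsub>M\<^esub> \<zero>\<^bsub>M\<^esub> \<in> ?O" using a_rcos_eq_iff[OF zero_submodule y(1) M.zero_closed] quot_zero[OF zero_submodule] by simp
    moreover have "\<ominus>\<^bsub>M\<^esub> \<zero>\<^bsub>M\<^esub> = \<zero>\<^bsub>M\<^esub>" by (metis M.r_neg M.l_zero M.a_inv_closed M.zero_closed)
    ultimately show ?thesis using y(1) by (simp add: M.minus_eq)
  qed
  thus ?thesis using t by blast
qed

theorem theorem4p6:
  fixes \<O> :: "'o ring" and A :: "'a ring" and lam :: "'a \<Rightarrow> 'o"
    and M :: "('a, 'b) module" and d :: nat
  assumes "discrete_valuation_ring \<O>"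
    and "in_category_C \<O> A lam"
    and "gorenstein_local_ring A"
    and "fin_gen_module A M"
    and "module_depth A M \<ge> 1"
    and "d = aug_rank \<O> A lam M"
  shows "free_module A M \<longleftrightarrow>
    wiles_defect \<O> A lam M \<le> int d * wiles_defect \<O> A lam (regular_module A) \<and>
    hs_multiplicity A M \<le> real d * hs_multiplicity A (regular_module A)"
proof -
  have cat: "noetherian_ring A" "local_ring A" "lam \<in> ring_hom A \<O>" "lam ` carrier A = carrier \<O>"
    "module_length \<O> (cotangent_module \<O> A lam) < \<infinity>"
    using assms(2) by (simp_all add: in_category_C_def)
  have local: "noeth_local A"
    using cat(1,2) by (intro noeth_local.intro noeth_local_axioms.intro) (simp_all add: local_ring_def)
  interpret A: noeth_local A by (rule local)
  have aug: "dvr_augmentation A \<O> lam"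
    by (intro dvr_augmentation.intro dvr_augmentation_axioms.intro local assms(1) cat)
  obtain \<pi> where \<pi>: "\<pi> \<in> max_ideal A" "\<pi> \<notin> a_kernel A \<O> lam"
    "\<forall>y\<in>max_ideal A. \<exists>b\<in>carrier A. y \<ominus>\<^bsub>A\<^esub> b \<otimes>\<^bsub>A\<^esub> \<pi> \<in> a_kernel A \<O> lam"
    using dvr_augmentation.exists_uniformizer[OF aug] by blast
  have "self_injective_dim A < \<infinity>" using assms(3) by (simp add: gorenstein_local_ring_def)
  \<comment> \<open>A finite infimum is witnessed by an actual resolution that vanishes beyond some
    \<open>n\<close>.\<close>
  then obtain n and E :: "nat \<Rightarrow> ('a, (nat \<times> 'a) set) module" and \<eta> \<delta>
    where res: "injective_resolution A (regular_module A) E \<eta> \<delta>" "\<forall>i>n. carrier (E i) = {\<zero>\<^bsub>E i\<^esub>}"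
    unfolding self_injective_dim_def Inf_less_iff by blast
  have "gorenstein_dvr_point A E \<eta> \<delta> n (a_kernel A \<O> lam) \<pi>"
  proof (intro gorenstein_dvr_point.intro finite_injective_resolution.intro local
      finite_injective_resolution_axioms.intro gorenstein_dvr_point_axioms.intro)
    show "primeideal (a_kernel A \<O> lam) A" by (rule dvr_augmentation.kernel_prime[OF aug])
    show "\<exists>s\<in>carrier A. s \<notin> a_kernel A \<O> lam \<and> (\<forall>y\<in>a_kernel A \<O> lam. y \<otimes>\<^bsub>A\<^esub> s = \<zero>\<^bsub>A\<^esub>)"
      by (rule dvr_augmentation.kernel_generically_zero[OF aug \<pi>(1,2)])
  qed (use res \<pi> in auto)
  moreover have M: "module A M" "fg_sub A M (carrier M)" using assms(4) by (auto simp: fin_gen_module_def fg_sub_def)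
  moreover have "\<exists>t\<in>max_ideal A. \<forall>y\<in>carrier M. t \<odot>\<^bsub>M\<^esub> y = \<zero>\<^bsub>M\<^esub> \<longrightarrow> y = \<zero>\<^bsub>M\<^esub>"
    by (rule noeth_local_module.exists_regular_of_depth[OF noeth_local_module.intro[OF local M(1)] assms(5)])
  ultimately have "depth_one_module A M E \<eta> \<delta> n (a_kernel A \<O> lam) \<pi>"
    by (intro depth_one_module.intro depth_one_module_axioms.intro)
  thus ?thesis by (rule depth_one_module.free_iff_inequalities[OF _ aug refl assms(6)])
qed

end
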